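(* Let $M$ be a piecewise flat Finsler surface of Landsberg type. Then the curvature at a vertex $x$ is independent of $v^\pm\in\mathcal S_x^\pm M$; that is, for each vertex $x$ there is a real number $K(x)$ such that $K(x,v^-)=K(x)$ for all $v^-\in\mathcal S_x^-M$ and $K(x,v^+)=K(x)$ for all $v^+\in\mathcal S_x^+M$.
   Context: A Minkowski norm on a finite-dimensional real vector space $V$ is a continuous $F:V\to[0,\infty)$, smooth and positive on $V\setminus\{0\}$, with $F(\lambda y)=\lambda F(y)$ for $\lambda\ge0$, such that for every $y\ne0$ the bilinear form $\langle u,v\rangle^F_y=\frac12\frac{\partial^2}{\partial s\partial t}F^2(y+su+tv)|_{s=t=0}$ is positive definite ($F(-y)=F(y)$ is not required). A Minkowski plane is $\mathbb R^2$ with the translation-invariant Finsler metric given by a Minkowski norm. A piecewise flat Finsler surface is a surface $M$ (without boundary) with a locally finite triangulation $M=\bigcup T_i$ by closed triangles, different triangles being disjoint or meeting in exactly one common edge or one common vertex, where each $T_i$ carries a flat metric $F_i$ such that $(T_i,F_i)$ is isometric to a straight-edged triangle in a Minkowski plane, and $F_i,F_j$ coincide on a common edge of $T_i,T_j$. Tangent cone: let $(T_1,F_1),\dots,(T_n,F_n)$ be the closed triangles containing $x$. Each is enlarged to a Minkowski cone $C_{x,i}$ with vertex $x$ (the planar sector at $x$ spanned by $T_i$; a half plane if $x$ is an edge point but not a vertex, the whole plane if $x$ is interior to a triangle) with $F_i$ extended to it; $T_xM=\bigcup_i C_{x,i}$, glued along common boundary rays (edges). The same notions apply to $T_xM$ itself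 in place of $M$. Tangent vectors and indicatrices: an outgoing (incoming) tangent vector at $p$ is an arrow in a cone at $p$ starting (ending) at $p$. $\mathcal S^+_{p,i}M$ ($\mathcal S^-_{p,i}M$) is the set of outgoing (incoming) vectors at $p$ in $C_{p,i}$ with $F_i=1$; $\mathcal S_p^\pm M=\bigcup_i\mathcal S_{p,i}^\pm M$ are circles, with arc length functional $l_p^\pm$ given on $\mathcal S_{p,i}^\pm M$ by the metric $\langle\cdot,\cdot\rangle^{F_i}_y$ at $y$. For $p\ne x$ in $T_xM$ let $\mathrm{Pr}_x^+(p)\in\mathcal S_x^+M$ ($\mathrm{Pr}_x^-(p)\in\mathcal S_x^-M$) be the unit vector in the direction from $x$ to $p$ (from $p$ to $x$). If a curve $\gamma$ in $T_xM\setminus\{x\}$ has monotonously rotating projection, $\sphericalangle_x^\pm(\gamma)$ is the arc length $l_x^\pm$ of the projected path $\mathrm{Pr}_x^\pm\circ\gamma$, counted with multiplicity. Geodesics: piecewise smooth curves of constant nonzero speed which are locally minimizing for $d$, where $d(p,q)$ is the infimum of the lengths $\int F(\dot c)\,dt$ of piecewise smooth paths from $p$ to $q$. Perturbations and curvature at a vertex $x$: fix an orientation of $T_xM$ to distinguish left from right. (i) Let $v^-\in\mathcal S_x^-M$ and let $c(t)$, $t\le0$, be the unit speed ray with $c(0)=x$, $\dot c=v^-$; put $x_0=c(-1)$. Translate a short piece $c|_{(-1-\varepsilon,-1+\varepsilon)}$ by a sufficiently small amount in the direction of a unit outgoing vector $w^+\notin\mathbb R\dot c(-1)$ at $x_0$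 pointing to the left (right) side; the resulting segment extends to a geodesic of $T_xM$ on $(-\infty,\infty)$ not passing through $x$, denoted $c_{+,l}$ ($c_{+,r}$). Then $$K(x,v^-)=\sphericalangle_x^+(c_{+,l})+\sphericalangle_x^+(c_{+,r})-l_x^+(\mathcal S_x^+M).$$ (ii) Let $v^+\in\mathcal S_x^+M$ and let $c(t)$, $t\ge0$, be the unit speed ray with $c(0)=x$, $\dot c=v^+$. Translating similarly a short piece of $c$ around $c(1)$ slightly to the left (right) and extending it to a geodesic on $(-\infty,\infty)$ gives $c_{-,l}$ ($c_{-,r}$), and $$K(x,v^+)=\sphericalangle_x^-(c_{-,l})+\sphericalangle_x^-(c_{-,r})-l_x^-(\mathcal S_x^-M).$$ These angles depend only on the side of the translation. Landsberg type: for any $x$ on an edge $E$ between two triangles $(T_1,F_1)$ and $(T_2,F_2)$ of $M$, $x$ not a vertex, the homeomorphism $\mathcal S_{x,1}^-M\to\mathcal S_{x,2}^+M$, $u_1^-\mapsto u_2^+$, defined by $\langle u_1^-,v\rangle^{F_1}_{u_1^-}=\langle u_2^+,v\rangle^{F_2}_{u_2^+}$, with $v$ any nonzero vector in the direction of $E$, is an isometry for the metrics on the indicatrices defined by $\langle\cdot,\cdot\rangle^{F_i}_y$. *)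

theory Defs
  imports "HOL-Analysis.Analysis"
begin

section \<open>Minkowski norms\<close>

primrec Ck_on :: "nat \<Rightarrow> 'a::euclidean_space set \<Rightarrow> ('a \<Rightarrow> 'b::real_normed_vector) \<Rightarrow> bool" where
  "Ck_on 0 S f \<longleftrightarrow> continuous_on S f"
| "Ck_on (Suc k) S f \<longleftrightarrow> (\<forall>x\<in>S. f differentiable (at x)) \<and>
     (\<forall>v. Ck_on k S (\<lambda>x. frechet_derivative f (at x) v))"

text \<open>Only used for open \<open>S\<close>.\<close>

definition smooth_on :: "'a::euclidean_space set \<Rightarrow> ('a \<Rightarrow> 'b::real_normed_vector) \<Rightarrow> bool" where
  "smooth_on S f \<longleftrightarrow> (\<forall>k. Ck_on k S f)"

definition fform :: "('a::real_vector \<Rightarrow> real) \<Rightarrow> 'a \<Rightarrow> 'a \<Rightarrow> 'a \<Rightarrow> real" where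
  "fform F y u v =
     1/2 * deriv (\<lambda>s. deriv (\<lambda>t. (F (y + s *\<^sub>R u + t *\<^sub>R v))\<^sup>2) 0) 0"

definition minkowski_norm :: "('a::euclidean_space \<Rightarrow> real) \<Rightarrow> bool" where
  "minkowski_norm F \<longleftrightarrow>
     continuous_on UNIV F \<and> (\<forall>y. 0 \<le> F y) \<and>
     smooth_on (- {0}) F \<and> (\<forall>y. y \<noteq> 0 \<longrightarrow> 0 < F y) \<and>
     (\<forall>a y. 0 \<le> a \<longrightarrow> F (a *\<^sub>R y) = a * F y) \<and>
     (\<forall>y u. y \<noteq> 0 \<longrightarrow> u \<noteq> 0 \<longrightarrow> 0 < fform F y u u)"


section \<open>Piecewise flat Finsler surfaces\<close>

text \<open>
  A flat metric on a cell is given by a chart into the plane together with a norm on the plane.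
  The same record describes a surface (cells are triangles) and its tangent cones
  (cells are planar sectors, half planes or planes).
\<close>

record ('p, 'i) flat_cells =
  cells :: "'i set"
  cell :: "'i \<Rightarrow> 'p set"
  chart :: "'i \<Rightarrow> 'p \<Rightarrow> real^2"
  fnorm :: "'i \<Rightarrow> real^2 \<Rightarrow> real"

definition surface :: "'p topology \<Rightarrow> bool" where
  "surface X \<longleftrightarrow> Hausdorff_space X \<and>
     (\<forall>x\<in>topspace X. \<exists>U. openin X U \<and> x \<in> U \<and>
        subtopology X U homeomorphic_space (euclidean :: (real^2) topology))"

definition cell_edge :: "('p, 'i) flat_cells \<Rightarrow> 'i \<Rightarrow> 'p set \<Rightarrow> bool" where
  "cell_edge M i E \<longleftrightarrow> E \<subseteq> cell M i \<and> (chart M i ` E) edge_of (chart M i ` cell M i)"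

definition cell_vertex :: "('p, 'i) flat_cells \<Rightarrow> 'i \<Rightarrow> 'p \<Rightarrow> bool" where
  "cell_vertex M i x \<longleftrightarrow> x \<in> cell M i \<and> (chart M i x) extreme_point_of (chart M i ` cell M i)"

definition vertices :: "('p, 'i) flat_cells \<Rightarrow> 'p set" where
  "vertices M = {x. \<exists>i\<in>cells M. cell_vertex M i x}"

text \<open>
  In the last clause the intersection is empty, a vertex (where the equation is trivial) or an
  edge. In the latter case, since \<open>p\<close> and \<open>q\<close> may be exchanged, the equation says that the two
  one-dimensional, possibly non-reversible metrics on the edge coincide; in particular the change
  of charts along the edge is affine.
\<close>

definition piecewise_flat_surface :: "'p topology \<Rightarrow> ('p, 'i) flat_cells \<Rightarrow> bool" where
  "piecewise_flat_surface X M \<longleftrightarrow>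
     surface X \<and>
     topspace X = (\<Union>i\<in>cells M. cell M i) \<and>
     (\<forall>x\<in>topspace X. \<exists>U. openin X U \<and> x \<in> U \<and> finite {i \<in> cells M. cell M i \<inter> U \<noteq> {}}) \<and>
     (\<forall>i\<in>cells M.
        minkowski_norm (fnorm M i) \<and>
        (\<exists>a b c. \<not> collinear {a, b, c} \<and> chart M i ` cell M i = convex hull {a, b, c}) \<and>
        homeomorphic_map (subtopology X (cell M i)) (top_of_set (chart M i ` cell M i))
          (chart M i)) \<and>
     (\<forall>i\<in>cells M. \<forall>j\<in>cells M. i \<noteq> j \<longrightarrow>
        cell M i \<inter> cell M j = {} \<or>
        cell_edge M i (cell M i \<inter> cell M j) \<and> cell_edge M j (cell M i \<inter> cell M j) \<or>
        (\<exists>p. cell M i \<inter> cell M j = {p} \<and> cell_vertex M i p \<and> cell_vertex M j p)) \<and>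
     (\<forall>i\<in>cells M. \<forall>j\<in>cells M. \<forall>p\<in>cell M i \<inter> cell M j. \<forall>q\<in>cell M i \<inter> cell M j.
        fnorm M i (chart M i q - chart M i p) = fnorm M j (chart M j q - chart M j p))"


section \<open>Tangent cones and indicatrices\<close>

text \<open>Vectors are written in the chart of the cell, with \<open>x\<close> moved to the origin.\<close>

definition sector :: "('p, 'i) flat_cells \<Rightarrow> 'p \<Rightarrow> 'i \<Rightarrow> (real^2) set" where
  "sector M x i = cone hull ((\<lambda>q. chart M i q - chart M i x) ` cell M i)"

definition cone_rel :: "('p, 'i) flat_cells \<Rightarrow> 'p \<Rightarrow> (('i \<times> (real^2)) \<times> ('i \<times> (real^2))) set" where
  "cone_rel M x = {((i, y), (j, z)). i \<in> cells M \<and> j \<in> cells M \<and> x \<in> cell M i \<and> x \<in> cell M j \<and>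
     (\<exists>q\<in>cell M i \<inter> cell M j. \<exists>a\<ge>0.
        y = a *\<^sub>R (chart M i q - chart M i x) \<and> z = a *\<^sub>R (chart M j q - chart M j x))}"

definition cone_points :: "('p, 'i) flat_cells \<Rightarrow> 'p \<Rightarrow> ('i \<times> (real^2)) set set" where
  "cone_points M x = Sigma {i \<in> cells M. x \<in> cell M i} (sector M x) // cone_rel M x"

definition tangent_cone :: "('p, 'i) flat_cells \<Rightarrow> 'p \<Rightarrow> (('i \<times> (real^2)) set, 'i) flat_cells" where
  "tangent_cone M x =
     \<lparr>cells = {i \<in> cells M. x \<in> cell M i},
      cell = (\<lambda>i. {P \<in> cone_points M x. \<exists>y. (i, y) \<in> P}),
      chart = (\<lambda>i P. THE y. (i, y) \<in> P),
      fnorm = fnorm M\<rparr>"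

definition cone_apex :: "('p, 'i) flat_cells \<Rightarrow> 'p \<Rightarrow> ('i \<times> (real^2)) set" where
  "cone_apex M x = {i \<in> cells M. x \<in> cell M i} \<times> {0}"

text \<open>The dilation of the tangent cone by the factor \<open>a \<ge> 0\<close>.\<close>

definition cone_scale ::
  "('p, 'i) flat_cells \<Rightarrow> 'p \<Rightarrow> real \<Rightarrow> ('i \<times> (real^2)) set \<Rightarrow> ('i \<times> (real^2)) set" where
  "cone_scale M x a P = cone_rel M x `` {(i, a *\<^sub>R y) | i y. (i, y) \<in> P}"

text \<open>
  Throughout, the sign \<open>\<sigma>\<close> is \<open>1\<close> for outgoing and \<open>-1\<close> for incoming vectors.
  \<open>unit_vectors\<close> is the part of the indicatrix in one cell, as a set of vectors in the plane.

  In the whole indicatrix a tangent vector at \<open>x\<close> is represented by the end of its arrow that is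
  different from \<open>x\<close>, a point of the tangent cone: the head of an outgoing vector and the tail
  of an incoming one. So the vector \<open>u\<close> of sign \<open>\<sigma>\<close> in the cell \<open>i\<close> is the point with chart
  coordinates \<open>\<sigma> *\<^sub>R u\<close>.
\<close>

definition unit_vectors :: "('p, 'i) flat_cells \<Rightarrow> real \<Rightarrow> 'p \<Rightarrow> 'i \<Rightarrow> (real^2) set" where
  "unit_vectors M \<sigma> x i = {u. \<sigma> *\<^sub>R u \<in> sector M x i \<and> fnorm M i u = 1}"

definition indicatrix :: "('p, 'i) flat_cells \<Rightarrow> real \<Rightarrow> 'p \<Rightarrow> ('i \<times> (real^2)) set set" where
  "indicatrix M \<sigma> x =
     {cone_rel M x `` {(i, \<sigma> *\<^sub>R u)} | i u. i \<in> cells M \<and> x \<in> cell M i \<and> u \<in> unit_vectors M \<sigma> x i}"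

text \<open>The projection of a point \<open>p\<close> of the tangent cone, other than the apex.\<close>

definition unit_dir ::
  "('p, 'i) flat_cells \<Rightarrow> real \<Rightarrow> 'p \<Rightarrow> ('i \<times> (real^2)) set \<Rightarrow> ('i \<times> (real^2)) set" where
  "unit_dir M \<sigma> x p = (THE Q. Q \<in> indicatrix M \<sigma> x \<and> (\<exists>a>0. Q = cone_scale M x a p))"


section \<open>Curves, lengths and geodesics\<close>

text \<open>
  \<open>pw_smooth M N \<gamma> \<rho> a b\<close>: the curve \<open>\<gamma>\<close> is piecewise smooth on \<open>{a..b}\<close>, each piece running in
  one cell, and away from the finitely many break points \<open>\<rho> t\<close> is its speed with respect to
  \<open>N\<close>, where \<open>N i y u\<close> is the norm of the vector \<open>u\<close> at the position \<open>y\<close> in the chart of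
  cell \<open>i\<close>. Hence \<open>integral {a..b} \<rho>\<close> is the \<open>N\<close>-length of \<open>\<gamma>\<close>.
\<close>

inductive pw_smooth :: "('p, 'i) flat_cells \<Rightarrow> ('i \<Rightarrow> real^2 \<Rightarrow> real^2 \<Rightarrow> real) \<Rightarrow>
    (real \<Rightarrow> 'p) \<Rightarrow> (real \<Rightarrow> real) \<Rightarrow> real \<Rightarrow> real \<Rightarrow> bool"
  for M N \<gamma> \<rho> where
  piece: "\<lbrakk>a < b; i \<in> cells M; \<gamma> ` {a..b} \<subseteq> cell M i;
      open U; {a..b} \<subseteq> U; smooth_on U g; \<forall>t\<in>{a..b}. chart M i (\<gamma> t) = g t;
      \<forall>t\<in>{a<..<b}. \<rho> t = N i (g t) (vector_derivative g (at t))\<rbrakk>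
    \<Longrightarrow> pw_smooth M N \<gamma> \<rho> a b"
| join: "\<lbrakk>pw_smooth M N \<gamma> \<rho> a b; pw_smooth M N \<gamma> \<rho> b c\<rbrakk> \<Longrightarrow> pw_smooth M N \<gamma> \<rho> a c"

definition finsler :: "('p, 'i) flat_cells \<Rightarrow> 'i \<Rightarrow> real^2 \<Rightarrow> real^2 \<Rightarrow> real" where
  "finsler M i y u = fnorm M i u"

text \<open>Only meaningful if \<open>p\<close> and \<open>q\<close> are joined by a curve, as is always so in a tangent cone.\<close>

definition fdist :: "('p, 'i) flat_cells \<Rightarrow> 'p \<Rightarrow> 'p \<Rightarrow> real" where
  "fdist M p q = Inf {integral {a..b} \<rho> | \<gamma> \<rho> a b.
     pw_smooth M (finsler M) \<gamma> \<rho> a b \<and> \<gamma> a = p \<and> \<gamma> b = q}"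

text \<open>Geodesics parametrized by the whole real line, with speed \<open>c\<close>.\<close>

definition geodesic :: "('p, 'i) flat_cells \<Rightarrow> (real \<Rightarrow> 'p) \<Rightarrow> bool" where
  "geodesic M \<gamma> \<longleftrightarrow> (\<exists>c>0.
     (\<forall>a b. a < b \<longrightarrow> pw_smooth M (finsler M) \<gamma> (\<lambda>_. c) a b) \<and>
     (\<forall>t. \<exists>\<delta>>0. \<forall>a b. t - \<delta> < a \<and> a < b \<and> b < t + \<delta> \<longrightarrow>
        fdist M (\<gamma> a) (\<gamma> b) = integral {a..b} (\<lambda>_. c)))"


section \<open>Angles\<close>

text \<open>
  The arc length element of the indicatrix of sign \<open>\<sigma>\<close>, in terms of the points of the tangent cone
  that represent the unit vectors: the point \<open>y\<close> stands for the vector \<open>\<sigma> *\<^sub>R y\<close>.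
\<close>

definition arc_norm :: "('p, 'i) flat_cells \<Rightarrow> real \<Rightarrow> 'i \<Rightarrow> real^2 \<Rightarrow> real^2 \<Rightarrow> real" where
  "arc_norm M \<sigma> i y u = sqrt (fform (fnorm M i) (\<sigma> *\<^sub>R y) u u)"

definition circle_length :: "('p, 'i) flat_cells \<Rightarrow> real \<Rightarrow> 'p \<Rightarrow> real \<Rightarrow> bool" where
  "circle_length M \<sigma> x L \<longleftrightarrow> (\<exists>\<tau> \<rho> a b.
     pw_smooth (tangent_cone M x) (arc_norm M \<sigma>) \<tau> \<rho> a b \<and>
     \<tau> ` {a..b} = indicatrix M \<sigma> x \<and> inj_on \<tau> {a..<b} \<and> \<tau> a = \<tau> b \<and>
     L = integral {a..b} \<rho>)"

text \<open>
  The angle under which a curve \<open>\<gamma> :: real \<Rightarrow> _\<close> in the tangent cone, avoiding the apex, is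
  seen from the apex: the total length of the projected path, with multiplicity.
\<close>

definition has_angle ::
  "('p, 'i) flat_cells \<Rightarrow> real \<Rightarrow> 'p \<Rightarrow> (real \<Rightarrow> ('i \<times> (real^2)) set) \<Rightarrow> real \<Rightarrow> bool" where
  "has_angle M \<sigma> x \<gamma> A \<longleftrightarrow> (\<exists>\<rho>.
     (\<forall>a b. a < b \<longrightarrow>
        pw_smooth (tangent_cone M x) (arc_norm M \<sigma>) (unit_dir M \<sigma> x \<circ> \<gamma>) \<rho> a b) \<and>
     (\<rho> has_integral A) UNIV)"


section \<open>Curvature at a vertex\<close>

text \<open>
  An orientation of the tangent cone chooses for each cell whether its chart preserves (\<open>1\<close>)
  or reverses (\<open>-1\<close>) orientation, so that along a common ray (through \<open>e\<close>) neighbouring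
  cells lie on opposite sides.
\<close>

definition cone_orientation :: "('p, 'i) flat_cells \<Rightarrow> 'p \<Rightarrow> ('i \<Rightarrow> real) \<Rightarrow> bool" where
  "cone_orientation M x ori \<longleftrightarrow> (let T = tangent_cone M x in
     (\<forall>i\<in>cells T. ori i \<in> {1, -1}) \<and>
     (\<forall>i\<in>cells T. \<forall>j\<in>cells T. i \<noteq> j \<longrightarrow>
        (\<forall>e\<in>cell T i \<inter> cell T j. \<forall>p\<in>cell T i. \<forall>q\<in>cell T j.
           (ori i * det (vector [chart T i e, chart T i p] :: real^2^2)) *
           (ori j * det (vector [chart T j e, chart T j q] :: real^2^2)) \<le> 0)))"

text \<open>
  For a unit vector \<open>v\<close> of sign \<open>\<sigma>\<close> at \<open>x\<close> let \<open>c t = cone_scale M x (\<sigma> * t) v\<close>, for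
  \<open>\<sigma> * t \<ge> 0\<close>, be the ray with velocity \<open>v\<close> at \<open>c 0 = x\<close>. It passes through the point \<open>v\<close>
  at time \<open>\<sigma>\<close>, where its velocity in the chart of cell \<open>i\<close> is \<open>\<sigma>\<close> times the
  coordinate vector of \<open>v\<close>.

  \<open>perturbed\<close>: the geodesic \<open>\<gamma>\<close> avoids the apex and extends the short piece of \<open>c\<close> around the
  time \<open>\<sigma>\<close>, translated by \<open>s\<close> times the vector \<open>w\<close> in cell \<open>i\<close>.
\<close>

definition perturbed :: "('p, 'i) flat_cells \<Rightarrow> real \<Rightarrow> 'p \<Rightarrow> ('i \<times> (real^2)) set \<Rightarrow>
    'i \<Rightarrow> real^2 \<Rightarrow> real \<Rightarrow> (real \<Rightarrow> ('i \<times> (real^2)) set) \<Rightarrow> bool" where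
  "perturbed M \<sigma> x v i w s \<gamma> \<longleftrightarrow> (let T = tangent_cone M x in
     geodesic T \<gamma> \<and> (\<forall>t. \<gamma> t \<noteq> cone_apex M x) \<and>
     (\<exists>\<epsilon>>0. \<forall>t. \<bar>t - \<sigma>\<bar> < \<epsilon> \<longrightarrow>
        \<gamma> t \<in> cell T i \<and>
        chart T i (\<gamma> t) = chart T i (cone_scale M x (\<sigma> * t) v) + s *\<^sub>R w))"

text \<open>
  \<open>A\<close> is the angle of the perturbed geodesics on the left (\<open>side = 1\<close>) or right
  (\<open>side = -1\<close>) of the ray. The sign condition on the determinant says that \<open>w\<close> points to that
  side; it excludes multiples of the velocity of the ray. For incoming \<open>v\<close> the angle is measured
  by outgoing vectors, and conversely.
\<close>

definition perturbed_angle :: "('p, 'i) flat_cells \<Rightarrow> ('i \<Rightarrow> real) \<Rightarrow> real \<Rightarrow> 'p \<Rightarrow>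
    ('i \<times> (real^2)) set \<Rightarrow> real \<Rightarrow> real \<Rightarrow> bool" where
  "perturbed_angle M ori \<sigma> x v side A \<longleftrightarrow> (let T = tangent_cone M x in
     \<forall>i\<in>cells T. \<forall>w\<in>unit_vectors T 1 v i.
       v \<in> cell T i \<and> 0 < side * ori i * det (vector [\<sigma> *\<^sub>R chart T i v, w] :: real^2^2) \<longrightarrow>
       (\<exists>\<eta>>0. \<forall>s. 0 < s \<and> s < \<eta> \<longrightarrow>
          (\<exists>\<gamma>. perturbed M \<sigma> x v i w s \<gamma>) \<and>
          (\<forall>\<gamma>. perturbed M \<sigma> x v i w s \<gamma> \<longrightarrow> has_angle M (- \<sigma>) x \<gamma> A)))"

text \<open>
  \<open>has_curvature M ori \<sigma> x v k\<close> says that the curvature \<open>K(x,v)\<close> of the unit vector \<open>v\<close> of sign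
  \<open>\<sigma>\<close> is well defined and equal to \<open>k\<close>.
\<close>

definition has_curvature :: "('p, 'i) flat_cells \<Rightarrow> ('i \<Rightarrow> real) \<Rightarrow> real \<Rightarrow> 'p \<Rightarrow>
    ('i \<times> (real^2)) set \<Rightarrow> real \<Rightarrow> bool" where
  "has_curvature M ori \<sigma> x v k \<longleftrightarrow> (\<exists>A\<^sub>l A\<^sub>r L.
     perturbed_angle M ori \<sigma> x v 1 A\<^sub>l \<and> perturbed_angle M ori \<sigma> x v (- 1) A\<^sub>r \<and>
     circle_length M (- \<sigma>) x L \<and> k = A\<^sub>l + A\<^sub>r - L)"


section \<open>Landsberg type\<close>

text \<open>
  The length metric that \<open>fform F\<close> induces on an arc \<open>S\<close> of the indicatrix of \<open>F\<close>.
\<close>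

definition arc_dist :: "(real^2 \<Rightarrow> real) \<Rightarrow> (real^2) set \<Rightarrow> real^2 \<Rightarrow> real^2 \<Rightarrow> real" where
  "arc_dist F S u u' = Inf {integral {a..b} (\<lambda>t. sqrt (fform F (g t)
       (vector_derivative g (at t)) (vector_derivative g (at t)))) | g a b U.
     a < b \<and> open U \<and> {a..b} \<subseteq> U \<and> smooth_on U g \<and> g ` {a..b} \<subseteq> S \<and> g a = u \<and> g b = u'}"

text \<open>
  If the common part of two triangles contains a point \<open>x\<close> that is not a vertex, it is an edge.
  As \<open>x\<close> is interior to it, the vectors from \<open>x\<close> to the points \<open>q\<close> of the edge represent, up
  to positive factors, all vectors in the direction of the edge.
\<close>

definition landsberg_type :: "('p, 'i) flat_cells \<Rightarrow> bool" where
  "landsberg_type M \<longleftrightarrow>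
     (\<forall>i\<in>cells M. \<forall>j\<in>cells M. \<forall>x\<in>cell M i \<inter> cell M j. i \<noteq> j \<and> x \<notin> vertices M \<longrightarrow>
       (\<exists>h h'. homeomorphism (unit_vectors M (- 1) x i) (unit_vectors M 1 x j) h h' \<and>
         (\<forall>u\<in>unit_vectors M (- 1) x i. \<forall>q\<in>cell M i \<inter> cell M j.
            fform (fnorm M i) u u (chart M i q - chart M i x) =
            fform (fnorm M j) (h u) (h u) (chart M j q - chart M j x)) \<and>
         (\<forall>u\<in>unit_vectors M (- 1) x i. \<forall>u'\<in>unit_vectors M (- 1) x i.
            arc_dist (fnorm M j) (unit_vectors M 1 x j) (h u) (h u') =
            arc_dist (fnorm M i) (unit_vectors M (- 1) x i) u u')))"

end

theory Submission
  imports Defs "HOL-Real_Asymp.Real_Asymp"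
begin

text \<open>
  Write every planar vector in polar coordinates and let \<open>Th F e\<close> be the arc length along the
  indicatrix of a Minkowski norm \<open>F\<close>. Geodesics in the tangent cone are straight in each cell, and
  their direction changes across a ray so that its momentum, the differential of the norm applied
  to the ray, is preserved. The Landsberg condition says that this refraction preserves arc
  length. Hence a geodesic that passes the vertex on the right turns, as seen from the vertex,
  through the arc of the half circle from its direction to the opposite direction, whatever cells
  it crosses, and one that passes on the left turns through the complementary half circle. The
  two angles add up to the total length of an indicatrix, which by the Landsberg condition is the
  same for all cells around the vertex. So the curvature is this length minus the length of the
  indicatrix of the tangent cone, for every incoming vector. Reversing all norms exchanges
  incoming and outgoing vectors; it keeps the length of a full indicatrix, and the lengths of the
  opposite sectors have the same sum as those of the sectors, so the curvature is unchanged.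
\<close>

section \<open>Smooth functions and Minkowski norms\<close>

text \<open>On the indicatrix \<open>fform F u u v\<close> equals \<open>dF u v\<close>, so the
  Landsberg condition and the first variation of length across an edge express one law of
  refraction. The ends of a half circle are the vectors of extremal momentum along the edge; strict
  convexity makes the Landsberg map send ends to ends, and an isometry doing so preserves arc length
  measured from an end.

  The curvature refers to all geodesics that extend a short segment, so the refracted line must be
  shown to be locally minimizing and to be the only extension. Minimality is a calibration argument:
  momenta on both sides of a ray agree on it and form a piecewise linear function that grows at most
  as fast as length. Uniqueness holds because a unit vector on a given side of a ray is determined
  by its momentum along the ray.

  Crossing an edge one way compares the half circles on one side of it, crossing back the other
  halves; only both together compare full indicatrices. The cyclic order of the triangles is not
  given; it comes from the surface by invariance of domain and connectedness of a punctured
  disc.\<close>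

lemma Ck_on_SucD: "Ck_on (Suc k) S f \<Longrightarrow> Ck_on k S f"
proof (induction k arbitrary: f)
  case 0
  then show ?case
    by (simp add: continuous_at_imp_continuous_on differentiable_imp_continuous_within)
next
  case (Suc k)
  have "Ck_on k S (\<lambda>x. frechet_derivative f (at x) v)" for v
  proof (rule Suc.IH)
    show "Ck_on (Suc k) S (\<lambda>x. frechet_derivative f (at x) v)"
      using Suc.prems by (subst (asm) Ck_on.simps(2)) simp
  qed
  then show ?case using Suc.prems by (subst Ck_on.simps(2)) (subst (asm) Ck_on.simps(2), simp)
qed

text \<open>Openness of \<open>S\<close> turns agreement on \<open>S\<close> into agreement near
  each of its points, so the derivatives agree as well and the induction goes through.\<close>

lemma Ck_on_cong:
  assumes "open S" and "\<And>x. x \<in> S \<Longrightarrow> f x = g x" and "Ck_on k S f"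
  shows "Ck_on k S g"
  using assms(2,3)
proof (induction k arbitrary: f g)
  case 0
  then show ?case by (simp cong: continuous_on_cong)
next
  case (Suc k)
  have d: "g differentiable (at x)" if "x \<in> S" for x
    using Suc.prems that assms(1) unfolding Ck_on.simps(2) differentiable_def
    by (metis has_derivative_transform_within_open)
  have eq: "frechet_derivative f (at x) v = frechet_derivative g (at x) v" if "x \<in> S" for x v
  proof -
    have "f differentiable at x" using Suc.prems(2) that by simp
    from frechet_derivative_transform_within_open[OF this assms(1) that Suc.prems(1)]
    show ?thesis by simp
  qed
  have "Ck_on k S (\<lambda>x. frechet_derivative g (at x) v)" for v
    using Suc.IH[of "\<lambda>x. frechet_derivative f (at x) v" "\<lambda>x. frechet_derivative g (at x) v"]
      eq Suc.prems(2) by auto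
  then show ?case using d by simp
qed

lemma Ck_on_const: "Ck_on k S (\<lambda>x. c)"
  by (induction k arbitrary: c) auto

lemma Ck_on_add:
  assumes "open S" "Ck_on k S f" "Ck_on k S g"
  shows "Ck_on k S (\<lambda>x. f x + g x)"
  using assms(2,3)
proof (induction k arbitrary: f g)
  case 0
  then show ?case by (simp add: continuous_on_add)
next
  case (Suc k)
  have d: "((\<lambda>x. f x + g x) has_derivative
      (\<lambda>v. frechet_derivative f (at x) v + frechet_derivative g (at x) v)) (at x)" if "x \<in> S" for x
    using Suc.prems that by (auto intro!: has_derivative_add simp flip: frechet_derivative_works)
  have "Ck_on k S (\<lambda>x. frechet_derivative f (at x) v + frechet_derivative g (at x) v)" for v
    using Suc by auto
  then have "Ck_on k S (\<lambda>x. frechet_derivative (\<lambda>x. f x + g x) (at x) v)" for v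
    by (rule Ck_on_cong[OF assms(1), rotated]) (simp add: frechet_derivative_at[OF d, symmetric])
  then show ?case using d by (auto simp: differentiable_def)
qed

lemma Ck_on_scaleR:
  fixes f :: "'a::euclidean_space \<Rightarrow> real"
  assumes "open S" "Ck_on k S f" "Ck_on k S g"
  shows "Ck_on k S (\<lambda>x. f x *\<^sub>R g x)"
  using assms(2,3)
proof (induction k arbitrary: f g)
  case 0
  then show ?case by (simp add: continuous_on_scaleR)
next
  case (Suc k)
  have d: "((\<lambda>x. f x *\<^sub>R g x) has_derivative
      (\<lambda>v. f x *\<^sub>R frechet_derivative g (at x) v + frechet_derivative f (at x) v *\<^sub>R g x)) (at x)"
    if "x \<in> S" for x
    using Suc.prems that by (auto intro!: has_derivative_scaleR simp flip: frechet_derivative_works)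
  have "Ck_on k S (\<lambda>x. f x *\<^sub>R frechet_derivative g (at x) v
      + frechet_derivative f (at x) v *\<^sub>R g x)" for v
    using Suc.prems by (intro Ck_on_add[OF assms(1)] Suc.IH) (auto intro: Ck_on_SucD)
  then have "Ck_on k S (\<lambda>x. frechet_derivative (\<lambda>x. f x *\<^sub>R g x) (at x) v)" for v
    by (rule Ck_on_cong[OF assms(1), rotated]) (simp add: frechet_derivative_at[OF d, symmetric])
  then show ?case using d by (auto simp: differentiable_def)
qed

text \<open>The derivative of the inverse contains the inverse itself, but only to order
  \<open>k\<close>, which the induction hypothesis covers. It is written with scalar products
  throughout so that \<open>Ck_on_scaleR\<close> handles each factor.\<close>

lemma Ck_on_inverse:
  fixes f :: "'a::euclidean_space \<Rightarrow> real"
  assumes "open S" "Ck_on k S f" and nz: "\<And>x. x \<in> S \<Longrightarrow> f x \<noteq> 0"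
  shows "Ck_on k S (\<lambda>x. inverse (f x))"
  using assms(2)
proof (induction k)
  case 0
  then show ?case using nz by (auto intro: continuous_on_inverse)
next
  case (Suc k)
  have d: "((\<lambda>x. inverse (f x)) has_derivative
      (\<lambda>v. ((-1) *\<^sub>R (inverse (f x) *\<^sub>R inverse (f x))) *\<^sub>R frechet_derivative f (at x) v)) (at x)"
    if "x \<in> S" for x
  proof -
    have "(f has_derivative frechet_derivative f (at x)) (at x)"
      using Suc.prems that by (auto simp flip: frechet_derivative_works)
    from Deriv.has_derivative_inverse[OF nz[OF that] this] show ?thesis
      by (rule has_derivative_eq_rhs) (simp add: fun_eq_iff)
  qed
  have *: "Ck_on k S (\<lambda>x. ((-1) *\<^sub>R (inverse (f x) *\<^sub>R inverse (f x))) *\<^sub>R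
      frechet_derivative f (at x) v)" for v
  proof -
    have f: "Ck_on k S (\<lambda>x. frechet_derivative f (at x) v)" using Suc.prems by simp
    have i: "Ck_on k S (\<lambda>x. inverse (f x))" by (rule Suc.IH[OF Ck_on_SucD[OF Suc.prems]])
    show ?thesis by (intro Ck_on_scaleR[OF assms(1)] Ck_on_const f i)
  qed
  have "Ck_on k S (\<lambda>x. frechet_derivative (\<lambda>x. inverse (f x)) (at x) v)" for v
    by (rule Ck_on_cong[OF assms(1) _ *[of v]]) (simp add: frechet_derivative_at[OF d, symmetric])
  then show ?case using d by (auto simp: differentiable_def)
qed

lemma Ck_on_affine:
  fixes f :: "'a::euclidean_space \<Rightarrow> 'b::real_normed_vector" and L :: "'c::euclidean_space \<Rightarrow> 'a"
  assumes "open T" "bounded_linear L" "\<And>t. t \<in> T \<Longrightarrow> y + L t \<in> S" "Ck_on k S f"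
  shows "Ck_on k T (\<lambda>t. f (y + L t))"
  using assms(4)
proof (induction k arbitrary: f)
  case 0
  have "continuous_on T (\<lambda>t. y + L t)"
    using assms(2) by (intro continuous_intros linear_continuous_on)
  then show ?case
    using 0 assms(3) by (auto intro: continuous_on_compose2[of S f])
next
  case (Suc k)
  have d: "((\<lambda>t. f (y + L t)) has_derivative
      (\<lambda>v. frechet_derivative f (at (y + L t)) (L v))) (at t)" if "t \<in> T" for t
  proof (rule has_derivative_compose[of "\<lambda>t. y + L t" L _ _ f])
    show "((\<lambda>t. y + L t) has_derivative L) (at t)"
      using bounded_linear_imp_has_derivative[OF assms(2)] by (auto intro!: derivative_eq_intros)
    show "(f has_derivative frechet_derivative f (at (y + L t))) (at (y + L t))"
      using Suc.prems assms(3)[OF that] by (auto simp flip: frechet_derivative_works)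
  qed
  have "Ck_on k T (\<lambda>t. frechet_derivative f (at (y + L t)) (L v))" for v
    by (rule Suc.IH) (use Suc.prems in auto)
  then have "Ck_on k T (\<lambda>x. frechet_derivative (\<lambda>t. f (y + L t)) (at x) v)" for v
    by (rule Ck_on_cong[OF assms(1), rotated]) (simp add: frechet_derivative_at[OF d, symmetric])
  then show ?case using d by (auto simp: differentiable_def)
qed

lemma Ck_on_line: "Ck_on k S (\<lambda>t::real. y + t *\<^sub>R u)"
proof (cases k)
  case 0
  then show ?thesis by (auto intro!: continuous_intros)
next
  case (Suc m)
  have d: "((\<lambda>t. y + t *\<^sub>R u) has_derivative (\<lambda>t. t *\<^sub>R u)) (at t)" for t
    by (auto intro!: derivative_eq_intros)
  have "(\<lambda>t. y + t *\<^sub>R u) differentiable (at t)" for t using d differentiable_def by blast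
  then show ?thesis
    using Suc by (simp add: frechet_derivative_at[OF d, symmetric] Ck_on_const)
qed

lemma smooth_on_line: "smooth_on S (\<lambda>t::real. y + t *\<^sub>R u)"
  by (simp add: smooth_on_def Ck_on_line)

lemma smooth_on_compose_line:
  fixes f :: "'a::euclidean_space \<Rightarrow> 'b::real_normed_vector"
  assumes "open T" "\<And>t::real. t \<in> T \<Longrightarrow> y + t *\<^sub>R u \<in> S" "smooth_on S f"
  shows "smooth_on T (\<lambda>t. f (y + t *\<^sub>R u))"
  unfolding smooth_on_def
proof
  fix k show "Ck_on k T (\<lambda>t. f (y + t *\<^sub>R u))"
    by (rule Ck_on_affine[OF assms(1) bounded_linear_scaleR_left assms(2)])
      (use assms(3) in \<open>auto simp: smooth_on_def\<close>)
qed

section \<open>Convexity of Minkowski norms\<close>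

locale minkowski =
  fixes F :: "'a::euclidean_space \<Rightarrow> real"
  assumes mn: "minkowski_norm F"
begin

text \<open>The momentum covector of the direction \<open>y\<close>; by \<open>dF_scale\<close> it
  depends only on the direction.\<close>

definition dF :: "'a \<Rightarrow> 'a \<Rightarrow> real" where
  "dF y = frechet_derivative F (at y)"

definition dQ :: "'a \<Rightarrow> 'a \<Rightarrow> real" where
  "dQ y = frechet_derivative (\<lambda>y. (F y)\<^sup>2) (at y)"

lemma cont: "continuous_on S F"
  using mn continuous_on_subset by (auto simp: minkowski_norm_def)

lemma nonneg: "0 \<le> F y" and pos: "y \<noteq> 0 \<Longrightarrow> 0 < F y"
  and scale: "0 \<le> a \<Longrightarrow> F (a *\<^sub>R y) = a * F y"
  and fform_pos: "y \<noteq> 0 \<Longrightarrow> u \<noteq> 0 \<Longrightarrow> 0 < fform F y u u"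
  and smooth: "smooth_on (- {0}) F"
  using mn by (auto simp: minkowski_norm_def)

lemma zero [simp]: "F 0 = 0"
  using scale[of 0 0] by simp

lemma eq_0_iff: "F y = 0 \<longleftrightarrow> y = 0"
  using pos[of y] by fastforce

lemma hdF: "y \<noteq> 0 \<Longrightarrow> (F has_derivative dF y) (at y)"
  using smooth unfolding smooth_on_def dF_def
  by (metis Ck_on.simps(2) ComplI frechet_derivative_works singletonD)

lemma Ck_Q: "Ck_on k (- {0}) (\<lambda>y. (F y)\<^sup>2)"
  using Ck_on_scaleR[OF open_Compl[OF closed_singleton], of k 0 F F] smooth
  by (simp add: smooth_on_def power2_eq_square)

lemma hdQ: "y \<noteq> 0 \<Longrightarrow> ((\<lambda>y. (F y)\<^sup>2) has_derivative dQ y) (at y)"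
  using Ck_Q[of 1] unfolding dQ_def by (simp flip: frechet_derivative_works)

lemma Ck_dQ: "Ck_on k (- {0}) (\<lambda>y. dQ y v)"
  using Ck_Q[of "Suc k"] by (simp add: dQ_def)

lemma hddQ: "y \<noteq> 0 \<Longrightarrow>
    ((\<lambda>y. dQ y v) has_derivative frechet_derivative (\<lambda>y. dQ y v) (at y)) (at y)"
  using Ck_dQ[of 1] by (simp flip: frechet_derivative_works)

lemma linear_dF: "y \<noteq> 0 \<Longrightarrow> linear (dF y)" and linear_dQ: "y \<noteq> 0 \<Longrightarrow> linear (dQ y)"
  using hdF hdQ has_derivative_linear by blast+

lemma dQ_eq: assumes "y \<noteq> 0" shows "dQ y v = 2 * F y * dF y v"
proof -
  have "((\<lambda>y. (F y)\<^sup>2) has_derivative (\<lambda>v. 2 * F y * dF y v)) (at y)"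
    using hdF[OF assms] by (auto intro!: derivative_eq_intros)
  then have "dQ y = (\<lambda>v. 2 * F y * dF y v)"
    using hdQ[OF assms] has_derivative_unique by blast
  then show ?thesis by simp
qed

lemma line_deriv:
  fixes f :: "'a \<Rightarrow> real"
  assumes "(f has_derivative f') (at (y + t *\<^sub>R u))"
  shows "((\<lambda>t. f (y + t *\<^sub>R u)) has_real_derivative f' u) (at t)"
proof -
  have "((\<lambda>t. f (y + t *\<^sub>R u)) has_derivative (\<lambda>s. f' (s *\<^sub>R u))) (at t)"
    by (rule has_derivative_compose[of "\<lambda>t. y + t *\<^sub>R u" "\<lambda>s. s *\<^sub>R u" _ _ f])
      (auto intro!: derivative_eq_intros assms)
  then show ?thesis
    using has_derivative_linear[OF assms]
    by (simp add: has_field_derivative_def linear_scale mult_commute_abs)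
qed

text \<open>The points \<open>y + s *\<^sub>R u\<close> avoid the origin for small \<open>s\<close>,
  so both one-variable derivatives in \<open>fform\<close> are directional derivatives of smooth
  functions. Bilinearity and continuity of \<open>fform\<close> are then inherited from
  \<open>dQ\<close>.\<close>

lemma fform_eq:
  assumes "y \<noteq> 0"
  shows "fform F y u v = frechet_derivative (\<lambda>z. dQ z v) (at y) u / 2"
proof -
  have 1: "deriv (\<lambda>t. (F (z + t *\<^sub>R v))\<^sup>2) 0 = dQ z v" if "z \<noteq> 0" for z
    using line_deriv[of "\<lambda>y. (F y)\<^sup>2" "dQ z" z 0 v] hdQ[OF that] by (simp add: DERIV_imp_deriv)
  have "\<forall>\<^sub>F s in nhds 0. y + s *\<^sub>R u \<noteq> 0"
  proof -
    have "open {s::real. y + s *\<^sub>R u \<noteq> 0}" by (intro open_Collect_neq continuous_intros)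
    from eventually_nhds_in_open[OF this, of 0] show ?thesis using assms by simp
  qed
  then have "\<forall>\<^sub>F s in nhds 0. deriv (\<lambda>t. (F (y + s *\<^sub>R u + t *\<^sub>R v))\<^sup>2) 0 = dQ (y + s *\<^sub>R u) v"
    by eventually_elim (rule 1)
  then have "deriv (\<lambda>s. deriv (\<lambda>t. (F (y + s *\<^sub>R u + t *\<^sub>R v))\<^sup>2) 0) 0
      = deriv (\<lambda>s. dQ (y + s *\<^sub>R u) v) 0"
    by (rule deriv_cong_ev) simp
  also have "\<dots> = frechet_derivative (\<lambda>z. dQ z v) (at y) u"
    using line_deriv[of "\<lambda>z. dQ z v" _ y 0 u] hddQ[OF assms] by (simp add: DERIV_imp_deriv)
  finally show ?thesis by (simp add: fform_def)
qed

lemma dF_scale: assumes "y \<noteq> 0" "0 < a" shows "dF (a *\<^sub>R y) = dF y"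
proof -
  have "((\<lambda>z. a * F ((1/a) *\<^sub>R z)) has_derivative (\<lambda>v. a * dF y ((1/a) *\<^sub>R v))) (at (a *\<^sub>R y))"
    by (rule has_derivative_mult_right,
        rule has_derivative_compose[of "\<lambda>z. (1/a) *\<^sub>R z" "\<lambda>v. (1/a) *\<^sub>R v" _ _ F "dF y"])
      (use assms hdF in \<open>auto intro!: derivative_eq_intros\<close>)
  moreover have "(\<lambda>z. a * F ((1/a) *\<^sub>R z)) = F"
    using assms scale[of "1/a"] by (auto simp: fun_eq_iff)
  moreover have "(\<lambda>v. a * dF y ((1/a) *\<^sub>R v)) = dF y"
    using assms linear_scale[OF linear_dF[OF assms(1)]] by (auto simp: fun_eq_iff)
  ultimately show ?thesis
    using hdF[of "a *\<^sub>R y"] assms has_derivative_unique[of F _ "a *\<^sub>R y"] by auto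
qed

text \<open>Euler's identity for homogeneity of degree one, obtained by differentiating along the
  ray through \<open>y\<close>.\<close>

lemma dF_self: assumes "y \<noteq> 0" shows "dF y y = F y"
proof -
  have 1: "((\<lambda>t. F (y + t *\<^sub>R y)) has_real_derivative dF y y) (at 0)"
    using line_deriv[of F "dF y" y 0 y] hdF[OF assms] by simp
  have "((\<lambda>t. (1 + t) * F y) has_real_derivative F y) (at 0)"
    by (auto intro!: derivative_eq_intros)
  then have "((\<lambda>t. F (y + t *\<^sub>R y)) has_real_derivative F y) (at 0)"
  proof (rule has_field_derivative_transform_within_open[of _ _ _ "{-1<..}"])
    fix t :: real assume "t \<in> {-1<..}"
    then show "(1 + t) * F y = F (y + t *\<^sub>R y)"
      using scale[of "1 + t" y] by (simp add: scaleR_add_left)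
  qed auto
  then show ?thesis using 1 DERIV_unique by blast
qed

lemma dF_pos_mult: "y \<noteq> 0 \<Longrightarrow> dF y (r *\<^sub>R y) = r * F y"
  using linear_dF by (simp add: linear_scale dF_self)

lemma dQ_scale: assumes "y \<noteq> 0" "0 < a" shows "dQ (a *\<^sub>R y) v = a * dQ y v"
  using assms by (simp add: dQ_eq dF_scale scale)

text \<open>Euler's identity for \<open>dQ y v\<close>, which is homogeneous of degree one in
  \<open>y\<close>. On the indicatrix it turns the Landsberg condition, stated with
  \<open>fform\<close>, into equality of momenta along the edge.\<close>

lemma fform_radial: assumes "y \<noteq> 0" shows "fform F y y v = F y * dF y v"
proof -
  have 1: "((\<lambda>t. dQ (y + t *\<^sub>R y) v) has_real_derivative frechet_derivative (\<lambda>z. dQ z v) (at y) y) (at 0)"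
    using line_deriv[of "\<lambda>z. dQ z v" _ y 0 y] hddQ[OF assms] by simp
  have "((\<lambda>t. (1 + t) * dQ y v) has_real_derivative dQ y v) (at 0)"
    by (auto intro!: derivative_eq_intros)
  then have "((\<lambda>t. dQ (y + t *\<^sub>R y) v) has_real_derivative dQ y v) (at 0)"
  proof (rule has_field_derivative_transform_within_open[of _ _ _ "{-1<..}"])
    fix t :: real assume "t \<in> {-1<..}"
    then show "(1 + t) * dQ y v = dQ (y + t *\<^sub>R y) v"
      using dQ_scale[OF assms, of "1 + t" v] by (simp add: scaleR_add_left)
  qed auto
  then have "frechet_derivative (\<lambda>z. dQ z v) (at y) y = dQ y v" using 1 DERIV_unique by blast
  then show ?thesis using assms by (simp add: fform_eq dQ_eq)
qed

lemma linear_fform1: assumes "y \<noteq> 0" shows "linear (\<lambda>u. fform F y u v)"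
proof -
  have "linear (frechet_derivative (\<lambda>z. dQ z v) (at y))"
    using hddQ[OF assms] has_derivative_linear by blast
  then show ?thesis
    by (simp add: fform_eq[OF assms] linear_iff add_divide_distrib)
qed

lemma linear_fform2: assumes "y \<noteq> 0" shows "linear (\<lambda>v. fform F y u v)"
proof (rule linearI)
  fix v w
  have "((\<lambda>z. dQ z v + dQ z w) has_derivative
      (\<lambda>u. frechet_derivative (\<lambda>z. dQ z v) (at y) u + frechet_derivative (\<lambda>z. dQ z w) (at y) u)) (at y)"
    by (intro has_derivative_add hddQ assms)
  then have "((\<lambda>z. dQ z (v + w)) has_derivative
      (\<lambda>u. frechet_derivative (\<lambda>z. dQ z v) (at y) u + frechet_derivative (\<lambda>z. dQ z w) (at y) u)) (at y)"
    by (rule has_derivative_transform_within_open[of _ _ _ _ "- {0}"])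
      (use assms linear_add[OF linear_dQ] in auto)
  from has_derivative_unique[OF this hddQ[OF assms]]
  show "fform F y u (v + w) = fform F y u v + fform F y u w"
    by (auto simp: fform_eq[OF assms] fun_eq_iff add_divide_distrib dest!: spec[of _ u])
next
  fix c v
  have "((\<lambda>z. c * dQ z v) has_derivative (\<lambda>u. c * frechet_derivative (\<lambda>z. dQ z v) (at y) u)) (at y)"
    by (intro has_derivative_mult_right hddQ assms)
  then have "((\<lambda>z. dQ z (c *\<^sub>R v)) has_derivative
      (\<lambda>u. c * frechet_derivative (\<lambda>z. dQ z v) (at y) u)) (at y)"
    by (rule has_derivative_transform_within_open[of _ _ _ _ "- {0}"])
      (use assms linear_scale[OF linear_dQ] in auto)
  from has_derivative_unique[OF this hddQ[OF assms]]
  show "fform F y u (c *\<^sub>R v) = c *\<^sub>R fform F y u v"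
    by (auto simp: fform_eq[OF assms] fun_eq_iff dest!: spec[of _ u])
qed

lemma fform_scale2:
  assumes "y \<noteq> 0" shows "fform F y (c *\<^sub>R v) (c *\<^sub>R v) = c\<^sup>2 * fform F y v v"
  using linear_scale[OF linear_fform1[OF assms]] linear_scale[OF linear_fform2[OF assms]]
  by (simp add: power2_eq_square)

lemma continuous_fform:
  assumes "continuous_on S g" "continuous_on S h" "continuous_on S k" "\<And>t. t \<in> S \<Longrightarrow> g t \<noteq> 0"
  shows "continuous_on S (\<lambda>t. fform F (g t) (h t) (k t))"
proof -
  have c: "continuous_on S (\<lambda>t. fform F (g t) u v)" for u v
  proof -
    have "continuous_on (- {0}) (\<lambda>y. frechet_derivative (\<lambda>z. dQ z v) (at y) u)"
      using Ck_dQ[of "Suc 0" v] by simp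
    then have "continuous_on S (\<lambda>t. frechet_derivative (\<lambda>z. dQ z v) (at (g t)) u)"
      by (rule continuous_on_compose2[OF _ assms(1)]) (use assms(4) in auto)
    then have "continuous_on S (\<lambda>t. frechet_derivative (\<lambda>z. dQ z v) (at (g t)) u / 2)"
      by (intro continuous_intros) auto
    then show ?thesis
      by (subst continuous_on_cong[OF refl fform_eq]) (use assms(4) in auto)
  qed
  \<comment> \<open>Bilinearity reduces moving arguments to finitely many coefficients with fixed
    basis vectors, whose continuity is already known.\<close>
  have "fform F (g t) (h t) (k t) = (\<Sum>a\<in>Basis. \<Sum>b\<in>Basis. (h t \<bullet> a) * ((k t \<bullet> b) * fform F (g t) a b))"
    if "t \<in> S" for t
  proof -
    note l1 = linear_fform1[OF assms(4)[OF that]] and l2 = linear_fform2[OF assms(4)[OF that]]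
    have 1: "fform F (g t) (h t) v = (\<Sum>a\<in>Basis. (h t \<bullet> a) * fform F (g t) a v)" for v
      by (subst (1) euclidean_representation[of "h t", symmetric])
        (simp only: linear_sum[OF l1] linear_scale[OF l1] real_scaleR_def o_def)
    have 2: "fform F (g t) a (k t) = (\<Sum>b\<in>Basis. (k t \<bullet> b) * fform F (g t) a b)" for a
      by (subst (1) euclidean_representation[of "k t", symmetric])
        (simp only: linear_sum[OF l2] linear_scale[OF l2] real_scaleR_def o_def)
    show ?thesis by (rule trans[OF 1[of "k t"]]) (simp only: 2 sum_distrib_left)
  qed
  moreover have "continuous_on S
      (\<lambda>t. \<Sum>a\<in>Basis. \<Sum>b\<in>Basis. (h t \<bullet> a) * ((k t \<bullet> b) * fform F (g t) a b))"
    by (intro continuous_intros c assms(2,3))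
  ultimately show ?thesis by (subst continuous_on_cong[OF refl]) auto
qed

text \<open>Along a line that misses the origin, the square of \<open>F\<close> is strictly convex
  because \<open>fform\<close> is positive. It has equal values at \<open>u\<close> and
  \<open>w\<close>, so its derivative at \<open>u\<close> towards \<open>w\<close> is
  negative.\<close>

lemma dF_less_aux:
  assumes "F u = 1" "F w = 1" "\<And>t. u + t *\<^sub>R (w - u) \<noteq> 0" "u \<noteq> w"
  shows "dF u w < 1"
proof -
  define d where "d = w - u"
  have nz: "u + t *\<^sub>R d \<noteq> 0" for t using assms(3) by (simp add: d_def)
  have u0: "u \<noteq> 0" using nz[of 0] by simp
  define f where "f t = (F (u + t *\<^sub>R d))\<^sup>2" for t
  have f1: "(f has_real_derivative dQ (u + t *\<^sub>R d) d) (at t)" for t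
    unfolding f_def by (rule line_deriv[of "\<lambda>y. (F y)\<^sup>2"]) (rule hdQ[OF nz])
  have f2: "((\<lambda>t. dQ (u + t *\<^sub>R d) d) has_real_derivative 2 * fform F (u + t *\<^sub>R d) d d) (at t)" for t
    using line_deriv[of "\<lambda>y. dQ y d", OF hddQ[OF nz]] by (simp add: fform_eq[OF nz])
  obtain z where z: "0 < z" "z < 1" "f 1 - f 0 = (1 - 0) * dQ (u + z *\<^sub>R d) d"
    using MVT2[of 0 1 f "\<lambda>t. dQ (u + t *\<^sub>R d) d"] f1 by auto
  have "dQ (u + 0 *\<^sub>R d) d < dQ (u + z *\<^sub>R d) d"
    using DERIV_pos_imp_increasing[of 0 z "\<lambda>t. dQ (u + t *\<^sub>R d) d"] f2 z(1) fform_pos[OF nz, of d] assms(4)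
    by (metis d_def eq_iff_diff_eq_0 mult_pos_pos zero_less_numeral)
  moreover have "f 1 - f 0 = 0" using assms by (simp add: f_def d_def)
  ultimately have "dQ u d < 0" using z by simp
  then show ?thesis
    using assms(1) u0 linear_diff[OF linear_dF[OF u0]] by (simp add: dQ_eq d_def dF_self)
qed

text \<open>The strict fundamental inequality. If \<open>w\<close> is a negative multiple of
  \<open>u\<close>, the left side is negative. Otherwise the line through the normalized vectors
  misses the origin and strict convexity along it applies.\<close>

lemma dF_less:
  assumes "u \<noteq> 0" and ne: "\<And>r. 0 \<le> r \<Longrightarrow> w \<noteq> r *\<^sub>R u"
  shows "dF u w < F w"
proof (cases "\<exists>r<0. w = r *\<^sub>R u")
  case True
  then obtain r where "r < 0" "w = r *\<^sub>R u" by blast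
  moreover have "dF u w = r * F u" using dF_pos_mult[OF assms(1)] \<open>w = r *\<^sub>R u\<close> by simp
  moreover have "r * F u < 0" using pos[OF assms(1)] \<open>r < 0\<close> mult_neg_pos by blast
  ultimately show ?thesis using nonneg[of w] by simp
next
  case False
  then have nm: "w \<noteq> r *\<^sub>R u" for r using ne[of r] by (cases "r < 0") auto
  have w0: "w \<noteq> 0" using nm[of 0] by simp
  note pu = pos[OF assms(1)] and pw = pos[OF w0]
  define u1 w1 where "u1 = (1 / F u) *\<^sub>R u" and "w1 = (1 / F w) *\<^sub>R w"
  have n1: "F u1 = 1" "F w1 = 1" using pu pw by (simp_all add: u1_def w1_def scale)
  have w1: "w = F w *\<^sub>R w1" "u1 = (1 / F u) *\<^sub>R u" using pw by (auto simp: w1_def u1_def)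
  have nm1: "w1 \<noteq> r *\<^sub>R u1" for r
    using nm[of "F w * r / F u"] w1 by (metis scaleR_scaleR times_divide_eq_right mult.right_neutral mult.assoc)
  have "u1 + t *\<^sub>R (w1 - u1) \<noteq> 0" for t
  proof
    assume eq: "u1 + t *\<^sub>R (w1 - u1) = 0"
    have "u1 \<noteq> 0" using n1 by auto
    then have "t \<noteq> 0" using eq by auto
    have "t *\<^sub>R w1 = (t - 1) *\<^sub>R u1" using eq by (simp add: algebra_simps)
    then have "w1 = ((t - 1) / t) *\<^sub>R u1"
      using \<open>t \<noteq> 0\<close> by (metis divide_inverse_commute left_inverse scaleR_one scaleR_scaleR)
    then show False using nm1 by blast
  qed
  then have "dF u1 w1 < 1" using dF_less_aux n1 nm1[of 1] by auto
  moreover have "dF u1 = dF u" unfolding u1_def using dF_scale[OF assms(1)] pu by simp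
  ultimately have "dF u w1 < 1" by simp
  then have "F w * dF u w1 < F w" using pw by simp
  then show ?thesis using w1(1) linear_scale[OF linear_dF[OF assms(1)], of "F w" w1] by simp
qed

lemma dF_le: assumes "u \<noteq> 0" shows "dF u w \<le> F w"
proof (cases "\<exists>r\<ge>0. w = r *\<^sub>R u")
  case True
  then show ?thesis using dF_pos_mult[OF assms] scale by auto
next
  case False
  then show ?thesis using dF_less[OF assms, of w] by force
qed

text \<open>This equality case carries all rigidity statements: straightness of geodesics,
  refraction along a ray and the behaviour of the Landsberg map at the ends of a half
  circle.\<close>

lemma dF_eq_imp: assumes "u \<noteq> 0" "dF u w = F w" shows "\<exists>r\<ge>0. w = r *\<^sub>R u"
  using dF_less[OF assms(1), of w] assms(2) by fastforce

lemma triangle: "F (v + w) \<le> F v + F w"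
proof (cases "v + w = 0")
  case True
  then show ?thesis using nonneg[of v] nonneg[of w] by simp
next
  case False
  have "F (v + w) = dF (v + w) v + dF (v + w) w"
    using dF_self[OF False] linear_add[OF linear_dF[OF False]] by metis
  then show ?thesis using dF_le[OF False, of v] dF_le[OF False, of w] by simp
qed

end

lemma minkowski_norm_reverse:
  assumes "minkowski_norm F" shows "minkowski_norm (\<lambda>y. F (- y))"
    and "y \<noteq> 0 \<Longrightarrow> fform (\<lambda>y. F (- y)) y u v = fform F (- y) u v"
proof -
  interpret minkowski F by unfold_locales (rule assms)
  have ff: "fform (\<lambda>y. F (- y)) y u v = fform F (- y) u v" if "y \<noteq> 0" for y u v
  proof -
    have "fform (\<lambda>y. F (- y)) y u v = fform F (- y) (- u) (- v)"
      unfolding fform_def by (simp add: minus_add_distrib[symmetric] del: minus_add_distrib minus_diff_eq)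
        (simp add: algebra_simps)
    also have "\<dots> = fform F (- y) u v"
      using linear_neg[OF linear_fform1[of "- y"]] linear_neg[OF linear_fform2[of "- y"]] that by simp
    finally show ?thesis .
  qed
  then show "y \<noteq> 0 \<Longrightarrow> fform (\<lambda>y. F (- y)) y u v = fform F (- y) u v" by blast
  have "Ck_on k (- {0}) (\<lambda>y. F (0 + (- y)))" for k
    by (rule Ck_on_affine[OF _ bounded_linear_minus[OF bounded_linear_ident], of _ _ "- {0}"])
      (use smooth in \<open>auto simp: smooth_on_def\<close>)
  then have "smooth_on (- {0}) (\<lambda>y. F (- y))" by (simp add: smooth_on_def)
  moreover have "continuous_on UNIV (\<lambda>y. F (- y))"
    by (rule continuous_on_compose2[OF cont[of UNIV]]) (auto intro: continuous_intros)
  ultimately show "minkowski_norm (\<lambda>y. F (- y))"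
    unfolding minkowski_norm_def using nonneg pos scale[of _ "- _"] fform_pos
    by (auto simp: ff)
qed

section \<open>Arc length of indicatrices in the plane\<close>

definition cross2 :: "real^2 \<Rightarrow> real^2 \<Rightarrow> real" where
  "cross2 y z = y$1 * z$2 - y$2 * z$1"

lemma det_vector2: "det (vector [y, z] :: real^2^2) = cross2 y z"
  by (simp add: det_2 cross2_def)

lemma cross2_add: "cross2 (x + y) z = cross2 x z + cross2 y z" "cross2 x (y + z) = cross2 x y + cross2 x z"
  and cross2_diff: "cross2 (x - y) z = cross2 x z - cross2 y z" "cross2 x (y - z) = cross2 x y - cross2 x z"
  and cross2_scale: "cross2 (c *\<^sub>R x) z = c * cross2 x z" "cross2 x (c *\<^sub>R z) = c * cross2 x z"
  and cross2_minus: "cross2 (- x) z = - cross2 x z" "cross2 x (- z) = - cross2 x z"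
  and cross2_self: "cross2 x x = 0"
  and cross2_zero: "cross2 0 x = 0" "cross2 x 0 = 0"
  by (simp_all add: cross2_def algebra_simps)

lemmas cross2_simps [simp] = cross2_add cross2_diff cross2_scale cross2_minus cross2_self cross2_zero

lemma cross2_commute: "cross2 y z = - cross2 z y"
  by (simp add: cross2_def)

lemma vec2_eq_iff: "(x::real^2) = y \<longleftrightarrow> x$1 = y$1 \<and> x$2 = y$2"
  by (simp add: vec_eq_iff forall_2)

lemma cross2_basis: assumes "cross2 a b \<noteq> 0"
  shows "y = (cross2 y b / cross2 a b) *\<^sub>R a + (cross2 a y / cross2 a b) *\<^sub>R b"
proof -
  have "cross2 a b *\<^sub>R y = cross2 y b *\<^sub>R a + cross2 a y *\<^sub>R b"
    by (simp add: vec2_eq_iff cross2_def algebra_simps)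
  then have "(1 / cross2 a b) *\<^sub>R (cross2 a b *\<^sub>R y) = (1 / cross2 a b) *\<^sub>R (cross2 y b *\<^sub>R a + cross2 a y *\<^sub>R b)"
    by simp
  then show ?thesis using assms by (simp add: scaleR_add_right)
qed

lemma cross2_eq_0_imp: assumes "cross2 a z = 0" "a \<noteq> 0" shows "\<exists>r. z = r *\<^sub>R a"
proof -
  have d: "(a$1)\<^sup>2 + (a$2)\<^sup>2 \<noteq> 0" using assms(2) by (auto simp: vec2_eq_iff)
  have "((a$1)\<^sup>2 + (a$2)\<^sup>2) *\<^sub>R z = (a$1 * z$1 + a$2 * z$2) *\<^sub>R a"
    using assms(1) by (simp add: vec2_eq_iff cross2_def power2_eq_square algebra_simps)
  then have "(1 / ((a$1)\<^sup>2 + (a$2)\<^sup>2)) *\<^sub>R (((a$1)\<^sup>2 + (a$2)\<^sup>2) *\<^sub>R z)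
      = (1 / ((a$1)\<^sup>2 + (a$2)\<^sup>2)) *\<^sub>R ((a$1 * z$1 + a$2 * z$2) *\<^sub>R a)" by simp
  then have "z = ((a$1 * z$1 + a$2 * z$2) / ((a$1)\<^sup>2 + (a$2)\<^sup>2)) *\<^sub>R a"
    using d by (auto split: if_splits)
  then show ?thesis by blast
qed

lemma continuous_cross2 [continuous_intros]:
  "continuous_on S f \<Longrightarrow> continuous_on S g \<Longrightarrow> continuous_on S (\<lambda>t. cross2 (f t) (g t))"
  unfolding cross2_def by (intro continuous_intros)

text \<open>The factor \<open>e\<close> is 1 or -1 and will be \<open>ori i\<close>: a growing angle
  then means turning left in the orientation of the cone, even in a chart that reverses it.\<close>

definition polar :: "real \<Rightarrow> real \<Rightarrow> real^2" where
  "polar e t = vector [cos t, e * sin t]"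

lemma polar_nth [simp]: "polar e t $ 1 = cos t" "polar e t $ 2 = e * sin t"
  by (simp_all add: polar_def)

lemma polar_shift: "polar e (t + pi) = - polar e t" "polar e (t - pi) = - polar e t"
    "polar e (t + 2 * pi) = polar e t"
  by (simp_all add: vec2_eq_iff)

lemma polar_uminus: "polar (- e) t = polar e (- t)"
  by (simp add: vec2_eq_iff)

locale sign =
  fixes e :: real
  assumes e: "e \<in> {1, -1}"
begin

lemma ee: "e * e = 1" "e \<noteq> 0" "\<bar>e\<bar> = 1" "e * (e * x) = x"
  using e by auto

lemma cross2_polar: "e * cross2 (polar e a) (polar e b) = sin (b - a)"
  using e by (auto simp: cross2_def sin_diff algebra_simps)

lemma polar_nz [simp]: "polar e t \<noteq> 0"
proof
  assume "polar e t = 0"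
  then have "cos t = 0" "sin t = 0" using ee(2) by (auto simp: vec2_eq_iff)
  then show False using sin_cos_squared_add[of t] by simp
qed

lemma polar_add: "polar e (a + b) = cos b *\<^sub>R polar e a + sin b *\<^sub>R polar e (a + pi / 2)"
  by (simp add: vec2_eq_iff cos_add sin_add algebra_simps)

lemma ex_polar: assumes "y \<noteq> 0" shows "\<exists>r>0. \<exists>t. a \<le> t \<and> t < a + 2 * pi \<and> y = r *\<^sub>R polar e t"
proof -
  define r where "r = sqrt ((y$1)\<^sup>2 + (y$2)\<^sup>2)"
  have p: "(y$1)\<^sup>2 + (y$2)\<^sup>2 > 0"
    using assms by (auto simp: vec2_eq_iff sum_power2_gt_zero_iff)
  have r: "r > 0" "r * r = (y$1)\<^sup>2 + (y$2)\<^sup>2" using p by (simp_all add: r_def)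
  have "(y$1 / r)\<^sup>2 + (e * y$2 / r)\<^sup>2 = ((y$1)\<^sup>2 + (y$2)\<^sup>2) / (r * r)"
    using ee(1) by (simp add: power_divide power_mult_distrib power2_eq_square[of e] add_divide_distrib power2_eq_square[of r])
  then have "(y$1 / r)\<^sup>2 + (e * y$2 / r)\<^sup>2 = 1" using r by (metis divide_self less_irrefl p)
  then obtain t where t: "y$1 / r = cos t" "e * y$2 / r = sin t"
    using sincos_total_2pi[of "y$1 / r" "e * y$2 / r"] by metis
  \<comment> \<open>The number of full turns that moves the angle into the prescribed period
    starting at \<open>a\<close>.\<close>
  define n where "n = ceiling ((a - t) / (2 * pi))"
  define s where "s = t + 2 * pi * of_int n"
  have n: "(a - t) / (2 * pi) \<le> of_int n" "of_int n < (a - t) / (2 * pi) + 1"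
    unfolding n_def by linarith+
  have "a \<le> s" "s < a + 2 * pi"
    using n pi_gt_zero by (simp_all add: s_def field_simps)
  moreover have "y = r *\<^sub>R polar e s"
  proof -
    have "cos s = cos t" "sin s = sin t"
      unfolding s_def by (simp_all add: cos_add sin_add)
    moreover have "y$1 = r * cos t" "y$2 = r * (e * sin t)"
      using t[symmetric] r(1) ee(4) by (simp_all)
    ultimately show ?thesis by (simp add: vec2_eq_iff)
  qed
  ultimately show ?thesis using r(1) by blast
qed

lemma polar_eqD:
  assumes "r *\<^sub>R polar e a = s *\<^sub>R polar e b" "0 < r" "0 < s" "\<bar>a - b\<bar> < 2 * pi"
  shows "a = b" "r = s"
proof -
  have c: "r * cos a = s * cos b" and d: "r * sin a = s * sin b"
    using assms(1) ee(2) by (auto simp: vec2_eq_iff)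
  have "r\<^sup>2 * ((sin a)\<^sup>2 + (cos a)\<^sup>2) = s\<^sup>2 * ((sin b)\<^sup>2 + (cos b)\<^sup>2)"
    unfolding distrib_left power_mult_distrib[symmetric] c d ..
  then have "r\<^sup>2 = s\<^sup>2" by simp
  then show rs: "r = s" using assms by (simp add: power2_eq_iff_nonneg)
  then have "cos a = cos b" "sin a = sin b" using c d assms by auto
  then have "cos (a - b) = 1" by (simp add: cos_diff sin_cos_squared_add2 flip: power2_eq_square)
  then obtain n :: int where n: "a - b = of_int n * 2 * pi" using cos_one_2pi_int by blast
  then have "\<bar>of_int n\<bar> * (2 * pi) < 1 * (2 * pi)" using assms(4) by (simp add: abs_mult)
  then have "\<bar>of_int n :: real\<bar> < 1" by (subst (asm) mult_less_cancel_right) auto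
  then have "n = 0" by linarith
  then show "a = b" using n by simp
qed

lemma ex_polar_ge:
  assumes "z \<noteq> 0" "0 \<le> e * cross2 (polar e a) z"
  shows "\<exists>r>0. \<exists>t\<in>{a..a+pi}. z = r *\<^sub>R polar e t"
proof -
  obtain r t where rt: "r > 0" "a \<le> t" "t < a + 2 * pi" "z = r *\<^sub>R polar e t" using ex_polar[OF assms(1)] by blast
  have "e * cross2 (polar e a) z = r * sin (t - a)" using rt cross2_polar[of a t] by simp
  then have "0 \<le> r * sin (t - a)" using assms(2) by simp
  then have "0 \<le> sin (t - a)" using rt(1) by (simp add: zero_le_mult_iff)
  then have "t - a \<le> pi" using sin_lt_zero[of "t - a"] rt by force
  then show ?thesis using rt by (intro exI[of _ r] conjI bexI[of _ t]) auto
qed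

lemma ex_polar_gt:
  assumes "0 < e * cross2 (polar e a) z"
  shows "\<exists>r>0. \<exists>t\<in>{a<..<a+pi}. z = r *\<^sub>R polar e t"
proof -
  have "z \<noteq> 0" using assms by auto
  then obtain r t where rt: "r > 0" "t \<in> {a..a+pi}" "z = r *\<^sub>R polar e t" using ex_polar_ge[of z a] assms by auto
  have "e * cross2 (polar e a) z = r * sin (t - a)" using rt cross2_polar[of a t] by simp
  then have "0 < r * sin (t - a)" using assms by simp
  then have "0 < sin (t - a)" using rt(1) by (simp add: zero_less_mult_iff)
  then have "t \<noteq> a" "t \<noteq> a + pi" by auto
  then show ?thesis using rt by force
qed

lemma polar_expand: "y = (y \<bullet> polar e t) *\<^sub>R polar e t + (e * cross2 (polar e t) y) *\<^sub>R polar e (t + pi / 2)"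
proof -
  have sc: "cos t * cos t + sin t * sin t = 1" using sin_cos_squared_add2[of t] by (simp add: power2_eq_square)
  have "y$1 = (y$1 * cos t + y$2 * (e * sin t)) * cos t
      + (e * (cos t * y$2 - e * sin t * y$1)) * (- sin t)"
    using sc ee(1) by algebra
  moreover have "y$2 = (y$1 * cos t + y$2 * (e * sin t)) * (e * sin t)
      + (e * (cos t * y$2 - e * sin t * y$1)) * (e * cos t)"
    using sc ee(1) by algebra
  moreover have "y \<bullet> polar e t = y$1 * cos t + y$2 * (e * sin t)"
    by (simp add: inner_vec_def sum_2)
  moreover have "cos (t + pi / 2) = - sin t" "sin (t + pi / 2) = cos t"
    by (simp_all add: cos_add sin_add)
  ultimately show ?thesis
    unfolding vec2_eq_iff cross2_def by simp
qed

text \<open>In the frame of the direction of \<open>u\<close> and its perpendicular at angle \<phi>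
  - pi/2, the line has constant distance \<open>d\<close> from the origin and position
  \<open>a t\<close> relative to the foot of the perpendicular. Its angle is therefore an arctangent
  of \<open>a t / d\<close>, which sweeps exactly the open half circle before the direction of
  \<open>u\<close>.\<close>

lemma line_polar:
  assumes "0 < e * cross2 y u" "u = r *\<^sub>R polar e \<phi>" "0 < r"
  shows "\<exists>\<theta> \<theta>'. (\<forall>t. (\<theta> has_real_derivative \<theta>' t) (at t)) \<and> continuous_on UNIV \<theta>' \<and> (\<forall>t. 0 < \<theta>' t) \<and>
     (\<forall>t. \<exists>\<rho>>0. y + t *\<^sub>R u = \<rho> *\<^sub>R polar e (\<theta> t)) \<and> (\<forall>t. \<phi> - pi < \<theta> t \<and> \<theta> t < \<phi>) \<and>
     (\<theta> \<longlongrightarrow> \<phi>) at_top \<and> (\<theta> \<longlongrightarrow> \<phi> - pi) at_bot"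
proof -
  define q where "q = \<phi> - pi / 2"
  define d where "d = y \<bullet> polar e q"
  define a where "a t = e * cross2 (polar e q) y + t * r" for t
  have q: "polar e (q + pi / 2) = polar e \<phi>" by (simp add: q_def)
  have ye: "y = d *\<^sub>R polar e q + (e * cross2 (polar e q) y) *\<^sub>R polar e \<phi>"
    using polar_expand[of y q] by (simp add: d_def q)
  have "e * cross2 y u = d * r * (e * cross2 (polar e q) (polar e \<phi>))"
    by (subst (1) ye) (simp add: assms(2) algebra_simps)
  also have "\<dots> = d * r" by (simp add: cross2_polar q_def)
  finally have d: "d > 0" using assms(1,3) by (simp add: zero_less_mult_iff)
  have line: "y + t *\<^sub>R u = d *\<^sub>R polar e q + a t *\<^sub>R polar e \<phi>" for t
    by (subst (1) ye) (simp add: a_def assms(2) scaleR_add_left)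
  define \<theta> where "\<theta> t = q + arctan (a t / d)" for t
  define \<theta>' where "\<theta>' t = (r / d) / (1 + (a t / d)\<^sup>2)" for t
  have "(\<theta> has_real_derivative \<theta>' t) (at t)" for t
  proof -
    have "((\<lambda>t. a t / d) has_real_derivative r / d) (at t)"
      unfolding a_def using d by (auto intro!: derivative_eq_intros)
    from DERIV_add[OF DERIV_const DERIV_chain2[OF DERIV_arctan this]]
    show ?thesis by (simp add: \<theta>_def[abs_def] \<theta>'_def divide_inverse mult.commute)
  qed
  moreover have "continuous_on UNIV \<theta>'"
    unfolding \<theta>'_def a_def using d by (intro continuous_intros) (auto simp: add_nonneg_eq_0_iff)
  moreover have "0 < \<theta>' t" for t
    unfolding \<theta>'_def using d assms(3) by (simp add: add_pos_nonneg)
  moreover have "\<exists>\<rho>>0. y + t *\<^sub>R u = \<rho> *\<^sub>R polar e (\<theta> t)" for t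
  proof (intro exI conjI)
    define x where "x = a t / d"
    have p: "sqrt (1 + x\<^sup>2) > 0" by (simp add: add_pos_nonneg)
    show "d * sqrt (1 + x\<^sup>2) > 0" using d p by simp
    have "polar e (\<theta> t) = (1 / sqrt (1 + x\<^sup>2)) *\<^sub>R polar e q + (x / sqrt (1 + x\<^sup>2)) *\<^sub>R polar e \<phi>"
      using polar_add[of q "arctan x"] by (simp only: \<theta>_def q x_def[symmetric] cos_arctan sin_arctan)
    then show "y + t *\<^sub>R u = (d * sqrt (1 + x\<^sup>2)) *\<^sub>R polar e (\<theta> t)"
      using p d by (simp add: line scaleR_add_right x_def)
  qed
  moreover have "\<phi> - pi < \<theta> t \<and> \<theta> t < \<phi>" for t
    using arctan[of "a t / d"] by (simp add: \<theta>_def q_def)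
  moreover have "(\<theta> \<longlongrightarrow> q + pi / 2) at_top"
    unfolding \<theta>_def
  proof (intro tendsto_add tendsto_const filterlim_compose[OF tendsto_arctan_at_top])
    show "LIM t at_top. a t / d :> at_top" unfolding a_def
      using d assms(3) by real_asymp
  qed
  moreover have "(\<theta> \<longlongrightarrow> q + - (pi / 2)) at_bot"
    unfolding \<theta>_def
  proof (intro tendsto_add tendsto_const filterlim_compose[OF tendsto_arctan_at_bot])
    show "LIM t at_bot. a t / d :> at_bot" unfolding a_def
      using d assms(3) by real_asymp
  qed
  ultimately show ?thesis
    by (intro exI[of _ \<theta>] exI[of _ \<theta>']) (simp add: q_def)
qed

end

section \<open>The indicatrix in polar coordinates and its arc length\<close>

definition nu :: "(real^2 \<Rightarrow> real) \<Rightarrow> real \<Rightarrow> real \<Rightarrow> real^2" where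
  "nu F e t = (1 / F (polar e t)) *\<^sub>R polar e t"

definition nu' :: "(real^2 \<Rightarrow> real) \<Rightarrow> real \<Rightarrow> real \<Rightarrow> real^2" where
  "nu' F e t = vector_derivative (nu F e) (at t)"

definition kap :: "(real^2 \<Rightarrow> real) \<Rightarrow> real \<Rightarrow> real \<Rightarrow> real" where
  "kap F e t = sqrt (fform F (nu F e t) (nu' F e t) (nu' F e t))"

text \<open>Arc length on the universal cover of the indicatrix: the integral is oriented, so
  negative angles give negative values, and further turns are counted with multiplicity.\<close>

definition Th :: "(real^2 \<Rightarrow> real) \<Rightarrow> real \<Rightarrow> real \<Rightarrow> real" where
  "Th F e t = (LBINT s=0..t. kap F e s)"

locale planar = minkowski F + sign e for F :: "real^2 \<Rightarrow> real" and e :: real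
begin

abbreviation "N \<equiv> nu F e"
abbreviation "N' \<equiv> nu' F e"
abbreviation "K \<equiv> kap F e"
abbreviation "T \<equiv> Th F e"

lemma polar_deriv: "(polar e has_vector_derivative polar e (t + pi / 2)) (at t)"
proof -
  have "((\<lambda>t. cos t *\<^sub>R polar e 0 + sin t *\<^sub>R polar e (pi / 2)) has_vector_derivative
      - sin t *\<^sub>R polar e 0 + cos t *\<^sub>R polar e (pi / 2)) (at t)"
    by (rule derivative_eq_intros refl | simp)+
  moreover have "(\<lambda>t. cos t *\<^sub>R polar e 0 + sin t *\<^sub>R polar e (pi / 2)) = polar e"
    by (simp add: fun_eq_iff vec2_eq_iff)
  moreover have "- sin t *\<^sub>R polar e 0 + cos t *\<^sub>R polar e (pi / 2) = polar e (t + pi / 2)"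
    by (simp add: vec2_eq_iff sin_add cos_add)
  ultimately show ?thesis by simp
qed

lemma cont_polar: "continuous_on S (polar e)"
  by (meson continuous_at_imp_continuous_on has_vector_derivative_continuous polar_deriv)

lemma N_deriv: "(N has_vector_derivative N' t) (at t)"
  and N'_eq: "N' t = (1 / F (polar e t)) *\<^sub>R polar e (t + pi / 2)
     + (- dF (polar e t) (polar e (t + pi / 2)) / (F (polar e t))\<^sup>2) *\<^sub>R polar e t"
proof -
  have p: "F (polar e t) > 0" using pos by simp
  have "((\<lambda>t. F (polar e t)) has_derivative (\<lambda>h. dF (polar e t) (h *\<^sub>R polar e (t + pi / 2)))) (at t)"
    by (rule has_derivative_compose[of "polar e" "\<lambda>h. h *\<^sub>R polar e (t + pi / 2)" _ _ F])
      (use polar_deriv hdF in \<open>auto simp: has_vector_derivative_def\<close>)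
  then have "((\<lambda>t. F (polar e t)) has_real_derivative dF (polar e t) (polar e (t + pi / 2))) (at t)"
    by (simp add: has_field_derivative_def linear_scale[OF linear_dF] mult_commute_abs)
  then have d: "((\<lambda>t. 1 / F (polar e t)) has_real_derivative
      - dF (polar e t) (polar e (t + pi / 2)) / (F (polar e t))\<^sup>2) (at t)"
    using p by (auto intro!: derivative_eq_intros simp: power2_eq_square)
  have v: "(N has_vector_derivative (1 / F (polar e t)) *\<^sub>R polar e (t + pi / 2)
     + (- dF (polar e t) (polar e (t + pi / 2)) / (F (polar e t))\<^sup>2) *\<^sub>R polar e t) (at t)"
    unfolding nu_def[abs_def] by (rule has_vector_derivative_scaleR[OF d polar_deriv])
  then show "N' t = (1 / F (polar e t)) *\<^sub>R polar e (t + pi / 2)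
     + (- dF (polar e t) (polar e (t + pi / 2)) / (F (polar e t))\<^sup>2) *\<^sub>R polar e t"
    by (simp add: nu'_def vector_derivative_at)
  with v show "(N has_vector_derivative N' t) (at t)" by simp
qed

lemma FN [simp]: "F (N t) = 1"
  using pos[OF polar_nz[of t]] by (simp add: nu_def scale)

lemma N_nz [simp]: "N t \<noteq> 0"
  using FN[of t] zero by force

lemma polar_N: "polar e t = F (polar e t) *\<^sub>R N t"
  using pos[OF polar_nz[of t]] by (simp add: nu_def)

lemma N'_nz [simp]: "N' t \<noteq> 0"
proof -
  have "e * cross2 (polar e t) (N' t) = 1 / F (polar e t)"
    using cross2_polar[of t "t + pi / 2"]
    by (simp add: N'_eq mult.assoc[symmetric] mult.commute)
  also have "\<dots> > 0" using pos[OF polar_nz[of t]] by simp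
  finally show ?thesis by auto
qed

lemma K_pos: "0 < K t"
  by (simp add: kap_def fform_pos)

lemma cont_N: "continuous_on S N"
  by (meson continuous_at_imp_continuous_on has_vector_derivative_continuous N_deriv)

lemma cont_N': "continuous_on S N'"
proof -
  have p: "F (polar e t) > 0" for t using pos by simp
  have c: "continuous_on S (\<lambda>t. F (polar e t))"
    by (rule continuous_on_compose2[OF cont[of UNIV] cont_polar]) simp
  have c2: "continuous_on S (\<lambda>t. polar e (t + pi / 2))"
    by (rule continuous_on_compose2[OF cont_polar[of UNIV]]) (auto intro: continuous_intros)
  \<comment> \<open>Continuity of the momentum along the circle is read off from that of
    \<open>fform\<close> by \<open>fform_radial\<close>.\<close>
  have "continuous_on S (\<lambda>t. fform F (polar e t) (polar e t) (polar e (t + pi / 2)) / F (polar e t))"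
    by (intro continuous_on_divide continuous_fform cont_polar c c2) (use p in \<open>auto simp: less_imp_neq[symmetric]\<close>)
  moreover have "fform F (polar e t) (polar e t) (polar e (t + pi / 2)) / F (polar e t)
      = dF (polar e t) (polar e (t + pi / 2))" for t
    using p[of t] by (simp add: fform_radial)
  ultimately have d: "continuous_on S (\<lambda>t. dF (polar e t) (polar e (t + pi / 2)))" by simp
  show ?thesis
    unfolding N'_eq[abs_def]
    by (intro continuous_intros c c2 d cont_polar) (use p in \<open>auto simp: less_imp_neq[symmetric]\<close>)
qed

lemma cont_K: "continuous_on S K"
  unfolding kap_def[abs_def]
  by (intro continuous_on_real_sqrt continuous_fform cont_N cont_N') simp

lemma N_comp_deriv:
  assumes "(\<theta> has_real_derivative d) (at t)"
  shows "((\<lambda>t. N (\<theta> t)) has_vector_derivative d *\<^sub>R N' (\<theta> t)) (at t)"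
  using vector_diff_chain_at[of \<theta> d t N "N' (\<theta> t)"] assms N_deriv
  by (simp add: o_def has_real_derivative_iff_has_vector_derivative)

lemma N_periodic: "N (t + 2 * pi) = N t"
  by (simp add: nu_def polar_shift)

lemma K_periodic: "K (t + 2 * pi) = K t"
proof -
  have "((\<lambda>t. N (t + 2 * pi)) has_vector_derivative 1 *\<^sub>R N' (t + 2 * pi)) (at t)"
    by (rule N_comp_deriv) (auto intro!: derivative_eq_intros)
  then have "((\<lambda>t. N (t + 2 * pi)) has_vector_derivative N' (t + 2 * pi)) (at t)" by simp
  then have "N' (t + 2 * pi) = N' t"
    unfolding N_periodic using N_deriv vector_derivative_unique_at by blast
  then show ?thesis by (simp add: kap_def N_periodic)
qed

lemma T_deriv: "(T has_real_derivative K t) (at t)"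
proof -
  \<comment> \<open>The interval has both 0 and \<open>t\<close> in its interior, so the one-sided
    fundamental theorem yields a two-sided derivative.\<close>
  define a b where "a = min 0 t - 1" and "b = max 0 t + 1"
  have "((\<lambda>u. LBINT y=0..u. K y) has_vector_derivative K t) (at t within {a..b})"
    using interval_integral_FTC2[of a 0 b K t] cont_K[of "{a..b}"]
    by (auto simp: a_def b_def zero_ereal_def)
  moreover have "at t within {a..b} = at t"
    by (rule at_within_interior) (auto simp: a_def b_def interior_atLeastAtMost_real)
  ultimately show ?thesis
    by (simp add: Th_def[abs_def] has_real_derivative_iff_has_vector_derivative)
qed

lemma T_0: "T 0 = 0"
  by (simp add: Th_def zero_ereal_def)

lemma T_less: "s < t \<Longrightarrow> T s < T t"
  using DERIV_pos_imp_increasing[of s t T] T_deriv K_pos by blast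

lemma T_le: "s \<le> t \<Longrightarrow> T s \<le> T t"
  using T_less[of s t] by (cases "s = t") auto

lemma T_less_iff: "T s < T t \<longleftrightarrow> s < t"
  using T_less T_le by (meson linorder_not_le)

lemma T_period: "T (s + 2 * pi) - T s = T (2 * pi)"
proof -
  have "((\<lambda>s. T (s + 2 * pi) - T s) has_real_derivative 0) (at s)" for s
  proof -
    have "((\<lambda>s. T (s + 2 * pi)) has_real_derivative K (s + 2 * pi) * 1) (at s)"
      by (rule DERIV_chain2[OF T_deriv]) (auto intro!: derivative_eq_intros)
    from DERIV_diff[OF this T_deriv] show ?thesis by (simp add: K_periodic)
  qed
  then have "T (s + 2 * pi) - T s = T (0 + 2 * pi) - T 0"
    by (intro DERIV_isconst_all[of "\<lambda>s. T (s + 2 * pi) - T s"]) blast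
  then show ?thesis by (simp add: T_0)
qed

lemma has_integral_K:
  assumes "a \<le> b" "\<And>t. (\<theta> has_real_derivative \<theta>' t) (at t)"
  shows "((\<lambda>t. \<theta>' t * K (\<theta> t)) has_integral T (\<theta> b) - T (\<theta> a)) {a..b}"
proof (rule fundamental_theorem_of_calculus[OF assms(1)])
  fix t
  from DERIV_chain2[OF T_deriv assms(2)]
  show "((\<lambda>t. T (\<theta> t)) has_vector_derivative \<theta>' t * K (\<theta> t)) (at t within {a..b})"
    by (simp add: has_vector_derivative_at_within mult.commute
        flip: has_real_derivative_iff_has_vector_derivative)
      (simp add: has_field_derivative_at_within)
qed

lemma arc_speed:
  assumes "(\<theta> has_real_derivative d) (at t)"
  shows "sqrt (fform F (N (\<theta> t)) (d *\<^sub>R N' (\<theta> t)) (d *\<^sub>R N' (\<theta> t))) = \<bar>d\<bar> * K (\<theta> t)"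
  by (simp add: fform_scale2 kap_def real_sqrt_mult)

lemma normalize_polar: assumes "y = r *\<^sub>R polar e t" "0 < r" shows "(1 / F y) *\<^sub>R y = N t"
  using assms by (simp add: nu_def scale)

lemma ex_N: assumes "F u = 1" "0 \<le> e * cross2 (polar e a) u" shows "\<exists>t\<in>{a..a+pi}. u = N t"
proof -
  have "u \<noteq> 0" using assms(1) by auto
  then obtain r t where rt: "r > 0" "t \<in> {a..a+pi}" "u = r *\<^sub>R polar e t"
    using ex_polar_ge[OF _ assms(2)] by blast
  from normalize_polar[OF rt(3,1)] assms(1) rt(2) show ?thesis by auto
qed

lemma N_eqD: "N a = N b \<Longrightarrow> \<bar>a - b\<bar> < 2 * pi \<Longrightarrow> a = b"
  using polar_eqD(1)[of "1 / F (polar e a)" a "1 / F (polar e b)" b] pos[OF polar_nz] by (simp add: nu_def)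

lemma side_N: "0 \<le> e * cross2 (polar e a) (N t) \<longleftrightarrow> 0 \<le> sin (t - a)"
  using cross2_polar[of a t] pos[OF polar_nz[of t]]
  by (simp add: nu_def zero_le_divide_iff)

text \<open>The form that \<open>unit_vectors\<close> takes at a point inside an edge, where the
  sector is a half plane.\<close>

definition half :: "real \<Rightarrow> (real^2) set" where
  "half b = {u. F u = 1 \<and> 0 \<le> e * cross2 (polar e b) u}"

lemma half_eq: "half b = N ` {b..b+pi}"
  unfolding half_def using ex_N side_N by (auto simp: sin_ge_zero)

text \<open>A curve in the half circle is lifted to the universal cover with the principal branch of
  the logarithm, after rotating the midpoint of the half circle to the positive real axis.\<close>

lemma arc_lower:
  assumes ac: "a < c" and U: "open U" "{a..c} \<subseteq> U" and g: "smooth_on U g" "g ` {a..c} \<subseteq> half b"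
    and ends: "g a = N s" "g c = N t" "s \<in> {b..b+pi}" "t \<in> {b..b+pi}"
  shows "T t - T s \<le> integral {a..c} (\<lambda>\<tau>. sqrt (fform F (g \<tau>) (vector_derivative g (at \<tau>)) (vector_derivative g (at \<tau>))))"
proof -
  define m where "m = b + pi / 2"
  define g' where "g' \<tau> = vector_derivative g (at \<tau>)" for \<tau>
  have dg: "(g has_vector_derivative g' \<tau>) (at \<tau>)" if "\<tau> \<in> {a..c}" for \<tau>
  proof -
    have "Ck_on 1 U g" using g(1) by (simp add: smooth_on_def)
    then have "g differentiable (at \<tau>)" using that U(2) by auto
    then show ?thesis by (simp add: g'_def vector_derivative_works)
  qed
  have cg': "continuous_on {a..c} g'"
  proof -
    have "Ck_on (Suc 0) U g" using g(1) by (simp add: smooth_on_def)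
    then have "continuous_on U (\<lambda>\<tau>. frechet_derivative g (at \<tau>) 1)"
      unfolding Ck_on.simps by blast
    then have "continuous_on {a..c} (\<lambda>\<tau>. frechet_derivative g (at \<tau>) 1)"
      using U(2) by (rule continuous_on_subset)
    moreover have "frechet_derivative g (at \<tau>) 1 = g' \<tau>" if "\<tau> \<in> {a..c}" for \<tau>
      using dg[OF that] frechet_derivative_at[of g "\<lambda>h. h *\<^sub>R g' \<tau>" \<tau>]
      by (metis has_vector_derivative_def scaleR_one)
    ultimately show ?thesis by (subst continuous_on_cong[OF refl]) (auto simp: eq_commute)
  qed
  define p q where "p = polar e m" and "q = polar e (m + pi / 2)"
  define z where "z \<tau> = Complex (g \<tau> \<bullet> p) (g \<tau> \<bullet> q)" for \<tau>
  define z' where "z' \<tau> = Complex (g' \<tau> \<bullet> p) (g' \<tau> \<bullet> q)" for \<tau>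
  have dz: "(z has_vector_derivative z' \<tau>) (at \<tau>)" if "\<tau> \<in> {a..c}" for \<tau>
  proof -
    have "((\<lambda>\<tau>. g \<tau> \<bullet> w) has_vector_derivative g' \<tau> \<bullet> w) (at \<tau>)" for w
      using bounded_linear.has_vector_derivative[OF bounded_linear_inner_left dg[OF that]] .
    then show ?thesis unfolding z_def[abs_def] z'_def
      by (simp add: has_vector_derivative_complex_iff has_real_derivative_iff_has_vector_derivative)
  qed
  define \<psi> where "\<psi> \<tau> = m + Im (Ln (z \<tau>))" for \<tau>
  have zN: "z \<tau> = of_real (1 / F (polar e x)) * cis (x - m) \<and> z \<tau> \<notin> \<real>\<^sub>\<le>\<^sub>0 \<and> \<psi> \<tau> = x"
    if "g \<tau> = N x" "x \<in> {b..b+pi}" for \<tau> x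
  proof -
    define r where "r = 1 / F (polar e x)"
    have r: "r > 0" using pos[OF polar_nz[of x]] by (simp add: r_def)
    have ip: "polar e v \<bullet> polar e w = cos (v - w)" for v w
      using e by (auto simp: inner_vec_def sum_2 cos_diff)
    have zx: "z \<tau> = of_real r * cis (x - m)"
    proof -
      have "z \<tau> = Complex (r * cos (x - m)) (r * cos (x - (m + pi / 2)))"
        by (simp add: z_def that nu_def r_def[symmetric] p_def q_def ip)
      also have "cos (x - (m + pi / 2)) = sin (x - m)" by (simp add: cos_diff sin_diff cos_add sin_add)
      finally show ?thesis by (simp add: complex_eq_iff)
    qed
    have x: "- pi < x - m" "x - m < pi" using that(2) pi_gt_zero unfolding m_def atLeastAtMost_iff by linarith+
    have a: "Arg (z \<tau>) = x - m"
      unfolding zx using x by (subst Arg_times_of_real[OF r]) (auto intro!: Arg_cis)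
    have nz: "z \<tau> \<noteq> 0" using zx r by auto
    have "z \<tau> \<notin> \<real>\<^sub>\<le>\<^sub>0"
    proof
      assume "z \<tau> \<in> \<real>\<^sub>\<le>\<^sub>0"
      then have "Arg (z \<tau>) = pi" using nz Arg_eq_pi
        by (auto simp: complex_nonpos_Reals_iff complex_eq_iff less_le)
      then show False using a x by auto
    qed
    moreover have "\<psi> \<tau> = x" using a nz Arg_eq_Im_Ln[OF nz] by (simp add: \<psi>_def)
    ultimately show ?thesis using zx by (simp add: r_def)
  qed
  have gx: "\<exists>x\<in>{b..b+pi}. g \<tau> = N x" if "\<tau> \<in> {a..c}" for \<tau>
    using g(2) that unfolding half_eq by blast
  have zn: "z \<tau> \<notin> \<real>\<^sub>\<le>\<^sub>0" if "\<tau> \<in> {a..c}" for \<tau> using gx[OF that] zN by blast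
  have g\<psi>: "g \<tau> = N (\<psi> \<tau>)" if "\<tau> \<in> {a..c}" for \<tau> using gx[OF that] zN by force
  define \<psi>' where "\<psi>' \<tau> = Im (z' \<tau> / z \<tau>)" for \<tau>
  have d\<psi>: "(\<psi> has_real_derivative \<psi>' \<tau>) (at \<tau>)" if "\<tau> \<in> {a..c}" for \<tau>
  proof -
    have "((\<lambda>\<tau>. Ln (z \<tau>)) has_vector_derivative z' \<tau> * (1 / z \<tau>)) (at \<tau>)"
      using field_vector_diff_chain_at[OF dz[OF that], of Ln "inverse (z \<tau>)"] has_field_derivative_Ln[OF zn[OF that]]
      by (simp add: o_def field_simps)
    then have "((\<lambda>\<tau>. Im (Ln (z \<tau>))) has_real_derivative \<psi>' \<tau>) (at \<tau>)"
      using bounded_linear.has_vector_derivative[OF bounded_linear_Im]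
      by (fastforce simp: \<psi>'_def has_real_derivative_iff_has_vector_derivative)
    from DERIV_add[OF DERIV_const this, of m] show ?thesis by (simp add: \<psi>_def[abs_def])
  qed
  have sp: "sqrt (fform F (g \<tau>) (g' \<tau>) (g' \<tau>)) = \<bar>\<psi>' \<tau>\<bar> * K (\<psi> \<tau>)" if "\<tau> \<in> {a<..<c}" for \<tau>
  proof -
    have t: "\<tau> \<in> {a..c}" using that by simp
    have "(g has_vector_derivative \<psi>' \<tau> *\<^sub>R N' (\<psi> \<tau>)) (at \<tau>)"
      by (rule has_vector_derivative_transform_within_open[OF N_comp_deriv[OF d\<psi>[OF t]], of "{a<..<c}"])
        (use that g\<psi> in auto)
    then have "g' \<tau> = \<psi>' \<tau> *\<^sub>R N' (\<psi> \<tau>)"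
      using dg[OF t] vector_derivative_unique_at by blast
    then show ?thesis using arc_speed[OF d\<psi>[OF t]] g\<psi>[OF t] by simp
  qed
  have cg: "continuous_on {a..c} g"
    by (meson continuous_at_imp_continuous_on dg has_vector_derivative_continuous)
  have int: "(\<lambda>\<tau>. sqrt (fform F (g \<tau>) (g' \<tau>) (g' \<tau>))) integrable_on {a..c}"
  proof (rule integrable_continuous_real, intro continuous_on_real_sqrt continuous_fform cg cg')
    show "g \<tau> \<noteq> 0" if "\<tau> \<in> {a..c}" for \<tau> using g\<psi>[OF that] by simp
  qed
  have "((\<lambda>\<tau>. \<psi>' \<tau> * K (\<psi> \<tau>)) has_integral T (\<psi> c) - T (\<psi> a)) {a..c}"
  proof (rule fundamental_theorem_of_calculus)
    show "a \<le> c" using ac by simp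
    fix \<tau> assume "\<tau> \<in> {a..c}"
    from DERIV_chain2[OF T_deriv d\<psi>[OF this]]
    show "((\<lambda>\<tau>. T (\<psi> \<tau>)) has_vector_derivative \<psi>' \<tau> * K (\<psi> \<tau>)) (at \<tau> within {a..c})"
      by (simp add: has_vector_derivative_at_within mult.commute
        flip: has_real_derivative_iff_has_vector_derivative)
      (simp add: has_field_derivative_at_within)
  qed
  then have h: "((\<lambda>\<tau>. \<psi>' \<tau> * K (\<psi> \<tau>)) has_integral T t - T s) {a<..<c}"
    using zN[OF ends(1,3)] zN[OF ends(2,4)] has_integral_Icc_iff_Ioo by metis
  have "T t - T s \<le> integral {a<..<c} (\<lambda>\<tau>. sqrt (fform F (g \<tau>) (g' \<tau>) (g' \<tau>)))"
  proof (rule has_integral_le[OF h integrable_integral])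
    show "(\<lambda>\<tau>. sqrt (fform F (g \<tau>) (g' \<tau>) (g' \<tau>))) integrable_on {a<..<c}"
      using int integrable_on_Icc_iff_Ioo by blast
    show "\<psi>' \<tau> * K (\<psi> \<tau>) \<le> sqrt (fform F (g \<tau>) (g' \<tau>) (g' \<tau>))" if "\<tau> \<in> {a<..<c}" for \<tau>
      unfolding sp[OF that] using K_pos[of "\<psi> \<tau>"] by (simp add: mult_right_mono)
  qed
  then show ?thesis by (simp add: g'_def integral_open_interval_real)
qed

lemma smooth_projection:
  assumes "open V" "\<And>t. t \<in> V \<Longrightarrow> y + t *\<^sub>R u \<noteq> 0"
  shows "smooth_on V (\<lambda>t. (1 / F (y + t *\<^sub>R u)) *\<^sub>R (y + t *\<^sub>R u))"
  unfolding smooth_on_def inverse_eq_divide[symmetric]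
proof
  fix k
  have "smooth_on V (\<lambda>t. F (y + t *\<^sub>R u))"
    by (rule smooth_on_compose_line[OF assms(1) _ smooth]) (use assms(2) in auto)
  then show "Ck_on k V (\<lambda>t. inverse (F (y + t *\<^sub>R u)) *\<^sub>R (y + t *\<^sub>R u))"
    using assms eq_0_iff
    by (intro Ck_on_scaleR Ck_on_inverse Ck_on_line) (auto simp: smooth_on_def)
qed

text \<open>The lower bound is \<open>arc_lower\<close>. It is attained by the radial projection of
  the chord from \<open>N s\<close> to \<open>N t\<close>, which is smooth and turns monotonically;
  the chord misses the origin because the angle between its ends is less than pi.\<close>

lemma arc_dist_eq:
  assumes st: "s \<in> {b..b+pi}" "t \<in> {b..b+pi}" "s < t" "t - s < pi"
  shows "arc_dist F (half b) (N s) (N t) = T t - T s"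
proof -
  define u where "u = N t - N s"
  have p: "F (polar e x) > 0" for x using pos by simp
  have Ns: "N s = (1 / F (polar e s)) *\<^sub>R polar e s" and Nt: "N t = (1 / F (polar e t)) *\<^sub>R polar e t"
    by (simp_all add: nu_def)
  have "e * cross2 (N s) (N t) = e * cross2 (polar e s) (polar e t) / (F (polar e s) * F (polar e t))"
    by (simp add: nu_def)
  also have "\<dots> > 0"
    using p st sin_gt_zero[of "t - s"] by (simp add: cross2_polar)
  finally have st0: "e * cross2 (N s) (N t) > 0" .
  have cs: "0 < e * cross2 (N s) u" using st0 by (simp add: u_def)
  have "0 < F (polar e s) * (e * cross2 (N s) u)" using cs p[of s] by (rule mult_pos_pos[rotated])
  also have "\<dots> = e * cross2 (polar e s) u"
    by (subst (2) polar_N) simp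
  finally have "0 < e * cross2 (polar e s) u" .
  from ex_polar_gt[OF this] obtain r \<phi> where r: "r > 0" "\<phi> \<in> {s<..<s+pi}" "u = r *\<^sub>R polar e \<phi>" by blast
  obtain \<theta> \<theta>' where \<theta>: "\<And>t. (\<theta> has_real_derivative \<theta>' t) (at t)" "\<And>t. 0 < \<theta>' t"
      "\<And>t. \<exists>\<rho>>0. N s + t *\<^sub>R u = \<rho> *\<^sub>R polar e (\<theta> t)" "\<And>t. \<phi> - pi < \<theta> t" "\<And>t. \<theta> t < \<phi>"
    using line_polar[OF cs r(3,1)] by blast
  \<comment> \<open>Both end angles then lie in the range of \<open>\<theta>\<close>, an interval of
    length pi, so \<open>\<theta> 0\<close> and \<open>\<theta> 1\<close> are \<open>s\<close> and
    \<open>t\<close> themselves and not other representatives of the same directions.\<close>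
  have "\<phi> > t"
  proof (rule ccontr)
    assume "\<not> \<phi> > t"
    then have "sin (t - \<phi>) \<ge> 0" using r(2) st by (intro sin_ge_zero) auto
    moreover have "e * cross2 (N t) u > 0" using st0 cross2_commute[of "N t" "N s"] by (simp add: u_def)
    moreover have "e * cross2 (N t) u = r / F (polar e t) * sin (\<phi> - t)"
      using cross2_polar[of t \<phi>] by (simp add: Nt r(3))
    ultimately have "0 < r / F (polar e t) * sin (\<phi> - t)" "sin (\<phi> - t) \<le> 0"
      using sin_minus[of "t - \<phi>"] by auto
    then show False using r(1) p[of t] by (simp add: zero_less_mult_iff zero_less_divide_iff)
  qed
  have \<theta>0: "\<theta> 0 = s"
  proof -
    obtain \<rho> where \<rho>: "\<rho> > 0" "N s = \<rho> *\<^sub>R polar e (\<theta> 0)" using \<theta>(3)[of 0] by auto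
    then have "\<rho> *\<^sub>R polar e (\<theta> 0) = (1 / F (polar e s)) *\<^sub>R polar e s" using Ns by simp
    then show ?thesis using polar_eqD(1)[OF _ \<rho>(1)] p[of s] \<theta>(4,5)[of 0] r(2) by force
  qed
  have \<theta>1: "\<theta> 1 = t"
  proof -
    obtain \<rho> where \<rho>: "\<rho> > 0" "N t = \<rho> *\<^sub>R polar e (\<theta> 1)" using \<theta>(3)[of 1] by (auto simp: u_def)
    then have "\<rho> *\<^sub>R polar e (\<theta> 1) = (1 / F (polar e t)) *\<^sub>R polar e t" using Nt by simp
    then show ?thesis using polar_eqD(1)[OF _ \<rho>(1)] p[of t] \<theta>(4,5)[of 1] r(2) \<open>\<phi> > t\<close> st by force
  qed
  have mono: "\<theta> x \<le> \<theta> y" if "x \<le> y" for x y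
    using DERIV_pos_imp_increasing[of x y \<theta>] \<theta>(1,2) that by (cases "x = y") force+
  define g where "g \<tau> = (1 / F (N s + \<tau> *\<^sub>R u)) *\<^sub>R (N s + \<tau> *\<^sub>R u)" for \<tau>
  have gN: "g \<tau> = N (\<theta> \<tau>)" for \<tau> using \<theta>(3)[of \<tau>] normalize_polar unfolding g_def by blast
  have "N s + \<tau> *\<^sub>R u \<noteq> 0" for \<tau> using \<theta>(3)[of \<tau>] by force
  then have sm: "smooth_on UNIV g" unfolding g_def by (intro smooth_projection) auto
  have vd: "vector_derivative g (at \<tau>) = \<theta>' \<tau> *\<^sub>R N' (\<theta> \<tau>)" for \<tau>
    unfolding gN[abs_def] by (rule vector_derivative_at[OF N_comp_deriv[OF \<theta>(1)]])
  have "integral {0..1} (\<lambda>\<tau>. sqrt (fform F (g \<tau>) (vector_derivative g (at \<tau>)) (vector_derivative g (at \<tau>)))) = T t - T s"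
  proof -
    have "sqrt (fform F (g \<tau>) (vector_derivative g (at \<tau>)) (vector_derivative g (at \<tau>))) = \<theta>' \<tau> * K (\<theta> \<tau>)" for \<tau>
      unfolding vd unfolding gN arc_speed[OF \<theta>(1)] using \<theta>(2)[of \<tau>] by simp
    then show ?thesis using integral_unique[OF has_integral_K[of 0 1, OF _ \<theta>(1)]] \<theta>0 \<theta>1 by simp
  qed
  moreover have "g ` {0..1} \<subseteq> half b"
  proof -
    have "\<theta> \<tau> \<in> {b..b+pi}" if "\<tau> \<in> {0..1}" for \<tau>
      using mono[of 0 \<tau>] mono[of \<tau> 1] that \<theta>0 \<theta>1 st by auto
    then show ?thesis unfolding half_eq gN by auto
  qed
  moreover have "g 0 = N s" "g 1 = N t" by (simp_all add: gN \<theta>0 \<theta>1)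
  ultimately have mem: "\<exists>g a c U. T t - T s = integral {a..c} (\<lambda>\<tau>. sqrt (fform F (g \<tau>) (vector_derivative g (at \<tau>)) (vector_derivative g (at \<tau>))))
      \<and> a < c \<and> open U \<and> {a..c} \<subseteq> U \<and> smooth_on U g \<and> g ` {a..c} \<subseteq> half b \<and> g a = N s \<and> g c = N t"
    using sm by (intro exI[of _ g] exI[of _ 0] exI[of _ 1] exI[of _ UNIV]) auto
  show ?thesis
    unfolding arc_dist_def
  proof (rule cInf_eq_minimum)
    show "T t - T s \<in> {integral {a..c} (\<lambda>\<tau>. sqrt (fform F (g \<tau>) (vector_derivative g (at \<tau>)) (vector_derivative g (at \<tau>)))) |g a c U.
       a < c \<and> open U \<and> {a..c} \<subseteq> U \<and> smooth_on U g \<and> g ` {a..c} \<subseteq> half b \<and> g a = N s \<and> g c = N t}"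
      unfolding mem_Collect_eq by (rule mem)
  next
    fix z assume "z \<in> {integral {a..c} (\<lambda>\<tau>. sqrt (fform F (g \<tau>) (vector_derivative g (at \<tau>)) (vector_derivative g (at \<tau>)))) |g a c U.
       a < c \<and> open U \<and> {a..c} \<subseteq> U \<and> smooth_on U g \<and> g ` {a..c} \<subseteq> half b \<and> g a = N s \<and> g c = N t}"
    then obtain g a c U where z: "z = integral {a..c} (\<lambda>\<tau>. sqrt (fform F (g \<tau>) (vector_derivative g (at \<tau>)) (vector_derivative g (at \<tau>))))"
      and *: "a < c" "open U" "{a..c} \<subseteq> U" "smooth_on U g" "g ` {a..c} \<subseteq> half b" "g a = N s" "g c = N t"
      unfolding mem_Collect_eq by (elim exE conjE)
    show "T t - T s \<le> z" unfolding z by (rule arc_lower[OF * st(1,2)])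
  qed
qed

text \<open>Changing the sign \<open>e\<close> runs through the same indicatrix in the opposite
  sense. This transfers statements about one side of a ray to the other side.\<close>

lemma reflect: "Th F (- e) t = - T (- t)"
proof -
  interpret R: planar F "- e" by unfold_locales (use e in auto)
  have n: "R.N = (\<lambda>t. N (- t))" by (simp add: nu_def fun_eq_iff polar_uminus)
  have n': "R.N' t = - N' (- t)" for t
  proof -
    have "(R.N has_vector_derivative (- 1) *\<^sub>R N' (- t)) (at t)"
      unfolding n by (rule N_comp_deriv) (auto intro!: derivative_eq_intros)
    from vector_derivative_unique_at[OF R.N_deriv this] show ?thesis by simp
  qed
  have k: "R.K t = K (- t)" for t
    using fform_scale2[of "N (- t)" "-1" "N' (- t)"] by (simp add: kap_def n n')
  have "((\<lambda>t. R.T t + T (- t)) has_real_derivative 0) (at t)" for t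
  proof -
    have "((\<lambda>t. T (- t)) has_real_derivative K (- t) * (- 1)) (at t)"
      by (rule DERIV_chain2[OF T_deriv]) (auto intro!: derivative_eq_intros)
    from DERIV_add[OF R.T_deriv this] show ?thesis unfolding k by simp
  qed
  note d = this
  have "R.T t + T (- t) = R.T 0 + T (- 0)" by (rule DERIV_isconst_all[of "\<lambda>t. R.T t + T (- t)"]) (use d in blast)
  then show ?thesis using T_0 R.T_0 by auto
qed

text \<open>The indicatrix of the reversed norm is the point reflection of that of \<open>F\<close>,
  which is a shift by pi in the angle.\<close>

lemma reverse: "Th (\<lambda>y. F (- y)) e b - Th (\<lambda>y. F (- y)) e a = T (b + pi) - T (a + pi)"
proof -
  interpret R: planar "\<lambda>y. F (- y)" e by unfold_locales (rule minkowski_norm_reverse(1)[OF mn])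
  have n: "R.N = (\<lambda>t. - N (t + pi))" by (simp add: nu_def fun_eq_iff polar_shift)
  have n': "R.N' t = - N' (t + pi)" for t
  proof -
    have "((\<lambda>t. N (t + pi)) has_vector_derivative 1 *\<^sub>R N' (t + pi)) (at t)"
      by (rule N_comp_deriv) (auto intro!: derivative_eq_intros)
    then have "(R.N has_vector_derivative - N' (t + pi)) (at t)"
      unfolding n using has_vector_derivative_minus by fastforce
    then show ?thesis using R.N_deriv vector_derivative_unique_at by blast
  qed
  have k: "R.K t = K (t + pi)" for t
    using fform_scale2[of "N (t + pi)" "-1" "N' (t + pi)"]
    by (simp add: kap_def n n' minkowski_norm_reverse(2)[OF mn])
  have "((\<lambda>t. R.T t - T (t + pi)) has_real_derivative 0) (at t)" for t
  proof -
    have "((\<lambda>t. T (t + pi)) has_real_derivative K (t + pi) * 1) (at t)"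
      by (rule DERIV_chain2[OF T_deriv]) (auto intro!: derivative_eq_intros)
    from DERIV_diff[OF R.T_deriv this] show ?thesis unfolding k by simp
  qed
  note d = this
  have "R.T b - T (b + pi) = R.T a - T (a + pi)" by (rule DERIV_isconst_all[of "\<lambda>t. R.T t - T (t + pi)"]) (use d in blast)
  then show ?thesis by simp
qed

end

text \<open>The momentum of a unit vector \<open>u\<close> along \<open>b\<close> reaches its bound
  \<open>F b\<close> only at the direction of \<open>b\<close>, and likewise for \<open>- b\<close>.
  Since \<open>h\<close> preserves momenta and the norms agree on the edge, \<open>h\<close> sends
  ends to ends. An isometry fixing the ends preserves arc length from an end, because
  \<open>arc_dist\<close> is a difference of values of \<open>Th\<close>.\<close>

lemma landsberg_half:
  assumes "minkowski_norm F" "minkowski_norm G" "e \<in> {1, -1}" "e' \<in> {1, -1}"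
    and b: "b = r *\<^sub>R polar e \<beta>" "0 < r" and a: "a = r' *\<^sub>R polar e' \<alpha>" "0 < r'"
    and ab: "F b = G a" "F (- b) = G (- a)"
    and h: "homeomorphism {u. F u = 1 \<and> 0 \<le> e * cross2 b u} {u. G u = 1 \<and> 0 \<le> e' * cross2 a u} h h'"
    and mom: "\<And>u. F u = 1 \<Longrightarrow> 0 \<le> e * cross2 b u \<Longrightarrow> fform F u u b = fform G (h u) (h u) a"
    and iso: "\<And>u u'. F u = 1 \<Longrightarrow> 0 \<le> e * cross2 b u \<Longrightarrow> F u' = 1 \<Longrightarrow> 0 \<le> e * cross2 b u' \<Longrightarrow>
      arc_dist G {u. G u = 1 \<and> 0 \<le> e' * cross2 a u} (h u) (h u')
      = arc_dist F {u. F u = 1 \<and> 0 \<le> e * cross2 b u} u u'"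
    and \<phi>: "\<phi> \<in> {\<beta>..\<beta>+pi}"
  shows "\<exists>\<phi>'\<in>{\<alpha>..\<alpha>+pi}. minkowski.dF F (nu F e \<phi>) b = minkowski.dF G (nu G e' \<phi>') a \<and>
    Th F e \<phi> - Th F e \<beta> = Th G e' \<phi>' - Th G e' \<alpha> \<and> (\<phi> = \<beta> + pi \<longrightarrow> \<phi>' = \<alpha> + pi)"
proof -
  interpret A: planar F e by unfold_locales (use assms in auto)
  interpret B: planar G e' by unfold_locales (use assms in auto)
  have nn: "0 \<le> d * cross2 (s *\<^sub>R y) u \<longleftrightarrow> 0 \<le> d * cross2 y u" if "0 < s" for d s y u
    using zero_le_mult_iff[of s "d * cross2 y u"] that by (simp add: mult.left_commute)
  have S: "{u. F u = 1 \<and> 0 \<le> e * cross2 b u} = A.half \<beta>"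
    unfolding A.half_def b(1) nn[OF b(2)] ..
  have S': "{u. G u = 1 \<and> 0 \<le> e' * cross2 a u} = B.half \<alpha>"
    unfolding B.half_def a(1) nn[OF a(2)] ..
  note h = h[unfolded S S'] and iso = iso[unfolded S S']
  have Sm: "F u = 1 \<and> 0 \<le> e * cross2 b u" if "u \<in> A.half \<beta>" for u using that S by blast
  have hS: "h u \<in> B.half \<alpha>" if "u \<in> A.half \<beta>" for u
    using homeomorphism_image1[OF h] that by blast
  have G1: "G w = 1" "w \<noteq> 0" if "w \<in> B.half \<alpha>" for w
    using that by (auto simp: B.half_def)
  have mom': "A.dF u b = B.dF (h u) a" if "u \<in> A.half \<beta>" for u
  proof -
    have "u \<noteq> 0" using Sm[OF that] by auto
    then show ?thesis
      using mom[of u] Sm[OF that] G1[OF hS[OF that]] by (simp add: A.fform_radial B.fform_radial)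
  qed
  have inj: "u = v" if "h u = h v" "u \<in> A.half \<beta>" "v \<in> A.half \<beta>" for u v
    using homeomorphism_apply1[OF h that(2)] homeomorphism_apply1[OF h that(3)] unfolding that(1) by simp
  have inA: "A.N x \<in> A.half \<beta>" if "x \<in> {\<beta>..\<beta>+pi}" for x using that by (auto simp: A.half_eq)
  have bnz: "b \<noteq> 0" using b by simp
  have b': "- b = r *\<^sub>R polar e (\<beta> + pi)" and a': "- a = r' *\<^sub>R polar e' (\<alpha> + pi)"
    using a b by (simp_all add: polar_shift)
  have bN: "b = F b *\<^sub>R A.N \<beta>" "- b = F (- b) *\<^sub>R A.N (\<beta> + pi)"
    unfolding A.normalize_polar[OF b, symmetric] A.normalize_polar[OF b' b(2), symmetric]
    using A.pos[OF bnz] A.pos[of "- b"] bnz by simp_all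
  have aN: "(1 / G a) *\<^sub>R a = B.N \<alpha>" "(1 / G (- a)) *\<^sub>R (- a) = B.N (\<alpha> + pi)"
    by (rule B.normalize_polar[OF a], rule B.normalize_polar[OF a' a(2)])
  \<comment> \<open>The equality case of the fundamental inequality, in the form needed to recognize
    an end of the half circle from its momentum.\<close>
  have eqG: "w = (1 / G z) *\<^sub>R z" if "G w = 1" "B.dF w z = G z" "z \<noteq> 0" for w z
  proof -
    have "w \<noteq> 0" using that(1) by auto
    from B.dF_eq_imp[OF this that(2)] obtain s where "s \<ge> 0" "z = s *\<^sub>R w" by blast
    then show ?thesis using that by (auto simp: B.scale)
  qed
  have anz: "a \<noteq> 0" using a by simp
  have h0: "h (A.N \<beta>) = B.N \<alpha>"
  proof -
    have m: "A.N \<beta> \<in> A.half \<beta>" by (rule inA) auto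
    have "A.dF (A.N \<beta>) b = F b" using bN(1) A.dF_pos_mult[OF A.N_nz, of \<beta> "F b"] by simp
    then have "B.dF (h (A.N \<beta>)) a = G a" using mom'[OF m] ab by simp
    then show ?thesis using eqG[OF G1(1)[OF hS[OF m]]] anz aN(1) by simp
  qed
  have h1: "h (A.N (\<beta> + pi)) = B.N (\<alpha> + pi)"
  proof -
    have m: "A.N (\<beta> + pi) \<in> A.half \<beta>" by (rule inA) auto
    have "A.dF (A.N (\<beta> + pi)) (- b) = F (- b)"
      using bN(2) A.dF_pos_mult[OF A.N_nz, of "\<beta> + pi" "F (- b)"] by simp
    then have "B.dF (h (A.N (\<beta> + pi))) (- a) = G (- a)"
      using mom'[OF m] ab linear_neg[OF A.linear_dF[OF A.N_nz]] linear_neg[OF B.linear_dF[OF G1(2)[OF hS[OF m]]]] by simp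
    from eqG[OF G1(1)[OF hS[OF m]] this] anz show ?thesis unfolding aN(2) by simp
  qed
  \<comment> \<open>By injectivity of \<open>h\<close> an inner point does not go to an end, so both
    arcs from the first end are shorter than a half circle and \<open>arc_dist_eq\<close> computes
    both distances.\<close>
  have open_case: "\<exists>x'\<in>{\<alpha><..<\<alpha>+pi}. h (A.N x) = B.N x' \<and> A.T x - A.T \<beta> = B.T x' - B.T \<alpha>"
    if x: "x \<in> {\<beta><..<\<beta>+pi}" for x
  proof -
    have m: "A.N x \<in> A.half \<beta>" by (rule inA) (use x in auto)
    obtain x' where x': "x' \<in> {\<alpha>..\<alpha>+pi}" "h (A.N x) = B.N x'" using hS[OF m] by (auto simp: B.half_eq)
    have "x' \<noteq> \<alpha>"
    proof
      assume "x' = \<alpha>"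
      then have "A.N x = A.N \<beta>" using x' h0 inj[OF _ m inA[of \<beta>]] by auto
      then show False using A.N_eqD[of x \<beta>] x by auto
    qed
    moreover have "x' \<noteq> \<alpha> + pi"
    proof
      assume "x' = \<alpha> + pi"
      then have "A.N x = A.N (\<beta> + pi)" using x' h1 inj[OF _ m inA[of "\<beta> + pi"]] by auto
      then show False using A.N_eqD[of x "\<beta> + pi"] x by auto
    qed
    ultimately have x'i: "x' \<in> {\<alpha><..<\<alpha>+pi}" using x' by auto
    have "arc_dist G (B.half \<alpha>) (B.N \<alpha>) (B.N x') = arc_dist F (A.half \<beta>) (A.N \<beta>) (A.N x)"
      using iso[of "A.N \<beta>" "A.N x"] Sm[OF m] Sm[OF inA[of \<beta>]] h0 x'(2) by auto
    then have "A.T x - A.T \<beta> = B.T x' - B.T \<alpha>"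
      using A.arc_dist_eq[of \<beta> \<beta> x] B.arc_dist_eq[of \<alpha> \<alpha> x'] x x'i by simp
    then show ?thesis using x'i x'(2) by blast
  qed
  consider "\<phi> = \<beta>" | "\<phi> \<in> {\<beta><..<\<beta>+pi}" | "\<phi> = \<beta> + pi" using \<phi> by fastforce
  then show ?thesis
  proof cases
    case 1
    have "A.dF (A.N \<beta>) b = B.dF (B.N \<alpha>) a" using mom'[OF inA[of \<beta>]] h0 by auto
    then show ?thesis using 1 by (intro bexI[of _ \<alpha>]) auto
  next
    case 2
    then obtain x' where x': "x' \<in> {\<alpha><..<\<alpha>+pi}" "h (A.N \<phi>) = B.N x'" "A.T \<phi> - A.T \<beta> = B.T x' - B.T \<alpha>"
      using open_case by blast
    have "A.dF (A.N \<phi>) b = B.dF (B.N x') a" using mom'[OF inA[OF \<phi>]] x'(2) by simp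
    then show ?thesis using 2 x' by (intro bexI[of _ x']) auto
  next
    case 3
    \<comment> \<open>The full half circle is beyond the range of \<open>arc_dist_eq\<close>, so it
      is cut at its middle and the two distances are added.\<close>
    define m where "m = \<beta> + pi / 2"
    have mi: "m \<in> {\<beta><..<\<beta>+pi}" by (simp add: m_def)
    then obtain m' where m': "m' \<in> {\<alpha><..<\<alpha>+pi}" "h (A.N m) = B.N m'" "A.T m - A.T \<beta> = B.T m' - B.T \<alpha>"
      using open_case by blast
    have "arc_dist G (B.half \<alpha>) (B.N m') (B.N (\<alpha> + pi)) = arc_dist F (A.half \<beta>) (A.N m) (A.N (\<beta> + pi))"
      using iso[of "A.N m" "A.N (\<beta> + pi)"] Sm[OF inA[of m]] Sm[OF inA[of "\<beta> + pi"]] h1 m'(2) mi by auto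
    then have "A.T (\<beta> + pi) - A.T m = B.T (\<alpha> + pi) - B.T m'"
      using A.arc_dist_eq[of m \<beta> "\<beta> + pi"] B.arc_dist_eq[of m' \<alpha> "\<alpha> + pi"] mi m' by simp
    moreover have "A.dF (A.N \<phi>) b = B.dF (B.N (\<alpha> + pi)) a" using mom'[OF inA[OF \<phi>]] h1 3 by simp
    ultimately show ?thesis using 3 m' by (intro bexI[of _ "\<alpha> + pi"]) auto
  qed
qed

section \<open>Geodesics of a tangent cone of Landsberg type\<close>

lemma smooth_on_vector_derivative:
  fixes g :: "real \<Rightarrow> 'b::real_normed_vector"
  assumes "smooth_on U g" "S \<subseteq> U"
  shows "t \<in> S \<Longrightarrow> (g has_vector_derivative vector_derivative g (at t)) (at t)"
    and "continuous_on S (\<lambda>t. vector_derivative g (at t))"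
proof -
  have C: "Ck_on (Suc 0) U g" using assms(1) by (simp add: smooth_on_def)
  show d: "(g has_vector_derivative vector_derivative g (at t)) (at t)" if "t \<in> S" for t
  proof -
    have "g differentiable (at t)" using C that assms(2) by auto
    then show ?thesis by (simp add: vector_derivative_works)
  qed
  have "continuous_on U (\<lambda>\<tau>. frechet_derivative g (at \<tau>) 1)"
    using C unfolding Ck_on.simps by blast
  then have c: "continuous_on S (\<lambda>\<tau>. frechet_derivative g (at \<tau>) 1)"
    using assms(2) by (rule continuous_on_subset)
  have "frechet_derivative g (at \<tau>) 1 = vector_derivative g (at \<tau>)" if "\<tau> \<in> S" for \<tau>
    using d[OF that] frechet_derivative_at[of g "\<lambda>h. h *\<^sub>R vector_derivative g (at \<tau>)" \<tau>]
    by (metis has_vector_derivative_def scaleR_one)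
  then show "continuous_on S (\<lambda>t. vector_derivative g (at t))"
    using continuous_on_cong[OF refl, of S "\<lambda>\<tau>. frechet_derivative g (at \<tau>) 1"] c by metis
qed

lemma pw_smooth_less: "pw_smooth M N \<gamma> \<rho> a b \<Longrightarrow> a < b"
  by (induction rule: pw_smooth.induct) auto

lemma pw_smooth_cong:
  assumes "pw_smooth M N \<gamma> \<rho> a b" "\<And>t. a \<le> t \<Longrightarrow> t \<le> b \<Longrightarrow> \<gamma> t = \<gamma>' t"
    "\<And>t. a < t \<Longrightarrow> t < b \<Longrightarrow> \<rho> t = \<rho>' t"
  shows "pw_smooth M N \<gamma>' \<rho>' a b"
  using assms
proof (induction rule: pw_smooth.induct)
  case (piece a b i U g)
  have "\<gamma>' ` {a..b} \<subseteq> cell M i" using piece(3,9) by force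
  moreover have "\<forall>t\<in>{a..b}. chart M i (\<gamma>' t) = g t" using piece(7,9) by force
  moreover have "\<forall>t\<in>{a<..<b}. \<rho>' t = N i (g t) (vector_derivative g (at t))" using piece(8,10) by force
  ultimately show ?case using piece by (intro pw_smooth.piece[of a b i M \<gamma>' U g]) auto
next
  case (join a b c)
  then show ?case using pw_smooth_less[OF join(1)] pw_smooth_less[OF join(2)]
    by (intro pw_smooth.join[of _ _ _ _ a b c]) auto
qed

text \<open>On the compact Euclidean unit sphere \<open>F\<close> has a positive minimum, so
  \<open>F\<close> dominates a multiple of the Euclidean norm and with it every linear
  functional.\<close>

lemma (in minkowski) linear_bound:
  assumes "linear f" shows "\<exists>C>0. \<forall>w. \<bar>f w :: real\<bar> \<le> C * F w"
proof -
  obtain B where B: "B > 0" "\<And>w. \<bar>f w\<bar> \<le> B * norm w"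
    using linear_bounded_pos[OF assms] by auto
  have "\<exists>m>0. \<forall>w. m * norm w \<le> F w"
  proof -
    obtain z :: 'a where "z \<in> Basis" using nonempty_Basis by blast
    then have "sphere (0::'a) 1 \<noteq> {}" using norm_Basis by force
    then obtain z where z: "z \<in> sphere 0 1" "\<And>w. w \<in> sphere 0 1 \<Longrightarrow> F z \<le> F w"
      using continuous_attains_inf[OF compact_sphere _ cont] by metis
    have "F z * norm w \<le> F w" for w
    proof (cases "w = 0")
      case False
      then have "F z \<le> F ((1 / norm w) *\<^sub>R w)" by (intro z(2)) simp
      also have "\<dots> = F w / norm w" by (simp add: scale)
      finally show ?thesis using False by (simp add: field_simps)
    qed simp
    moreover have "z \<noteq> 0" using z(1) by auto
    ultimately show ?thesis using pos by blast
  qed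
  then obtain m where m: "m > 0" "\<And>w. m * norm w \<le> F w" by blast
  have "\<bar>f w\<bar> \<le> (B / m) * F w" for w
  proof -
    have "\<bar>f w\<bar> \<le> (B / m) * (m * norm w)" using B m by simp
    also have "\<dots> \<le> (B / m) * F w" using B m by (intro mult_left_mono) auto
    finally show ?thesis .
  qed
  then show ?thesis using B(1) m(1) by (intro exI[of _ "B / m"]) auto
qed

text \<open>
  The sectors around the vertex in cyclic order: \<open>a i\<close> and \<open>b i\<close> span the first and last ray
  of sector \<open>i\<close>, at the angles \<open>al i\<close> and \<open>be i\<close>, and the last ray is glued to the first ray of
  \<open>nxt i\<close>. \<open>refract\<close> is the Landsberg condition for geodesics passing from \<open>i\<close> to \<open>nxt i\<close>, and
  \<open>half_minus\<close> a consequence of it for the opposite direction.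
\<close>

locale vertex_cone =
  fixes M :: "('p, 'i) flat_cells" and x :: 'p and ori :: "'i \<Rightarrow> real" and nxt :: "'i \<Rightarrow> 'i"
    and a b :: "'i \<Rightarrow> real^2" and al be :: "'i \<Rightarrow> real" and I :: "'i set"
    and F :: "'i \<Rightarrow> real^2 \<Rightarrow> real" and S :: "'i \<Rightarrow> (real^2) set"
  defines "I \<equiv> {i \<in> cells M. x \<in> cell M i}" and "F \<equiv> fnorm M" and "S \<equiv> sector M x"
  assumes finI: "finite I" and I_ne: "I \<noteq> {}"
    and nxt: "bij_betw nxt I I"
    and nxt1: "i \<in> I \<Longrightarrow> nxt i \<noteq> i" and nxt2: "i \<in> I \<Longrightarrow> nxt (nxt i) \<noteq> i"
    and conn: "A \<subseteq> I \<Longrightarrow> A \<noteq> {} \<Longrightarrow> nxt ` A \<subseteq> A \<Longrightarrow> A = I"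
    and mink: "i \<in> I \<Longrightarrow> minkowski_norm (F i)"
    and ori: "i \<in> I \<Longrightarrow> ori i \<in> {1, -1}"
    and angle_a: "i \<in> I \<Longrightarrow> \<exists>r>0. a i = r *\<^sub>R polar (ori i) (al i)"
    and angle_b: "i \<in> I \<Longrightarrow> \<exists>r>0. b i = r *\<^sub>R polar (ori i) (be i)"
    and al_be: "i \<in> I \<Longrightarrow> al i < be i \<and> be i < al i + pi"
    and S_eq: "i \<in> I \<Longrightarrow> S i = {s *\<^sub>R a i + t *\<^sub>R b i | s t. 0 \<le> s \<and> 0 \<le> t}"
    and glue: "i \<in> I \<Longrightarrow> F i (r *\<^sub>R b i) = F (nxt i) (r *\<^sub>R a (nxt i))"
    and rel: "((i, y), (j, z)) \<in> cone_rel M x \<longleftrightarrow> i \<in> I \<and> j \<in> I \<and> y \<in> S i \<and> z \<in> S j \<and>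
      (i = j \<and> y = z \<or> y = 0 \<and> z = 0 \<or> j = nxt i \<and> (\<exists>r\<ge>0. y = r *\<^sub>R b i \<and> z = r *\<^sub>R a j)
       \<or> i = nxt j \<and> (\<exists>r\<ge>0. y = r *\<^sub>R a i \<and> z = r *\<^sub>R b j))"
    and refract: "i \<in> I \<Longrightarrow> \<phi> \<in> {be i..be i + pi} \<Longrightarrow> \<exists>\<phi>'\<in>{al (nxt i)..al (nxt i) + pi}.
      minkowski.dF (F i) (nu (F i) (ori i) \<phi>) (b i)
        = minkowski.dF (F (nxt i)) (nu (F (nxt i)) (ori (nxt i)) \<phi>') (a (nxt i)) \<and>
      Th (F i) (ori i) \<phi> - Th (F i) (ori i) (be i)
        = Th (F (nxt i)) (ori (nxt i)) \<phi>' - Th (F (nxt i)) (ori (nxt i)) (al (nxt i)) \<and>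
      (\<phi> = be i + pi \<longrightarrow> \<phi>' = al (nxt i) + pi)"
    and half_minus: "i \<in> I \<Longrightarrow> Th (F i) (ori i) (be i) - Th (F i) (ori i) (be i - pi)
        = Th (F (nxt i)) (ori (nxt i)) (al (nxt i)) - Th (F (nxt i)) (ori (nxt i)) (al (nxt i) - pi)"
begin

section \<open>Coordinates on the sectors of the cone\<close>

lemma nxt_in: "i \<in> I \<Longrightarrow> nxt i \<in> I"
  using nxt by (auto simp: bij_betw_def)

lemma nxt_inj: "i \<in> I \<Longrightarrow> j \<in> I \<Longrightarrow> nxt i = nxt j \<Longrightarrow> i = j"
  using nxt by (auto simp: bij_betw_def inj_on_def)

lemma ex_prev: "j \<in> I \<Longrightarrow> \<exists>i\<in>I. nxt i = j"
  using nxt unfolding bij_betw_def by (metis imageE)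

lemma planar: "i \<in> I \<Longrightarrow> planar (F i) (ori i)"
  using mink ori by (simp add: planar_def minkowski_def sign_def)

lemma minkowski: "i \<in> I \<Longrightarrow> minkowski (F i)"
  using mink by (simp add: minkowski_def)

lemma cross_ab: assumes "i \<in> I" shows "0 < ori i * cross2 (a i) (b i)"
proof -
  interpret planar "F i" "ori i" by (rule planar[OF assms])
  obtain r s where "r > 0" "a i = r *\<^sub>R polar (ori i) (al i)" "s > 0" "b i = s *\<^sub>R polar (ori i) (be i)"
    using angle_a[OF assms] angle_b[OF assms] by blast
  moreover have "sin (be i - al i) > 0" using al_be[OF assms] by (intro sin_gt_zero) auto
  ultimately have "0 < (r * s) * (ori i * cross2 (polar (ori i) (al i)) (polar (ori i) (be i)))"
    unfolding cross2_polar by simp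
  also have "\<dots> = ori i * cross2 (a i) (b i)" using \<open>a i = _\<close> \<open>b i = _\<close> by simp
  finally show ?thesis .
qed

lemma cross_nz: "i \<in> I \<Longrightarrow> cross2 (a i) (b i) \<noteq> 0"
  using cross_ab by fastforce

lemma a_nz: "i \<in> I \<Longrightarrow> a i \<noteq> 0" and b_nz: "i \<in> I \<Longrightarrow> b i \<noteq> 0"
  using cross_nz by force+

definition cA :: "'i \<Rightarrow> real^2 \<Rightarrow> real" where "cA i y = cross2 y (b i) / cross2 (a i) (b i)"
definition cB :: "'i \<Rightarrow> real^2 \<Rightarrow> real" where "cB i y = cross2 (a i) y / cross2 (a i) (b i)"

lemma cAB_simps [simp]:
  "cA i (y + z) = cA i y + cA i z" "cB i (y + z) = cB i y + cB i z"
  "cA i (y - z) = cA i y - cA i z" "cB i (y - z) = cB i y - cB i z"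
  "cA i (r *\<^sub>R y) = r * cA i y" "cB i (r *\<^sub>R y) = r * cB i y"
  "cA i 0 = 0" "cB i 0 = 0" "cA i (- y) = - cA i y" "cB i (- y) = - cB i y"
  "cA i (b i) = 0" "cB i (a i) = 0"
  by (simp_all add: cA_def cB_def add_divide_distrib diff_divide_distrib)

lemma cAB_ab [simp]: "i \<in> I \<Longrightarrow> cA i (a i) = 1" "i \<in> I \<Longrightarrow> cB i (b i) = 1"
  using cross_nz by (simp_all add: cA_def cB_def)

lemma expand: "i \<in> I \<Longrightarrow> y = cA i y *\<^sub>R a i + cB i y *\<^sub>R b i"
  using cross2_basis[OF cross_nz] by (simp add: cA_def cB_def)

lemma S_iff: assumes "i \<in> I" shows "y \<in> S i \<longleftrightarrow> 0 \<le> cA i y \<and> 0 \<le> cB i y"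
  using expand[OF assms, of y] assms by (force simp: S_eq[OF assms])

lemma cAB_eqI: "i \<in> I \<Longrightarrow> cA i y = cA i z \<Longrightarrow> cB i y = cB i z \<Longrightarrow> y = z"
  using expand by metis

text \<open>The hat function of the ray between \<open>k\<close> and \<open>nxt k\<close>, as in
  finite elements: linear in each sector, 1 at the spanning vector of this ray and 0 at those of the
  other rays. Together the hats are coordinates for points of the whole cone, whatever sector
  represents them.\<close>

definition hat :: "'i \<Rightarrow> 'i \<Rightarrow> real^2 \<Rightarrow> real" where
  "hat k i y = (if k = i then cB i y else if nxt k = i then cA i y else 0)"

lemma hat_simps [simp]: "hat k i (y + z) = hat k i y + hat k i z" "hat k i (r *\<^sub>R y) = r * hat k i y"
    "hat k i (y - z) = hat k i y - hat k i z" "hat k i 0 = 0"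
  by (simp_all add: hat_def)

lemma linear_hat: "linear (hat k i)"
  by (rule linearI) simp_all

lemma hat_self: "hat i i y = cB i y" by (simp add: hat_def)
lemma hat_prev: "i \<in> I \<Longrightarrow> hat i (nxt i) y = cA (nxt i) y"
  using nxt1[of i] by (auto simp: hat_def)

text \<open>In a sector only the hats of its two rays can be nonzero. Equal hats in two different
  sectors thus leave nothing but a common ray, or the apex; as \<open>nxt\<close> has no orbit of
  length two, two sectors share at most one ray.\<close>

lemma rel_hat:
  "((i, y), (j, z)) \<in> cone_rel M x \<longleftrightarrow> i \<in> I \<and> j \<in> I \<and> y \<in> S i \<and> z \<in> S j \<and> (\<forall>k\<in>I. hat k i y = hat k j z)"
  (is "?L \<longleftrightarrow> ?R")
proof
  assume ?L
  then have ij: "i \<in> I" "j \<in> I" "y \<in> S i" "z \<in> S j"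
    and c: "i = j \<and> y = z \<or> y = 0 \<and> z = 0 \<or> j = nxt i \<and> (\<exists>r\<ge>0. y = r *\<^sub>R b i \<and> z = r *\<^sub>R a j)
       \<or> i = nxt j \<and> (\<exists>r\<ge>0. y = r *\<^sub>R a i \<and> z = r *\<^sub>R b j)"
    unfolding rel by blast+
  have 1: "hat k i (b i) = (if k = i then 1 else 0)" "hat k i (a i) = (if nxt k = i then 1 else 0)"
    if "i \<in> I" "k \<in> I" for i k
    using that nxt1 nxt_inj by (auto simp: hat_def)
  from c have "hat k i y = hat k j z" if "k \<in> I" for k
    using ij 1[OF _ that] nxt_inj[OF that] that by auto
  then show ?R using ij by blast
next
  assume R: ?R
  then have ij: "i \<in> I" "j \<in> I" and n: "0 \<le> cA i y" "0 \<le> cB i y" "0 \<le> cA j z" "0 \<le> cB j z"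
    and h: "\<And>k. k \<in> I \<Longrightarrow> hat k i y = hat k j z"
    using S_iff by auto
  obtain i' j' where p: "i' \<in> I" "nxt i' = i" "j' \<in> I" "nxt j' = j" using ex_prev ij by meson
  have ai: "hat i' i y = cA i y" and aj: "hat j' j z = cA j z" using p hat_prev by auto
  note hi = h[OF ij(1)] h[OF ij(2)] h[OF p(1)] h[OF p(3)]
  have "i = j \<and> y = z \<or> y = 0 \<and> z = 0 \<or> j = nxt i \<and> (\<exists>r\<ge>0. y = r *\<^sub>R b i \<and> z = r *\<^sub>R a j)
       \<or> i = nxt j \<and> (\<exists>r\<ge>0. y = r *\<^sub>R a i \<and> z = r *\<^sub>R b j)"
  proof -
    consider "i = j" | "j = nxt i" | "i = nxt j" | "i \<noteq> j" "j \<noteq> nxt i" "i \<noteq> nxt j" by blast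
    then show ?thesis
    proof cases
      case 1
      have "hat i' i z = cA i z" using p hat_prev by auto
      then have "y = z" using hi(1,3) ai 1 by (intro cAB_eqI[OF ij(1)]) (auto simp: hat_self)
      then show ?thesis using 1 by blast
    next
      case 2
      then have "j' = i" using p nxt_inj ij by blast
      have "nxt j \<noteq> i" using nxt2[OF ij(1)] 2 by simp
      then have "i' \<noteq> j" using p by auto
      have "hat i' j z = 0" using \<open>i' \<noteq> j\<close> p(2) nxt1[OF ij(1)] unfolding 2 by (auto simp: hat_def)
      then have "cA i y = 0" using hi(3) ai by simp
      moreover have "cB j z = 0" using hi(2) \<open>nxt j \<noteq> i\<close> nxt1[OF ij(1)] 2 by (auto simp: hat_def)
      moreover have "cB i y = cA j z" using hi(1) hat_prev[OF ij(1)] 2 by (simp add: hat_self)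
      ultimately have "y = cB i y *\<^sub>R b i" "z = cB i y *\<^sub>R a j"
        using expand[OF ij(1), of y] expand[OF ij(2), of z] ij by simp_all
      then show ?thesis using 2 n by blast
    next
      case 3
      then have "i' = j" using p nxt_inj ij by blast
      have "nxt i \<noteq> j" using nxt2[OF ij(2)] 3 by simp
      then have "j' \<noteq> i" using p by auto
      have "hat j' i y = 0" using \<open>j' \<noteq> i\<close> p(4) nxt1[OF ij(2)] unfolding 3 by (auto simp: hat_def)
      then have "cA j z = 0" using hi(4) aj by simp
      moreover have "cB i y = 0" using hi(1) \<open>nxt i \<noteq> j\<close> nxt1[OF ij(2)] 3 by (auto simp: hat_def)
      moreover have "cA i y = cB j z" using hi(2) hat_prev[OF ij(2)] 3 by (simp add: hat_self)
      ultimately have "y = cB j z *\<^sub>R a i" "z = cB j z *\<^sub>R b j"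
        using expand[OF ij(1), of y] expand[OF ij(2), of z] ij by simp_all
      then show ?thesis using 3 n by blast
    next
      case 4
      have ne: "i' \<noteq> j'" "i' \<noteq> j" "j' \<noteq> i" using p 4 nxt_inj ij by auto
      have z: "hat i' j z = 0" "hat j' i y = 0" using ne p 4 by (auto simp: hat_def)
      then have "cA i y = 0" using hi(3) ai by simp
      moreover have "cB i y = 0" using hi(1) 4 by (auto simp: hat_def)
      moreover have "cA j z = 0" using hi(4) aj z by simp
      moreover have "cB j z = 0" using hi(2) 4 by (auto simp: hat_def)
      ultimately show ?thesis using expand[OF ij(1), of y] expand[OF ij(2), of z] ij by simp
    qed
  qed
  then show ?L using R unfolding rel by blast
qed

section \<open>Points, cells and charts of the tangent cone\<close>

abbreviation "TC \<equiv> tangent_cone M x"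

definition pt :: "'i \<Rightarrow> real^2 \<Rightarrow> ('i \<times> (real^2)) set" where
  "pt i y = cone_rel M x `` {(i, y)}"

lemma in_pt: "(j, z) \<in> pt i y \<longleftrightarrow> ((i, y), (j, z)) \<in> cone_rel M x"
  by (simp add: pt_def)

lemma in_pt_self: "i \<in> I \<Longrightarrow> y \<in> S i \<Longrightarrow> (i, y) \<in> pt i y"
  by (simp add: in_pt rel_hat)

lemma pt_eq_iff:
  assumes "i \<in> I" "y \<in> S i" "j \<in> I" "z \<in> S j"
  shows "pt i y = pt j z \<longleftrightarrow> (\<forall>k\<in>I. hat k i y = hat k j z)"
proof
  assume "pt i y = pt j z"
  then have "(j, z) \<in> pt i y" using in_pt_self assms by simp
  then show "\<forall>k\<in>I. hat k i y = hat k j z" by (simp add: in_pt rel_hat)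
next
  assume h: "\<forall>k\<in>I. hat k i y = hat k j z"
  have "(m, w) \<in> pt i y \<longleftrightarrow> (m, w) \<in> pt j z" for m w
    using h assms by (simp add: in_pt rel_hat)
  then show "pt i y = pt j z" by auto
qed

lemma pt_eq_rel: assumes "i \<in> I" "y \<in> S i" "j \<in> I" "z \<in> S j"
  shows "pt i y = pt j z \<longleftrightarrow> ((i, y), (j, z)) \<in> cone_rel M x"
  using assms by (simp add: pt_eq_iff rel_hat)

lemma in_pt_iff: "i \<in> I \<Longrightarrow> y \<in> S i \<Longrightarrow> (j, z) \<in> pt i y \<longleftrightarrow> j \<in> I \<and> z \<in> S j \<and> pt i y = pt j z"
  using pt_eq_rel[of i y j z] rel_hat[of i y j z] by (auto simp: in_pt)

lemma pt_same: "i \<in> I \<Longrightarrow> y \<in> S i \<Longrightarrow> z \<in> S i \<Longrightarrow> pt i y = pt i z \<longleftrightarrow> y = z"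
  using nxt1[of i] nxt2[of i] by (auto simp: pt_eq_rel rel)

lemma pt_ray: assumes "i \<in> I" "0 \<le> r" shows "pt i (r *\<^sub>R b i) = pt (nxt i) (r *\<^sub>R a (nxt i))"
  using assms nxt_in[OF assms(1)] by (subst pt_eq_rel) (auto simp: rel S_iff)

lemma cells_TC [simp]: "cells TC = I" and fnorm_TC [simp]: "fnorm TC = F"
  by (simp_all add: tangent_cone_def I_def F_def)

lemma cone_points_eq: "cone_points M x = {pt i y | i y. i \<in> I \<and> y \<in> S i}"
  unfolding cone_points_def quotient_def pt_def I_def S_def by auto

lemma cell_TC: assumes "i \<in> I" shows "cell TC i = pt i ` S i"
proof -
  have "cell TC i = {P \<in> cone_points M x. \<exists>y. (i, y) \<in> P}" by (simp add: tangent_cone_def)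
  also have "\<dots> = pt i ` S i"
    unfolding cone_points_eq using in_pt_iff assms by (auto intro: in_pt_self)
  finally show ?thesis .
qed

lemma chart_TC: assumes "i \<in> I" "y \<in> S i" shows "chart TC i (pt i y) = y"
proof -
  have "(THE z. (i, z) \<in> pt i y) = y"
    by (rule the_equality) (use assms in_pt_self in_pt_iff pt_same in auto)
  then show ?thesis by (simp add: tangent_cone_def)
qed

lemma apex_eq: assumes "i \<in> I" shows "cone_apex M x = pt i 0"
proof -
  have "(m, w) \<in> pt i 0 \<longleftrightarrow> m \<in> I \<and> w = 0" for m w
  proof
    assume "(m, w) \<in> pt i 0"
    then show "m \<in> I \<and> w = 0" using a_nz b_nz by (auto simp: in_pt rel)
  next
    assume "m \<in> I \<and> w = 0"
    then show "(m, w) \<in> pt i 0" using assms by (auto simp: in_pt rel S_iff)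
  qed
  then show ?thesis by (auto simp: cone_apex_def I_def)
qed

lemma pt_apex: "i \<in> I \<Longrightarrow> y \<in> S i \<Longrightarrow> pt i y = cone_apex M x \<longleftrightarrow> y = 0"
  using pt_same[of i y 0] S_iff[of i 0] by (simp add: apex_eq)

lemma S_add: "i \<in> I \<Longrightarrow> y \<in> S i \<Longrightarrow> z \<in> S i \<Longrightarrow> y + z \<in> S i"
  and S_scale: "i \<in> I \<Longrightarrow> y \<in> S i \<Longrightarrow> 0 \<le> r \<Longrightarrow> r *\<^sub>R y \<in> S i"
  and S_0: "i \<in> I \<Longrightarrow> 0 \<in> S i"
  by (simp_all add: S_iff)

lemma S_convex: assumes "i \<in> I" "y \<in> S i" "z \<in> S i" "0 \<le> t" "t \<le> 1"
  shows "y + t *\<^sub>R (z - y) \<in> S i"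
proof -
  have "y + t *\<^sub>R (z - y) = (1 - t) *\<^sub>R y + t *\<^sub>R z" by (simp add: algebra_simps)
  then show ?thesis using assms by (simp add: S_add S_scale)
qed

lemma pw_line:
  assumes "s < t" "i \<in> I" "\<And>\<tau>. s \<le> \<tau> \<Longrightarrow> \<tau> \<le> t \<Longrightarrow> y + \<tau> *\<^sub>R u \<in> S i \<and> \<gamma> \<tau> = pt i (y + \<tau> *\<^sub>R u)"
    "\<And>\<tau>. s < \<tau> \<Longrightarrow> \<tau> < t \<Longrightarrow> \<rho> \<tau> = F i u"
  shows "pw_smooth TC (finsler TC) \<gamma> \<rho> s t"
proof (rule pw_smooth.piece[OF assms(1), of i _ _ UNIV "\<lambda>\<tau>. y + \<tau> *\<^sub>R u"])
  have "vector_derivative (\<lambda>\<tau>. y + \<tau> *\<^sub>R u) (at \<tau>) = u" for \<tau>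
    by (rule vector_derivative_at) (auto intro!: derivative_eq_intros)
  then show "\<forall>\<tau>\<in>{s<..<t}. \<rho> \<tau> = finsler TC i (y + \<tau> *\<^sub>R u) (vector_derivative (\<lambda>\<tau>. y + \<tau> *\<^sub>R u) (at \<tau>))"
    using assms(4) by (simp add: finsler_def)
  show "\<gamma> ` {s..t} \<subseteq> cell TC i" using assms(2,3) by (auto simp: cell_TC)
  show "\<forall>\<tau>\<in>{s..t}. chart TC i (\<gamma> \<tau>) = y + \<tau> *\<^sub>R u" using assms(2,3) by (auto simp: chart_TC)
qed (use assms smooth_on_line in auto)

text \<open>A function that is linear in each cell with differential at most \<open>C\<close> times
  the norm grows along a curve by at most \<open>C\<close> times the length. It is applied with
  hats, to confine short curves to a star; with momenta and \<open>C\<close> equal to 1, as a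
  calibration; and with the zero function, to get that lengths exist and are nonnegative.\<close>

lemma lip:
  assumes "pw_smooth TC (finsler TC) \<gamma> \<rho> A B"
    and lam: "\<And>k. k \<in> J \<Longrightarrow> linear (lam k)" "\<And>k w. k \<in> J \<Longrightarrow> lam k w \<le> C * F k w"
    and "\<And>t k. A \<le> t \<Longrightarrow> t \<le> B \<Longrightarrow> k \<in> I \<Longrightarrow> \<gamma> t \<in> cell TC k \<Longrightarrow> k \<in> J \<and> f (\<gamma> t) = lam k (chart TC k (\<gamma> t))"
  shows "\<rho> integrable_on {A..B} \<and> (\<forall>s t. A \<le> s \<and> s \<le> t \<and> t \<le> B \<longrightarrow>
     0 \<le> integral {s..t} \<rho> \<and> f (\<gamma> t) - f (\<gamma> s) \<le> C * integral {s..t} \<rho>)"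
  using assms(1,4)
proof (induction rule: pw_smooth.induct)
  case (piece A B i U g)
  have i: "i \<in> I" using piece(2) by simp
  interpret minkowski "F i" by (rule minkowski[OF i])
  define g' where "g' t = vector_derivative g (at t)" for t
  note g = smooth_on_vector_derivative[OF piece(6,5), folded g'_def]
  define G where "G t = F i (g' t)" for t
  have cG: "continuous_on {A..B} G"
    unfolding G_def by (rule continuous_on_compose2[OF cont[of UNIV] g(2)]) auto
  have sp: "\<rho> t = G t" if "t \<in> {A..B} - {A, B}" for t
    using piece(8) that by (auto simp: G_def g'_def finsler_def)
  have "G integrable_on {A..B}" using cG by (rule integrable_continuous_real)
  then have "\<rho> integrable_on {A..B}"
    by (rule integrable_spike_finite[of "{A, B}", rotated 2]) (use sp in auto)
  moreover have "0 \<le> integral {s..t} \<rho> \<and> f (\<gamma> t) - f (\<gamma> s) \<le> C * integral {s..t} \<rho>"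
    if st: "A \<le> s" "s \<le> t" "t \<le> B" for s t
  proof -
    have Gi: "G integrable_on {s..t}"
      by (rule integrable_continuous_real[OF continuous_on_subset[OF cG]]) (use st in auto)
    have eq: "integral {s..t} \<rho> = integral {s..t} G"
      by (rule integral_spike[of "{A, B}"]) (use sp st in auto)
    have "0 \<le> integral {s..t} G" by (rule integral_nonneg[OF Gi]) (simp add: G_def nonneg)
    moreover
    have J: "\<And>\<tau>. A \<le> \<tau> \<Longrightarrow> \<tau> \<le> B \<Longrightarrow> i \<in> J \<and> f (\<gamma> \<tau>) = lam i (g \<tau>)"
      using piece(3,7,9) i by fastforce
    then have iJ: "i \<in> J" using st by force
    have bl: "bounded_linear (lam i)" using lam(1)[OF iJ] by (rule linear_conv_bounded_linear[THEN iffD1])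
    have 1: "((\<lambda>\<tau>. lam i (g' \<tau>)) has_integral lam i (g t) - lam i (g s)) {s..t}"
      by (rule fundamental_theorem_of_calculus[OF st(2)])
        (use st in \<open>auto intro!: has_vector_derivative_at_within bounded_linear.has_vector_derivative[OF bl] g(1)\<close>)
    have 2: "((\<lambda>\<tau>. C * G \<tau>) has_integral C * integral {s..t} G) {s..t}"
      by (intro has_integral_mult_right integrable_integral Gi)
    have "lam i (g t) - lam i (g s) \<le> C * integral {s..t} G"
      by (rule has_integral_le[OF 1 2]) (simp add: G_def lam(2)[OF iJ])
    moreover have "f (\<gamma> t) = lam i (g t)" "f (\<gamma> s) = lam i (g s)" using J st by auto
    ultimately show ?thesis using eq by simp
  qed
  ultimately show ?case by blast
next
  case (join A B D)
  note lt = pw_smooth_less[OF join(1)] pw_smooth_less[OF join(2)]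
  have I1: "\<rho> integrable_on {A..B} \<and> (\<forall>s t. A \<le> s \<and> s \<le> t \<and> t \<le> B \<longrightarrow>
     0 \<le> integral {s..t} \<rho> \<and> f (\<gamma> t) - f (\<gamma> s) \<le> C * integral {s..t} \<rho>)"
    by (rule join(3)) (use join(5) lt in \<open>meson order_trans less_imp_le\<close>)
  have I2: "\<rho> integrable_on {B..D} \<and> (\<forall>s t. B \<le> s \<and> s \<le> t \<and> t \<le> D \<longrightarrow>
     0 \<le> integral {s..t} \<rho> \<and> f (\<gamma> t) - f (\<gamma> s) \<le> C * integral {s..t} \<rho>)"
    by (rule join(4)) (use join(5) lt in \<open>meson order_trans less_imp_le\<close>)
  have int: "\<rho> integrable_on {A..D}"
    using lt by (intro Henstock_Kurzweil_Integration.integrable_combine[OF _ _ conjunct1[OF I1] conjunct1[OF I2]]) auto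
  moreover have "0 \<le> integral {s..t} \<rho> \<and> f (\<gamma> t) - f (\<gamma> s) \<le> C * integral {s..t} \<rho>"
    if st: "A \<le> s" "s \<le> t" "t \<le> D" for s t
  proof -
    consider "t \<le> B" | "B \<le> s" | "s \<le> B" "B \<le> t" by linarith
    then show ?thesis
    proof cases
      case 3
      have "\<rho> integrable_on {s..t}" by (rule integrable_on_subinterval[OF int]) (use st in auto)
      then have e: "integral {s..t} \<rho> = integral {s..B} \<rho> + integral {B..t} \<rho>"
        using Henstock_Kurzweil_Integration.integral_combine[OF 3, of \<rho>] by simp
      show ?thesis using conjunct2[OF I1, THEN spec[of _ s], THEN spec[of _ B]] conjunct2[OF I2, THEN spec[of _ B], THEN spec[of _ t]] st 3 by (simp add: e distrib_left)
    qed (use I1 I2 st in auto)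
  qed
  ultimately show ?case by blast
qed

end

section \<open>Distances in the cone and calibrations\<close>

context vertex_cone begin

lemma hat_bound: "\<exists>C>0. \<forall>i\<in>I. \<forall>k\<in>I. \<forall>w. \<bar>hat k i w\<bar> \<le> C * F i w"
proof -
  have "\<forall>p\<in>I \<times> I. \<exists>c>0. \<forall>w. \<bar>hat (snd p) (fst p) w\<bar> \<le> c * F (fst p) w"
    using minkowski.linear_bound[OF minkowski linear_hat] by auto
  from bchoice[OF this] obtain c where
    "\<forall>p\<in>I \<times> I. c p > 0 \<and> (\<forall>w. \<bar>hat (snd p) (fst p) w\<bar> \<le> c p * F (fst p) w)" ..
  note c = bspec[OF this]
  define C where "C = (\<Sum>p\<in>I\<times>I. c p) + 1"
  have le: "c p \<le> C" if "p \<in> I \<times> I" for p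
    using member_le_sum[OF that, of c] c finI by (force simp: C_def less_imp_le)
  have "0 \<le> (\<Sum>p\<in>I\<times>I. c p)" using c by (intro sum_nonneg) (simp add: less_imp_le)
  then have "C > 0" by (simp add: C_def)
  moreover have "\<bar>hat k i w\<bar> \<le> C * F i w" if "i \<in> I" "k \<in> I" for i k w
  proof -
    have "\<bar>hat k i w\<bar> \<le> c (i, k) * F i w" using c[of "(i, k)"] that by auto
    also have "\<dots> \<le> C * F i w"
      using le[of "(i, k)"] that minkowski.nonneg[OF minkowski] by (intro mult_right_mono) auto
    finally show ?thesis .
  qed
  ultimately show ?thesis by blast
qed

text \<open>A hat as a function of the point alone; \<open>hatp_pt\<close> shows that the chosen
  cell does not matter.\<close>

definition hatp :: "'i \<Rightarrow> ('i \<times> (real^2)) set \<Rightarrow> real" where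
  "hatp k P = (let i = SOME i. i \<in> I \<and> P \<in> cell TC i in hat k i (chart TC i P))"

lemma hatp_pt: assumes "i \<in> I" "y \<in> S i" "k \<in> I" shows "hatp k (pt i y) = hat k i y"
proof -
  define j where "j = (SOME j. j \<in> I \<and> pt i y \<in> cell TC j)"
  have "j \<in> I \<and> pt i y \<in> cell TC j"
    unfolding j_def by (rule someI[of _ i]) (use assms cell_TC in auto)
  then obtain z where z: "j \<in> I" "z \<in> S j" "pt i y = pt j z" by (auto simp: cell_TC)
  then have "hat k i y = hat k j z" using assms pt_eq_iff[OF assms(1,2) z(1,2)] by auto
  moreover have "chart TC j (pt i y) = z" unfolding z(3) by (rule chart_TC[OF z(1,2)])
  ultimately show ?thesis unfolding hatp_def Let_def j_def[symmetric] by simp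
qed

lemma cell_TC_iff: "i \<in> I \<Longrightarrow> P \<in> cell TC i \<longleftrightarrow> (\<exists>y\<in>S i. P = pt i y)"
  by (auto simp: cell_TC)

lemma len_nonneg: "pw_smooth TC (finsler TC) \<gamma> \<rho> A B \<Longrightarrow> 0 \<le> integral {A..B} \<rho>"
  using lip[of \<gamma> \<rho> A B I "\<lambda>_ _. 0" 0 "\<lambda>_. 0"] pw_smooth_less[of TC "finsler TC" \<gamma> \<rho> A B]
  by (simp add: linear_zero)

lemma fdist_le: assumes "pw_smooth TC (finsler TC) \<gamma> \<rho> A B"
  shows "fdist TC (\<gamma> A) (\<gamma> B) \<le> integral {A..B} \<rho>"
  unfolding fdist_def
proof (rule cInf_lower)
  show "bdd_below {integral {s..t} \<rho> |c \<rho> s t. pw_smooth TC (finsler TC) c \<rho> s t \<and> c s = \<gamma> A \<and> c t = \<gamma> B}"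
    by (rule bdd_belowI[of _ 0]) (use len_nonneg in auto)
qed (use assms in blast)

text \<open>The given curve only witnesses that the set of lengths is nonempty, as a lower bound for
  an infimum in the reals requires.\<close>

lemma fdist_ge:
  assumes "pw_smooth TC (finsler TC) \<gamma> \<rho> A B" "\<gamma> A = P" "\<gamma> B = Q"
    and "\<And>c \<rho> s t. pw_smooth TC (finsler TC) c \<rho> s t \<Longrightarrow> c s = P \<Longrightarrow> c t = Q \<Longrightarrow> m \<le> integral {s..t} \<rho>"
  shows "m \<le> fdist TC P Q"
  unfolding fdist_def by (rule cInf_greatest) (use assms in blast)+

text \<open>Two straight segments meeting at a point that \<open>i\<close> and \<open>j\<close>
  share. Such paths bound distances from above and also witness that distances are infima of
  nonempty sets.\<close>

lemma path2:
  assumes "i \<in> I" "j \<in> I" "y \<in> S i" "p1 \<in> S i" "p2 \<in> S j" "z \<in> S j" "pt i p1 = pt j p2"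
  shows "\<exists>\<gamma> \<rho>. pw_smooth TC (finsler TC) \<gamma> \<rho> 0 2 \<and> \<gamma> 0 = pt i y \<and> \<gamma> 2 = pt j z \<and>
    integral {0..2} \<rho> = F i (p1 - y) + F j (z - p2)"
proof -
  define \<gamma> where "\<gamma> t = (if t \<le> 1 then pt i (y + t *\<^sub>R (p1 - y)) else pt j (p2 + (t - 1) *\<^sub>R (z - p2)))" for t :: real
  define \<rho> where "\<rho> t = (if t \<le> 1 then F i (p1 - y) else F j (z - p2))" for t :: real
  have 1: "pw_smooth TC (finsler TC) \<gamma> \<rho> 0 1"
    by (rule pw_line[of 0 1 i y "p1 - y"]) (use assms S_convex in \<open>auto simp: \<gamma>_def \<rho>_def\<close>)
  have 2: "pw_smooth TC (finsler TC) \<gamma> \<rho> 1 2"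
  proof (rule pw_line[of 1 2 j "p2 - (z - p2)" "z - p2"])
    fix t :: real assume t: "1 \<le> t" "t \<le> 2"
    have eq: "p2 - (z - p2) + t *\<^sub>R (z - p2) = p2 + (t - 1) *\<^sub>R (z - p2)" by (simp add: algebra_simps)
    show "p2 - (z - p2) + t *\<^sub>R (z - p2) \<in> S j \<and> \<gamma> t = pt j (p2 - (z - p2) + t *\<^sub>R (z - p2))"
      unfolding eq using t assms S_convex[of j p2 z "t - 1"] by (cases "t = 1") (auto simp: \<gamma>_def)
  qed (use assms in \<open>auto simp: \<rho>_def\<close>)
  have "(\<rho> has_integral F i (p1 - y)) {0..1}"
    by (rule has_integral_spike_finite[of "{1}" _ _ "\<lambda>_. F i (p1 - y)"])
      (use has_integral_const_real[of "F i (p1 - y)" 0 1] in \<open>auto simp: \<rho>_def\<close>)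
  moreover have "(\<rho> has_integral F j (z - p2)) {1..2}"
    by (rule has_integral_spike_finite[of "{1}" _ _ "\<lambda>_. F j (z - p2)"])
      (use has_integral_const_real[of "F j (z - p2)" 1 2] in \<open>auto simp: \<rho>_def\<close>)
  ultimately have "(\<rho> has_integral F i (p1 - y) + F j (z - p2)) {0..2}"
    by (rule has_integral_combine[rotated 2]) auto
  then show ?thesis
    using pw_smooth.join[OF 1 2] by (intro exI[of _ \<gamma>] exI[of _ \<rho>]) (auto simp: \<gamma>_def integral_unique)
qed

lemma fdist_two:
  assumes "i \<in> I" "j \<in> I" "y \<in> S i" "p1 \<in> S i" "p2 \<in> S j" "z \<in> S j" "pt i p1 = pt j p2"
  shows "fdist TC (pt i y) (pt j z) \<le> F i (p1 - y) + F j (z - p2)"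
  using path2[OF assms] fdist_le by metis

lemma fdist_line: "i \<in> I \<Longrightarrow> y \<in> S i \<Longrightarrow> z \<in> S i \<Longrightarrow> fdist TC (pt i y) (pt i z) \<le> F i (z - y)"
  using fdist_two[of i i y z z z] minkowski.zero[OF minkowski, of i] by simp

text \<open>A hat is positive only in the two sectors next to its ray. So a point where all hats
  that are positive at \<open>pt m y0\<close> are still positive can only lie in a sector that
  contains \<open>pt m y0\<close>.\<close>

lemma star:
  assumes m: "m \<in> I" "y0 \<in> S m" "y0 \<noteq> 0" and i: "i \<in> I" "y \<in> S i"
    and h: "\<And>k. k \<in> I \<Longrightarrow> 0 < hat k m y0 \<Longrightarrow> 0 < hat k i y"
  shows "pt m y0 \<in> cell TC i"
proof -
  obtain m' where m': "m' \<in> I" "nxt m' = m" using ex_prev[OF m(1)] by blast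
  have hA: "hat m' m y0 = cA m y0" using hat_prev[OF m'(1)] m'(2) by auto
  have hB: "hat m m y0 = cB m y0" by (rule hat_self)
  have n: "0 \<le> cA m y0" "0 \<le> cB m y0" using m S_iff by auto
  have ex: "y0 = cA m y0 *\<^sub>R a m + cB m y0 *\<^sub>R b m" by (rule expand[OF m(1)])
  have B: "m = i \<or> nxt m = i" if "0 < cB m y0"
  proof -
    have "0 < hat m i y" using h[OF m(1)] that hB by simp
    then show ?thesis by (auto simp: hat_def split: if_splits)
  qed
  have A: "m' = i \<or> m = i" if "0 < cA m y0"
  proof -
    have "0 < hat m' i y" using h[OF m'(1)] that hA by simp
    then show ?thesis using m'(2) by (auto simp: hat_def split: if_splits)
  qed
  consider "0 < cA m y0" "0 < cB m y0" | "cA m y0 = 0" "0 < cB m y0" | "0 < cA m y0" "cB m y0 = 0"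
    using n ex m(3) by fastforce
  then show ?thesis
  proof cases
    case 1
    then have "i = m" using A B m' nxt2[OF m(1)] by auto
    then show ?thesis using m by (auto simp: cell_TC)
  next
    case 2
    then have e: "y0 = cB m y0 *\<^sub>R b m" using ex by simp
    have "pt m y0 = pt (nxt m) (cB m y0 *\<^sub>R a (nxt m))"
      using pt_ray[OF m(1) n(2)] e by simp
    moreover have "cB m y0 *\<^sub>R a (nxt m) \<in> S (nxt m)" using n nxt_in[OF m(1)] by (simp add: S_iff)
    ultimately show ?thesis using B[OF 2(2)] m nxt_in[OF m(1)] cell_TC by (metis imageI)
  next
    case 3
    then have e: "y0 = cA m y0 *\<^sub>R a m" using ex by simp
    have "pt m' (cA m y0 *\<^sub>R b m') = pt m y0"
      using pt_ray[OF m'(1) n(1)] m'(2) e by simp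
    moreover have "cA m y0 *\<^sub>R b m' \<in> S m'" using n m'(1) by (simp add: S_iff)
    ultimately show ?thesis using A[OF 3(1)] m m'(1) cell_TC by (metis imageI)
  qed
qed

text \<open>Two different sectors meet only in a ray or in the apex, and here the ray is the one
  through \<open>y0\<close>. By homogeneity, agreement at the nonzero point \<open>y0\<close> gives
  agreement on the whole ray.\<close>

lemma lam_consistent:
  assumes m: "m \<in> I" "y0 \<in> S m" "y0 \<noteq> 0"
    and i: "i \<in> I" "pt m y0 \<in> cell TC i" and j: "j \<in> I" "pt m y0 \<in> cell TC j"
    and lam: "linear (lam i)" "linear (lam j)"
    and cons: "lam i (chart TC i (pt m y0)) = lam j (chart TC j (pt m y0))"
    and yz: "y \<in> S i" "z \<in> S j" "pt i y = pt j z"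
  shows "lam i y = (lam j z :: real)"
proof (cases "i = j")
  case True
  then show ?thesis using pt_same[of i y z] i yz by auto
next
  case False
  obtain y1 z1 where 1: "y1 \<in> S i" "pt m y0 = pt i y1" "z1 \<in> S j" "pt m y0 = pt j z1"
    using i j by (auto simp: cell_TC)
  have "y1 \<noteq> 0" using 1 m pt_apex[OF m(1,2)] i apex_eq by metis
  have "lam i y1 = lam j z1" using cons 1 i j chart_TC by metis
  moreover have r1: "((i, y1), (j, z1)) \<in> cone_rel M x" "((i, y), (j, z)) \<in> cone_rel M x"
    using 1 i j yz pt_eq_rel by metis+
  moreover have nn: "\<not> (j = nxt i \<and> i = nxt j)" using nxt2 i by metis
  moreover have "\<exists>p q. y1 = p \<and> z1 = q \<and> (\<exists>r s. r \<noteq> 0 \<and> y = s *\<^sub>R ((1 / r) *\<^sub>R p) \<and> z = s *\<^sub>R ((1 / r) *\<^sub>R q))"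
  proof -
    from r1(1) False \<open>y1 \<noteq> 0\<close> obtain r where r: "r \<noteq> 0" and
      d: "j = nxt i \<and> y1 = r *\<^sub>R b i \<and> z1 = r *\<^sub>R a j \<or> i = nxt j \<and> y1 = r *\<^sub>R a i \<and> z1 = r *\<^sub>R b j"
      unfolding rel by force
    from r1(2) False obtain s where
      "y = 0 \<and> z = 0 \<or> j = nxt i \<and> y = s *\<^sub>R b i \<and> z = s *\<^sub>R a j \<or> i = nxt j \<and> y = s *\<^sub>R a i \<and> z = s *\<^sub>R b j"
      unfolding rel by blast
    then show ?thesis
    proof (elim disjE)
      assume "y = 0 \<and> z = 0"
      then show ?thesis by (intro exI[of _ y1] exI[of _ z1] conjI refl exI[of _ 1] exI[of _ 0]) auto
    qed (use d nn r in \<open>intro exI[of _ y1] exI[of _ z1] conjI refl exI[of _ r] exI[of _ s]; auto\<close>)+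
  qed
  ultimately show ?thesis
    using linear_scale[OF lam(1)] linear_scale[OF lam(2)] by auto
qed

text \<open>The functionals \<open>lam k\<close> fit together to a function \<open>f\<close> on the
  star of \<open>y0\<close> that grows at most as fast as length. A curve from near
  \<open>y0\<close> either stays in the star, and \<open>f\<close> bounds its length from below, or
  has at least a fixed length; this explains the minimum with \<delta>.\<close>

lemma calib:
  assumes m: "m \<in> I" "y0 \<in> S m" "y0 \<noteq> 0"
    and J: "J = {i \<in> I. pt m y0 \<in> cell TC i}"
    and lam: "\<And>k. k \<in> J \<Longrightarrow> linear (lam k)" "\<And>k w. k \<in> J \<Longrightarrow> lam k w \<le> F k w"
    and cons: "\<And>i j. i \<in> J \<Longrightarrow> j \<in> J \<Longrightarrow> lam i (chart TC i (pt m y0)) = lam j (chart TC j (pt m y0))"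
  shows "\<exists>\<delta>>0. \<exists>\<eta>>0. \<forall>i\<in>J. \<forall>j\<in>J. \<forall>y\<in>S i. \<forall>z\<in>S j. (\<forall>k\<in>I. \<bar>hat k i y - hat k m y0\<bar> < \<eta>) \<longrightarrow>
     min \<delta> (lam j z - lam i y) \<le> fdist TC (pt i y) (pt j z)"
proof -
  obtain C where C: "C > 0" "\<And>i k w. i \<in> I \<Longrightarrow> k \<in> I \<Longrightarrow> \<bar>hat k i w\<bar> \<le> C * F i w"
    using hat_bound by blast
  define R where "R = {k \<in> I. 0 < hat k m y0}"
  obtain m' where m': "m' \<in> I" "nxt m' = m" using ex_prev[OF m(1)] by blast
  have "cA m y0 \<noteq> 0 \<or> cB m y0 \<noteq> 0" using expand[OF m(1), of y0] m(3) by auto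
  then have "0 < cA m y0 \<or> 0 < cB m y0" using m S_iff by fastforce
  then have "m \<in> R \<or> m' \<in> R" using m m' hat_prev[OF m'(1)] by (auto simp: R_def hat_self)
  then have R: "finite R" "R \<noteq> {}" using finI by (auto simp: R_def)
  \<comment> \<open>The least positive hat at \<open>y0\<close>: the room within which a point can
    move without leaving the star.\<close>
  define \<mu> where "\<mu> = Min ((\<lambda>k. hat k m y0) ` R)"
  have \<mu>: "\<mu> > 0" "\<And>k. k \<in> R \<Longrightarrow> \<mu> \<le> hat k m y0"
    using R by (auto simp: \<mu>_def R_def)
  define f where "f P = (let i = SOME i. i \<in> J \<and> P \<in> cell TC i in lam i (chart TC i P))" for P
  have JI: "i \<in> I" "pt m y0 \<in> cell TC i" if "i \<in> J" for i using that J by auto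
  have f: "f (pt i y) = lam i y" if iy: "i \<in> J" "y \<in> S i" for i y
  proof -
    define j where "j = (SOME j. j \<in> J \<and> pt i y \<in> cell TC j)"
    have "j \<in> J \<and> pt i y \<in> cell TC j"
      unfolding j_def by (rule someI[of _ i]) (use iy JI cell_TC in auto)
    then obtain z where z: "j \<in> J" "z \<in> S j" "pt i y = pt j z" using JI by (auto simp: cell_TC)
    have "lam i y = lam j z"
      by (rule lam_consistent[OF m JI[OF iy(1)] JI[OF z(1)] lam(1)[OF iy(1)] lam(1)[OF z(1)]
            cons[OF iy(1) z(1)] iy(2) z(2,3)])
    moreover have "chart TC j (pt i y) = z" unfolding z(3) by (rule chart_TC[OF JI(1)[OF z(1)] z(2)])
    ultimately show ?thesis unfolding f_def Let_def j_def[symmetric] by simp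
  qed
  \<comment> \<open>The start may spoil a hat by \<mu>/2, and a curve shorter than
    \<open>\<mu> / (4 * C)\<close> by another \<mu>/4. A quarter of \<mu> remains, so the positive
    hats stay positive along the curve.\<close>
  have main: "min (\<mu> / (4 * C)) (lam j z - lam i y) \<le> fdist TC (pt i y) (pt j z)"
    if ij: "i \<in> J" "j \<in> J" "y \<in> S i" "z \<in> S j" and near: "\<And>k. k \<in> I \<Longrightarrow> \<bar>hat k i y - hat k m y0\<bar> < \<mu> / 2"
    for i j y z
  proof -
    obtain p1 p2 where p: "p1 \<in> S i" "pt m y0 = pt i p1" "p2 \<in> S j" "pt m y0 = pt j p2"
      using JI[OF ij(1)] JI[OF ij(2)] by (auto simp: cell_TC)
    then obtain \<gamma>0 \<rho>0 where g0: "pw_smooth TC (finsler TC) \<gamma>0 \<rho>0 0 2" "\<gamma>0 0 = pt i y" "\<gamma>0 2 = pt j z"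
      using path2[of i j y p1 p2 z] ij JI by metis
    show ?thesis
    proof (rule fdist_ge[OF g0])
      fix c \<rho> A B assume c: "pw_smooth TC (finsler TC) c \<rho> A B" "c A = pt i y" "c B = pt j z"
      note AB = pw_smooth_less[OF c(1)]
      have nn: "\<rho> integrable_on {A..B}" "\<And>s t. A \<le> s \<Longrightarrow> s \<le> t \<Longrightarrow> t \<le> B \<Longrightarrow> 0 \<le> integral {s..t} \<rho>"
        using lip[OF c(1), of I "\<lambda>_ _. 0" 0 "\<lambda>_. 0"] by (auto simp: linear_zero)
      show "min (\<mu> / (4 * C)) (lam j z - lam i y) \<le> integral {A..B} \<rho>"
      proof (cases "integral {A..B} \<rho> < \<mu> / (4 * C)")
        case True
        have inJ: "l \<in> J" if t: "A \<le> t" "t \<le> B" "l \<in> I" "c t \<in> cell TC l" for t l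
        proof -
          obtain w where w: "w \<in> S l" "c t = pt l w" using t by (auto simp: cell_TC)
          have "0 < hat k l w" if k: "k \<in> I" "0 < hat k m y0" for k
          proof -
            have "- hatp k (c t) - - hatp k (c A) \<le> C * integral {A..t} \<rho>"
            proof -
              have "\<rho> integrable_on {A..B} \<and> (\<forall>s t. A \<le> s \<and> s \<le> t \<and> t \<le> B \<longrightarrow>
                0 \<le> integral {s..t} \<rho> \<and> (\<lambda>P. - hatp k P) (c t) - (\<lambda>P. - hatp k P) (c s) \<le> C * integral {s..t} \<rho>)"
              proof (rule lip[OF c(1), of I "\<lambda>i w. - hat k i w"])
                show "linear (\<lambda>w. - hat k i w)" for i by (rule linear_compose_neg[OF linear_hat])
                show "- hat k i w \<le> C * F i w" if "i \<in> I" for i w using C(2)[OF that k(1), of w] by linarith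
                show "i \<in> I \<and> - hatp k (c t) = - hat k i (chart TC i (c t))"
                  if "A \<le> t" "t \<le> B" "i \<in> I" "c t \<in> cell TC i" for t i
                  using that k by (auto simp: cell_TC chart_TC hatp_pt)
              qed
              then show ?thesis using t AB by simp
            qed
            moreover have "integral {A..t} \<rho> \<le> integral {A..B} \<rho>"
              using Henstock_Kurzweil_Integration.integral_combine[OF t(1,2) nn(1)] nn(2)[of t B] t by simp
            then have "C * integral {A..t} \<rho> < C * (\<mu> / (4 * C))"
              using True C(1) by (intro mult_strict_left_mono) auto
            then have "C * integral {A..t} \<rho> < \<mu> / 4" using C(1) by simp
            moreover have "hatp k (c t) = hat k l w" "hatp k (c A) = hat k i y"
              using w c(2) ij JI t k by (simp_all add: hatp_pt)
            moreover have "hat k i y > hat k m y0 - \<mu> / 2" using near[OF k(1)] by linarith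
            moreover have "\<mu> \<le> hat k m y0" using \<mu>(2) k by (simp add: R_def)
            ultimately show ?thesis using \<mu>(1) by linarith
          qed
          from star[OF m t(3) w(1) this] show ?thesis using t J by auto
        qed
        have "\<rho> integrable_on {A..B} \<and> (\<forall>s t. A \<le> s \<and> s \<le> t \<and> t \<le> B \<longrightarrow>
            0 \<le> integral {s..t} \<rho> \<and> f (c t) - f (c s) \<le> 1 * integral {s..t} \<rho>)"
        proof (rule lip[OF c(1), of J lam])
          show "i \<in> J \<and> f (c t) = lam i (chart TC i (c t))"
            if "A \<le> t" "t \<le> B" "i \<in> I" "c t \<in> cell TC i" for t i
            using inJ[OF that] that by (auto simp: cell_TC chart_TC f)
        qed (use lam in auto)
        then have "f (c B) - f (c A) \<le> integral {A..B} \<rho>" using AB by simp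
        then show ?thesis using c ij f by simp
      qed simp
    qed
  qed
  show ?thesis
    by (rule exI[of _ "\<mu> / (4 * C)"], rule conjI, use \<mu> C in simp, rule exI[of _ "\<mu> / 2"])
      (use \<mu> main in auto)
qed

text \<open>The unit velocities \<open>u\<close> and \<open>v\<close> attain equality in
  \<open>lam k w\<close> \<le> \<open>F k w\<close>. So the calibrating function grows at rate
  exactly 1 along \<gamma> and bounds the distance from below by the elapsed time, while the length
  of \<gamma> bounds it from above.\<close>

lemma locally_minimizing:
  assumes m: "m \<in> I" "y0 \<in> S m" "y0 \<noteq> 0"
    and J: "J = {i \<in> I. pt m y0 \<in> cell TC i}"
    and lam: "\<And>k. k \<in> J \<Longrightarrow> linear (lam k)" "\<And>k w. k \<in> J \<Longrightarrow> lam k w \<le> F k w"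
    and cons: "\<And>i j. i \<in> J \<Longrightarrow> j \<in> J \<Longrightarrow> lam i (chart TC i (pt m y0)) = lam j (chart TC j (pt m y0))"
    and ij: "i \<in> J" "j \<in> J" "y \<in> S i" "pt i y = pt m y0" "z \<in> S j" "pt j z = pt m y0"
    and uv: "lam i u = 1" "F i u = 1" "lam j v = 1" "F j v = 1"
    and \<gamma>: "0 < \<delta>0"
      "\<And>s. t - \<delta>0 \<le> s \<Longrightarrow> s \<le> t \<Longrightarrow> y + (s - t) *\<^sub>R u \<in> S i \<and> \<gamma> s = pt i (y + (s - t) *\<^sub>R u)"
      "\<And>s. t \<le> s \<Longrightarrow> s \<le> t + \<delta>0 \<Longrightarrow> z + (s - t) *\<^sub>R v \<in> S j \<and> \<gamma> s = pt j (z + (s - t) *\<^sub>R v)"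
    and pw: "\<And>A B. t - \<delta>0 < A \<Longrightarrow> A < B \<Longrightarrow> B < t + \<delta>0 \<Longrightarrow> pw_smooth TC (finsler TC) \<gamma> (\<lambda>_. 1) A B"
  shows "\<exists>\<delta>>0. \<forall>A B. t - \<delta> < A \<and> A < B \<and> B < t + \<delta> \<longrightarrow> fdist TC (\<gamma> A) (\<gamma> B) = B - A"
proof -
  obtain C where C: "C > 0" "\<And>i k w. i \<in> I \<Longrightarrow> k \<in> I \<Longrightarrow> \<bar>hat k i w\<bar> \<le> C * F i w"
    using hat_bound by blast
  obtain \<delta> \<eta> where d: "\<delta> > 0" "\<eta> > 0" and cal: "\<And>i j y z. i \<in> J \<Longrightarrow> j \<in> J \<Longrightarrow> y \<in> S i \<Longrightarrow> z \<in> S j \<Longrightarrow>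
      (\<And>k. k \<in> I \<Longrightarrow> \<bar>hat k i y - hat k m y0\<bar> < \<eta>) \<Longrightarrow> min \<delta> (lam j z - lam i y) \<le> fdist TC (pt i y) (pt j z)"
    using calib[OF m J lam cons] by metis
  have JI: "i \<in> I" if "i \<in> J" for i using that J by auto
  \<comment> \<open>The bound \<open>\<delta> / 2\<close> makes \<open>B - A\<close> smaller than
    \<delta>, so the minimum in \<open>calib\<close> is its second term; the bound
    \<open>\<eta> / C\<close> keeps all hats within \<eta> of their values at
    \<open>y0\<close>.\<close>
  define ee where "ee = min \<delta>0 (min (\<delta> / 2) (\<eta> / C))"
  have ee: "ee > 0" "ee \<le> \<delta>0" "ee \<le> \<delta> / 2" "ee \<le> \<eta> / C" proof -
    show "ee > 0" using d \<gamma>(1) C(1) by (simp add: ee_def)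
  qed (unfold ee_def, linarith+)
  have lz: "lam j z = lam i y" proof -
    have "chart TC i (pt m y0) = y" "chart TC j (pt m y0) = z"
      unfolding ij(4)[symmetric] using chart_TC[OF JI[OF ij(1)] ij(3)] apply simp
      unfolding ij(4) ij(6)[symmetric] using chart_TC[OF JI[OF ij(2)] ij(5)] by simp
    then show ?thesis using cons[OF ij(1,2)] by simp
  qed
  have rep: "\<exists>k w. k \<in> J \<and> w \<in> S k \<and> \<gamma> s = pt k w \<and> lam k w = lam i y + (s - t) \<and> (\<forall>l\<in>I. \<bar>hat l k w - hat l m y0\<bar> < \<eta>)"
    if s: "t - ee < s" "s < t + ee" for s
  proof -
    have *: "\<bar>hat l k (w + (s - t) *\<^sub>R q) - hat l m y0\<bar> < \<eta>"
      if "k \<in> J" "w \<in> S k" "pt k w = pt m y0" "F k q = 1" "l \<in> I" for k w q l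
    proof -
      have "hat l k w = hat l m y0"
        using pt_eq_iff[OF JI[OF that(1)] that(2) m(1,2)] that(3,5) by blast
      then have "\<bar>hat l k (w + (s - t) *\<^sub>R q) - hat l m y0\<bar> = \<bar>s - t\<bar> * \<bar>hat l k q\<bar>" by (simp add: abs_mult)
      also have "\<dots> \<le> \<bar>s - t\<bar> * C" using C(2)[OF JI[OF that(1)] that(5), of q] that(4) by (intro mult_left_mono) auto
      also have "\<dots> < \<eta> / C * C" using s ee C(1) by (intro mult_strict_right_mono) auto
      finally show ?thesis using C(1) by simp
    qed
    show ?thesis
    proof (cases "s \<le> t")
      case True
      then show ?thesis using \<gamma>(2)[of s] s ee *[OF ij(1,3,4) uv(2)] ij lam(1)[OF ij(1)] uv
        by (intro exI[of _ i] exI[of _ "y + (s - t) *\<^sub>R u"]) (auto simp: linear_add linear_scale)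
    next
      case False
      then show ?thesis using \<gamma>(3)[of s] s ee *[OF ij(2,5,6) uv(4)] ij lam(1)[OF ij(2)] uv lz
        by (intro exI[of _ j] exI[of _ "z + (s - t) *\<^sub>R v"]) (auto simp: linear_add linear_scale)
    qed
  qed
  have "fdist TC (\<gamma> A) (\<gamma> B) = B - A" if AB: "t - ee < A" "A < B" "B < t + ee" for A B
  proof (rule antisym)
    show "fdist TC (\<gamma> A) (\<gamma> B) \<le> B - A"
      using fdist_le[OF pw[of A B]] AB ee by simp
    obtain k w where k: "k \<in> J" "w \<in> S k" "\<gamma> A = pt k w" "lam k w = lam i y + (A - t)" "\<And>l. l \<in> I \<Longrightarrow> \<bar>hat l k w - hat l m y0\<bar> < \<eta>"
      using rep[of A] AB by auto
    obtain k' w' where k': "k' \<in> J" "w' \<in> S k'" "\<gamma> B = pt k' w'" "lam k' w' = lam i y + (B - t)"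
      using rep[of B] AB by auto
    have "min \<delta> (lam k' w' - lam k w) \<le> fdist TC (\<gamma> A) (\<gamma> B)"
      unfolding k(3) k'(3) by (rule cal) (use k k' in auto)
    moreover have "lam k' w' - lam k w = B - A" using k(4) k'(4) by simp
    moreover have "B - A < \<delta>" using AB ee by linarith
    ultimately show "B - A \<le> fdist TC (\<gamma> A) (\<gamma> B)" by simp
  qed
  then show ?thesis using ee(1) by (intro exI[of _ ee]) auto
qed

end

text \<open>If the vectors differed, the difference \<open>d\<close> of their momentum covectors
  would be positive at \<open>u\<close> and negative at \<open>u'\<close> by strict convexity, while
  it vanishes at \<open>w\<close>. Hence \<open>u\<close> and \<open>u'\<close> would lie strictly
  on opposite sides of the line of \<open>w\<close>.\<close>

lemma (in planar) momentum_unique: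
  assumes "F u = F u'" "0 < F u" "dF u w = dF u' w" "w \<noteq> 0"
    and "\<kappa> \<noteq> 0" "0 \<le> \<kappa> * cross2 w u" "0 \<le> \<kappa> * cross2 w u'"
  shows "u = u'"
proof (rule ccontr)
  assume ne: "u \<noteq> u'"
  have u: "u \<noteq> 0" "u' \<noteq> 0" using assms(1,2) by auto
  have lt: "dF p q < F q" if "p \<noteq> q" "F p = F q" "p \<noteq> 0" for p q
  proof (rule dF_less[OF that(3)])
    fix r :: real assume "0 \<le> r"
    show "q \<noteq> r *\<^sub>R p"
    proof
      assume "q = r *\<^sub>R p"
      then have "r * F p = F p" using that(2) scale[OF \<open>0 \<le> r\<close>, of p] by simp
      then have "r = 1" using pos[OF that(3)] by simp
      then show False using that \<open>q = _\<close> by simp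
    qed
  qed
  define d where "d z = dF u z - dF u' z" for z
  have lin: "linear d" unfolding d_def using linear_compose_sub linear_dF u by blast
  have d: "0 < d u" "d u' < 0" "d w = 0"
    using lt[OF ne assms(1) u(1)] lt[OF ne[symmetric] assms(1)[symmetric] u(2)] u assms(1,3)
    by (auto simp: d_def dF_self)
  have "cross2 w (cross2 w u' *\<^sub>R u - cross2 w u *\<^sub>R u') = 0" by simp
  then obtain r where "cross2 w u' *\<^sub>R u - cross2 w u *\<^sub>R u' = r *\<^sub>R w"
    using cross2_eq_0_imp assms(4) by blast
  then have "d (cross2 w u' *\<^sub>R u - cross2 w u *\<^sub>R u') = 0"
    using d(3) linear_scale[OF lin] by simp
  then have eq: "cross2 w u' * d u = cross2 w u * d u'"
    using linear_diff[OF lin] linear_scale[OF lin] by simp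
  then have "(\<kappa> * cross2 w u') * d u = (\<kappa> * cross2 w u) * d u'" by simp
  moreover have "0 \<le> (\<kappa> * cross2 w u') * d u" by (rule mult_nonneg_nonneg[OF assms(7) less_imp_le[OF d(1)]])
  moreover have "(\<kappa> * cross2 w u) * d u' \<le> 0" by (rule mult_nonneg_nonpos[OF assms(6) less_imp_le[OF d(2)]])
  ultimately have "(\<kappa> * cross2 w u) * d u' = 0" by linarith
  then have "cross2 w u = 0" using d(2) assms(5) by simp
  then obtain s where "u = s *\<^sub>R w" using cross2_eq_0_imp assms(4) by blast
  then have "d u = 0" using d(3) linear_scale[OF lin] by simp
  then show False using d(1) by simp
qed

section \<open>Geodesics are straight in the sectors and refract at the rays\<close>

context vertex_cone begin

definition minimizing_at :: "(real \<Rightarrow> ('i \<times> (real^2)) set) \<Rightarrow> real \<Rightarrow> real \<Rightarrow> bool" where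
  "minimizing_at \<gamma> c t \<longleftrightarrow> (\<exists>\<delta>>0. \<forall>s r. t - \<delta> < s \<and> s < r \<and> r < t + \<delta> \<longrightarrow>
     fdist TC (\<gamma> s) (\<gamma> r) = c * (r - s))"

definition straight :: "(real \<Rightarrow> ('i \<times> (real^2)) set) \<Rightarrow> 'i \<Rightarrow> real^2 \<Rightarrow> real^2 \<Rightarrow> real \<Rightarrow> real \<Rightarrow> bool" where
  "straight \<gamma> i y u s t \<longleftrightarrow> i \<in> I \<and> (\<forall>\<tau>\<in>{s..t}. y + \<tau> *\<^sub>R u \<in> S i \<and> \<gamma> \<tau> = pt i (y + \<tau> *\<^sub>R u))"

lemma geodesic_iff:
  "geodesic TC \<gamma> \<longleftrightarrow> (\<exists>c>0. (\<forall>a b. a < b \<longrightarrow> pw_smooth TC (finsler TC) \<gamma> (\<lambda>_. c) a b) \<and> (\<forall>t. minimizing_at \<gamma> c t))"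
proof -
  have "(t - \<delta> < s \<and> s < r \<and> r < t + \<delta> \<longrightarrow> fdist TC (\<gamma> s) (\<gamma> r) = integral {s..r} (\<lambda>_. c)) \<longleftrightarrow>
      (t - \<delta> < s \<and> s < r \<and> r < t + \<delta> \<longrightarrow> fdist TC (\<gamma> s) (\<gamma> r) = c * (r - s))" for t s r \<delta> c :: real
    by (cases "s < r") (simp_all add: mult.commute)
  then show ?thesis unfolding geodesic_def minimizing_at_def by simp
qed

text \<open>On a short time interval let \<open>v\<close> be the difference of the end points. The
  functional \<open>dF v\<close> integrates over the velocity to \<open>F i v\<close>, which is at
  least the distance, and it never exceeds the speed \<open>c\<close>. So equality holds at every
  time, and the velocity is the positive multiple of \<open>v\<close> with norm
  \<open>c\<close>.\<close>

lemma piece_straight: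
  assumes AB: "A < B" and i: "i \<in> I" and U: "open U" "{A..B} \<subseteq> U" "smooth_on U g"
    and g: "\<And>t. t \<in> {A..B} \<Longrightarrow> g t \<in> S i \<and> \<gamma> t = pt i (g t)"
    and sp: "\<And>t. t \<in> {A<..<B} \<Longrightarrow> F i (vector_derivative g (at t)) = c"
    and c: "0 < c" and min: "\<And>t. minimizing_at \<gamma> c t"
  shows "\<exists>y u. F i u = c \<and> straight \<gamma> i y u A B"
proof -
  interpret minkowski "F i" by (rule minkowski[OF i])
  define g' where "g' t = vector_derivative g (at t)" for t
  note dg = smooth_on_vector_derivative(1)[OF U(3,2), folded g'_def]
    and cg' = smooth_on_vector_derivative(2)[OF U(3,2), folded g'_def]
  have FTC: "(g' has_integral g t - g s) {s..t}" if "A \<le> s" "s \<le> t" "t \<le> B" for s t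
    by (rule fundamental_theorem_of_calculus[OF that(2)], rule has_vector_derivative_at_within, rule dg)
      (use that in auto)
  have loc: "\<exists>d>0. \<forall>r\<in>{t0-d<..<t0+d}. r \<in> {A<..<B} \<and> g' r = g' t0" if t0: "t0 \<in> {A<..<B}" for t0
  proof -
    obtain \<delta> where \<delta>: "\<delta> > 0" "\<And>s r. t0 - \<delta> < s \<Longrightarrow> s < r \<Longrightarrow> r < t0 + \<delta> \<Longrightarrow> fdist TC (\<gamma> s) (\<gamma> r) = c * (r - s)"
      using min[of t0] unfolding minimizing_at_def by blast
    define d where "d = min (\<delta> / 2) (min ((t0 - A) / 2) ((B - t0) / 2))"
    have "d \<le> \<delta> / 2" "d \<le> (t0 - A) / 2" "d \<le> (B - t0) / 2" unfolding d_def by linarith+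
    moreover have d0: "d > 0" using \<delta>(1) t0 by (simp add: d_def)
    ultimately have d: "d > 0" "d < \<delta>" "A < t0 - d" "t0 + d < B" using \<delta>(1) t0 by auto
    define s where "s = t0 - d" define t where "t = t0 + d"
    have st: "s < t" "A < s" "t < B" using d by (auto simp: s_def t_def)
    define v where "v = g t - g s"
    have "c * (t - s) = fdist TC (\<gamma> s) (\<gamma> t)" using \<delta>(2)[of s t] d by (simp add: s_def t_def)
    also have "\<dots> \<le> F i v" using fdist_line[OF i, of "g s" "g t"] g[of s] g[of t] st by (simp add: v_def)
    finally have le: "c * (t - s) \<le> F i v" .
    moreover have "0 < c * (t - s)" using c st by simp
    ultimately have Fv: "0 < F i v" by linarith
    then have v0: "v \<noteq> 0" by auto
    have bl: "bounded_linear (dF v)" using linear_dF[OF v0] linear_conv_bounded_linear by blast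
    have cst: "continuous_on {s..t} g'" by (rule continuous_on_subset[OF cg']) (use st in auto)
    have "((\<lambda>r. dF v (g' r)) has_integral dF v v) {s..t}"
      using has_integral_linear[OF FTC[of s t] bl] st by (simp add: o_def v_def)
    \<comment> \<open>The integrand is continuous and nonnegative, and minimality makes its integral
      nonpositive, so it vanishes identically.\<close>
    then have "((\<lambda>r. c - dF v (g' r)) has_integral c * (t - s) - F i v) {s..t}"
      using has_integral_diff[OF has_integral_const_real[of c s t]] st dF_self[OF v0] by (simp add: mult.commute)
    then have int: "integral {s..t} (\<lambda>r. c - dF v (g' r)) \<le> 0" using le by (simp add: integral_unique)
    have nn: "0 \<le> c - dF v (g' r)" if "r \<in> {s..t}" for r
      using dF_le[OF v0, of "g' r"] sp[of r, folded g'_def] that st by simp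
    have cc: "continuous_on {s..t} (\<lambda>r. c - dF v (g' r))"
      by (intro continuous_intros bounded_linear.continuous_on[OF bl] cst)
    have "0 \<le> integral {s..t} (\<lambda>r. c - dF v (g' r))"
      by (rule integral_nonneg[OF integrable_continuous_real[OF cc] nn])
    then have "\<forall>r\<in>{s..t}. c - dF v (g' r) = 0"
      using int integral_eq_0_iff[OF cc st(1) nn] by linarith
    then have e: "dF v (g' r) = F i (g' r)" "F i (g' r) = c" if "r \<in> {s..t}" for r
      using sp[of r, folded g'_def] that st by auto
    have "g' r = (c / F i v) *\<^sub>R v" if r: "r \<in> {s..t}" for r
    proof -
      obtain q where "q \<ge> 0" "g' r = q *\<^sub>R v" using dF_eq_imp[OF v0 e(1)[OF r]] by blast
      moreover have "q * F i v = c" using e(2)[OF r] scale calculation by simp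
      ultimately show ?thesis using Fv by (auto simp: field_simps)
    qed
    then show ?thesis using d by (intro exI[of _ d]) (auto simp: s_def t_def)
  qed
  have "\<exists>u. \<forall>t\<in>{A<..<B}. g' t = u"
  proof (rule has_derivative_zero_constant)
    fix t0 assume "t0 \<in> {A<..<B}"
    then obtain d where d: "d > 0" "\<And>r. r \<in> {t0-d<..<t0+d} \<Longrightarrow> r \<in> {A<..<B} \<and> g' r = g' t0"
      using loc by blast
    have "(g' has_derivative (\<lambda>h. 0)) (at t0)"
    proof (rule has_derivative_transform_within_open[of "\<lambda>_. g' t0" _ t0 UNIV "{t0-d<..<t0+d}"])
      show "g' t0 = g' r" if "r \<in> {t0-d<..<t0+d}" for r using conjunct2[OF d(2)[OF that]] by (rule sym)
    qed (use d(1) in auto)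
    then show "(g' has_derivative (\<lambda>h. 0)) (at t0 within {A<..<B})" by (rule has_derivative_at_withinI)
  qed simp
  then obtain u where u: "\<And>t. t \<in> {A<..<B} \<Longrightarrow> g' t = u" by blast
  have lin: "(g A - A *\<^sub>R u) + t *\<^sub>R u = g t" if t: "t \<in> {A..B}" for t
  proof -
    have "((\<lambda>_. u) has_integral g t - g A) {A..t}"
      by (rule has_integral_spike_finite[of "{A, B}" _ _ g']) (use u FTC[of A t] t in auto)
    moreover have "((\<lambda>_. u) has_integral (t - A) *\<^sub>R u) {A..t}"
      using has_integral_const_real[of u A t] t by simp
    ultimately have "g t - g A = (t - A) *\<^sub>R u" by (rule has_integral_unique)
    then show ?thesis by (simp add: algebra_simps)
  qed
  have "straight \<gamma> i (g A - A *\<^sub>R u) u A B" unfolding straight_def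
  proof (intro conjI ballI i)
    fix t assume t: "t \<in> {A..B}"
    show "g A - A *\<^sub>R u + t *\<^sub>R u \<in> S i" "\<gamma> t = pt i (g A - A *\<^sub>R u + t *\<^sub>R u)"
      unfolding lin[OF t] using g[OF t] by simp_all
  qed
  moreover have "F i u = c"
    using u[of "(A + B) / 2"] sp[of "(A + B) / 2"] AB by (simp add: g'_def)
  ultimately show ?thesis by blast
qed

text \<open>At a break point the pieces before and after may lie in different cells and have
  different velocities, so the two sides are recorded separately.\<close>

lemma pw_germs:
  assumes "pw_smooth TC (finsler TC) \<gamma> (\<lambda>_. c) A B" and c: "0 < c" and min: "\<And>t. minimizing_at \<gamma> c t"
  shows "(\<forall>t. A < t \<and> t \<le> B \<longrightarrow> (\<exists>s i y u. s < t \<and> F i u = c \<and> straight \<gamma> i y u s t)) \<and>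
    (\<forall>t. A \<le> t \<and> t < B \<longrightarrow> (\<exists>s i y u. t < s \<and> F i u = c \<and> straight \<gamma> i y u t s))"
  using assms(1)
proof (induction rule: pw_smooth.induct)
  case (piece A B i U g)
  have i: "i \<in> I" using piece(2) by simp
  have g: "g t \<in> S i \<and> \<gamma> t = pt i (g t)" if t: "t \<in> {A..B}" for t
  proof -
    have "\<gamma> t \<in> cell TC i" using piece(3) t by auto
    then obtain w where "w \<in> S i" "\<gamma> t = pt i w" using i by (auto simp: cell_TC)
    moreover have "g t = w" using bspec[OF piece(7) t] calculation chart_TC[OF i] by simp
    ultimately show ?thesis by simp
  qed
  have sp: "F i (vector_derivative g (at t)) = c" if "t \<in> {A<..<B}" for t
    using piece(8) that by (simp add: finsler_def)
  obtain y u where yu: "F i u = c" "straight \<gamma> i y u A B"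
    using piece_straight[OF piece(1) i piece(4,5,6) g sp c min] by blast
  then have "straight \<gamma> i y u s t" if "A \<le> s" "t \<le> B" for s t using that by (auto simp: straight_def)
  then show ?case using yu by (intro conjI allI impI) blast+
next
  case (join A B D)
  show ?case
  proof (intro conjI allI impI)
    fix t assume "A < t \<and> t \<le> D"
    then show "\<exists>s i y u. s < t \<and> F i u = c \<and> straight \<gamma> i y u s t"
      using join(3,4) by (cases "t \<le> B") auto
  next
    fix t assume "A \<le> t \<and> t < D"
    then show "\<exists>s i y u. t < s \<and> F i u = c \<and> straight \<gamma> i y u t s"
      using join(3,4) by (cases "t < B") auto
  qed
qed

text \<open>The sign \<epsilon> selects the future or the past of \<open>t\<close>; in both cases
  \<open>u\<close> is the velocity with respect to forward time.\<close>

definition germ :: "(real \<Rightarrow> ('i \<times> (real^2)) set) \<Rightarrow> real \<Rightarrow> real \<Rightarrow> 'i \<Rightarrow> real^2 \<Rightarrow> real^2 \<Rightarrow> real \<Rightarrow> bool" where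
  "germ \<gamma> t \<epsilon> i p u \<delta> \<longleftrightarrow> i \<in> I \<and> 0 < \<delta> \<and>
     (\<forall>s\<in>{0..\<delta>}. p + (\<epsilon> * s) *\<^sub>R u \<in> S i \<and> \<gamma> (t + \<epsilon> * s) = pt i (p + (\<epsilon> * s) *\<^sub>R u))"

lemma germ_mono: "germ \<gamma> t \<epsilon> i p u \<delta> \<Longrightarrow> 0 < \<delta>' \<Longrightarrow> \<delta>' \<le> \<delta> \<Longrightarrow> germ \<gamma> t \<epsilon> i p u \<delta>'"
  by (auto simp: germ_def)

lemma germ_at: "germ \<gamma> t \<epsilon> i p u \<delta> \<Longrightarrow> p \<in> S i \<and> \<gamma> t = pt i p"
  unfolding germ_def by (auto dest!: bspec[of _ _ 0])

lemma ex_germ: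
  assumes pw: "\<And>a b. a < b \<Longrightarrow> pw_smooth TC (finsler TC) \<gamma> (\<lambda>_. c) a b"
    and c: "0 < c" and min: "\<And>t. minimizing_at \<gamma> c t" and e: "\<epsilon> \<in> {1, -1}"
  shows "\<exists>i p u \<delta>. F i u = c \<and> germ \<gamma> t \<epsilon> i p u \<delta>"
proof -
  have "t - 1 < t + 1" by simp
  note G = pw_germs[OF pw[OF this] c min]
  show ?thesis
  proof (cases "\<epsilon> = 1")
    case True
    obtain s i y u where "t < s" "F i u = c" "straight \<gamma> i y u t s"
      using conjunct2[OF G, THEN spec[of _ t]] by auto
    then have "germ \<gamma> t \<epsilon> i (y + t *\<^sub>R u) u (s - t)"
      by (auto simp: germ_def straight_def True add.assoc scaleR_add_left[symmetric])
    then show ?thesis using \<open>F i u = c\<close> by blast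
  next
    case False
    then have e: "\<epsilon> = -1" using e by simp
    obtain s i y u where "s < t" "F i u = c" "straight \<gamma> i y u s t"
      using conjunct1[OF G, THEN spec[of _ t]] by auto
    then have "germ \<gamma> t \<epsilon> i (y + t *\<^sub>R u) u (t - s)"
      by (auto simp: germ_def straight_def e add.assoc scaleR_diff_left[symmetric] simp flip: add_diff_eq)
    then show ?thesis using \<open>F i u = c\<close> by blast
  qed
qed

definition ray :: "'i \<Rightarrow> real^2 \<Rightarrow> 'i \<Rightarrow> real^2 \<Rightarrow> bool" where
  "ray i w j w' \<longleftrightarrow> i \<in> I \<and> j \<in> I \<and> (j = nxt i \<and> w = b i \<and> w' = a j \<or> i = nxt j \<and> w = a i \<and> w' = b j)"

lemma ray_sym: "ray i w j w' \<Longrightarrow> ray j w' i w"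
  by (auto simp: ray_def)

lemma ray_pt: "ray i w j w' \<Longrightarrow> 0 \<le> r \<Longrightarrow> r *\<^sub>R w \<in> S i \<and> r *\<^sub>R w' \<in> S j \<and> pt i (r *\<^sub>R w) = pt j (r *\<^sub>R w')"
  using pt_ray by (auto simp: ray_def S_iff nxt_in)

lemma ray_F: "ray i w j w' \<Longrightarrow> F i (r *\<^sub>R w) = F j (r *\<^sub>R w')"
  using glue by (auto simp: ray_def)

lemma ray_nz: "ray i w j w' \<Longrightarrow> w \<noteq> 0"
  using a_nz b_nz by (auto simp: ray_def)

text \<open>A sector lies on one side of each of its boundary rays; \<kappa> carries the sign and
  the normalization.\<close>

lemma ray_side: assumes "ray i w j w'"
  obtains \<kappa> where "\<kappa> \<noteq> 0" "\<And>y. y \<in> S i \<Longrightarrow> 0 \<le> \<kappa> * cross2 w y"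
proof (cases "w = a i")
  case True
  show ?thesis
    by (rule that[of "1 / cross2 (a i) (b i)"])
      (use True assms cross_nz[of i] S_iff[of i] in \<open>auto simp: ray_def cB_def\<close>)
next
  case False
  then have w: "w = b i" "i \<in> I" using assms by (auto simp: ray_def)
  have "- 1 / cross2 (a i) (b i) * cross2 (b i) y = cA i y" for y
    using cross2_commute[of y "b i"] by (simp add: cA_def)
  then show ?thesis
    by (intro that[of "- 1 / cross2 (a i) (b i)"]) (use w cross_nz[of i] S_iff[of i] in auto)
qed

lemma pt_eq_ray:
  assumes "i \<in> I" "p \<in> S i" "j \<in> I" "q \<in> S j" "pt i p = pt j q" "p \<noteq> 0" "i \<noteq> j"
  shows "\<exists>w w' r. ray i w j w' \<and> 0 < r \<and> p = r *\<^sub>R w \<and> q = r *\<^sub>R w'"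
proof -
  have "((i, p), (j, q)) \<in> cone_rel M x" using pt_eq_rel assms by metis
  then have "j = nxt i \<and> (\<exists>r\<ge>0. p = r *\<^sub>R b i \<and> q = r *\<^sub>R a j) \<or> i = nxt j \<and> (\<exists>r\<ge>0. p = r *\<^sub>R a i \<and> q = r *\<^sub>R b j)"
    unfolding rel using assms by blast
  then show ?thesis
  proof (elim disjE conjE exE)
    fix r assume "j = nxt i" "0 \<le> r" "p = r *\<^sub>R b i" "q = r *\<^sub>R a j"
    moreover then have "0 < r" using assms(6) by (cases "r = 0") auto
    ultimately show ?thesis using assms by (intro exI[of _ "b i"] exI[of _ "a j"] exI[of _ r]) (simp add: ray_def)
  next
    fix r assume "i = nxt j" "0 \<le> r" "p = r *\<^sub>R a i" "q = r *\<^sub>R b j"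
    moreover then have "0 < r" using assms(6) by (cases "r = 0") auto
    ultimately show ?thesis using assms by (intro exI[of _ "a i"] exI[of _ "b j"] exI[of _ r]) (simp add: ray_def)
  qed
qed

text \<open>Snell's law away from the apex: at a ray the velocity may jump, but the momentum along
  the ray is kept.\<close>

definition refracted :: "'i \<Rightarrow> real^2 \<Rightarrow> real^2 \<Rightarrow> 'i \<Rightarrow> real^2 \<Rightarrow> real^2 \<Rightarrow> bool" where
  "refracted i p u j q v \<longleftrightarrow> (i = j \<and> p = q \<and> u = v) \<or> (i \<noteq> j \<and> (\<exists>w w' r. ray i w j w' \<and> 0 < r \<and>
     p = r *\<^sub>R w \<and> q = r *\<^sub>R w' \<and> minkowski.dF (F i) u w = minkowski.dF (F j) v w'))"

lemma refracted_sym: "refracted i p u j q v \<Longrightarrow> refracted j q v i p u"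
  unfolding refracted_def using ray_sym by metis

text \<open>First variation of length. For a change of cell the crossing point is moved along the
  ray; without a change of cell the equality case of the triangle inequality excludes a
  corner.\<close>

lemma geodesic_refracted:
  assumes min: "minimizing_at \<gamma> c t" and c: "0 < c"
    and L: "germ \<gamma> t (-1) i p u \<delta>1" "F i u = c" and R: "germ \<gamma> t 1 j q v \<delta>2" "F j v = c"
    and nz: "p \<noteq> 0"
  shows "refracted i p u j q v"
proof -
  have ij: "i \<in> I" "j \<in> I" using L R by (auto simp: germ_def)
  interpret A: minkowski "F i" by (rule minkowski[OF ij(1)])
  interpret B: minkowski "F j" by (rule minkowski[OF ij(2)])
  have pq: "p \<in> S i" "q \<in> S j" "pt i p = pt j q" using germ_at[OF L(1)] germ_at[OF R(1)] by auto
  obtain \<delta>0 where d0: "\<delta>0 > 0" "\<And>s r. t - \<delta>0 < s \<Longrightarrow> s < r \<Longrightarrow> r < t + \<delta>0 \<Longrightarrow> fdist TC (\<gamma> s) (\<gamma> r) = c * (r - s)"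
    using min unfolding minimizing_at_def by blast
  define d where "d = min (\<delta>0 / 2) (min \<delta>1 \<delta>2)"
  have "d > 0" using d0 L R by (simp add: d_def germ_def)
  moreover have "d \<le> \<delta>0 / 2" "d \<le> \<delta>1" "d \<le> \<delta>2" unfolding d_def by linarith+
  ultimately have d: "0 < d" "d < \<delta>0" "d \<le> \<delta>1" "d \<le> \<delta>2" using d0 by auto
  have gl: "p - d *\<^sub>R u \<in> S i" "\<gamma> (t - d) = pt i (p - d *\<^sub>R u)"
    using L(1) d unfolding germ_def by (auto dest!: bspec[of _ _ d])
  have gr: "q + d *\<^sub>R v \<in> S j" "\<gamma> (t + d) = pt j (q + d *\<^sub>R v)"
    using R(1) d unfolding germ_def by (auto dest!: bspec[of _ _ d])
  have dist: "fdist TC (pt i (p - d *\<^sub>R u)) (pt j (q + d *\<^sub>R v)) = 2 * c * d"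
    using d0(2)[of "t - d" "t + d"] d gl gr by simp
  have nzu: "u \<noteq> 0" "v \<noteq> 0" using L(2) R(2) c by auto
  show ?thesis
  proof (cases "i = j")
    \<comment> \<open>The straight segment between two nearby points on either side of time
      \<open>t\<close> stays in the sector, so the broken line cannot be longer than it.\<close>
    case True
    then have pq': "p = q" using pt_same pq ij by metis
    have "2 * c * d \<le> F i (q + d *\<^sub>R v - (p - d *\<^sub>R u))"
      using fdist_line[OF ij(1) gl(1)] gr(1) dist True by metis
    also have "\<dots> = F i (d *\<^sub>R (u + v))" by (simp add: pq' algebra_simps)
    also have "\<dots> = d * F i (u + v)" using d by (simp add: A.scale)
    finally have ge: "2 * c \<le> F i (u + v)" using d(1) by simp
    then have nzs: "u + v \<noteq> 0" using c by auto
    have sum: "A.dF (u + v) u + A.dF (u + v) v = F i (u + v)"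
      using A.dF_self[OF nzs] linear_add[OF A.linear_dF[OF nzs]] by metis
    have le: "A.dF (u + v) u \<le> c" "A.dF (u + v) v \<le> c"
      using A.dF_le[OF nzs, of u] A.dF_le[OF nzs, of v] L(2) R(2) True by auto
    then have "A.dF (u + v) u = F i u" "A.dF (u + v) v = F i v" using sum ge L(2) R(2) True by auto
    then obtain r s where rs: "0 \<le> r" "u = r *\<^sub>R (u + v)" "0 \<le> s" "v = s *\<^sub>R (u + v)"
      using A.dF_eq_imp[OF nzs] by metis
    have "r * F i (u + v) = c" using A.scale[OF rs(1)] L(2) rs(2) by metis
    moreover have "s * F i (u + v) = c" using A.scale[OF rs(3)] R(2) True rs(4) by metis
    ultimately have "r = s" using A.pos[OF nzs] by (metis mult_right_cancel less_irrefl)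
    then have "u = v" using rs by metis
    then show ?thesis using True pq' by (simp add: refracted_def)
  next
    case False
    obtain w w' r where w: "ray i w j w'" "0 < r" "p = r *\<^sub>R w" "q = r *\<^sub>R w'"
      using pt_eq_ray[OF ij(1) pq(1) ij(2) pq(2,3) nz False] by blast
    \<comment> \<open>Length of the broken line that crosses the ray at
      \<open>(r + z) *\<^sub>R w\<close> instead of \<open>r *\<^sub>R w\<close>. Minimality puts a
      local minimum at 0, and the vanishing derivative is the equality of momenta.\<close>
    define f where "f z = F i (d *\<^sub>R u + z *\<^sub>R w) + F j (d *\<^sub>R v + z *\<^sub>R (- w'))" for z
    have nzd: "d *\<^sub>R u \<noteq> 0" "d *\<^sub>R v \<noteq> 0" using d nzu by auto
    have der: "(f has_real_derivative A.dF (d *\<^sub>R u) w + B.dF (d *\<^sub>R v) (- w')) (at 0)"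
      unfolding f_def using nzd
      by (intro DERIV_add A.line_deriv B.line_deriv) (auto intro: A.hdF B.hdF)
    have "f 0 \<le> f z" if "\<bar>0 - z\<bar> < r" for z
    proof -
      have rz: "0 \<le> r + z" using that by linarith
      have "2 * c * d \<le> F i ((r + z) *\<^sub>R w - (p - d *\<^sub>R u)) + F j (q + d *\<^sub>R v - (r + z) *\<^sub>R w')"
        using fdist_two[OF ij gl(1) _ _ gr(1)] ray_pt[OF w(1) rz] dist by metis
      also have "\<dots> = f z" by (simp add: f_def w algebra_simps)
      finally show ?thesis using L(2) R(2) d by (simp add: f_def A.scale B.scale)
    qed
    then have "A.dF (d *\<^sub>R u) w + B.dF (d *\<^sub>R v) (- w') = 0"
      using DERIV_local_min[OF der w(2)] by blast
    then have "A.dF u w = B.dF v w'"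
      using A.dF_scale[OF nzu(1) d(1)] B.dF_scale[OF nzu(2) d(1)] linear_neg[OF B.linear_dF[OF nzu(2)]] by simp
    then show ?thesis using w False unfolding refracted_def by blast
  qed
qed

end

section \<open>Angles of unbounded lines as improper integrals\<close>

lemma has_integral_reflect_UNIV:
  fixes f :: "real \<Rightarrow> real"
  assumes "(f has_integral l) UNIV" shows "((\<lambda>x. f (- x)) has_integral l) UNIV"
proof -
  have int: "f integrable_on cbox s t" for s t using assms unfolding has_integral_alt'[of f] by simp
  have *: "\<exists>B>0. \<forall>s t. ball 0 B \<subseteq> cbox s t \<longrightarrow> norm (integral (cbox s t) f - l) < e" if "e > 0" for e
    using assms that unfolding has_integral_alt'[of f] by simp
  show ?thesis unfolding has_integral_alt'[of "\<lambda>x. f (- x)"]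
  proof (intro conjI allI impI)
    fix s t show "(\<lambda>x. if x \<in> UNIV then f (- x) else 0) integrable_on cbox s t"
      using int[of "-t" "-s"] integrable_reflect[of f "-s" "-t"] by simp
  next
    fix e :: real assume "e > 0"
    then obtain B where B: "B > 0" "\<And>s t. ball 0 B \<subseteq> cbox s t \<Longrightarrow> norm (integral (cbox s t) f - l) < e"
      using * by blast
    show "\<exists>B>0. \<forall>s t. ball 0 B \<subseteq> cbox s t \<longrightarrow>
        norm (integral (cbox s t) (\<lambda>x. if x \<in> UNIV then f (- x) else 0) - l) < e"
    proof (intro exI[of _ B] conjI allI impI B(1))
      fix s t :: real assume st: "ball 0 B \<subseteq> cbox s t"
      have "ball 0 B \<subseteq> cbox (- t) (- s)"
      proof
        fix y :: real assume "y \<in> ball 0 B"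
        then have "- y \<in> ball 0 B" by (simp add: dist_norm)
        then have "- y \<in> cbox s t" using st by blast
        then show "y \<in> cbox (- t) (- s)" by auto
      qed
      from B(2)[OF this] show "norm (integral (cbox s t) (\<lambda>x. if x \<in> UNIV then f (- x) else 0) - l) < e"
        using integral_reflect[of "- s" "- t" f] by simp
    qed
  qed
qed

context planar begin

lemma has_integral_K_top:
  assumes \<theta>: "\<And>t. (\<theta> has_real_derivative \<theta>' t) (at t)" "\<And>t. 0 < \<theta>' t" and lim: "(\<theta> \<longlongrightarrow> \<phi>) at_top"
  shows "((\<lambda>t. \<theta>' t * K (\<theta> t)) has_integral T \<phi> - T (\<theta> s)) {s..}"
proof (rule has_integral_to_inf)
  show "(\<lambda>t. \<theta>' t * K (\<theta> t)) integrable_on {s..y}" for y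
    using has_integral_K[of s y, OF _ \<theta>(1)] by (cases "s \<le> y") auto
  have "((\<lambda>y. T (\<theta> y) - T (\<theta> s)) \<longlongrightarrow> T \<phi> - T (\<theta> s)) at_top"
    by (intro tendsto_intros isCont_tendsto_compose[OF DERIV_isCont[OF T_deriv] lim])
  then show "((\<lambda>y. integral {s..y} (\<lambda>t. \<theta>' t * K (\<theta> t))) \<longlongrightarrow> T \<phi> - T (\<theta> s)) at_top"
    by (rule Lim_transform_eventually)
      (intro eventually_mono[OF eventually_ge_at_top[of s]] integral_unique[symmetric] has_integral_K[OF _ \<theta>(1)])
  show "0 \<le> \<theta>' y * K (\<theta> y)" for y using \<theta>(2)[of y] K_pos[of "\<theta> y"] by simp
qed

lemma has_integral_K_bot:
  assumes \<theta>: "\<And>t. (\<theta> has_real_derivative \<theta>' t) (at t)" "\<And>t. 0 < \<theta>' t" and lim: "(\<theta> \<longlongrightarrow> \<phi>) at_bot"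
  shows "((\<lambda>t. \<theta>' t * K (\<theta> t)) has_integral T (\<theta> s) - T \<phi>) {..s}"
proof -
  define h where "h t = \<theta>' t * K (\<theta> t)" for t
  have "((\<lambda>t. h (- t)) has_integral T (\<theta> s) - T \<phi>) {- s..}"
  proof (rule has_integral_to_inf)
    have hi: "((\<lambda>t. h (- t)) has_integral T (\<theta> s) - T (\<theta> (- y))) {- s..y}" if "- s \<le> y" for y
      using has_integral_reflect_real[where f = h and a = "- y" and b = s] has_integral_K[of "- y" s, OF _ \<theta>(1), folded h_def] that
      by simp
    show "(\<lambda>t. h (- t)) integrable_on {- s..y}" for y
      using hi[of y] by (cases "- s \<le> y") auto
    have "((\<lambda>y. \<theta> (- y)) \<longlongrightarrow> \<phi>) at_top" using lim by (simp add: filterlim_at_bot_mirror)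
    then have "((\<lambda>y. T (\<theta> s) - T (\<theta> (- y))) \<longlongrightarrow> T (\<theta> s) - T \<phi>) at_top"
      by (intro tendsto_intros isCont_tendsto_compose[OF DERIV_isCont[OF T_deriv]])
    then show "((\<lambda>y. integral {- s..y} (\<lambda>t. h (- t))) \<longlongrightarrow> T (\<theta> s) - T \<phi>) at_top"
      by (rule Lim_transform_eventually)
        (intro eventually_mono[OF eventually_ge_at_top[of "- s"]] integral_unique[symmetric] hi)
    show "0 \<le> h (- y)" for y using \<theta>(2)[of "- y"] K_pos[of "\<theta> (- y)"] by (simp add: h_def)
  qed
  then have "((\<lambda>t. if t \<in> {- s..} then h (- t) else 0) has_integral T (\<theta> s) - T \<phi>) UNIV"
    by (simp only: has_integral_restrict_UNIV)
  from has_integral_reflect_UNIV[OF this]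
  have "((\<lambda>t. if t \<in> {..s} then h t else 0) has_integral T (\<theta> s) - T \<phi>) UNIV"
    by (simp cong: if_cong)
  then show ?thesis unfolding has_integral_restrict_UNIV h_def .
qed

end

section \<open>Unique continuation of geodesics\<close>

context vertex_cone begin

text \<open>A velocity along \<open>e\<close> has the largest momentum that its norm allows. The
  equality case then leaves only the same multiple of \<open>e'\<close> on the other side.\<close>

lemma F_scale_match:
  assumes i: "i \<in> I" and j: "j \<in> I" and e: "e \<noteq> 0" "e' \<noteq> 0" "F i e = F j e'"
    and u: "u = \<mu> *\<^sub>R e" "0 < \<mu>" and v: "F i u = F j v" "minkowski.dF (F i) u e = minkowski.dF (F j) v e'"
  shows "v = \<mu> *\<^sub>R e'"
proof -
  interpret A: minkowski "F i" by (rule minkowski[OF i])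
  interpret B: minkowski "F j" by (rule minkowski[OF j])
  have "F j v = \<mu> * F i e" using v u A.scale by simp
  moreover have "0 < \<mu> * F i e" using u(2) A.pos[OF e(1)] by simp
  ultimately have Fv: "F j v = \<mu> * F j e'" "v \<noteq> 0" using e(3) by auto
  have "B.dF v e' = F j e'" using v(2) u A.dF_scale[OF e(1) u(2)] A.dF_self[OF e(1)] e(3) by simp
  then obtain r where r: "r \<ge> 0" "e' = r *\<^sub>R v" using B.dF_eq_imp[OF Fv(2)] by blast
  then have "F j v = (\<mu> * r) * F j v" using Fv(1) B.scale by simp
  then have "\<mu> * r = 1" using B.pos[OF Fv(2)] by simp
  then show ?thesis using r by simp
qed

text \<open>If a line through a point of the boundary ray stays in the sector both before and after
  it, it must run along the ray, since the sector lies on one side. The neighbour then sees the same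
  motion along the ray.\<close>

lemma refracted_along:
  assumes w: "ray i w j w'" and c: "0 < F i u" "F i u = F j v"
    and dF: "minkowski.dF (F i) u w = minkowski.dF (F j) v w'"
    and S: "r *\<^sub>R w + d *\<^sub>R u \<in> S i" "r *\<^sub>R w + (- d) *\<^sub>R u \<in> S i" "d \<noteq> 0"
  shows "\<exists>\<mu>. u = \<mu> *\<^sub>R w \<and> v = \<mu> *\<^sub>R w'"
proof -
  have ij: "i \<in> I" "j \<in> I" using w by (auto simp: ray_def)
  interpret A: minkowski "F i" by (rule minkowski[OF ij(1)])
  interpret B: minkowski "F j" by (rule minkowski[OF ij(2)])
  have nz: "w \<noteq> 0" "w' \<noteq> 0" "u \<noteq> 0" "v \<noteq> 0" using ray_nz[OF w] ray_nz[OF ray_sym[OF w]] c by auto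
  obtain \<kappa> where \<kappa>: "\<kappa> \<noteq> 0" "\<And>y. y \<in> S i \<Longrightarrow> 0 \<le> \<kappa> * cross2 w y" by (rule ray_side[OF w]) blast
  have "\<kappa> * (d * cross2 w u) = 0" using \<kappa>(2)[OF S(1)] \<kappa>(2)[OF S(2)] by simp
  then have "cross2 w u = 0" using \<kappa>(1) S(3) by simp
  then obtain \<mu> where \<mu>: "u = \<mu> *\<^sub>R w" using cross2_eq_0_imp nz by blast
  then have "\<mu> \<noteq> 0" using nz by auto
  consider "\<mu> > 0" | "\<mu> < 0" using \<open>\<mu> \<noteq> 0\<close> by linarith
  then show ?thesis
  proof cases
    case 1
    have "v = \<mu> *\<^sub>R w'"
      by (rule F_scale_match[OF ij nz(1,2) _ \<mu> 1 c(2) dF]) (use ray_F[OF w, of 1] in simp)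
    then show ?thesis using \<mu> by blast
  next
    case 2
    have "v = (- \<mu>) *\<^sub>R (- w')"
      by (rule F_scale_match[OF ij, of "- w" _ u "- \<mu>"])
        (use ray_F[OF w, of "-1"] nz \<mu> 2 c dF linear_neg[OF A.linear_dF[OF nz(3)]] linear_neg[OF B.linear_dF[OF nz(4)]] in auto)
    then show ?thesis using \<mu> by auto
  qed
qed

text \<open>The two continuations may be written in different cells and still be the same curve. If
  one of them stays in \<open>i\<close>, the motion is along the ray and both describe it. If both
  leave \<open>i\<close>, they cross the same ray, since \<open>p\<close> is not the apex, and
  \<open>momentum_unique\<close> identifies the velocities.\<close>

lemma refracted_determines:
  assumes r1: "refracted i p u j q v" and r2: "refracted i p u j' q' v'"
    and I: "i \<in> I" "j \<in> I" "j' \<in> I" "p \<noteq> 0"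
    and c: "0 < c" "F i u = c" "F j v = c" "F j' v' = c" and e: "\<epsilon> \<noteq> 0" and d: "0 < \<delta>"
    and S: "\<And>s. s \<in> {0..\<delta>} \<Longrightarrow> q + (\<epsilon> * s) *\<^sub>R v \<in> S j" "\<And>s. s \<in> {0..\<delta>} \<Longrightarrow> q' + (\<epsilon> * s) *\<^sub>R v' \<in> S j'"
      "\<And>s. s \<in> {0..\<delta>} \<Longrightarrow> p + (- \<epsilon> * s) *\<^sub>R u \<in> S i"
    and s: "s \<in> {0..\<delta>}"
  shows "pt j (q + (\<epsilon> * s) *\<^sub>R v) = pt j' (q' + (\<epsilon> * s) *\<^sub>R v')"
proof -
  have along: "pt i (p + (\<epsilon> * s) *\<^sub>R u) = pt j (q + (\<epsilon> * s) *\<^sub>R v)"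
    if r: "refracted i p u j q v" and ne: "i \<noteq> j" and j: "F j v = c"
      and S': "\<And>s. s \<in> {0..\<delta>} \<Longrightarrow> p + (\<epsilon> * s) *\<^sub>R u \<in> S i" for j q v
  proof -
    obtain w w' r where w: "ray i w j w'" "0 < r" "p = r *\<^sub>R w" "q = r *\<^sub>R w'"
        "minkowski.dF (F i) u w = minkowski.dF (F j) v w'"
      using r ne unfolding refracted_def by blast
    have "\<exists>\<mu>. u = \<mu> *\<^sub>R w \<and> v = \<mu> *\<^sub>R w'"
      by (rule refracted_along[OF w(1) _ _ w(5), of r "\<epsilon> * \<delta>"])
        (use c j e d S'[of \<delta>] S(3)[of \<delta>] w in auto)
    then obtain \<mu> where \<mu>: "u = \<mu> *\<^sub>R w" "v = \<mu> *\<^sub>R w'" by blast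
    define t where "t = r + \<epsilon> * s * \<mu>"
    have eq: "p + (\<epsilon> * s) *\<^sub>R u = t *\<^sub>R w" "q + (\<epsilon> * s) *\<^sub>R v = t *\<^sub>R w'"
      by (simp_all add: w \<mu> t_def scaleR_add_left)
    have "t *\<^sub>R w \<in> S i" using S'[OF s] eq by simp
    then have "0 \<le> t" using w(1) S_iff by (auto simp: ray_def)
    then show ?thesis using ray_pt[OF w(1)] eq by simp
  qed
  consider "j = i" "j' = i" | "j = i" "j' \<noteq> i" | "j \<noteq> i" "j' = i" | "j \<noteq> i" "j' \<noteq> i" by blast
  then show ?thesis
  proof cases
    case 1
    then show ?thesis using r1 r2 by (simp add: refracted_def)
  next
    case 2
    then have "q = p" "v = u" using r1 by (auto simp: refracted_def)
    then show ?thesis using along[OF r2] 2 c(4) S(1) by metis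
  next
    case 3
    then have "q' = p" "v' = u" using r2 by (auto simp: refracted_def)
    then show ?thesis using along[OF r1] 3 c(3) S(2) by metis
  next
    case 4
    obtain w w1 r where w: "ray i w j w1" "0 < r" "p = r *\<^sub>R w" "q = r *\<^sub>R w1"
        "minkowski.dF (F i) u w = minkowski.dF (F j) v w1"
      using r1 4 unfolding refracted_def by blast
    obtain w' w2 r' where w': "ray i w' j' w2" "0 < r'" "p = r' *\<^sub>R w'" "q' = r' *\<^sub>R w2"
        "minkowski.dF (F i) u w' = minkowski.dF (F j') v' w2"
      using r2 4 unfolding refracted_def by blast
    have eq: "r *\<^sub>R w = r' *\<^sub>R w'" using w w' by simp
    have "w = w'"
    proof (rule ccontr)
      assume "w \<noteq> w'"
      then have "{w, w'} = {a i, b i}" using w(1) w'(1) by (auto simp: ray_def)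
      then have "cross2 w w' \<noteq> 0"
        using cross_nz[OF I(1)] cross2_commute[of "a i" "b i"] by (auto simp: doubleton_eq_iff)
      moreover have "r * cross2 w w' = 0" using arg_cong[OF eq, of "\<lambda>z. cross2 z w'"] by simp
      ultimately show False using w(2) by simp
    qed
    have "a i \<noteq> b i" using cross_nz[OF I(1)] by auto
    then have jj: "j = j'" "w1 = w2"
      using w(1) w'(1) \<open>w = w'\<close> nxt_inj by (auto simp: ray_def)
    have "(r - r') *\<^sub>R w = 0" using eq \<open>w = w'\<close> by (simp add: scaleR_diff_left)
    then have "r = r'" using ray_nz[OF w(1)] by simp
    then have qq: "q = q'" using w(4) w'(4) jj(2) by simp
    interpret B: planar "F j" "ori j" by (rule planar[OF I(2)])
    obtain \<kappa> where \<kappa>: "\<kappa> \<noteq> 0" "\<And>y. y \<in> S j \<Longrightarrow> 0 \<le> \<kappa> * cross2 w1 y"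
      by (rule ray_side[OF ray_sym[OF w(1)]]) blast
    have "v = v'"
    proof (rule B.momentum_unique[of v v' w1 "\<kappa> * (\<epsilon> * \<delta>)"])
      show "B.dF v w1 = B.dF v' w1" using w(5) w'(5) unfolding jj(2)[symmetric] jj(1)[symmetric] \<open>w = w'\<close> by simp
      show "w1 \<noteq> 0" using ray_nz[OF ray_sym[OF w(1)]] .
      show "F j v = F j v'" "0 < F j v" using c(1,3,4) unfolding jj(1)[symmetric] by simp_all
      show "\<kappa> * (\<epsilon> * \<delta>) \<noteq> 0" using \<kappa>(1) e d by simp
      show "0 \<le> \<kappa> * (\<epsilon> * \<delta>) * cross2 w1 v" using \<kappa>(2)[OF S(1)[of \<delta>]] d w(4) by (simp add: mult.assoc)
      show "0 \<le> \<kappa> * (\<epsilon> * \<delta>) * cross2 w1 v'"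
        using \<kappa>(2)[OF S(2)[of \<delta>, folded jj qq]] d w(4) by (simp add: mult.assoc)
    qed
    then show ?thesis unfolding qq jj(1) by simp
  qed
qed

text \<open>Replaces a passage to the limit: hats are affine along both segments, so their values at
  the start are extrapolated from those at \<open>d\<close> and \<open>d / 2\<close>.\<close>

lemma affine_hat_eq:
  assumes i: "i \<in> I" "i' \<in> I" and d: "0 < d"
    and S: "p \<in> S i" "p' \<in> S i'" "\<And>s. s \<in> {0<..d} \<Longrightarrow> p + s *\<^sub>R u \<in> S i" "\<And>s. s \<in> {0<..d} \<Longrightarrow> p' + s *\<^sub>R u' \<in> S i'"
    and eq: "\<And>s. s \<in> {0<..d} \<Longrightarrow> pt i (p + s *\<^sub>R u) = pt i' (p' + s *\<^sub>R u')"
  shows "pt i p = pt i' p'"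
  unfolding pt_eq_iff[OF i(1) S(1) i(2) S(2)]
proof
  fix k assume k: "k \<in> I"
  have h: "hat k i p + s * hat k i u = hat k i' p' + s * hat k i' u'" if "s \<in> {0<..d}" for s
    using eq[OF that] k unfolding pt_eq_iff[OF i(1) S(3)[OF that] i(2) S(4)[OF that]] by simp
  show "hat k i p = hat k i' p'" using h[of d] h[of "d / 2"] d by simp
qed

text \<open>If the geodesics separated, let \<open>T\<close> be the infimum of the parameters where
  they differ. They still agree at \<open>T\<close>, and with the same germ behind them refraction
  forces the same germ ahead, so they agree beyond \<open>T\<close>. Refraction applies because the
  apex is avoided.\<close>

lemma geodesic_unique_side:
  assumes pw: "\<And>s t. s < t \<Longrightarrow> pw_smooth TC (finsler TC) \<gamma> (\<lambda>_. c) s t" "\<And>s t. s < t \<Longrightarrow> pw_smooth TC (finsler TC) \<gamma>' (\<lambda>_. c) s t"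
    and c: "0 < c" and min: "\<And>t. minimizing_at \<gamma> c t" "\<And>t. minimizing_at \<gamma>' c t"
    and apex: "\<And>t. \<gamma> t \<noteq> cone_apex M x" and e: "\<epsilon> \<in> {1, -1}"
    and agree: "0 < \<eta>" "\<And>s. \<bar>s - t0\<bar> < \<eta> \<Longrightarrow> \<gamma> s = \<gamma>' s"
  shows "0 \<le> s \<Longrightarrow> \<gamma> (t0 + \<epsilon> * s) = \<gamma>' (t0 + \<epsilon> * s)"
proof (rule ccontr)
  assume "0 \<le> s" and ne: "\<gamma> (t0 + \<epsilon> * s) \<noteq> \<gamma>' (t0 + \<epsilon> * s)"
  define B where "B = {s. 0 \<le> s \<and> \<gamma> (t0 + \<epsilon> * s) \<noteq> \<gamma>' (t0 + \<epsilon> * s)}"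
  have B: "B \<noteq> {}" "bdd_below B" using ne \<open>0 \<le> s\<close> by (auto simp: B_def)
  define T where "T = Inf B"
  have "\<eta> \<le> s" if "s \<in> B" for s
  proof (rule ccontr)
    assume "\<not> \<eta> \<le> s"
    then have "\<bar>(t0 + \<epsilon> * s) - t0\<bar> < \<eta>" using that e by (auto simp: B_def)
    then show False using agree(2) that by (auto simp: B_def)
  qed
  then have T0: "0 < T" using cInf_greatest[OF B(1), of \<eta>] agree(1) by (auto simp: T_def)
  have lt: "\<gamma> (t0 + \<epsilon> * s) = \<gamma>' (t0 + \<epsilon> * s)" if "0 \<le> s" "s < T" for s
    using cInf_lower[OF _ B(2), of s] that by (force simp: B_def T_def)
  define t where "t = t0 + \<epsilon> * T"
  have ee: "- \<epsilon> \<in> {1, -1}" "\<epsilon> \<noteq> 0" using e by auto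
  obtain i p u \<delta>1 where L: "F i u = c" "germ \<gamma> t (- \<epsilon>) i p u \<delta>1"
    using ex_germ[OF pw(1) c min(1) ee(1)] by blast
  obtain i' p' u' \<delta>2 where L': "F i' u' = c" "germ \<gamma>' t (- \<epsilon>) i' p' u' \<delta>2"
    using ex_germ[OF pw(2) c min(2) ee(1)] by blast
  obtain j q v \<delta>3 where R: "F j v = c" "germ \<gamma> t \<epsilon> j q v \<delta>3"
    using ex_germ[OF pw(1) c min(1) e] by blast
  obtain j' q' v' \<delta>4 where R': "F j' v' = c" "germ \<gamma>' t \<epsilon> j' q' v' \<delta>4"
    using ex_germ[OF pw(2) c min(2) e] by blast
  define d where "d = min T (min (min \<delta>1 \<delta>2) (min \<delta>3 \<delta>4))"
  have d0: "0 < d" using T0 L L' R R' by (simp add: d_def germ_def)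
  have dle: "d \<le> T" "d \<le> \<delta>1" "d \<le> \<delta>2" "d \<le> \<delta>3" "d \<le> \<delta>4" unfolding d_def by linarith+
  note L2 = germ_mono[OF L(2) d0 dle(2)] and L2' = germ_mono[OF L'(2) d0 dle(3)]
    and R2 = germ_mono[OF R(2) d0 dle(4)] and R2' = germ_mono[OF R'(2) d0 dle(5)]
  have I: "i \<in> I" "i' \<in> I" "j \<in> I" "j' \<in> I" using L L' R R' by (auto simp: germ_def)
  have backw: "\<gamma> (t + - \<epsilon> * s) = \<gamma>' (t + - \<epsilon> * s)" if "0 < s" "s \<le> d" for s
    using lt[of "T - s"] that dle by (simp add: t_def algebra_simps)
  \<comment> \<open>Agreement before \<open>T\<close> passes to \<open>T\<close> itself, although
    the two germs may be written in different cells.\<close>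
  have at: "\<gamma> t = \<gamma>' t"
  proof -
    have "pt i p = pt i' p'"
    proof (rule affine_hat_eq[OF I(1,2) d0, of _ _ "(- \<epsilon>) *\<^sub>R u" "(- \<epsilon>) *\<^sub>R u'"])
      fix s assume s: "s \<in> {0<..d}"
      have e1: "s *\<^sub>R (- \<epsilon>) *\<^sub>R z = (- \<epsilon> * s) *\<^sub>R z" for z :: "real^2" by simp
      show "p + s *\<^sub>R (- \<epsilon>) *\<^sub>R u \<in> S i" "p' + s *\<^sub>R (- \<epsilon>) *\<^sub>R u' \<in> S i'"
        "pt i (p + s *\<^sub>R (- \<epsilon>) *\<^sub>R u) = pt i' (p' + s *\<^sub>R (- \<epsilon>) *\<^sub>R u')"
        unfolding e1 using s L2 L2' backw[of s] unfolding germ_def by auto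
    qed (use germ_at L L' in auto)
    then show ?thesis using germ_at[OF L(2)] germ_at[OF L'(2)] by simp
  qed
  have L3: "germ \<gamma>' t (- \<epsilon>) i p u d"
    unfolding germ_def
  proof (intro conjI ballI I d0)
    fix s assume s: "s \<in> {0..d}"
    show "p + (- \<epsilon> * s) *\<^sub>R u \<in> S i" using L2 s by (simp add: germ_def)
    have "\<gamma> (t + - \<epsilon> * s) = \<gamma>' (t + - \<epsilon> * s)" using backw[of s] at s by (cases "s = 0") auto
    then show "\<gamma>' (t + - \<epsilon> * s) = pt i (p + (- \<epsilon> * s) *\<^sub>R u)" using L2 s by (simp add: germ_def)
  qed
  have p0: "p \<noteq> 0" using apex[of t] germ_at[OF L(2)] pt_apex I by auto
  have "pt i p = pt j q" "pt i p = pt j' q'" using germ_at[OF L2] germ_at[OF R2] germ_at[OF L3] germ_at[OF R2'] by auto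
  then have q0: "q \<noteq> 0" "q' \<noteq> 0"
    using germ_at[OF R2] germ_at[OF R2'] pt_apex I p0 germ_at[OF L2] by metis+
  have ref: "refracted i p u j q v" "refracted i p u j' q' v'"
  proof -
    consider "\<epsilon> = 1" | "\<epsilon> = -1" using e by auto
    then have "refracted i p u j q v \<and> refracted i p u j' q' v'"
    proof cases
      case 1
      then show ?thesis
        using geodesic_refracted[OF min(1) c _ L(1) _ R(1) p0] geodesic_refracted[OF min(2) c _ L(1) _ R'(1) p0]
          L2 R2 L3 R2' by simp
    next
      case 2
      \<comment> \<open>Going backwards in time the known germ is the future one, so refraction is
        used in the opposite direction.\<close>
      then show ?thesis
        using geodesic_refracted[OF min(1) c _ R(1) _ L(1) q0(1)] geodesic_refracted[OF min(2) c _ R'(1) _ L(1) q0(2)]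
          L2 R2 L3 R2' refracted_sym by simp
    qed
    then show "refracted i p u j q v" "refracted i p u j' q' v'" by auto
  qed
  have fwd: "\<gamma> (t + \<epsilon> * s) = \<gamma>' (t + \<epsilon> * s)" if s: "s \<in> {0..d}" for s
  proof -
    have "pt j (q + (\<epsilon> * s) *\<^sub>R v) = pt j' (q' + (\<epsilon> * s) *\<^sub>R v')"
      by (rule refracted_determines[OF ref I(1,3,4) p0 c L(1) R(1) R'(1) ee(2) d0 _ _ _ s])
        (use R2 R2' L2 in \<open>auto simp: germ_def\<close>)
    then show ?thesis using R2 R2' s by (simp add: germ_def)
  qed
  obtain s where s: "s \<in> B" "s < T + d" using cInf_lessD[OF B(1), of "T + d"] d0 by (auto simp: T_def)
  then have "T \<le> s" using cInf_lower[OF s(1) B(2)] by (simp add: T_def)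
  then have "\<gamma> (t0 + \<epsilon> * s) = \<gamma>' (t0 + \<epsilon> * s)" using fwd[of "s - T"] s(2) by (simp add: t_def algebra_simps)
  then show False using s(1) by (simp add: B_def)
qed

text \<open>The two speeds are not assumed equal; they coincide because near \<open>t0\<close> both
  measure the same distances in the same time.\<close>

lemma geodesic_unique:
  assumes "geodesic TC \<gamma>" "geodesic TC \<gamma>'" "\<And>t. \<gamma> t \<noteq> cone_apex M x"
    and agree: "0 < \<eta>" "\<And>s. \<bar>s - t0\<bar> < \<eta> \<Longrightarrow> \<gamma> s = \<gamma>' s"
  shows "\<gamma> = \<gamma>'"
proof
  fix t
  obtain c where c: "c > 0" "\<And>s t. s < t \<Longrightarrow> pw_smooth TC (finsler TC) \<gamma> (\<lambda>_. c) s t" "\<And>t. minimizing_at \<gamma> c t"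
    using assms(1) unfolding geodesic_iff by blast
  obtain c' where c': "c' > 0" "\<And>s t. s < t \<Longrightarrow> pw_smooth TC (finsler TC) \<gamma>' (\<lambda>_. c') s t" "\<And>t. minimizing_at \<gamma>' c' t"
    using assms(2) unfolding geodesic_iff by blast
  obtain \<delta> where \<delta>: "\<delta> > 0" "\<And>s r. t0 - \<delta> < s \<Longrightarrow> s < r \<Longrightarrow> r < t0 + \<delta> \<Longrightarrow> fdist TC (\<gamma> s) (\<gamma> r) = c * (r - s)"
    using c(3)[of t0] unfolding minimizing_at_def by blast
  obtain \<delta>' where \<delta>': "\<delta>' > 0" "\<And>s r. t0 - \<delta>' < s \<Longrightarrow> s < r \<Longrightarrow> r < t0 + \<delta>' \<Longrightarrow> fdist TC (\<gamma>' s) (\<gamma>' r) = c' * (r - s)"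
    using c'(3)[of t0] unfolding minimizing_at_def by blast
  define d where "d = min \<eta> (min \<delta> \<delta>') / 2"
  have d: "0 < d" "d < \<eta>" "d < \<delta>" "d < \<delta>'" using \<delta>(1) \<delta>'(1) agree(1) by (auto simp: d_def)
  have "c * d = c' * d"
    using \<delta>(2)[of t0 "t0 + d"] \<delta>'(2)[of t0 "t0 + d"] agree(2)[of t0] agree(2)[of "t0 + d"] d by simp
  then have cc: "c' = c" using d by simp
  show "\<gamma> t = \<gamma>' t"
  proof (cases "t0 \<le> t")
    case True
    then show ?thesis
      using geodesic_unique_side[OF c(2) c'(2)[unfolded cc] c(1,3) c'(3)[unfolded cc] assms(3) _ agree, where \<epsilon> = 1 and ?t0.0 = t0 and s = "t - t0"] by simp
  next
    case False
    then show ?thesis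
      using geodesic_unique_side[OF c(2) c'(2)[unfolded cc] c(1,3) c'(3)[unfolded cc] assms(3) _ agree, where \<epsilon> = "-1" and ?t0.0 = t0 and s = "t0 - t"] by simp
  qed
qed

end

lemma pw_smooth_glue:
  assumes "\<And>s t. s < t \<Longrightarrow> P s \<Longrightarrow> t \<le> t1 \<Longrightarrow> pw_smooth M N \<gamma> \<rho> s t"
    and "\<And>s t. s < t \<Longrightarrow> t1 \<le> s \<Longrightarrow> pw_smooth M N \<gamma> \<rho> s t" and "s < t" "P s"
  shows "pw_smooth M N \<gamma> \<rho> s t"
proof -
  consider "t \<le> t1" | "t1 \<le> s" | "s < t1" "t1 < t" by linarith
  then show ?thesis
  proof cases
    case 3
    show ?thesis by (rule pw_smooth.join[OF assms(1)[OF 3(1) assms(4)] assms(2)[OF 3(2)]]) auto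
  qed (use assms in auto)
qed

section \<open>Existence of geodesics and their angle as seen from the apex\<close>

context vertex_cone begin

lemma F_pt: assumes "i \<in> I" "j \<in> I" "y \<in> S i" "z \<in> S j" "pt i y = pt j z" shows "F i y = F j z"
proof (cases "y = 0 \<or> i = j")
  case True
  then show ?thesis
    using assms pt_same[OF assms(1,3)] pt_apex[OF assms(1,3)] pt_apex[OF assms(2,4)]
      minkowski.zero[OF minkowski] by auto
next
  case False
  then obtain w w' r where "ray i w j w'" "y = r *\<^sub>R w" "z = r *\<^sub>R w'"
    using pt_eq_ray[OF assms(1,3,2,4,5)] by blast
  then show ?thesis using ray_F by simp
qed

lemma indicatrix_eq: assumes "\<sigma> \<in> {1, -1}"
  shows "indicatrix M \<sigma> x = {pt i y | i y. i \<in> I \<and> y \<in> S i \<and> F i (\<sigma> *\<^sub>R y) = 1}"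
proof -
  have "\<sigma> * \<sigma> = 1" using assms by auto
  then have eq: "\<sigma> *\<^sub>R \<sigma> *\<^sub>R u = u" for u :: "real^2" by simp
  have "indicatrix M \<sigma> x = {pt i (\<sigma> *\<^sub>R u) | i u. i \<in> I \<and> \<sigma> *\<^sub>R u \<in> S i \<and> F i u = 1}"
    by (simp add: indicatrix_def pt_def unit_vectors_def I_def S_def F_def conj_assoc)
  also have "\<dots> = {pt i y | i y. i \<in> I \<and> y \<in> S i \<and> F i (\<sigma> *\<^sub>R y) = 1}"
    using eq by (metis (no_types, lifting))
  finally show ?thesis .
qed

lemma cone_scale_pt: assumes "i \<in> I" "y \<in> S i" "0 \<le> r" shows "cone_scale M x r (pt i y) = pt i (r *\<^sub>R y)"
proof -
  have eq: "pt j (r *\<^sub>R z) = pt i (r *\<^sub>R y)" if "(j, z) \<in> pt i y" for j z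
  proof -
    have jz: "j \<in> I" "z \<in> S j" "pt i y = pt j z" using that in_pt_iff[OF assms(1,2)] by auto
    then have "\<forall>k\<in>I. hat k i y = hat k j z" using pt_eq_iff[OF assms(1,2)] by blast
    then show ?thesis using jz assms S_scale by (subst pt_eq_iff) auto
  qed
  have "cone_scale M x r (pt i y) = (\<Union>(j, z)\<in>pt i y. pt j (r *\<^sub>R z))"
    by (auto simp: cone_scale_def pt_def)
  also have "\<dots> = (\<Union>(j, z)\<in>pt i y. pt i (r *\<^sub>R y))"
    by (intro SUP_cong refl) (auto simp: eq split: prod.splits)
  also have "\<dots> = pt i (r *\<^sub>R y)" using in_pt_self[OF assms(1,2)] by auto
  finally show ?thesis .
qed

lemma unit_dir_pt: assumes i: "i \<in> I" "y \<in> S i" "y \<noteq> 0" shows "unit_dir M 1 x (pt i y) = pt i ((1 / F i y) *\<^sub>R y)"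
  unfolding unit_dir_def
proof (rule the_equality)
  interpret minkowski "F i" by (rule minkowski[OF i(1)])
  have p: "0 < F i y" using pos i by simp
  have "(1 / F i y) *\<^sub>R y \<in> S i" "F i ((1 / F i y) *\<^sub>R y) = 1" using i p S_scale by (simp_all add: scale)
  moreover have "pt i ((1 / F i y) *\<^sub>R y) = cone_scale M x (1 / F i y) (pt i y)"
    using cone_scale_pt[OF i(1,2)] p by simp
  ultimately show "pt i ((1 / F i y) *\<^sub>R y) \<in> indicatrix M 1 x \<and>
      (\<exists>r>0. pt i ((1 / F i y) *\<^sub>R y) = cone_scale M x r (pt i y))"
    using i p by (auto simp: indicatrix_eq intro!: exI[of _ "1 / F i y"])
  fix Q assume "Q \<in> indicatrix M 1 x \<and> (\<exists>r>0. Q = cone_scale M x r (pt i y))"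
  then obtain j z r where Q: "Q = pt j z" "j \<in> I" "z \<in> S j" "F j z = 1" "0 < r" "Q = cone_scale M x r (pt i y)"
    by (auto simp: indicatrix_eq)
  then have "pt j z = pt i (r *\<^sub>R y)" using cone_scale_pt[OF i(1,2)] by simp
  then have "F i (r *\<^sub>R y) = 1" using F_pt[OF Q(2) i(1) Q(3) S_scale[OF i(1,2)]] Q(4,5) by simp
  then have "r = 1 / F i y" using Q(5) p by (simp add: scale field_simps)
  then show "Q = pt i ((1 / F i y) *\<^sub>R y)" using Q(5,6) cone_scale_pt[OF i(1,2)] by simp
qed

text \<open>The sector coordinates are quotients of determinants and hence sines of the angles to
  the bounding rays, so membership in the sector is read off from the angle.\<close>

lemma cAB_polar: assumes i: "i \<in> I"
  obtains k k' where "0 < k" "0 < k'" "\<And>\<rho> \<theta>. cA i (\<rho> *\<^sub>R polar (ori i) \<theta>) = k * \<rho> * sin (be i - \<theta>)"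
    "\<And>\<rho> \<theta>. cB i (\<rho> *\<^sub>R polar (ori i) \<theta>) = k' * \<rho> * sin (\<theta> - al i)"
proof -
  interpret planar "F i" "ori i" by (rule planar[OF i])
  obtain r s where rs: "r > 0" "a i = r *\<^sub>R polar (ori i) (al i)" "s > 0" "b i = s *\<^sub>R polar (ori i) (be i)"
    using angle_a[OF i] angle_b[OF i] by blast
  define D where "D = ori i * cross2 (a i) (b i)"
  have D: "D > 0" using cross_ab[OF i] by (simp add: D_def)
  have A: "cA i y = (ori i * cross2 y (b i)) / D" and B: "cB i y = (ori i * cross2 (a i) y) / D" for y
    using ee(2) by (simp_all add: cA_def cB_def D_def)
  have "cA i (\<rho> *\<^sub>R polar (ori i) \<theta>) = (s / D) * \<rho> * sin (be i - \<theta>)" for \<rho> \<theta>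
    unfolding A cross2_polar[symmetric] by (subst rs(4)) simp
  moreover have "cB i (\<rho> *\<^sub>R polar (ori i) \<theta>) = (r / D) * \<rho> * sin (\<theta> - al i)" for \<rho> \<theta>
    unfolding B cross2_polar[symmetric] by (subst rs(2)) simp
  ultimately show ?thesis using that[of "s / D" "r / D"] rs D by simp
qed

lemma polar_in_S: assumes "i \<in> I" "0 \<le> \<rho>" "al i \<le> \<theta>" "\<theta> \<le> be i" shows "\<rho> *\<^sub>R polar (ori i) \<theta> \<in> S i"
proof -
  obtain k k' where k: "0 < k" "0 < k'" "\<And>\<rho> \<theta>. cA i (\<rho> *\<^sub>R polar (ori i) \<theta>) = k * \<rho> * sin (be i - \<theta>)"
    "\<And>\<rho> \<theta>. cB i (\<rho> *\<^sub>R polar (ori i) \<theta>) = k' * \<rho> * sin (\<theta> - al i)"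
    using cAB_polar[OF assms(1)] by blast
  have "0 \<le> sin (be i - \<theta>)" "0 \<le> sin (\<theta> - al i)" using assms al_be[OF assms(1)] by (auto intro!: sin_ge_zero)
  then show ?thesis using assms k(1,2) unfolding S_iff[OF assms(1)] k(3,4) by simp
qed

lemma polar_interior: assumes "i \<in> I" "0 < \<rho>" "al i < \<theta>" "\<theta> < be i"
  shows "0 < cA i (\<rho> *\<^sub>R polar (ori i) \<theta>)" "0 < cB i (\<rho> *\<^sub>R polar (ori i) \<theta>)"
proof -
  obtain k k' where k: "0 < k" "0 < k'" "\<And>\<rho> \<theta>. cA i (\<rho> *\<^sub>R polar (ori i) \<theta>) = k * \<rho> * sin (be i - \<theta>)"
    "\<And>\<rho> \<theta>. cB i (\<rho> *\<^sub>R polar (ori i) \<theta>) = k' * \<rho> * sin (\<theta> - al i)"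
    using cAB_polar[OF assms(1)] by blast
  have "0 < sin (be i - \<theta>)" "0 < sin (\<theta> - al i)" using assms al_be[OF assms(1)] by (auto intro!: sin_gt_zero)
  then show "0 < cA i (\<rho> *\<^sub>R polar (ori i) \<theta>)" "0 < cB i (\<rho> *\<^sub>R polar (ori i) \<theta>)"
    using assms(2) k(1,2) unfolding k(3,4) by simp_all
qed

lemma cells_interior: assumes i: "i \<in> I" and p: "0 < cA i y" "0 < cB i y"
  shows "{k \<in> I. pt i y \<in> cell TC k} = {i}"
proof -
  have y: "y \<in> S i" "y \<noteq> 0" using i p S_iff by auto
  have "k = i" if k: "k \<in> I" "pt i y \<in> cell TC k" for k
  proof (rule ccontr)
    assume "k \<noteq> i"
    obtain z where z: "z \<in> S k" "pt i y = pt k z" using k cell_TC_iff[OF k(1)] by blast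
    obtain w w' r where "ray i w k w'" "y = r *\<^sub>R w"
      using pt_eq_ray[OF i y(1) k(1) z y(2)] \<open>k \<noteq> i\<close> by blast
    then show False using p by (auto simp: ray_def)
  qed
  then show ?thesis using i y by (auto simp: cell_TC)
qed

lemma cells_ray: assumes i: "i \<in> I" and r: "0 < r"
  shows "{k \<in> I. pt i (r *\<^sub>R b i) \<in> cell TC k} = {i, nxt i}"
proof -
  have y: "r *\<^sub>R b i \<in> S i" "r *\<^sub>R b i \<noteq> 0" using i r S_iff b_nz by auto
  have "k = nxt i" if k: "k \<in> I" "pt i (r *\<^sub>R b i) \<in> cell TC k" "k \<noteq> i" for k
  proof -
    obtain z where z: "z \<in> S k" "pt i (r *\<^sub>R b i) = pt k z" using k cell_TC_iff[OF k(1)] by blast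
    obtain w w' s where w: "ray i w k w'" "r *\<^sub>R b i = s *\<^sub>R w"
      using pt_eq_ray[OF i y(1) k(1) z y(2)] k(3) by blast
    have "w \<noteq> a i"
    proof
      assume "w = a i"
      then have "cB i (r *\<^sub>R b i) = 0" unfolding w(2) by simp
      then show False using r i by simp
    qed
    then show ?thesis using w(1) by (auto simp: ray_def)
  qed
  moreover have "pt i (r *\<^sub>R b i) \<in> cell TC (nxt i)"
    using pt_ray[OF i] r nxt_in[OF i] by (auto simp: cell_TC S_iff)
  moreover have "pt i (r *\<^sub>R b i) \<in> cell TC i" using y(1) cell_TC[OF i] by blast
  ultimately show ?thesis using i nxt_in[OF i] by blast
qed

lemma minimizing_cong:
  assumes "minimizing_at \<gamma>' c t" "0 < d" "\<And>s. t - d < s \<Longrightarrow> s < t + d \<Longrightarrow> \<gamma> s = \<gamma>' s"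
  shows "minimizing_at \<gamma> c t"
proof -
  obtain \<delta> where \<delta>: "\<delta> > 0" "\<And>s r. t - \<delta> < s \<Longrightarrow> s < r \<Longrightarrow> r < t + \<delta> \<Longrightarrow> fdist TC (\<gamma>' s) (\<gamma>' r) = c * (r - s)"
    using assms(1) unfolding minimizing_at_def by blast
  show ?thesis unfolding minimizing_at_def
    by (rule exI[of _ "min \<delta> d"]) (use \<delta> assms(2,3) in auto)
qed

text \<open>An interior point of a sector lies in no other cell, so the single functional
  \<open>dF u\<close> calibrates the line.\<close>

lemma minimizing_straight:
  assumes i: "i \<in> I" "F i u = 1" and \<delta>: "0 < \<delta>" and int: "0 < cA i (y + t *\<^sub>R u)" "0 < cB i (y + t *\<^sub>R u)"
    and \<gamma>: "\<And>\<tau>. t - \<delta> \<le> \<tau> \<Longrightarrow> \<tau> \<le> t + \<delta> \<Longrightarrow> y + \<tau> *\<^sub>R u \<in> S i \<and> \<gamma> \<tau> = pt i (y + \<tau> *\<^sub>R u)"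
  shows "minimizing_at \<gamma> 1 t"
proof -
  interpret minkowski "F i" by (rule minkowski[OF i(1)])
  have u0: "u \<noteq> 0" using i(2) by auto
  define p where "p = y + t *\<^sub>R u"
  have "p \<noteq> 0"
  proof
    assume "p = 0"
    then have "cA i (y + t *\<^sub>R u) = cA i 0" by (simp only: p_def)
    then show False using int(1) by simp
  qed
  then have p: "p \<in> S i" "p \<noteq> 0" using int i S_iff by (simp_all add: p_def)
  have eq: "p + (s - t) *\<^sub>R u = y + s *\<^sub>R u" for s by (simp add: p_def algebra_simps)
  have "\<exists>d>0. \<forall>A B. t - d < A \<and> A < B \<and> B < t + d \<longrightarrow> fdist TC (\<gamma> A) (\<gamma> B) = B - A"
  proof (rule locally_minimizing[OF i(1) p cells_interior[symmetric, OF i(1) int, folded p_def], where lam = "\<lambda>_. dF u" and y = p and z = p and u = u and v = u])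
    show "pw_smooth TC (finsler TC) \<gamma> (\<lambda>_. 1) A B" if "t - \<delta> < A" "A < B" "B < t + \<delta>" for A B
      by (rule pw_line[OF that(2) i(1)]) (use \<gamma> that i in auto)
  qed (use i p u0 dF_self linear_dF dF_le \<gamma> \<delta> eq in auto)
  then show ?thesis by (simp add: minimizing_at_def)
qed

text \<open>The converse of the first variation: \<open>dF u\<close> on one side and
  \<open>dF v\<close> on the other agree on the common ray by \<open>mom\<close>, so together they
  calibrate the broken line.\<close>

lemma minimizing_crossing:
  assumes i: "i \<in> I" "F i u = 1" "F (nxt i) v = 1" and \<delta>: "0 < \<delta>" and r: "0 < r"
    and y: "y + t *\<^sub>R u = r *\<^sub>R b i" "z + t *\<^sub>R v = r *\<^sub>R a (nxt i)"
    and mom: "minkowski.dF (F i) u (b i) = minkowski.dF (F (nxt i)) v (a (nxt i))"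
    and L: "\<And>\<tau>. t - \<delta> \<le> \<tau> \<Longrightarrow> \<tau> \<le> t \<Longrightarrow> y + \<tau> *\<^sub>R u \<in> S i \<and> \<gamma> \<tau> = pt i (y + \<tau> *\<^sub>R u)"
    and R: "\<And>\<tau>. t \<le> \<tau> \<Longrightarrow> \<tau> \<le> t + \<delta> \<Longrightarrow> z + \<tau> *\<^sub>R v \<in> S (nxt i) \<and> \<gamma> \<tau> = pt (nxt i) (z + \<tau> *\<^sub>R v)"
  shows "minimizing_at \<gamma> 1 t"
proof -
  define j where "j = nxt i"
  have j: "j \<in> I" "j \<noteq> i" using nxt_in nxt1 i by (auto simp: j_def)
  interpret A: minkowski "F i" by (rule minkowski[OF i(1)])
  interpret B: minkowski "F j" by (rule minkowski[OF j(1)])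
  have nz: "u \<noteq> 0" "v \<noteq> 0" using i A.zero B.zero[unfolded j_def] by auto
  define p where "p = r *\<^sub>R b i" define q where "q = r *\<^sub>R a j"
  have p: "p \<in> S i" "p \<noteq> 0" using i r S_iff b_nz by (auto simp: p_def)
  have q: "q \<in> S j" "pt j q = pt i p" using pt_ray[OF i(1)] r j by (auto simp: p_def q_def j_def S_iff)
  have J: "{i, j} = {k \<in> I. pt i p \<in> cell TC k}" using cells_ray[OF i(1) r] by (simp add: p_def j_def)
  have ch: "chart TC i (pt i p) = p" "chart TC j (pt i p) = q"
    using chart_TC[OF i(1) p(1)] chart_TC[OF j(1) q(1)] q(2) by auto
  define lam where "lam k = (if k = i then A.dF u else B.dF v)" for k
  have lpq: "A.dF u p = B.dF v q"
    using mom linear_scale[OF A.linear_dF[OF nz(1)]] linear_scale[OF B.linear_dF[OF nz(2)]] by (simp add: p_def q_def j_def)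
  have eqp: "p + (s - t) *\<^sub>R u = y + s *\<^sub>R u" and eqq: "q + (s - t) *\<^sub>R v = z + s *\<^sub>R v" for s
    using y by (simp_all add: p_def q_def j_def scaleR_diff_left flip: y)
  have "\<exists>d>0. \<forall>A B. t - d < A \<and> A < B \<and> B < t + d \<longrightarrow> fdist TC (\<gamma> A) (\<gamma> B) = B - A"
  proof (rule locally_minimizing[OF i(1) p J, where lam = lam and i = i and j = j and y = p and z = q and u = u and v = v])
    show "pw_smooth TC (finsler TC) \<gamma> (\<lambda>_. 1) A B" if "t - \<delta> < A" "A < B" "B < t + \<delta>" for A B
    proof -
      have l: "pw_smooth TC (finsler TC) \<gamma> (\<lambda>_. 1) s s'" if "t - \<delta> < s" "s < s'" "s' \<le> t" for s s'
        by (rule pw_line[OF that(2) i(1)]) (use L that i in auto)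
      have r: "pw_smooth TC (finsler TC) \<gamma> (\<lambda>_. 1) s s'" if "t \<le> s" "s < s'" "s' < t + \<delta>" for s s'
        by (rule pw_line[OF that(2) j(1), of z v]) (use R that i in \<open>auto simp: j_def\<close>)
      consider "B \<le> t" | "t \<le> A" | "A < t" "t < B" by linarith
      then show ?thesis
      proof cases
        case 3
        show ?thesis by (rule pw_smooth.join[OF l r]) (use 3 that \<delta> in auto)
      qed (use l r that in auto)
    qed
    show "linear (lam k)" if "k \<in> {i, j}" for k
      using A.linear_dF[OF nz(1)] B.linear_dF[OF nz(2)] by (simp add: lam_def)
    show "lam k w \<le> F k w" if "k \<in> {i, j}" for k w
      using A.dF_le[OF nz(1)] B.dF_le[OF nz(2)] that by (auto simp: lam_def)
    show "lam k (chart TC k (pt i p)) = lam l (chart TC l (pt i p))" if "k \<in> {i, j}" "l \<in> {i, j}" for k l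
      using that ch lpq j by (auto simp: lam_def)
    show "lam i u = 1" "lam j v = 1"
      using A.dF_self[OF nz(1)] B.dF_self[OF nz(2)] i j by (auto simp: lam_def j_def[symmetric])
    show "p + (s - t) *\<^sub>R u \<in> S i \<and> \<gamma> s = pt i (p + (s - t) *\<^sub>R u)" if "t - \<delta> \<le> s" "s \<le> t" for s
      unfolding eqp using L that by blast
    show "q + (s - t) *\<^sub>R v \<in> S j \<and> \<gamma> s = pt j (q + (s - t) *\<^sub>R v)" if "t \<le> s" "s \<le> t + \<delta>" for s
      unfolding eqq j_def using R that by blast
  qed (use i p q \<delta> in \<open>auto simp: j_def[symmetric]\<close>)
  then show ?thesis by (simp add: minimizing_at_def)
qed

lemma arc_line:
  assumes i: "i \<in> I" and st: "s < t"
    and \<gamma>: "\<And>\<tau>. s \<le> \<tau> \<Longrightarrow> \<tau> \<le> t \<Longrightarrow> y + \<tau> *\<^sub>R u \<in> S i \<and> \<gamma> \<tau> = pt i (y + \<tau> *\<^sub>R u)"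
    and \<theta>: "\<And>\<tau>. \<exists>\<rho>>0. y + \<tau> *\<^sub>R u = \<rho> *\<^sub>R polar (ori i) (\<theta> \<tau>)"
      "\<And>\<tau>. (\<theta> has_real_derivative \<theta>' \<tau>) (at \<tau>)" "\<And>\<tau>. 0 < \<theta>' \<tau>"
    and \<rho>: "\<And>\<tau>. s < \<tau> \<Longrightarrow> \<tau> < t \<Longrightarrow> \<rho> \<tau> = \<theta>' \<tau> * kap (F i) (ori i) (\<theta> \<tau>)"
  shows "pw_smooth TC (arc_norm M 1) (unit_dir M 1 x \<circ> \<gamma>) \<rho> s t"
proof -
  interpret planar "F i" "ori i" by (rule planar[OF i])
  define g where "g \<tau> = (1 / F i (y + \<tau> *\<^sub>R u)) *\<^sub>R (y + \<tau> *\<^sub>R u)" for \<tau>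
  have nz: "y + \<tau> *\<^sub>R u \<noteq> 0" for \<tau>
  proof -
    obtain \<rho> where "\<rho> > 0" "y + \<tau> *\<^sub>R u = \<rho> *\<^sub>R polar (ori i) (\<theta> \<tau>)" using \<theta>(1)[of \<tau>] by blast
    then show ?thesis by simp
  qed
  have gN: "g \<tau> = N (\<theta> \<tau>)" for \<tau> using \<theta>(1)[of \<tau>] normalize_polar unfolding g_def by blast
  have sm: "smooth_on UNIV g" unfolding g_def using nz by (intro smooth_projection) auto
  have vd: "vector_derivative g (at \<tau>) = \<theta>' \<tau> *\<^sub>R N' (\<theta> \<tau>)" for \<tau>
    unfolding gN[abs_def] by (rule vector_derivative_at[OF N_comp_deriv[OF \<theta>(2)]])
  have dir: "g \<tau> \<in> S i \<and> (unit_dir M 1 x \<circ> \<gamma>) \<tau> = pt i (g \<tau>)" if "s \<le> \<tau>" "\<tau> \<le> t" for \<tau>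
    using \<gamma>[OF that] unit_dir_pt[OF i _ nz] S_scale[OF i] nonneg by (simp add: g_def)
  show ?thesis
  proof (rule pw_smooth.piece[OF st, of i _ _ UNIV g])
    show "(unit_dir M 1 x \<circ> \<gamma>) ` {s..t} \<subseteq> cell TC i" using dir i by (auto simp: cell_TC)
    show "\<forall>\<tau>\<in>{s..t}. chart TC i ((unit_dir M 1 x \<circ> \<gamma>) \<tau>) = g \<tau>" using dir chart_TC[OF i] by auto
    show "\<forall>\<tau>\<in>{s<..<t}. \<rho> \<tau> = arc_norm M 1 i (g \<tau>) (vector_derivative g (at \<tau>))"
    proof
      fix \<tau> assume "\<tau> \<in> {s<..<t}"
      then show "\<rho> \<tau> = arc_norm M 1 i (g \<tau>) (vector_derivative g (at \<tau>))"
        using arc_speed[OF \<theta>(2)] \<theta>(3)[of \<tau>] \<rho> by (simp add: arc_norm_def vd gN flip: F_def)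
    qed
  qed (use i sm in auto)
qed

text \<open>\<open>R\<close> is the angle swept from time \<open>t0\<close> on. Minimality is
  required only after \<open>t0\<close>, since at \<open>t0\<close> the curve may start on a ray,
  where an earlier piece is attached later.\<close>

definition half_geodesic :: "(real \<Rightarrow> ('i \<times> (real^2)) set) \<Rightarrow> real \<Rightarrow> (real \<Rightarrow> real) \<Rightarrow> real \<Rightarrow> bool" where
  "half_geodesic \<gamma> t0 \<rho> R \<longleftrightarrow> (\<forall>s t. t0 \<le> s \<and> s < t \<longrightarrow> pw_smooth TC (finsler TC) \<gamma> (\<lambda>_. 1) s t) \<and>
     (\<forall>t>t0. minimizing_at \<gamma> 1 t) \<and> (\<forall>t\<ge>t0. \<gamma> t \<noteq> cone_apex M x) \<and>
     (\<forall>s t. t0 \<le> s \<and> s < t \<longrightarrow> pw_smooth TC (arc_norm M 1) (unit_dir M 1 x \<circ> \<gamma>) \<rho> s t) \<and>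
     (\<rho> has_integral R) {t0..}"

text \<open>Induction on the angle that is left: it is invariant under refraction and decreases by the
  angle of a full sector whenever a cell is traversed from one ray to the other.\<close>

lemma half_geodesic_exists:
  assumes m: "0 < m" "\<And>k. k \<in> I \<Longrightarrow> m \<le> Th (F k) (ori k) (be k) - Th (F k) (ori k) (al k)"
  shows "i \<in> I \<Longrightarrow> F i u = 1 \<Longrightarrow> u = r *\<^sub>R polar (ori i) \<phi> \<Longrightarrow> 0 < r \<Longrightarrow>
    y + t0 *\<^sub>R u = r0 *\<^sub>R polar (ori i) \<eta> \<Longrightarrow> 0 < r0 \<Longrightarrow> al i \<le> \<eta> \<Longrightarrow> \<eta> < be i \<Longrightarrow> \<eta> < \<phi> \<Longrightarrow> \<phi> < \<eta> + pi \<Longrightarrow>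
    Th (F i) (ori i) \<phi> - Th (F i) (ori i) (al i) < real n * m \<Longrightarrow>
    \<exists>\<gamma> \<rho>. half_geodesic \<gamma> t0 \<rho> (Th (F i) (ori i) \<phi> - Th (F i) (ori i) \<eta>) \<and>
      (\<exists>\<delta>>0. \<forall>\<tau>\<in>{t0..t0 + \<delta>}. y + \<tau> *\<^sub>R u \<in> S i \<and> \<gamma> \<tau> = pt i (y + \<tau> *\<^sub>R u))"
proof (induction n arbitrary: i u r \<phi> y t0 r0 \<eta>)
  case (0 i u r \<phi> y t0 r0 \<eta>)
  interpret planar "F i" "ori i" by (rule planar[OF 0(1)])
  show ?case using 0 T_less[of "al i" \<phi>] by simp
next
  case (Suc n i u r \<phi> y t0 r0 \<eta>)
  note i = Suc.prems(1) and Fu = Suc.prems(2) and u = Suc.prems(3,4) and y0 = Suc.prems(5,6) and ang = Suc.prems(7-10)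
  interpret planar "F i" "ori i" by (rule planar[OF i])
  have "ori i * cross2 y u = ori i * cross2 (y + t0 *\<^sub>R u) u" by simp
  also have "\<dots> = (r0 * r) * (ori i * cross2 (polar (ori i) \<eta>) (polar (ori i) \<phi>))"
    unfolding y0(1) by (subst u(1)) simp
  also have "\<dots> > 0" unfolding cross2_polar using y0(2) u(2) ang by (simp add: sin_gt_zero)
  finally have cr: "0 < ori i * cross2 y u" .
  obtain \<theta> \<theta>' where \<theta>: "\<And>t. (\<theta> has_real_derivative \<theta>' t) (at t)" "\<And>t. 0 < \<theta>' t"
      "\<And>t. \<exists>\<rho>>0. y + t *\<^sub>R u = \<rho> *\<^sub>R polar (ori i) (\<theta> t)" "\<And>t. \<phi> - pi < \<theta> t" "\<And>t. \<theta> t < \<phi>" "(\<theta> \<longlongrightarrow> \<phi>) at_top"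
    using line_polar[OF cr u] by blast
  have \<theta>0: "\<theta> t0 = \<eta>"
  proof -
    obtain \<rho> where \<rho>: "\<rho> > 0" "y + t0 *\<^sub>R u = \<rho> *\<^sub>R polar (ori i) (\<theta> t0)" using \<theta>(3)[of t0] by blast
    have "\<bar>\<theta> t0 - \<eta>\<bar> < 2 * pi" using \<theta>(4,5)[of t0] ang by linarith
    then show ?thesis using polar_eqD(1)[of \<rho> "\<theta> t0" r0 \<eta>] \<rho> y0 by simp
  qed
  have mono: "\<theta> s < \<theta> t" if "s < t" for s t
    by (rule DERIV_pos_imp_increasing[OF that]) (use \<theta>(1,2) in blast)
  have mono': "\<theta> s \<le> \<theta> t" if "s \<le> t" for s t using mono[of s t] that by (cases "s = t") auto
  have nz: "y + t *\<^sub>R u \<noteq> 0" for t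
  proof -
    obtain \<rho> where "\<rho> > 0" "y + t *\<^sub>R u = \<rho> *\<^sub>R polar (ori i) (\<theta> t)" using \<theta>(3)[of t] by blast
    then show ?thesis by simp
  qed
  have inS: "y + t *\<^sub>R u \<in> S i" if "t0 \<le> t" "\<theta> t \<le> be i" for t
  proof -
    obtain \<rho> where "\<rho> > 0" "y + t *\<^sub>R u = \<rho> *\<^sub>R polar (ori i) (\<theta> t)" using \<theta>(3)[of t] by blast
    then show ?thesis using polar_in_S[OF i, of \<rho> "\<theta> t"] mono'[OF that(1)] \<theta>0 ang that(2) by simp
  qed
  have int: "0 < cA i (y + t *\<^sub>R u)" "0 < cB i (y + t *\<^sub>R u)" if "t0 < t" "\<theta> t < be i" for t
  proof -
    obtain \<rho> where "\<rho> > 0" "y + t *\<^sub>R u = \<rho> *\<^sub>R polar (ori i) (\<theta> t)" using \<theta>(3)[of t] by blast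
    then show "0 < cA i (y + t *\<^sub>R u)" "0 < cB i (y + t *\<^sub>R u)"
      using polar_interior[OF i, of \<rho> "\<theta> t"] mono[OF that(1)] \<theta>0 ang that(2) by simp_all
  qed
  show ?case
  proof (cases "\<phi> \<le> be i")
    \<comment> \<open>The angle of the line increases to \<phi> without reaching it, so the line
      never meets the last ray and stays in the sector forever.\<close>
    case True
    define \<gamma> where "\<gamma> t = pt i (y + t *\<^sub>R u)" for t
    have le: "\<theta> t \<le> be i" "\<theta> t < be i" for t using \<theta>(5)[of t] True by simp_all
    have "half_geodesic \<gamma> t0 (\<lambda>t. \<theta>' t * K (\<theta> t)) (T \<phi> - T \<eta>)"
      unfolding half_geodesic_def
    proof (intro conjI allI impI)
      fix s t assume st: "t0 \<le> s \<and> s < t"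
      show "pw_smooth TC (finsler TC) \<gamma> (\<lambda>_. 1) s t"
        by (rule pw_line[OF _ i, of s t y u]) (use st inS le Fu in \<open>auto simp: \<gamma>_def\<close>)
      show "pw_smooth TC (arc_norm M 1) (unit_dir M 1 x \<circ> \<gamma>) (\<lambda>t. \<theta>' t * K (\<theta> t)) s t"
        by (rule arc_line[OF i _ _ \<theta>(3,1,2)]) (use st inS le in \<open>auto simp: \<gamma>_def\<close>)
    next
      fix t assume "t0 < t"
      then show "minimizing_at \<gamma> 1 t"
        by (intro minimizing_straight[OF i Fu, of "t - t0" y t] int le inS conjI) (auto simp: \<gamma>_def)
    next
      fix t assume "t0 \<le> t"
      then show "\<gamma> t \<noteq> cone_apex M x" using pt_apex[OF i inS[OF _ le(1)]] nz by (simp add: \<gamma>_def)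
    next
      show "((\<lambda>t. \<theta>' t * K (\<theta> t)) has_integral T \<phi> - T \<eta>) {t0..}"
        using has_integral_K_top[OF \<theta>(1,2,6), of t0] \<theta>0 by simp
    qed
    moreover have "\<forall>\<tau>\<in>{t0..t0 + 1}. y + \<tau> *\<^sub>R u \<in> S i \<and> \<gamma> \<tau> = pt i (y + \<tau> *\<^sub>R u)"
      using inS le by (auto simp: \<gamma>_def)
    ultimately show ?thesis by (intro exI[of _ \<gamma>] exI[of _ "\<lambda>t. \<theta>' t * K (\<theta> t)"] conjI exI[of _ 1]) auto
  next
    case False
    define j where "j = nxt i"
    have j: "j \<in> I" using nxt_in i by (simp add: j_def)
    interpret B: planar "F j" "ori j" by (rule planar[OF j])
    have "\<forall>\<^sub>F t in at_top. be i < \<theta> t" using order_tendstoD(1)[OF \<theta>(6), of "be i"] False by simp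
    then obtain t2 where t2: "t0 < t2" "be i < \<theta> t2"
      using eventually_conj[OF _ eventually_gt_at_top[of t0]] eventually_happens'[OF trivial_limit_at_top_linorder] by (metis (no_types, lifting))
    have "\<exists>t\<ge>t0. t \<le> t2 \<and> \<theta> t = be i"
      by (rule IVT) (use t2 \<theta>0 ang DERIV_isCont[OF \<theta>(1)] in auto)
    then obtain t1 where t1: "t0 \<le> t1" "\<theta> t1 = be i" by blast
    then have t01: "t0 < t1" using \<theta>0 ang by (cases "t0 = t1") auto
    have lt: "\<theta> t < be i" if "t < t1" for t using mono[OF that] t1 by simp
    have le: "\<theta> t \<le> be i" if "t \<le> t1" for t using mono'[OF that] t1 by simp
    obtain rb where rb: "rb > 0" "b i = rb *\<^sub>R polar (ori i) (be i)" using angle_b[OF i] by blast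
    obtain ra where ra: "ra > 0" "a j = ra *\<^sub>R polar (ori j) (al j)" using angle_a[OF j] by blast
    obtain \<rho>1 where \<rho>1: "\<rho>1 > 0" "y + t1 *\<^sub>R u = \<rho>1 *\<^sub>R polar (ori i) (be i)" using \<theta>(3)[of t1] t1 by auto
    define r1 where "r1 = \<rho>1 / rb"
    have r1: "r1 > 0" "y + t1 *\<^sub>R u = r1 *\<^sub>R b i" using \<rho>1 rb by (auto simp: r1_def)
    have "\<phi> \<in> {be i..be i + pi}" using False ang by auto
    from refract[OF i this, folded j_def] obtain \<phi>' where \<phi>': "\<phi>' \<in> {al j..al j + pi}"
      "dF (N \<phi>) (b i) = B.dF (B.N \<phi>') (a j)" "T \<phi> - T (be i) = B.T \<phi>' - B.T (al j)" by blast
    have "be i + pi \<in> {be i..be i + pi}" by simp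
    \<comment> \<open>The half circles beyond the ray have equal length in both cells. This keeps
      the refracted direction strictly before the opposite of the ray.\<close>
    from refract[OF i this, folded j_def] have full: "T (be i + pi) - T (be i) = B.T (al j + pi) - B.T (al j)" by auto
    have "0 < B.T \<phi>' - B.T (al j)" using \<phi>'(3) T_less[of "be i" \<phi>] False by simp
    then have gt: "al j < \<phi>'" by (simp add: B.T_less_iff)
    have "B.T \<phi>' < B.T (al j + pi)" using \<phi>'(3) full T_less[of \<phi> "be i + pi"] ang by simp
    then have ltpi: "\<phi>' < al j + pi" by (simp add: B.T_less_iff)
    define v where "v = B.N \<phi>'"
    have v: "F j v = 1" "v = (1 / F j (polar (ori j) \<phi>')) *\<^sub>R polar (ori j) \<phi>'" "0 < 1 / F j (polar (ori j) \<phi>')"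
      using B.pos[OF B.polar_nz, of \<phi>'] B.FN[of \<phi>'] by (simp_all add: v_def, simp add: nu_def)
    have uN: "u = N \<phi>" using normalize_polar[OF u] Fu by simp
    define z where "z = r1 *\<^sub>R a j - t1 *\<^sub>R v"
    have z: "z + t1 *\<^sub>R v = r1 *\<^sub>R a j" by (simp add: z_def)
    then have z': "z + t1 *\<^sub>R v = (r1 * ra) *\<^sub>R polar (ori j) (al j)" "0 < r1 * ra" using ra r1 by simp_all
    \<comment> \<open>The arc left after the crossing is the previous one minus the arc of sector
      \<open>i\<close>, which is at least \<open>m\<close>; hence one step of the induction is paid
      for.\<close>
    have "B.T \<phi>' - B.T (al j) < real n * m"
      using Suc.prems(11) m(2)[OF i] \<phi>'(3) by (simp add: algebra_simps)
    from Suc.IH[OF j v(1,2,3) z' order_refl _ gt ltpi this] al_be[OF j]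
    obtain \<gamma>' \<rho>' \<delta> where H: "half_geodesic \<gamma>' t1 \<rho>' (B.T \<phi>' - B.T (al j))"
      and \<delta>: "\<delta> > 0" "\<And>\<tau>. t1 \<le> \<tau> \<Longrightarrow> \<tau> \<le> t1 + \<delta> \<Longrightarrow> z + \<tau> *\<^sub>R v \<in> S j \<and> \<gamma>' \<tau> = pt j (z + \<tau> *\<^sub>R v)" by auto
    have at1: "\<gamma>' t1 = pt i (y + t1 *\<^sub>R u)"
      using \<delta>(2)[of t1] \<delta>(1) pt_ray[OF i, of r1] r1 z by (simp add: j_def)
    define \<gamma> where "\<gamma> t = (if t \<le> t1 then pt i (y + t *\<^sub>R u) else \<gamma>' t)" for t
    define \<rho> where "\<rho> t = (if t < t1 then \<theta>' t * K (\<theta> t) else \<rho>' t)" for t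
    have \<gamma>R: "\<gamma> t = \<gamma>' t" if "t1 \<le> t" for t using that at1 by (cases "t = t1") (auto simp: \<gamma>_def)
    have \<gamma>L: "y + t *\<^sub>R u \<in> S i \<and> \<gamma> t = pt i (y + t *\<^sub>R u)" if "t0 \<le> t" "t \<le> t1" for t
      using inS le that by (auto simp: \<gamma>_def)
    have H': "\<And>s t. s < t \<Longrightarrow> t1 \<le> s \<Longrightarrow> pw_smooth TC (finsler TC) \<gamma>' (\<lambda>_. 1) s t"
      "\<And>t. t1 < t \<Longrightarrow> minimizing_at \<gamma>' 1 t" "\<And>t. t1 \<le> t \<Longrightarrow> \<gamma>' t \<noteq> cone_apex M x"
      "\<And>s t. s < t \<Longrightarrow> t1 \<le> s \<Longrightarrow> pw_smooth TC (arc_norm M 1) (unit_dir M 1 x \<circ> \<gamma>') \<rho>' s t"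
      "(\<rho>' has_integral B.T \<phi>' - B.T (al j)) {t1..}"
      using H unfolding half_geodesic_def by blast+
    have "half_geodesic \<gamma> t0 \<rho> (T \<phi> - T \<eta>)"
      unfolding half_geodesic_def
    proof (intro conjI allI impI)
      fix s t assume st: "t0 \<le> s \<and> s < t"
      show "pw_smooth TC (finsler TC) \<gamma> (\<lambda>_. 1) s t"
      proof (rule pw_smooth_glue[where P = "\<lambda>s. t0 \<le> s" and ?t1.0 = t1])
        show "pw_smooth TC (finsler TC) \<gamma> (\<lambda>_. 1) s t" if "s < t" "t0 \<le> s" "t \<le> t1" for s t
          by (rule pw_line[OF that(1) i, of y u]) (use that \<gamma>L Fu in auto)
        show "pw_smooth TC (finsler TC) \<gamma> (\<lambda>_. 1) s t" if "s < t" "t1 \<le> s" for s t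
          by (rule pw_smooth_cong[OF H'(1)[OF that]]) (use that \<gamma>R in auto)
      qed (use st in auto)
      show "pw_smooth TC (arc_norm M 1) (unit_dir M 1 x \<circ> \<gamma>) \<rho> s t"
      proof (rule pw_smooth_glue[where P = "\<lambda>s. t0 \<le> s" and ?t1.0 = t1])
        show "pw_smooth TC (arc_norm M 1) (unit_dir M 1 x \<circ> \<gamma>) \<rho> s t" if "s < t" "t0 \<le> s" "t \<le> t1" for s t
          by (rule arc_line[OF i that(1) _ \<theta>(3,1,2)]) (use that \<gamma>L in \<open>auto simp: \<rho>_def\<close>)
        show "pw_smooth TC (arc_norm M 1) (unit_dir M 1 x \<circ> \<gamma>) \<rho> s t" if "s < t" "t1 \<le> s" for s t
          by (rule pw_smooth_cong[OF H'(4)[OF that]]) (use that \<gamma>R in \<open>auto simp: \<rho>_def\<close>)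
      qed (use st in auto)
    next
      fix t assume t: "t0 < t"
      consider "t < t1" | "t = t1" | "t1 < t" by linarith
      then show "minimizing_at \<gamma> 1 t"
      proof cases
        case 1
        define d where "d = min (t - t0) (t1 - t)"
        have d: "0 < d" "d \<le> t - t0" "d \<le> t1 - t" using 1 t by (auto simp: d_def)
        show ?thesis
          by (rule minimizing_straight[OF i Fu d(1) int[OF t lt[OF 1]]]) (use \<gamma>L d in auto)
      next
        case 2
        define d where "d = min (t1 - t0) \<delta>"
        have d: "0 < d" "d \<le> t1 - t0" "d \<le> \<delta>" using t01 \<delta>(1) by (auto simp: d_def)
        show ?thesis unfolding 2
          by (rule minimizing_crossing[OF i Fu v(1)[unfolded j_def] d(1) r1(1,2) z[unfolded j_def] \<phi>'(2)[folded uN v_def, unfolded j_def]])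
            (use \<gamma>L \<gamma>R \<delta> d in \<open>auto simp: j_def\<close>)
      next
        case 3
        show ?thesis by (rule minimizing_cong[OF H'(2)[OF 3], of "t - t1"]) (use 3 \<gamma>R in auto)
      qed
    next
      fix t assume t: "t0 \<le> t"
      show "\<gamma> t \<noteq> cone_apex M x"
        using H'(3)[of t] \<gamma>R[of t] \<gamma>L[of t] pt_apex[OF i] nz t by (cases "t1 \<le> t") auto
    next
      have "((\<lambda>t. \<theta>' t * K (\<theta> t)) has_integral T (be i) - T \<eta>) {t0..t1}"
        using has_integral_K[of t0 t1, OF _ \<theta>(1)] \<theta>0 t1 by simp
      then have "(\<rho> has_integral T (be i) - T \<eta>) {t0..t1}"
        by (rule has_integral_spike_finite[of "{t1}", rotated 2]) (auto simp: \<rho>_def)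
      moreover have "(\<rho> has_integral B.T \<phi>' - B.T (al j)) {t1..}"
        by (rule has_integral_eq[OF _ H'(5)]) (auto simp: \<rho>_def)
      moreover have "{t0..t1} \<inter> {t1..} = {t1}" "{t0..t1} \<union> {t1..} = {t0..}" using t01 by auto
      ultimately have "(\<rho> has_integral (T (be i) - T \<eta>) + (B.T \<phi>' - B.T (al j))) {t0..}"
        using has_integral_Un[of \<rho> _ "{t0..t1}" _ "{t1..}"] by simp
      moreover have "(T (be i) - T \<eta>) + (B.T \<phi>' - B.T (al j)) = T \<phi> - T \<eta>" using \<phi>'(3) by simp
      ultimately show "(\<rho> has_integral T \<phi> - T \<eta>) {t0..}" by simp
    qed
    moreover have "\<forall>\<tau>\<in>{t0..t0 + (t1 - t0)}. y + \<tau> *\<^sub>R u \<in> S i \<and> \<gamma> \<tau> = pt i (y + \<tau> *\<^sub>R u)" using \<gamma>L by auto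
    ultimately show ?thesis using t01 by (intro exI[of _ \<gamma>] exI[of _ \<rho>] conjI exI[of _ "t1 - t0"]) auto
  qed
qed

end

section \<open>Lengths of indicatrices\<close>

context vertex_cone begin

lemma refract_half: assumes "i \<in> I"
  shows "Th (F i) (ori i) (be i + pi) - Th (F i) (ori i) (be i)
    = Th (F (nxt i)) (ori (nxt i)) (al (nxt i) + pi) - Th (F (nxt i)) (ori (nxt i)) (al (nxt i))"
  using refract[OF assms, of "be i + pi"] by auto

text \<open>At a common ray \<open>refract\<close> compares the half circles on one side and
  \<open>half_minus\<close> those on the other; their sum is a full turn. The equality spreads
  around the vertex by \<open>conn\<close>.\<close>

lemma total_length: assumes "i \<in> I" "j \<in> I" shows "Th (F i) (ori i) (2 * pi) = Th (F j) (ori j) (2 * pi)"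
proof -
  have step: "Th (F k) (ori k) (2 * pi) = Th (F (nxt k)) (ori (nxt k)) (2 * pi)" if k: "k \<in> I" for k
  proof -
    interpret A: planar "F k" "ori k" by (rule planar[OF k])
    interpret B: planar "F (nxt k)" "ori (nxt k)" by (rule planar[OF nxt_in[OF k]])
    show ?thesis
      using refract_half[OF k] half_minus[OF k] A.T_period[of "be k - pi"] B.T_period[of "al (nxt k) - pi"]
      by (simp add: algebra_simps)
  qed
  have "{k \<in> I. Th (F k) (ori k) (2 * pi) = Th (F i) (ori i) (2 * pi)} = I"
    by (rule conn) (use assms step nxt_in in auto)
  then have "j \<in> {k \<in> I. Th (F k) (ori k) (2 * pi) = Th (F i) (ori i) (2 * pi)}"
    using assms(2) by (simp only:)
  then show ?thesis by simp
qed

definition sector_arc :: "'i \<Rightarrow> real" where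
  "sector_arc i = Th (F i) (ori i) (be i) - Th (F i) (ori i) (al i)"

lemma sector_arc_pos: assumes "i \<in> I" shows "0 < sector_arc i"
proof -
  interpret planar "F i" "ori i" by (rule planar[OF assms])
  show ?thesis using T_less[of "al i" "be i"] al_be[OF assms] by (simp add: sector_arc_def)
qed

text \<open>The half circles on one side of a common ray have equal lengths, so going once around the
  vertex the opposite sectors have the same total length as the sectors.\<close>

lemma opposite_arcs: "(\<Sum>i\<in>I. Th (F i) (ori i) (be i + pi) - Th (F i) (ori i) (al i + pi)) = (\<Sum>i\<in>I. sector_arc i)"
proof -
  define d where "d i = Th (F i) (ori i) (al i + pi) - Th (F i) (ori i) (al i)" for i
  have "Th (F i) (ori i) (be i + pi) - Th (F i) (ori i) (al i + pi) = sector_arc i + (d (nxt i) - d i)" if "i \<in> I" for i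
    using refract_half[OF that] by (simp add: sector_arc_def d_def)
  then have "(\<Sum>i\<in>I. Th (F i) (ori i) (be i + pi) - Th (F i) (ori i) (al i + pi))
      = (\<Sum>i\<in>I. sector_arc i) + ((\<Sum>i\<in>I. d (nxt i)) - (\<Sum>i\<in>I. d i))"
    by (simp add: sum.distrib sum_subtractf)
  also have "(\<Sum>i\<in>I. d (nxt i)) = (\<Sum>i\<in>I. d i)" by (rule sum.reindex_bij_betw[OF nxt])
  finally show ?thesis by simp
qed

text \<open>The orbit of \<open>i0\<close> under the injective map \<open>nxt\<close> returns to
  \<open>i0\<close> since \<open>I\<close> is finite, and up to the first return it has no
  repetition. Being closed under \<open>nxt\<close>, it is all of \<open>I\<close>.\<close>

lemma cyclic_enumeration:
  assumes i0: "i0 \<in> I"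
  obtains n where "0 < n" "(nxt ^^ n) i0 = i0" "bij_betw (\<lambda>k. (nxt ^^ k) i0) {..<n} I"
proof -
  define q where "q k = (nxt ^^ k) i0" for k
  have q: "q 0 = i0" "q (Suc k) = nxt (q k)" for k by (simp_all add: q_def)
  have qI: "q k \<in> I" for k by (induction k) (use q i0 nxt_in in auto)
  \<comment> \<open>Injectivity lowers both indices together until one of them is 0, so every
    coincidence is a return to \<open>i0\<close>.\<close>
  have shift: "q (k + d) = q k \<Longrightarrow> q d = i0" for k d
    by (induction k) (use q nxt_inj qI in auto)
  have rep: "\<exists>p>0. q p = i0"
  proof -
    have "\<not> inj q"
      using finite_imageD[of q UNIV] finite_subset[OF _ finI, of "range q"] qI by auto
    then obtain k l where "k < l" "q k = q l" unfolding inj_def by (metis linorder_neqE_nat)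
    then show ?thesis using shift[of k "l - k"] by (intro exI[of _ "l - k"]) auto
  qed
  define n where "n = (LEAST p. 0 < p \<and> q p = i0)"
  have n: "0 < n" "q n = i0" using LeastI_ex[OF rep] by (simp_all add: n_def)
  have least: "n \<le> p" if "0 < p" "q p = i0" for p unfolding n_def by (rule Least_le) (use that in simp)
  have inj: "inj_on q {..<n}"
  proof (rule linorder_inj_onI)
    fix k l assume "k < l" "k \<in> {..<n}" "l \<in> {..<n}"
    then show "q k \<noteq> q l" using shift[of k "l - k"] least[of "l - k"] by force
  qed auto
  have "q ` {..<n} = I"
  proof (rule conn)
    show "q ` {..<n} \<noteq> {}" using n by auto
    show "nxt ` q ` {..<n} \<subseteq> q ` {..<n}"
    proof
      fix y assume "y \<in> nxt ` q ` {..<n}"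
      then obtain k where k: "k < n" "y = q (Suc k)" using q by auto
      show "y \<in> q ` {..<n}"
      proof (cases "Suc k = n")
        case True
        then show ?thesis using k n q by (metis image_eqI lessThan_iff)
      next
        case False
        then show ?thesis using k by auto
      qed
    qed
  qed (use qI in auto)
  then show ?thesis
    by (intro that[of n]) (use n inj in \<open>simp_all add: q_def[abs_def] bij_betw_def\<close>)
qed

text \<open>The chord between the spanning vectors serves as a smooth parameter for the arc of the
  sector after radial projection.\<close>

lemma sector_param:
  assumes i: "i \<in> I"
  shows "\<exists>\<theta> \<theta>'. (\<forall>t. (\<theta> has_real_derivative \<theta>' t) (at t)) \<and> (\<forall>t. 0 < \<theta>' t) \<and>
     (\<forall>t. \<exists>\<rho>>0. a i + t *\<^sub>R (b i - a i) = \<rho> *\<^sub>R polar (ori i) (\<theta> t)) \<and> \<theta> 0 = al i \<and> \<theta> 1 = be i"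
proof -
  interpret planar "F i" "ori i" by (rule planar[OF i])
  obtain ra rb where r: "ra > 0" "a i = ra *\<^sub>R polar (ori i) (al i)" "rb > 0" "b i = rb *\<^sub>R polar (ori i) (be i)"
    using angle_a[OF i] angle_b[OF i] by blast
  have cr: "0 < ori i * cross2 (a i) (b i - a i)" using cross_ab[OF i] by simp
  also have "\<dots> = ra * (ori i * cross2 (polar (ori i) (al i)) (b i - a i))"
    by (subst (1) r(2)) (simp add: algebra_simps)
  finally have "0 < ori i * cross2 (polar (ori i) (al i)) (b i - a i)"
    using r(1) zero_less_mult_pos by blast
  from ex_polar_gt[OF this] obtain s \<phi> where s: "s > 0" "\<phi> \<in> {al i<..<al i + pi}" "b i - a i = s *\<^sub>R polar (ori i) \<phi>" by blast
  obtain \<theta> \<theta>' where \<theta>: "\<And>t. (\<theta> has_real_derivative \<theta>' t) (at t)" "\<And>t. 0 < \<theta>' t"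
      "\<And>t. \<exists>\<rho>>0. a i + t *\<^sub>R (b i - a i) = \<rho> *\<^sub>R polar (ori i) (\<theta> t)" "\<And>t. \<phi> - pi < \<theta> t" "\<And>t. \<theta> t < \<phi>"
    using line_polar[OF cr s(3,1)] by blast
  obtain \<rho>0 \<rho>1 where \<rho>: "\<rho>0 > 0" "a i = \<rho>0 *\<^sub>R polar (ori i) (\<theta> 0)" "\<rho>1 > 0" "b i = \<rho>1 *\<^sub>R polar (ori i) (\<theta> 1)"
    using \<theta>(3)[of 0] \<theta>(3)[of 1] by auto
  have "\<theta> 0 = al i" using polar_eqD(1)[of \<rho>0 "\<theta> 0" ra "al i"] \<rho> r \<theta>(4,5)[of 0] s(2) by auto
  moreover have "\<theta> 1 = be i"
    using polar_eqD(1)[of \<rho>1 "\<theta> 1" rb "be i"] \<rho> r \<theta>(4,5)[of 1] s(2) al_be[OF i] by auto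
  ultimately show ?thesis using \<theta>(1-3) by blast
qed

text \<open>The circle is the radial projection of the closed polygon of chords from
  \<open>a\<close> to \<open>b\<close>, one unit of time per cell in cyclic order. Gluing makes
  consecutive chords meet, and each contributes the arc of its sector.\<close>

lemma circle_length_eq: "circle_length M 1 x (\<Sum>i\<in>I. sector_arc i)"
proof -
  obtain i0 where i0: "i0 \<in> I" using I_ne by blast
  obtain n where n: "0 < n" "(nxt ^^ n) i0 = i0" "bij_betw (\<lambda>k. (nxt ^^ k) i0) {..<n} I"
    by (rule cyclic_enumeration[OF i0])
  define q where "q k = (nxt ^^ k) i0" for k
  have q: "q 0 = i0" "q (Suc k) = nxt (q k)" for k by (simp_all add: q_def)
  have qI: "q k \<in> I" for k by (induction k) (use q i0 nxt_in in auto)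
  have "\<forall>i\<in>I. \<exists>\<theta> \<theta>'. (\<forall>t. (\<theta> has_real_derivative \<theta>' t) (at t)) \<and> (\<forall>t. 0 < \<theta>' t) \<and>
     (\<forall>t. \<exists>\<rho>>0. a i + t *\<^sub>R (b i - a i) = \<rho> *\<^sub>R polar (ori i) (\<theta> t)) \<and> \<theta> 0 = al i \<and> \<theta> 1 = be i"
    by (rule ballI, rule sector_param)
  from bchoice[OF this] obtain \<theta> where "\<forall>i\<in>I. \<exists>\<theta>'. (\<forall>t. (\<theta> i has_real_derivative \<theta>' t) (at t)) \<and> (\<forall>t. 0 < \<theta>' t) \<and>
     (\<forall>t. \<exists>\<rho>>0. a i + t *\<^sub>R (b i - a i) = \<rho> *\<^sub>R polar (ori i) (\<theta> i t)) \<and> \<theta> i 0 = al i \<and> \<theta> i 1 = be i" ..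
  from bchoice[OF this] obtain \<theta>' where
    "\<forall>i\<in>I. (\<forall>t. (\<theta> i has_real_derivative \<theta>' i t) (at t)) \<and> (\<forall>t. 0 < \<theta>' i t) \<and>
     (\<forall>t. \<exists>\<rho>>0. a i + t *\<^sub>R (b i - a i) = \<rho> *\<^sub>R polar (ori i) (\<theta> i t)) \<and> \<theta> i 0 = al i \<and> \<theta> i 1 = be i" ..
  then have \<theta>: "\<And>i t. i \<in> I \<Longrightarrow> (\<theta> i has_real_derivative \<theta>' i t) (at t)" "\<And>i t. i \<in> I \<Longrightarrow> 0 < \<theta>' i t"
     "\<And>i t. i \<in> I \<Longrightarrow> \<exists>\<rho>>0. a i + t *\<^sub>R (b i - a i) = \<rho> *\<^sub>R polar (ori i) (\<theta> i t)"
     "\<And>i. i \<in> I \<Longrightarrow> \<theta> i 0 = al i" "\<And>i. i \<in> I \<Longrightarrow> \<theta> i 1 = be i" by blast+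
  define c where "c i s = a i + s *\<^sub>R (b i - a i)" for i and s :: real
  have cAB: "cA i (c i s) = 1 - s" "cB i (c i s) = s" if "i \<in> I" for i s
    using that by (simp_all add: c_def)
  have cS: "c i s \<in> S i" "c i s \<noteq> 0" if "i \<in> I" "0 \<le> s" "s \<le> 1" for i s
  proof -
    show "c i s \<in> S i" using that cAB by (simp add: S_iff)
    show "c i s \<noteq> 0"
    proof
      assume "c i s = 0"
      then show False using cAB[OF that(1), of s] by simp
    qed
  qed
  \<comment> \<open>At an integer time the floor selects the cell that begins there;
    \<open>\<gamma>k\<close> shows that the end of the previous chord is the same point.\<close>
  define \<gamma> where "\<gamma> t = (let k = nat \<lfloor>t\<rfloor> in pt (q k) (c (q k) (t - real k)))" for t
  define \<rho> where "\<rho> t = (let k = nat \<lfloor>t\<rfloor> in \<theta>' (q k) (t - real k) * kap (F (q k)) (ori (q k)) (\<theta> (q k) (t - real k)))" for t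
  have fl: "nat \<lfloor>t\<rfloor> = k" if "real k \<le> t" "t < real k + 1" for t k
    using that by (metis floor_of_nat floor_unique nat_int of_int_of_nat_eq)
  have \<gamma>k: "\<gamma> t = pt (q k) (c (q k) (t - real k))" if "real k \<le> t" "t \<le> real k + 1" for t k
  proof (cases "t = real k + 1")
    case True
    have "nat \<lfloor>t\<rfloor> = Suc k" by (rule fl) (use True in auto)
    then have "\<gamma> t = pt (q (Suc k)) (a (q (Suc k)))" by (simp add: \<gamma>_def c_def True)
    also have "\<dots> = pt (q k) (b (q k))" using pt_ray[OF qI[of k], of 1] by (simp add: q)
    finally show ?thesis by (simp add: c_def True)
  next
    case False
    then have "nat \<lfloor>t\<rfloor> = k" by (intro fl) (use that in auto)
    then show ?thesis by (simp add: \<gamma>_def)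
  qed
  define \<tau> where "\<tau> = unit_dir M 1 x \<circ> \<gamma>"
  have piece: "pw_smooth TC (arc_norm M 1) \<tau> \<rho> (real k) (real k + 1) \<and> (\<rho> has_integral sector_arc (q k)) {real k..real k + 1}" for k
  proof -
    define i where "i = q k"
    have i: "i \<in> I" using qI by (simp add: i_def)
    interpret planar "F i" "ori i" by (rule planar[OF i])
    define \<psi> where "\<psi> t = \<theta> i (t - real k)" for t
    define \<psi>' where "\<psi>' t = \<theta>' i (t - real k)" for t
    have \<psi>: "(\<psi> has_real_derivative \<psi>' t) (at t)" "0 < \<psi>' t" for t
    proof -
      have "(\<psi> has_real_derivative \<psi>' t * 1) (at t)" unfolding \<psi>_def[abs_def] \<psi>'_def
        by (rule DERIV_chain2[OF \<theta>(1)[OF i]]) (auto intro!: derivative_eq_intros)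
      then show "(\<psi> has_real_derivative \<psi>' t) (at t)" by simp
      show "0 < \<psi>' t" using \<theta>(2)[OF i] by (simp add: \<psi>'_def)
    qed
    have line: "(a i - real k *\<^sub>R (b i - a i)) + t *\<^sub>R (b i - a i) = c i (t - real k)" for t
      by (simp add: c_def algebra_simps)
    have \<rho>k: "\<rho> t = \<psi>' t * K (\<psi> t)" if "real k \<le> t" "t < real k + 1" for t
      using fl[OF that] by (simp add: \<rho>_def \<psi>_def \<psi>'_def i_def)
    have "pw_smooth TC (arc_norm M 1) \<tau> \<rho> (real k) (real k + 1)"
      unfolding \<tau>_def
    proof (rule arc_line[OF i, where y = "a i - real k *\<^sub>R (b i - a i)" and u = "b i - a i" and \<theta> = \<psi> and \<theta>' = \<psi>'])
      fix t assume t: "real k \<le> t" "t \<le> real k + 1"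
      show "a i - real k *\<^sub>R (b i - a i) + t *\<^sub>R (b i - a i) \<in> S i
          \<and> \<gamma> t = pt i (a i - real k *\<^sub>R (b i - a i) + t *\<^sub>R (b i - a i))"
        unfolding line using cS(1)[OF i, of "t - real k"] \<gamma>k[OF t] t by (simp add: i_def)
    next
      fix t show "\<exists>\<rho>>0. a i - real k *\<^sub>R (b i - a i) + t *\<^sub>R (b i - a i) = \<rho> *\<^sub>R polar (ori i) (\<psi> t)"
        unfolding line c_def \<psi>_def by (rule \<theta>(3)[OF i])
    qed (use \<psi> \<rho>k in auto)
    moreover have "((\<lambda>t. \<psi>' t * K (\<psi> t)) has_integral T (\<psi> (real k + 1)) - T (\<psi> (real k))) {real k..real k + 1}"
      by (rule has_integral_K[OF _ \<psi>(1)]) simp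
    then have "((\<lambda>t. \<psi>' t * K (\<psi> t)) has_integral sector_arc i) {real k..real k + 1}"
      using \<theta>(4,5)[OF i] by (simp add: \<psi>_def sector_arc_def)
    then have "(\<rho> has_integral sector_arc i) {real k..real k + 1}"
      by (rule has_integral_spike_finite[of "{real k + 1}", rotated 2]) (auto simp: \<rho>k)
    ultimately show ?thesis by (simp add: i_def)
  qed
  have tot: "pw_smooth TC (arc_norm M 1) \<tau> \<rho> 0 (real (Suc k)) \<and> (\<rho> has_integral (\<Sum>l<Suc k. sector_arc (q l))) {0..real (Suc k)}" for k
  proof (induction k)
    case 0
    then show ?case using piece[of 0] by simp
  next
    case (Suc k)
    have p: "pw_smooth TC (arc_norm M 1) \<tau> \<rho> (real (Suc k)) (real (Suc (Suc k)))"
      "(\<rho> has_integral sector_arc (q (Suc k))) {real (Suc k)..real (Suc (Suc k))}"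
      using piece[of "Suc k"] by (simp_all add: add.commute)
    have "(\<rho> has_integral (\<Sum>l<Suc k. sector_arc (q l)) + sector_arc (q (Suc k))) {0..real (Suc (Suc k))}"
      by (rule has_integral_combine[OF _ _ conjunct2[OF Suc] p(2)]) auto
    moreover have "(\<Sum>l<Suc k. sector_arc (q l)) + sector_arc (q (Suc k)) = (\<Sum>l<Suc (Suc k). sector_arc (q l))" by simp
    ultimately show ?case using pw_smooth.join[OF conjunct1[OF Suc] p(1)] by simp
  qed
  have bij: "bij_betw q {..<n} I" using n(3) by (simp add: q_def[abs_def])
  have sum: "(\<Sum>l<n. sector_arc (q l)) = (\<Sum>i\<in>I. sector_arc i)" by (rule sum.reindex_bij_betw[OF bij])
  have nS: "real (Suc (n - 1)) = real n" "Suc (n - 1) = n" using n(1) by auto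
  have qn: "q n = i0" using n(2) by (simp add: q_def)
  have \<tau>k: "\<tau> t = pt (q k) ((1 / F (q k) (c (q k) (t - real k))) *\<^sub>R c (q k) (t - real k))"
    if "real k \<le> t" "t \<le> real k + 1" for t k
    unfolding \<tau>_def o_def \<gamma>k[OF that] using cS[OF qI, of "t - real k" k] that by (intro unit_dir_pt[OF qI]) auto
  have locate: "\<exists>k<n. real k \<le> t \<and> t < real k + 1" if t: "0 \<le> t" "t < real n" for t
  proof -
    have "real (nat \<lfloor>t\<rfloor>) \<le> t" "t < real (nat \<lfloor>t\<rfloor>) + 1" using t by linarith+
    moreover from this have "nat \<lfloor>t\<rfloor> < n" using t(2) by linarith
    ultimately show ?thesis by blast
  qed
  have ends: "\<tau> 0 = \<tau> (real n)"
    using \<tau>k[of 0 0] \<tau>k[of n "real n"] by (simp add: q(1) qn)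
  have img: "\<tau> ` {0..real n} = indicatrix M 1 x"
  proof
    show "\<tau> ` {0..real n} \<subseteq> indicatrix M 1 x"
    proof
      fix P assume "P \<in> \<tau> ` {0..real n}"
      then obtain t0 where t0: "0 \<le> t0" "t0 \<le> real n" "P = \<tau> t0" by auto
      have "\<exists>t. 0 \<le> t \<and> t < real n \<and> P = \<tau> t"
      proof (cases "t0 = real n")
        case True
        then have "P = \<tau> 0" using ends t0 by simp
        then show ?thesis using n(1) by (intro exI[of _ 0]) auto
      next
        case False
        then show ?thesis using t0 by (intro exI[of _ t0]) auto
      qed
      then obtain t where t: "0 \<le> t" "t < real n" "P = \<tau> t" by blast
      obtain k where k: "real k \<le> t" "t < real k + 1" using locate t by blast
      interpret minkowski "F (q k)" by (rule minkowski[OF qI])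
      define z where "z = c (q k) (t - real k)"
      have z: "z \<in> S (q k)" "z \<noteq> 0" using cS[OF qI, of "t - real k" k] k by (auto simp: z_def)
      then have "P = pt (q k) ((1 / F (q k) z) *\<^sub>R z)" using \<tau>k[of k t] k t by (simp add: z_def)
      moreover have "(1 / F (q k) z) *\<^sub>R z \<in> S (q k)" "F (q k) ((1 / F (q k) z) *\<^sub>R z) = 1"
        using S_scale[OF qI z(1)] pos[OF z(2)] by (simp_all add: scale)
      ultimately show "P \<in> indicatrix M 1 x" using qI[of k] unfolding indicatrix_eq[of 1, simplified] by blast
    qed
    show "indicatrix M 1 x \<subseteq> \<tau> ` {0..real n}"
    proof
      fix P assume "P \<in> indicatrix M 1 x"
      then obtain i y where y: "P = pt i y" "i \<in> I" "y \<in> S i" "F i y = 1" by (auto simp: indicatrix_eq)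
      interpret minkowski "F i" by (rule minkowski[OF y(2)])
      obtain k where k: "k < n" "q k = i" using bij y(2) unfolding bij_betw_def by auto
      \<comment> \<open>The ray through \<open>y\<close> meets the chord in \<open>y\<close> divided
        by \<open>s\<close>, which gives the parameter that hits \<open>P\<close>.\<close>
      define s where "s = cA i y + cB i y"
      have nn: "0 \<le> cA i y" "0 \<le> cB i y" using y S_iff by auto
      have ex: "y = cA i y *\<^sub>R a i + cB i y *\<^sub>R b i" by (rule expand[OF y(2)])
      have "s \<noteq> 0"
      proof
        assume "s = 0"
        then have "cA i y = 0" "cB i y = 0" using nn by (auto simp: s_def)
        then have "y = 0" using ex by simp
        then show False using y(4) by simp
      qed
      then have s: "s > 0" using nn by (simp add: s_def)
      define t where "t = cB i y / s"
      have t: "0 \<le> t" "t \<le> 1" using nn s by (auto simp: t_def s_def)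
      have "s *\<^sub>R c i t = (s - s * t) *\<^sub>R a i + (s * t) *\<^sub>R b i" by (simp add: c_def algebra_simps)
      also have "\<dots> = y" using s ex by (simp add: t_def s_def)
      finally have yc: "s *\<^sub>R c i t = y" .
      have "s * F i (c i t) = 1" using y(4) s unfolding yc[symmetric] by (simp add: scale)
      then have "F i (c i t) = 1 / s" using s by (simp add: eq_divide_eq mult.commute)
      then have "1 / F i (c i t) = s" by simp
      then have "\<tau> (real k + t) = P" using \<tau>k[of k "real k + t"] t k y(1) yc by simp
      moreover have "real k + t \<in> {0..real n}" using t k by auto
      ultimately show "P \<in> \<tau> ` {0..real n}" by force
    qed
  qed
  have inj: "inj_on \<tau> {0..<real n}"
  proof (rule inj_onI)
    fix t t' assume t: "t \<in> {0..<real n}" "t' \<in> {0..<real n}" and eq: "\<tau> t = \<tau> t'"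
    obtain k where k: "k < n" "real k \<le> t" "t < real k + 1" using locate[of t] t(1) by auto
    obtain k' where k': "k' < n" "real k' \<le> t'" "t' < real k' + 1" using locate[of t'] t(2) by auto
    define i j where "i = q k" and "j = q k'"
    have ij: "i \<in> I" "j \<in> I" using qI by (auto simp: i_def j_def)
    define s s' where "s = t - real k" and "s' = t' - real k'"
    have s: "0 \<le> s" "s < 1" "0 \<le> s'" "s' < 1" using k k' by (auto simp: s_def s'_def)
    interpret A: minkowski "F i" by (rule minkowski[OF ij(1)])
    interpret B: minkowski "F j" by (rule minkowski[OF ij(2)])
    define r r' where "r = 1 / F i (c i s)" and "r' = 1 / F j (c j s')"
    have r: "r > 0" "r' > 0" using A.pos[OF cS(2)[OF ij(1), of s]] B.pos[OF cS(2)[OF ij(2), of s']] s by (simp_all add: r_def r'_def)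
    have eq': "pt i (r *\<^sub>R c i s) = pt j (r' *\<^sub>R c j s')"
      using eq unfolding \<tau>k[OF k(2) less_imp_le[OF k(3)]] \<tau>k[OF k'(2) less_imp_le[OF k'(3)]]
      unfolding i_def j_def s_def s'_def r_def r'_def .
    have inS: "r *\<^sub>R c i s \<in> S i" "r' *\<^sub>R c j s' \<in> S j" 
      using S_scale[OF ij(1) cS(1)[OF ij(1), of s], of r] S_scale[OF ij(2) cS(1)[OF ij(2), of s'], of r'] s r by simp_all
    \<comment> \<open>On half-open unit intervals a point is never on the last ray of its cell. Two
      cells can share a point only on a ray that is last for one of them, so the cells
      coincide.\<close>
    have pA: "0 < cA i (r *\<^sub>R c i s)" "0 < cA j (r' *\<^sub>R c j s')" 
      using s r by (simp_all only: cAB_simps(5) cAB(1)[OF ij(1)] cAB(1)[OF ij(2)]) simp_all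
    have ie: "i = j"
    proof (rule ccontr)
      assume ne: "i \<noteq> j"
      have "r *\<^sub>R c i s \<noteq> 0"
      proof
        assume "r *\<^sub>R c i s = 0"
        then have "cA i (r *\<^sub>R c i s) = cA i 0" by (simp only:)
        then show False using pA(1) cAB_simps(7)[of i] by linarith
      qed
      then obtain w w' u where w: "ray i w j w'" "r *\<^sub>R c i s = u *\<^sub>R w" "r' *\<^sub>R c j s' = u *\<^sub>R w'"
        using pt_eq_ray[OF ij(1) inS(1) ij(2) inS(2) eq' _ ne] by blast
      have "w \<noteq> b i" using pA(1) unfolding w(2) by auto
      moreover have "w' \<noteq> b j" using pA(2) unfolding w(3) by auto
      ultimately show False using w(1) by (auto simp: ray_def)
    qed
    then have "r *\<^sub>R c i s = r' *\<^sub>R c i s'" using eq' inS pt_same[OF ij(1)] by simp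
    then have "cA i (r *\<^sub>R c i s) = cA i (r' *\<^sub>R c i s')" "cB i (r *\<^sub>R c i s) = cB i (r' *\<^sub>R c i s')"
      by (simp_all only:)
    then have rs: "r * (1 - s) = r' * (1 - s')" "r * s = r' * s'"
      by (simp_all only: cAB_simps(5,6) cAB[OF ij(1)])
    then have "r = r'" by (simp add: right_diff_distrib)
    then have "s = s'" using r rs(2) by simp
    moreover have "k = k'" using bij k(1) k'(1) ie by (auto simp: bij_betw_def inj_on_def i_def j_def)
    ultimately show "t = t'" by (simp add: s_def s'_def)
  qed
  show ?thesis unfolding circle_length_def
  proof (intro exI conjI)
    show "pw_smooth TC (arc_norm M 1) \<tau> \<rho> 0 (real n)" using tot[of "n - 1"] nS by simp
    show "(\<Sum>i\<in>I. sector_arc i) = integral {0..real n} \<rho>"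
      by (rule integral_unique[symmetric]) (use tot[of "n - 1"] nS sum in simp)
  qed (use img inj ends in auto)
qed

end

section \<open>Perturbed rays and their angles\<close>

context vertex_cone begin

lemma polar_of_S: assumes i: "i \<in> I" and y: "y \<in> S i" "y \<noteq> 0"
  shows "\<exists>r>0. \<exists>\<eta>\<in>{al i..be i}. y = r *\<^sub>R polar (ori i) \<eta>"
proof -
  interpret planar "F i" "ori i" by (rule planar[OF i])
  obtain ra where ra: "ra > 0" "a i = ra *\<^sub>R polar (ori i) (al i)" using angle_a[OF i] by blast
  obtain k k' where k: "0 < k" "0 < k'" "\<And>\<rho> \<theta>. cA i (\<rho> *\<^sub>R polar (ori i) \<theta>) = k * \<rho> * sin (be i - \<theta>)"
    "\<And>\<rho> \<theta>. cB i (\<rho> *\<^sub>R polar (ori i) \<theta>) = k' * \<rho> * sin (\<theta> - al i)"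
    using cAB_polar[OF i] by blast
  have "ori i * cross2 (a i) y = cB i y * (ori i * cross2 (a i) (b i))" using cross_nz[OF i] by (simp add: cB_def)
  also have "\<dots> \<ge> 0" using cross_ab[OF i] y S_iff[OF i] by simp
  finally have "0 \<le> ra * (ori i * cross2 (polar (ori i) (al i)) y)" unfolding ra(2) by (simp add: mult.left_commute)
  then have "0 \<le> ori i * cross2 (polar (ori i) (al i)) y" using ra(1) by (simp only: zero_le_mult_iff) auto
  from ex_polar_ge[OF y(2) this] obtain r \<eta> where r: "r > 0" "\<eta> \<in> {al i..al i + pi}" "y = r *\<^sub>R polar (ori i) \<eta>" by blast
  have "\<eta> \<le> be i"
  proof (rule ccontr)
    assume "\<not> \<eta> \<le> be i"
    then have "0 < sin (\<eta> - be i)" using r al_be[OF i] by (intro sin_gt_zero) auto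
    then have "sin (be i - \<eta>) < 0" using sin_minus[of "\<eta> - be i"] by simp
    then have "cA i y < 0" unfolding r(3) k(3) using k(1) r(1) by (simp add: mult_pos_neg)
    then show False using y S_iff[OF i] by simp
  qed
  then show ?thesis using r by (intro exI[of _ r] conjI bexI[of _ \<eta>]) auto
qed

lemma polar_of_interior: assumes i: "i \<in> I" and y: "0 < cA i y" "0 < cB i y"
  shows "\<exists>r>0. \<exists>\<eta>. al i < \<eta> \<and> \<eta> < be i \<and> y = r *\<^sub>R polar (ori i) \<eta>"
proof -
  have "y \<in> S i" "y \<noteq> 0" using i y S_iff by auto
  from polar_of_S[OF i this] obtain r \<eta> where r: "r > 0" "\<eta> \<in> {al i..be i}" "y = r *\<^sub>R polar (ori i) \<eta>" by blast
  obtain k k' where k: "0 < k" "0 < k'" "\<And>\<rho> \<theta>. cA i (\<rho> *\<^sub>R polar (ori i) \<theta>) = k * \<rho> * sin (be i - \<theta>)"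
    "\<And>\<rho> \<theta>. cB i (\<rho> *\<^sub>R polar (ori i) \<theta>) = k' * \<rho> * sin (\<theta> - al i)"
    using cAB_polar[OF i] by blast
  have "\<eta> \<noteq> al i" "\<eta> \<noteq> be i" using y unfolding r(3) k(3,4) by auto
  then show ?thesis using r by force
qed

text \<open>A point on a ray has coordinates in two cells; \<open>refract_half\<close> makes the
  half circle after its direction equally long in both.\<close>

lemma half_indep:
  assumes i: "i \<in> I" "j \<in> I" and y: "y \<in> S i" "z \<in> S j" "pt i y = pt j z"
    and p: "y = r *\<^sub>R polar (ori i) \<eta>" "0 < r" "\<eta> \<in> {al i..be i}"
      "z = s *\<^sub>R polar (ori j) \<psi>" "0 < s" "\<psi> \<in> {al j..be j}"
  shows "Th (F i) (ori i) (\<eta> + pi) - Th (F i) (ori i) \<eta> = Th (F j) (ori j) (\<psi> + pi) - Th (F j) (ori j) \<psi>"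
proof -
  interpret A: planar "F i" "ori i" by (rule planar[OF i(1)])
  interpret B: planar "F j" "ori j" by (rule planar[OF i(2)])
  have uniq: "\<eta> = \<zeta>" if "k \<in> I" "r *\<^sub>R polar (ori k) \<eta> = u *\<^sub>R polar (ori k) \<zeta>" "0 < r" "0 < u"
    "\<eta> \<in> {al k..be k}" "\<zeta> \<in> {al k..be k}" for k r \<eta> u \<zeta>
  proof -
    interpret K: planar "F k" "ori k" by (rule planar[OF that(1)])
    show ?thesis using K.polar_eqD(1)[OF that(2-4)] that(5,6) al_be[OF that(1)] by force
  qed
  show ?thesis
  proof (cases "i = j")
    case True
    then have "y = z" using y pt_same[OF i(1)] by auto
    then show ?thesis using uniq[OF i(1), of r \<eta> s \<psi>] p True by auto
  next
    case False
    have "y \<noteq> 0" using p by simp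
    then obtain w w' u where w: "ray i w j w'" "0 < u" "y = u *\<^sub>R w" "z = u *\<^sub>R w'"
      using pt_eq_ray[OF i(1) y(1) i(2) y(2,3) _ False] by blast
    have B': "\<zeta> = be k" if k: "k \<in> I" "u *\<^sub>R b k = r *\<^sub>R polar (ori k) \<zeta>" "0 < r" "\<zeta> \<in> {al k..be k}" for k r \<zeta>
    proof -
      obtain rb where rb: "rb > 0" "b k = rb *\<^sub>R polar (ori k) (be k)" using angle_b[OF k(1)] by blast
      have "r *\<^sub>R polar (ori k) \<zeta> = (u * rb) *\<^sub>R polar (ori k) (be k)"
        unfolding k(2)[symmetric] by (subst rb(2)) simp
      then show ?thesis using uniq[OF k(1) _ k(3)] rb(1) w(2) k(4) al_be[OF k(1)] by force
    qed
    have A': "\<zeta> = al k" if k: "k \<in> I" "u *\<^sub>R a k = r *\<^sub>R polar (ori k) \<zeta>" "0 < r" "\<zeta> \<in> {al k..be k}" for k r \<zeta>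
    proof -
      obtain ra where ra: "ra > 0" "a k = ra *\<^sub>R polar (ori k) (al k)" using angle_a[OF k(1)] by blast
      have "r *\<^sub>R polar (ori k) \<zeta> = (u * ra) *\<^sub>R polar (ori k) (al k)"
        unfolding k(2)[symmetric] by (subst ra(2)) simp
      then show ?thesis using uniq[OF k(1) _ k(3)] ra(1) w(2) k(4) al_be[OF k(1)] by force
    qed
    consider "j = nxt i" "w = b i" "w' = a j" | "i = nxt j" "w = a i" "w' = b j" using w(1) by (auto simp: ray_def)
    then show ?thesis
    proof cases
      case 1
      have "\<eta> = be i" using B'[OF i(1) _ p(2,3)] p(1) w(3) 1(2) by simp
      moreover have "\<psi> = al j" using A'[OF i(2) _ p(5,6)] p(4) w(4) 1(3) by simp
      ultimately show ?thesis using refract_half[OF i(1)] 1(1) by simp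
    next
      case 2
      have "\<eta> = al i" using A'[OF i(1) _ p(2,3)] p(1) w(3) 2(2) by simp
      moreover have "\<psi> = be j" using B'[OF i(2) _ p(5,6)] p(4) w(4) 2(3) by simp
      ultimately show ?thesis using refract_half[OF i(2)] 2(1) by simp
    qed
  qed
qed

text \<open>The ray has velocity \<open>- z\<close>, and \<open>w\<close> to the left of
  \<open>z\<close> is on its right. Before time -1 the shifted line stays in the sector and turns
  from \<eta> to the angle \<open>\<eta>'\<close> of its point at time -1; afterwards
  \<open>half_geodesic_exists\<close> continues it from \<open>\<eta>'\<close> to \<eta> + pi. The
  two arcs add up to a half circle.\<close>

lemma perturbed_geodesic:
  assumes j: "j \<in> I" and z: "z \<in> S j" "F j (- z) = 1" "z = r *\<^sub>R polar (ori j) \<eta>" "0 < r" "\<eta> \<in> {al j..be j}"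
    and w: "0 < ori j * cross2 z w" and s: "0 < s" and int: "0 < cA j (z + s *\<^sub>R w)" "0 < cB j (z + s *\<^sub>R w)"
  shows "\<exists>\<gamma>. geodesic TC \<gamma> \<and> (\<forall>t. \<gamma> t \<noteq> cone_apex M x) \<and>
    (\<exists>\<delta>>0. \<forall>t. \<bar>t - - 1\<bar> < \<delta> \<longrightarrow> s *\<^sub>R w - t *\<^sub>R z \<in> S j \<and> \<gamma> t = pt j (s *\<^sub>R w - t *\<^sub>R z)) \<and>
    has_angle M 1 x \<gamma> (Th (F j) (ori j) (\<eta> + pi) - Th (F j) (ori j) \<eta>)"
proof -
  interpret planar "F j" "ori j" by (rule planar[OF j])
  define u where "u = - z"
  have u: "F j u = 1" "u = r *\<^sub>R polar (ori j) (\<eta> + pi)" using z by (simp_all add: u_def polar_shift)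
  define y where "y = s *\<^sub>R w"
  have line: "y + t *\<^sub>R u = s *\<^sub>R w - t *\<^sub>R z" for t by (simp add: y_def u_def)
  have p: "y + (-1) *\<^sub>R u = z + s *\<^sub>R w" by (simp add: y_def u_def)
  obtain r0 \<eta>' where \<eta>': "r0 > 0" "al j < \<eta>'" "\<eta>' < be j" "y + (-1) *\<^sub>R u = r0 *\<^sub>R polar (ori j) \<eta>'"
    using polar_of_interior[OF j int] unfolding p by blast
  have "0 < ori j * cross2 z (z + s *\<^sub>R w)" using mult_pos_pos[OF s w] by (simp add: mult.left_commute)
  also have "\<dots> = (r * r0) * (ori j * cross2 (polar (ori j) \<eta>) (polar (ori j) \<eta>'))"
    unfolding p[symmetric] \<eta>'(4) by (subst z(3)) simp
  finally have "0 < (r * r0) * sin (\<eta>' - \<eta>)" unfolding cross2_polar .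
  then have "0 < sin (\<eta>' - \<eta>)" by (rule zero_less_mult_pos) (use z(4) \<eta>'(1) in simp)
  then have "\<eta> < \<eta>'"
  proof (rule contrapos_pp)
    assume "\<not> \<eta> < \<eta>'"
    then have "0 \<le> sin (\<eta> - \<eta>')" using z(5) \<eta>' al_be[OF j] by (intro sin_ge_zero) auto
    then show "\<not> 0 < sin (\<eta>' - \<eta>)" using sin_minus[of "\<eta> - \<eta>'"] by simp
  qed
  then have ang: "\<eta>' < \<eta> + pi" "\<eta> + pi < \<eta>' + pi" using z(5) \<eta>' al_be[OF j] by auto
  \<comment> \<open>Finiteness of \<open>I\<close> gives a smallest sector arc, and with it a bound
    on the number of rays that can be crossed.\<close>
  define m where "m = Min (sector_arc ` I)"
  have m: "0 < m" "\<And>k. k \<in> I \<Longrightarrow> m \<le> Th (F k) (ori k) (be k) - Th (F k) (ori k) (al k)"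
    using finI I_ne sector_arc_pos by (auto simp: m_def sector_arc_def[symmetric])
  obtain n where n: "T (\<eta> + pi) - T (al j) < real n * m" using reals_Archimedean3[OF m(1)] by blast
  obtain \<gamma>' \<rho>' \<delta> where H: "half_geodesic \<gamma>' (-1) \<rho>' (T (\<eta> + pi) - T \<eta>')"
    and \<delta>: "\<delta> > 0" "\<And>\<tau>. -1 \<le> \<tau> \<Longrightarrow> \<tau> \<le> -1 + \<delta> \<Longrightarrow> y + \<tau> *\<^sub>R u \<in> S j \<and> \<gamma>' \<tau> = pt j (y + \<tau> *\<^sub>R u)"
    using half_geodesic_exists[OF m j u z(4) \<eta>'(4,1) less_imp_le[OF \<eta>'(2)] \<eta>'(3) ang n] by auto
  have H': "\<And>s t. s < t \<Longrightarrow> -1 \<le> s \<Longrightarrow> pw_smooth TC (finsler TC) \<gamma>' (\<lambda>_. 1) s t"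
    "\<And>t. -1 < t \<Longrightarrow> minimizing_at \<gamma>' 1 t" "\<And>t. -1 \<le> t \<Longrightarrow> \<gamma>' t \<noteq> cone_apex M x"
    "\<And>s t. s < t \<Longrightarrow> -1 \<le> s \<Longrightarrow> pw_smooth TC (arc_norm M 1) (unit_dir M 1 x \<circ> \<gamma>') \<rho>' s t"
    "(\<rho>' has_integral T (\<eta> + pi) - T \<eta>') {-1..}"
    using H unfolding half_geodesic_def by blast+
  have "0 < ori j * cross2 y u"
    using mult_pos_pos[OF s w] cross2_commute[of w z] by (simp add: y_def u_def mult.left_commute)
  from line_polar[OF this u(2) z(4)]
  obtain \<theta> \<theta>' where \<theta>: "\<And>t. (\<theta> has_real_derivative \<theta>' t) (at t)" "\<And>t. 0 < \<theta>' t"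
      "\<And>t. \<exists>\<rho>>0. y + t *\<^sub>R u = \<rho> *\<^sub>R polar (ori j) (\<theta> t)" "\<And>t. \<eta> + pi - pi < \<theta> t" "\<And>t. \<theta> t < \<eta> + pi"
      "(\<theta> \<longlongrightarrow> \<eta> + pi - pi) at_bot" by blast
  have \<theta>1: "\<theta> (-1) = \<eta>'"
  proof -
    obtain \<rho> where \<rho>: "\<rho> > 0" "y + (-1) *\<^sub>R u = \<rho> *\<^sub>R polar (ori j) (\<theta> (-1))" using \<theta>(3)[of "-1"] by blast
    have "\<bar>\<theta> (-1) - \<eta>'\<bar> < 2 * pi" using \<theta>(4,5)[of "-1"] ang \<open>\<eta> < \<eta>'\<close> by linarith
    then show ?thesis using polar_eqD(1)[of \<rho> "\<theta> (-1)" r0 \<eta>'] \<rho> \<eta>' by simp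
  qed
  have zc: "0 \<le> cA j z" "0 \<le> cB j z" using z(1) S_iff[OF j] by auto
  \<comment> \<open>Further back in time, nonnegative multiples of \<open>z\<close>, a vector of the
    sector, are added to an interior point of the sector.\<close>
  have intL: "0 < cA j (y + t *\<^sub>R u)" "0 < cB j (y + t *\<^sub>R u)" if "t \<le> -1" for t
  proof -
    have eq: "y + t *\<^sub>R u = (z + s *\<^sub>R w) + (-1 - t) *\<^sub>R z" by (simp add: y_def u_def algebra_simps)
    have "0 \<le> (-1 - t) * cA j z" "0 \<le> (-1 - t) * cB j z" using zc that by auto
    then show "0 < cA j (y + t *\<^sub>R u)" "0 < cB j (y + t *\<^sub>R u)" using int unfolding eq cAB_simps by linarith+
  qed
  have SL: "y + t *\<^sub>R u \<in> S j" if "t \<le> -1" for t using intL[OF that] S_iff[OF j] by simp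
  define \<gamma> where "\<gamma> t = (if t \<le> -1 then pt j (y + t *\<^sub>R u) else \<gamma>' t)" for t
  define \<rho> where "\<rho> t = (if t < -1 then \<theta>' t * K (\<theta> t) else \<rho>' t)" for t
  have \<gamma>R: "\<gamma> t = \<gamma>' t" if "-1 \<le> t" for t
    using that \<delta>(2)[of "-1"] \<delta>(1) by (cases "t = -1") (auto simp: \<gamma>_def)
  have \<gamma>L: "y + t *\<^sub>R u \<in> S j \<and> \<gamma> t = pt j (y + t *\<^sub>R u)" if "t \<le> -1" for t using SL that by (simp add: \<gamma>_def)
  have near: "y + t *\<^sub>R u \<in> S j \<and> \<gamma> t = pt j (y + t *\<^sub>R u)" if "t \<le> -1 + \<delta>" for t
    using \<gamma>L[of t] \<gamma>R[of t] \<delta>(2)[of t] that by (cases "t \<le> -1") auto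
  have pw: "pw_smooth TC (finsler TC) \<gamma> (\<lambda>_. 1) s t" if "s < t" for s t
  proof (rule pw_smooth_glue[where P = "\<lambda>_. True" and ?t1.0 = "-1"])
    show "pw_smooth TC (finsler TC) \<gamma> (\<lambda>_. 1) s t" if "s < t" "t \<le> -1" for s t
      by (rule pw_line[OF that(1) j, of y u]) (use that \<gamma>L u in auto)
    show "pw_smooth TC (finsler TC) \<gamma> (\<lambda>_. 1) s t" if "s < t" "-1 \<le> s" for s t
      by (rule pw_smooth_cong[OF H'(1)[OF that]]) (use that \<gamma>R in auto)
  qed (use that in auto)
  have sector_arc: "pw_smooth TC (arc_norm M 1) (unit_dir M 1 x \<circ> \<gamma>) \<rho> s t" if "s < t" for s t
  proof (rule pw_smooth_glue[where P = "\<lambda>_. True" and ?t1.0 = "-1"])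
    show "pw_smooth TC (arc_norm M 1) (unit_dir M 1 x \<circ> \<gamma>) \<rho> s t" if "s < t" "t \<le> -1" for s t
      by (rule arc_line[OF j that(1) _ \<theta>(3,1,2)]) (use that \<gamma>L in \<open>auto simp: \<rho>_def\<close>)
    show "pw_smooth TC (arc_norm M 1) (unit_dir M 1 x \<circ> \<gamma>) \<rho> s t" if "s < t" "-1 \<le> s" for s t
      by (rule pw_smooth_cong[OF H'(4)[OF that]]) (use that \<gamma>R in \<open>auto simp: \<rho>_def\<close>)
  qed (use that in auto)
  have min: "minimizing_at \<gamma> 1 t" for t
  proof (cases "t \<le> -1")
    case True
    show ?thesis
      by (rule minimizing_straight[OF j u(1) \<delta>(1) intL[OF True]]) (use near True in auto)
  next
    case False
    then show ?thesis by (intro minimizing_cong[OF H'(2), of t "t + 1"]) (use \<gamma>R in auto)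
  qed
  have geo: "geodesic TC \<gamma>" unfolding geodesic_iff using pw min by (intro exI[of _ 1]) auto
  have apex: "\<gamma> t \<noteq> cone_apex M x" for t
  proof (cases "t \<le> -1")
    case True
    have "y + t *\<^sub>R u \<noteq> 0"
    proof
      assume "y + t *\<^sub>R u = 0"
      then have "cA j (y + t *\<^sub>R u) = cA j 0" by (simp only:)
      then show False using intL(1)[OF True] by simp
    qed
    then show ?thesis using \<gamma>L[OF True] pt_apex[OF j] by auto
  next
    case False
    then show ?thesis using \<gamma>R H'(3) by simp
  qed
  have "((\<lambda>t. \<theta>' t * K (\<theta> t)) has_integral T \<eta>' - T \<eta>) {..-1}"
    using has_integral_K_bot[OF \<theta>(1,2,6), of "-1"] \<theta>1 by simp
  then have i1: "(\<rho> has_integral T \<eta>' - T \<eta>) {..-1}"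
    by (rule has_integral_spike_finite[of "{-1}", rotated 2]) (auto simp: \<rho>_def)
  have i2: "(\<rho> has_integral T (\<eta> + pi) - T \<eta>') {-1..}"
    by (rule has_integral_eq[OF _ H'(5)]) (auto simp: \<rho>_def)
  have "{..-1} \<inter> {-1..} = {-1::real}" "{..-1} \<union> {-1..} = (UNIV :: real set)" by auto
  then have "(\<rho> has_integral (T \<eta>' - T \<eta>) + (T (\<eta> + pi) - T \<eta>')) UNIV"
    using has_integral_Un[OF i1 i2] by simp
  moreover have "(T \<eta>' - T \<eta>) + (T (\<eta> + pi) - T \<eta>') = T (\<eta> + pi) - T \<eta>" by simp
  ultimately have "(\<rho> has_integral T (\<eta> + pi) - T \<eta>) UNIV" by simp
  then have "has_angle M 1 x \<gamma> (T (\<eta> + pi) - T \<eta>)"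
    unfolding has_angle_def using sector_arc by (intro exI[of _ \<rho>]) auto
  moreover have "\<exists>\<delta>>0. \<forall>t. \<bar>t - - 1\<bar> < \<delta> \<longrightarrow> s *\<^sub>R w - t *\<^sub>R z \<in> S j \<and> \<gamma> t = pt j (s *\<^sub>R w - t *\<^sub>R z)"
    using near \<delta>(1) unfolding line[symmetric] by (intro exI[of _ \<delta>]) auto
  ultimately show ?thesis using geo apex by blast
qed

text \<open>A perturbed geodesic is prescribed on a short interval, so unique continuation
  identifies it with the constructed one. This settles the quantifier over all extensions in
  \<open>perturbed_angle\<close>.\<close>

lemma perturbed_iff:
  assumes j: "j \<in> I" and z: "z \<in> S j" and geo: "geodesic TC \<gamma>0" "\<And>t. \<gamma>0 t \<noteq> cone_apex M x"
    and \<delta>: "0 < \<delta>" "\<And>t. \<bar>t - - 1\<bar> < \<delta> \<Longrightarrow> s *\<^sub>R w - t *\<^sub>R z \<in> S j \<and> \<gamma>0 t = pt j (s *\<^sub>R w - t *\<^sub>R z)"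
  shows "perturbed M (- 1) x (pt j z) j w s \<gamma> \<longleftrightarrow> \<gamma> = \<gamma>0"
proof -
  have ch: "chart TC j (cone_scale M x (- 1 * t) (pt j z)) + s *\<^sub>R w = s *\<^sub>R w - t *\<^sub>R z" if "t \<le> 0" for t
    using that cone_scale_pt[OF j z, of "- t"] chart_TC[OF j S_scale[OF j z, of "- t"]] by simp
  show ?thesis
  proof
    assume "perturbed M (- 1) x (pt j z) j w s \<gamma>"
    then obtain \<epsilon> where p: "geodesic TC \<gamma>" "\<epsilon> > 0" "\<And>t. \<bar>t - - 1\<bar> < \<epsilon> \<Longrightarrow> \<gamma> t \<in> cell TC j \<and>
        chart TC j (\<gamma> t) = chart TC j (cone_scale M x (- 1 * t) (pt j z)) + s *\<^sub>R w"
      unfolding perturbed_def Let_def by blast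
    \<comment> \<open>The bound 1 keeps \<open>t\<close> negative, so that \<open>cone_scale\<close>
      is applied with a positive factor.\<close>
    have "\<gamma>0 = \<gamma>"
    proof (rule geodesic_unique[OF geo(1) p(1) geo(2), where \<eta> = "min 1 (min \<delta> \<epsilon>)" and ?t0.0 = "-1"])
      show "0 < min 1 (min \<delta> \<epsilon>)" using \<delta>(1) p(2) by simp
      fix t assume t: "\<bar>t - - 1\<bar> < min 1 (min \<delta> \<epsilon>)"
      then have t': "t \<le> 0" "\<bar>t - - 1\<bar> < \<delta>" "\<bar>t - - 1\<bar> < \<epsilon>" by auto
      obtain q where q: "q \<in> S j" "\<gamma> t = pt j q" using p(3)[OF t'(3)] cell_TC_iff[OF j] by blast
      then have "q = s *\<^sub>R w - t *\<^sub>R z" using p(3)[OF t'(3)] ch[OF t'(1)] chart_TC[OF j q(1)] by simp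
      then show "\<gamma>0 t = \<gamma> t" using \<delta>(2)[OF t'(2)] q by simp
    qed
    then show "\<gamma> = \<gamma>0" by simp
  next
    assume "\<gamma> = \<gamma>0"
    moreover have "\<gamma>0 t \<in> cell TC j \<and> chart TC j (\<gamma>0 t) = chart TC j (cone_scale M x (- 1 * t) (pt j z)) + s *\<^sub>R w"
      if "\<bar>t - - 1\<bar> < min 1 \<delta>" for t
    proof -
      have t': "t \<le> 0" "\<bar>t - - 1\<bar> < \<delta>" using that by auto
      show ?thesis using \<delta>(2)[OF t'(2)] ch[OF t'(1)] chart_TC[OF j] cell_TC_iff[OF j] by auto
    qed
    ultimately show "perturbed M (- 1) x (pt j z) j w s \<gamma>"
      unfolding perturbed_def Let_def using geo \<delta>(1) by (intro conjI exI[of _ "min 1 \<delta>"]) auto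
  qed
qed

text \<open>The definition ranges over every cell containing \<open>v\<close>, which are two if
  \<open>v\<close> is on a ray. In each of them an admissible \<open>w\<close> moves the ray into
  the interior of the sector for small \<open>s\<close>, and \<open>half_indep\<close> shows that
  the resulting angle is the same.\<close>

lemma perturbed_angle_right:
  assumes i: "i \<in> I" and y: "y \<in> S i" "F i (- y) = 1" "y = r *\<^sub>R polar (ori i) \<eta>" "0 < r" "\<eta> \<in> {al i..be i}"
  shows "perturbed_angle M ori (- 1) x (pt i y) (- 1) (Th (F i) (ori i) (\<eta> + pi) - Th (F i) (ori i) \<eta>)"
    (is "perturbed_angle M ori (- 1) x ?v (- 1) ?A")
  unfolding perturbed_angle_def Let_def
proof (intro ballI impI)
  fix j w assume "j \<in> cells TC" and w: "w \<in> unit_vectors TC 1 ?v j"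
    and h: "?v \<in> cell TC j \<and> 0 < - 1 * ori j * det (vector [- 1 *\<^sub>R chart TC j ?v, w])"
  then have j: "j \<in> I" by simp
  obtain z where z: "z \<in> S j" "?v = pt j z" using h cell_TC_iff[OF j] by blast
  then have chz: "chart TC j ?v = z" using chart_TC[OF j] by simp
  have cr: "0 < ori j * cross2 z w" using h by (simp add: chz det_vector2)
  have Fz: "F j (- z) = 1"
  proof -
    show ?thesis
    proof (cases "i = j")
      case True
      then show ?thesis using pt_same[OF i y(1)] z y(2) by auto
    next
      case False
      have "y \<noteq> 0" using y(2) minkowski.zero[OF minkowski[OF i]] by auto
      then obtain e e' u where "ray i e j e'" "y = u *\<^sub>R e" "z = u *\<^sub>R e'"
        using pt_eq_ray[OF i y(1) j z _ False] by blast
      then show ?thesis using ray_F[of i e j e' "- u"] y(2) by simp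
    qed
  qed
  have znz: "z \<noteq> 0" using cr by auto
  obtain r' \<eta>' where p: "r' > 0" "\<eta>' \<in> {al j..be j}" "z = r' *\<^sub>R polar (ori j) \<eta>'" using polar_of_S[OF j z(1) znz] by blast
  have A: "?A = Th (F j) (ori j) (\<eta>' + pi) - Th (F j) (ori j) \<eta>'"
    by (rule half_indep[OF i j y(1) z(1,2) y(3-5) p(3,1,2)])
  \<comment> \<open>Directions at the point \<open>z\<close> of a convex sector are nonnegative
    multiples of differences \<open>q' - z\<close> with \<open>q'\<close> in the sector.\<close>
  have "w \<in> cone hull ((\<lambda>q. chart TC j q - z) ` cell TC j)"
    using w by (simp add: unit_vectors_def sector_def chz)
  then obtain k q where k: "k \<ge> 0" "q \<in> cell TC j" "w = k *\<^sub>R (chart TC j q - z)"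
    unfolding cone_hull_expl by auto
  define q' where "q' = chart TC j q"
  have q': "q' \<in> S j" using k(2) cell_TC_iff[OF j] chart_TC[OF j] by (auto simp: q'_def)
  have w': "w = k *\<^sub>R (q' - z)" using k(3) by (simp add: q'_def)
  have "k \<noteq> 0" using cr w' by auto
  then have k0: "k > 0" using k(1) by simp
  have "0 < k * (ori j * cross2 z q')" using cr by (simp add: w' algebra_simps)
  then have zq: "0 < ori j * cross2 z q'" using k0 by (simp only: zero_less_mult_iff) auto
  have n: "0 \<le> cA j z" "0 \<le> cB j z" "0 \<le> cA j q'" "0 \<le> cB j q'" using z(1) q' S_iff[OF j] by auto
  have cz: "cross2 z q' = (cA j z * cB j q' - cB j z * cA j q') * cross2 (a j) (b j)"
    by (subst (1) expand[OF j, of z], subst (1) expand[OF j, of q'])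
      (simp add: cross2_commute[of "b j" "a j"] algebra_simps)
  have "ori j * cross2 z q' = (cA j z * cB j q' - cB j z * cA j q') * (ori j * cross2 (a j) (b j))"
    unfolding cz by (simp add: algebra_simps)
  then have "0 < (cA j z * cB j q' - cB j z * cA j q') * (ori j * cross2 (a j) (b j))"
    using zq by (simp only:)
  then have "0 < cA j z * cB j q' - cB j z * cA j q'" by (rule zero_less_mult_pos2[OF _ cross_ab[OF j]])
  moreover have "0 \<le> cB j z * cA j q'" using n by simp
  ultimately have "0 < cA j z * cB j q'" by linarith
  \<comment> \<open>That \<open>q'\<close> is strictly to the left of \<open>z\<close> means that
    \<open>z\<close> is not on the last ray and \<open>q'\<close> not on the first. Proper convex
    combinations of them are therefore interior.\<close>
  then have pos: "0 < cA j z" "0 < cB j q'" using n by (auto simp: zero_less_mult_iff)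
  show "\<exists>\<eta>>0. \<forall>s. 0 < s \<and> s < \<eta> \<longrightarrow> (\<exists>\<gamma>. perturbed M (- 1) x ?v j w s \<gamma>) \<and>
      (\<forall>\<gamma>. perturbed M (- 1) x ?v j w s \<gamma> \<longrightarrow> has_angle M (- (- 1)) x \<gamma> ?A)"
  \<comment> \<open>For \<open>s\<close> below this bound, \<open>z + s *\<^sub>R w\<close> is a
    proper convex combination of \<open>z\<close> and \<open>q'\<close>.\<close>
  proof (rule exI[of _ "1 / k"], intro conjI allI impI)
    show "0 < 1 / k" using k0 by simp
    fix s assume s: "0 < s \<and> s < 1 / k"
    then have sk: "0 < s * k" "s * k < 1" using k0 by (auto simp: field_simps)
    have eq: "z + s *\<^sub>R w = (1 - s * k) *\<^sub>R z + (s * k) *\<^sub>R q'" by (simp add: w' algebra_simps)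
    have "0 < (1 - s * k) * cA j z" "0 \<le> (s * k) * cA j q'" "0 \<le> (1 - s * k) * cB j z" "0 < (s * k) * cB j q'"
      using sk n pos by auto
    then have int: "0 < cA j (z + s *\<^sub>R w)" "0 < cB j (z + s *\<^sub>R w)"
      unfolding eq cAB_simps by linarith+
    obtain \<gamma>0 \<delta> where g: "geodesic TC \<gamma>0" "\<And>t. \<gamma>0 t \<noteq> cone_apex M x" "\<delta> > 0"
      "\<And>t. \<bar>t - - 1\<bar> < \<delta> \<Longrightarrow> s *\<^sub>R w - t *\<^sub>R z \<in> S j \<and> \<gamma>0 t = pt j (s *\<^sub>R w - t *\<^sub>R z)"
      "has_angle M 1 x \<gamma>0 ?A"
      using perturbed_geodesic[OF j z(1) Fz p(3,1,2) cr conjunct1[OF s] int] unfolding A by blast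
    have iff: "perturbed M (- 1) x (pt j z) j w s \<gamma> \<longleftrightarrow> \<gamma> = \<gamma>0" for \<gamma>
      by (rule perturbed_iff[OF j z(1) g(1-4)])
    show "\<exists>\<gamma>. perturbed M (- 1) x ?v j w s \<gamma>"
      unfolding z(2) using iff[of \<gamma>0] by blast
    fix \<gamma> assume "perturbed M (- 1) x ?v j w s \<gamma>"
    then have "\<gamma> = \<gamma>0" using iff[of \<gamma>] unfolding z(2) by blast
    then show "has_angle M (- (- 1)) x \<gamma> ?A" using g(5) by simp
  qed
qed

end

section \<open>Triangles around a vertex\<close>

lemma cross2_noncollinear: assumes "\<not> collinear {A, B, C}" shows "cross2 (B - A) (C - A) \<noteq> 0"
proof
  assume c: "cross2 (B - A) (C - A) = 0"
  have "collinear {0, B - A, C - A}"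
  proof (cases "B - A = 0")
    case False
    then show ?thesis using cross2_eq_0_imp[OF c] unfolding collinear_lemma by blast
  qed (simp add: collinear_lemma)
  then have "collinear {B, A, C}" by (simp only: collinear_3[of B A C] NO_MATCH_def simp_thms)
  then show False using assms by (simp add: insert_commute)
qed

lemma triangle_independent: assumes "\<not> collinear {A, B, C :: real^2}"
  shows "\<not> affine_dependent {A, B, C}" "A \<noteq> B" "A \<noteq> C" "B \<noteq> C"
  using assms unfolding collinear_3_eq_affine_dependent by auto

lemma triangle_extreme: assumes "\<not> collinear {A, B, C :: real^2}"
  shows "z extreme_point_of convex hull {A, B, C} \<longleftrightarrow> z \<in> {A, B, C}"
  by (rule extreme_point_of_convex_hull_affine_independent[OF triangle_independent(1)[OF assms]])

lemma triangle_edge: assumes "\<not> collinear {A, B, C :: real^2}" "E edge_of convex hull {A, B, C}"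
  shows "\<exists>P Q. P \<in> {A, B, C} \<and> Q \<in> {A, B, C} \<and> P \<noteq> Q \<and> E = closed_segment P Q"
proof -
  note ind = triangle_independent(1)[OF assms(1)]
  obtain c where c: "c \<subseteq> {A, B, C}" "E = convex hull c"
    using assms(2) unfolding edge_of_def face_of_convex_hull_affine_independent[OF ind] by blast
  have "\<not> affine_dependent c" using affine_independent_subset[OF ind c(1)] .
  then have "aff_dim E = int (card c) - 1" unfolding c(2) aff_dim_convex_hull
    using aff_dim_affine_independent[of c] by simp
  then have "card c = 2" using assms(2) by (simp add: edge_of_def)
  then obtain P Q where "c = {P, Q}" "P \<noteq> Q" by (auto simp: card_2_iff)
  then have "P \<in> {A, B, C}" "Q \<in> {A, B, C}" "P \<noteq> Q" "E = closed_segment P Q"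
    using c by (simp_all add: segment_convex_hull)
  then show ?thesis by blast
qed

text \<open>The norms of \<open>v\<close> and \<open>w\<close> add up to that of
  \<open>v + w\<close>, so \<open>dF (v + w)\<close> reaches the norm at \<open>v\<close>, and the
  equality case makes \<open>v\<close> a multiple of the sum. This is what makes the change of
  charts along an edge affine.\<close>

lemma (in minkowski) norm_split:
  assumes "F v = t * F (v + w)" "F w = (1 - t) * F (v + w)" "v + w \<noteq> 0" shows "v = t *\<^sub>R (v + w)"
proof -
  have "dF (v + w) v + dF (v + w) w = F (v + w)"
    using dF_self[OF assms(3)] linear_add[OF linear_dF[OF assms(3)]] by metis
  moreover have "dF (v + w) v \<le> F v" "dF (v + w) w \<le> F w" using dF_le[OF assms(3)] by auto
  ultimately have "dF (v + w) v = F v" using assms(1,2) by (simp add: algebra_simps)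
  then obtain r where r: "r \<ge> 0" "v = r *\<^sub>R (v + w)" using dF_eq_imp[OF assms(3)] by blast
  then have "F v = r * F (v + w)" using scale[OF r(1)] by metis
  then have "r = t" using assms(1) pos[OF assms(3)] by simp
  then show ?thesis using r(2) by simp
qed

text \<open>Invariance of domain, applied in a Euclidean neighbourhood of
  \<open>\<psi> d0\<close>.\<close>

lemma surface_image_nbhd:
  fixes \<psi> :: "real^2 \<Rightarrow> 'p"
  assumes X: "surface X" and D: "open D" "d0 \<in> D"
    and \<psi>: "continuous_map (top_of_set D) X \<psi>" "inj_on \<psi> D"
  shows "\<exists>O'. openin X O' \<and> \<psi> d0 \<in> O' \<and> O' \<subseteq> \<psi> ` D"
proof -
  have "\<psi> d0 \<in> topspace X" using continuous_map_funspace[OF \<psi>(1)] D(2) by auto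
  then obtain V where V: "openin X V" "\<psi> d0 \<in> V" "subtopology X V homeomorphic_space (euclidean :: (real^2) topology)"
    using X unfolding surface_def by blast
  obtain \<phi> \<phi>' where "homeomorphic_maps (subtopology X V) (euclidean :: (real^2) topology) \<phi> \<phi>'"
    using V(3) unfolding homeomorphic_space_def by blast
  then have \<phi>: "continuous_map (subtopology X V) euclidean \<phi>" "\<And>y. y \<in> V \<Longrightarrow> \<phi>' (\<phi> y) = y"
    using openin_subset[OF V(1)] unfolding homeomorphic_maps_def by auto
  define D1 where "D1 = {d \<in> D. \<psi> d \<in> V}"
  have "openin (top_of_set D) D1"
    using openin_continuous_map_preimage[OF \<psi>(1) V(1)] by (simp add: D1_def)
  then have oD1: "open D1" using D(1) by (simp add: openin_open_eq)
  have "continuous_map (top_of_set D1) (subtopology X V) \<psi>"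
    using continuous_map_from_subtopology[OF \<psi>(1), of D1]
    by (auto simp: continuous_map_in_subtopology D1_def subtopology_subtopology Int_absorb1 Collect_mono_iff image_subset_iff Int_def)
  from continuous_map_compose[OF this \<phi>(1)]
  have "continuous_on D1 (\<phi> \<circ> \<psi>)" by simp
  moreover have inj: "inj_on (\<phi> \<circ> \<psi>) D1"
  proof (rule inj_onI)
    fix d e assume de: "d \<in> D1" "e \<in> D1" "(\<phi> \<circ> \<psi>) d = (\<phi> \<circ> \<psi>) e"
    then have "\<phi>' (\<phi> (\<psi> d)) = \<phi>' (\<phi> (\<psi> e))" by simp
    then have "\<psi> d = \<psi> e" using \<phi>(2)[of "\<psi> d"] \<phi>(2)[of "\<psi> e"] de(1,2) by (simp add: D1_def)
    then show "d = e" using \<psi>(2) de by (auto simp: D1_def inj_on_def)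
  qed
  ultimately have "open ((\<phi> \<circ> \<psi>) ` D1)" by (intro invariance_of_domain oD1)
  then have "openin (subtopology X V) {y \<in> topspace (subtopology X V). \<phi> y \<in> (\<phi> \<circ> \<psi>) ` D1}"
    by (intro openin_continuous_map_preimage[OF \<phi>(1)]) simp
  then have "openin X {y \<in> topspace (subtopology X V). \<phi> y \<in> (\<phi> \<circ> \<psi>) ` D1}"
    using V(1) openin_trans_full by blast
  moreover have "{y \<in> topspace (subtopology X V). \<phi> y \<in> (\<phi> \<circ> \<psi>) ` D1} \<subseteq> \<psi> ` D"
  proof
    fix y assume "y \<in> {y \<in> topspace (subtopology X V). \<phi> y \<in> (\<phi> \<circ> \<psi>) ` D1}"
    then obtain d where d: "y \<in> V" "d \<in> D1" "\<phi> y = \<phi> (\<psi> d)" by auto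
    have "y = \<phi>' (\<phi> y)" using \<phi>(2)[of y] d(1) by simp
    also have "\<dots> = \<psi> d" unfolding d(3) using \<phi>(2)[of "\<psi> d"] d(2) by (simp add: D1_def)
    finally have "y = \<psi> d" .
    then show "y \<in> \<psi> ` D" using d(2) by (auto simp: D1_def)
  qed
  moreover have "\<psi> d0 \<in> {y \<in> topspace (subtopology X V). \<phi> y \<in> (\<phi> \<circ> \<psi>) ` D1}"
    using V D \<open>\<psi> d0 \<in> topspace X\<close> by (auto simp: D1_def)
  ultimately show ?thesis by (intro exI conjI)
qed

section \<open>Cells, edges and vertices of a piecewise flat surface\<close>

locale pf_surface =
  fixes X :: "'p topology" and M :: "('p, 'i) flat_cells"
  assumes pf: "piecewise_flat_surface X M"
begin

abbreviation "C \<equiv> cell M"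
abbreviation "ch \<equiv> chart M"

lemma surf: "surface X" and Hausdorff: "Hausdorff_space X"
  using pf by (auto simp: piecewise_flat_surface_def surface_def)

lemma topspace: "topspace X = (\<Union>i\<in>cells M. C i)"
  using pf by (simp add: piecewise_flat_surface_def)

lemma cell_sub: "i \<in> cells M \<Longrightarrow> C i \<subseteq> topspace X"
  using topspace by auto

lemma mink: "i \<in> cells M \<Longrightarrow> minkowski_norm (fnorm M i)"
  using pf by (simp add: piecewise_flat_surface_def)

lemma minkowski: "i \<in> cells M \<Longrightarrow> minkowski (fnorm M i)"
  by (simp add: minkowski_def mink)

lemma triangle: "i \<in> cells M \<Longrightarrow> \<exists>a b c. \<not> collinear {a, b, c} \<and> ch i ` C i = convex hull {a, b, c}"
  using pf by (simp add: piecewise_flat_surface_def)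

lemma chart_homeo: "i \<in> cells M \<Longrightarrow> homeomorphic_map (subtopology X (C i)) (top_of_set (ch i ` C i)) (ch i)"
  using pf by (simp add: piecewise_flat_surface_def)

lemma norm_eq: "i \<in> cells M \<Longrightarrow> j \<in> cells M \<Longrightarrow> p \<in> C i \<inter> C j \<Longrightarrow> q \<in> C i \<inter> C j \<Longrightarrow>
    fnorm M i (ch i q - ch i p) = fnorm M j (ch j q - ch j p)"
  by (rule pf[unfolded piecewise_flat_surface_def, THEN conjunct2, THEN conjunct2, THEN conjunct2, THEN conjunct2,
        THEN conjunct2, rule_format])

lemma chart_inv:
  assumes "i \<in> cells M"
  shows "\<exists>g. continuous_map (top_of_set (ch i ` C i)) X g \<and> (\<forall>y\<in>C i. g (ch i y) = y)"
proof -
  obtain g where "homeomorphic_maps (subtopology X (C i)) (top_of_set (ch i ` C i)) (ch i) g"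
    using chart_homeo[OF assms] unfolding homeomorphic_map_maps by blast
  then show ?thesis using cell_sub[OF assms]
    unfolding homeomorphic_maps_def by (intro exI[of _ g]) (auto simp: continuous_map_in_subtopology)
qed

lemma chart_inj: "i \<in> cells M \<Longrightarrow> y \<in> C i \<Longrightarrow> z \<in> C i \<Longrightarrow> ch i y = ch i z \<Longrightarrow> y = z"
  using chart_inv by metis

text \<open>A cell is the continuous image of a compact triangle in a Hausdorff space.\<close>

lemma cell_closed: assumes "i \<in> cells M" shows "closedin X (C i)"
proof -
  obtain g where g: "continuous_map (top_of_set (ch i ` C i)) X g" "\<And>y. y \<in> C i \<Longrightarrow> g (ch i y) = y"
    using chart_inv[OF assms] by blast
  obtain A B D where T: "ch i ` C i = convex hull {A, B, D}" using triangle[OF assms] by blast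
  have "compactin (top_of_set (ch i ` C i)) (ch i ` C i)"
    by (simp add: compactin_subtopology T compact_convex_hull finite_imp_compact)
  then have "compactin X (g ` ch i ` C i)" by (rule image_compactin[OF _ g(1)])
  moreover have "g ` ch i ` C i = C i" using g(2) by (force simp: image_image)
  ultimately show ?thesis using compactin_imp_closedin[OF Hausdorff] by simp
qed

text \<open>Local finiteness leaves finitely many cells that meet a neighbourhood but miss
  \<open>p\<close>; they are closed and can be removed from it.\<close>

lemma star_nbhd:
  assumes "p \<in> topspace X"
  shows "\<exists>W. openin X W \<and> p \<in> W \<and> W \<subseteq> (\<Union>k\<in>{k \<in> cells M. p \<in> C k}. C k) \<and> finite {k \<in> cells M. p \<in> C k}"
proof -
  obtain U where U: "openin X U" "p \<in> U" "finite {i \<in> cells M. C i \<inter> U \<noteq> {}}"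
    using pf[unfolded piecewise_flat_surface_def, THEN conjunct2, THEN conjunct2, THEN conjunct1, rule_format, OF assms]
    by (elim exE conjE)
  define B where "B = {i \<in> cells M. C i \<inter> U \<noteq> {} \<and> p \<notin> C i}"
  have "finite B" using U(3) by (rule rev_finite_subset) (auto simp: B_def)
  then have "closedin X (\<Union>i\<in>B. C i)" by (intro closedin_Union) (auto simp: B_def cell_closed)
  then have "openin X (U - (\<Union>i\<in>B. C i))" using U(1) by (rule openin_diff[rotated])
  moreover have "U - (\<Union>i\<in>B. C i) \<subseteq> (\<Union>k\<in>{k \<in> cells M. p \<in> C k}. C k)"
    using openin_subset[OF U(1)] topspace by (force simp: B_def)
  moreover have "finite {k \<in> cells M. p \<in> C k}" using U(3) by (rule rev_finite_subset) (use U(2) in auto)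
  moreover have "p \<in> U - (\<Union>i\<in>B. C i)" using U(2) by (auto simp: B_def)
  ultimately show ?thesis by blast
qed

lemma near_in_cell:
  assumes i: "i \<in> cells M" and y: "y \<in> C i" and W: "openin X W" "y \<in> W"
    and v: "\<And>t. 0 \<le> t \<Longrightarrow> t \<le> d \<Longrightarrow> ch i y + t *\<^sub>R v \<in> ch i ` C i" "0 < d"
  shows "\<exists>t>0. t \<le> d \<and> (\<exists>z\<in>C i \<inter> W. ch i z = ch i y + t *\<^sub>R v)"
proof -
  obtain g where g: "continuous_map (top_of_set (ch i ` C i)) X g" "\<And>y. y \<in> C i \<Longrightarrow> g (ch i y) = y"
    using chart_inv[OF i] by blast
  have "openin (top_of_set (ch i ` C i)) {z \<in> ch i ` C i. g z \<in> W}"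
    using openin_continuous_map_preimage[OF g(1) W(1)] by simp
  then obtain O' where O': "open O'" "{z \<in> ch i ` C i. g z \<in> W} = ch i ` C i \<inter> O'"
    unfolding openin_open by blast
  have "ch i y \<in> O'" using O'(2) y W(2) g(2) by auto
  moreover have "((\<lambda>t. ch i y + t *\<^sub>R v) \<longlongrightarrow> ch i y + 0 *\<^sub>R v) (at_right 0)"
    by (intro tendsto_intros)
  ultimately have "\<forall>\<^sub>F t in at_right 0. ch i y + t *\<^sub>R v \<in> O'"
    using O'(1) topological_tendstoD[of "\<lambda>t. ch i y + t *\<^sub>R v" "ch i y" "at_right 0" O'] by simp
  moreover have "\<forall>\<^sub>F t in at_right 0. t < d" using v(2) eventually_at_right_less by (metis eventually_at_right)
  ultimately obtain e where e: "e > 0" "\<And>t. 0 < t \<Longrightarrow> t < e \<Longrightarrow> ch i y + t *\<^sub>R v \<in> O' \<and> t < d"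
    using eventually_conj unfolding eventually_at_right_field by (metis (no_types, lifting) min_less_iff_conj)
  have t: "0 < e / 2" "ch i y + (e / 2) *\<^sub>R v \<in> O'" "e / 2 < d" using e(1) e(2)[of "e / 2"] by auto
  then obtain z where "z \<in> C i" "ch i z = ch i y + (e / 2) *\<^sub>R v" using v(1)[of "e / 2"] by auto
  moreover have "z \<in> W" using O'(2) t(2) g(2) calculation by force
  ultimately show ?thesis using t by (intro exI[of _ "e / 2"]) auto
qed

text \<open>Each chart sends the common part to an edge of its triangle. Agreement of the norms on
  differences of edge points forces the two affine parameters to coincide, so the ends are vertices
  of both triangles.\<close>

lemma edge_common:
  assumes ij: "i \<in> cells M" "j \<in> cells M" and e: "cell_edge M i (C i \<inter> C j)" "cell_edge M j (C i \<inter> C j)"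
  shows "\<exists>p q. p \<noteq> q \<and> cell_vertex M i p \<and> cell_vertex M i q \<and> cell_vertex M j p \<and> cell_vertex M j q \<and>
    p \<in> C i \<inter> C j \<and> q \<in> C i \<inter> C j \<and>
    (\<forall>y\<in>C i \<inter> C j. \<exists>t\<in>{0..1}. ch i y = ch i p + t *\<^sub>R (ch i q - ch i p) \<and> ch j y = ch j p + t *\<^sub>R (ch j q - ch j p)) \<and>
    (\<forall>t\<in>{0..1}. \<exists>y\<in>C i \<inter> C j. ch i y = ch i p + t *\<^sub>R (ch i q - ch i p))"
proof -
  define E where "E = C i \<inter> C j"
  interpret j: minkowski "fnorm M j" by (rule minkowski[OF ij(2)])
  interpret i: minkowski "fnorm M i" by (rule minkowski[OF ij(1)])
  obtain A B D where Ti: "\<not> collinear {A, B, D}" "ch i ` C i = convex hull {A, B, D}" using triangle[OF ij(1)] by blast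
  obtain A' B' D' where Tj: "\<not> collinear {A', B', D'}" "ch j ` C j = convex hull {A', B', D'}" using triangle[OF ij(2)] by blast
  obtain P Q where PQ: "P \<in> {A, B, D}" "Q \<in> {A, B, D}" "P \<noteq> Q" "ch i ` E = closed_segment P Q"
    using triangle_edge[OF Ti(1) e(1)[unfolded cell_edge_def, THEN conjunct2, folded E_def, unfolded Ti(2)]] by (elim exE conjE)
  obtain P' Q' where PQ': "P' \<in> {A', B', D'}" "Q' \<in> {A', B', D'}" "P' \<noteq> Q'" "ch j ` E = closed_segment P' Q'"
    using triangle_edge[OF Tj(1) e(2)[unfolded cell_edge_def, THEN conjunct2, folded E_def, unfolded Tj(2)]] by (elim exE conjE)
  have "P \<in> ch i ` E" "Q \<in> ch i ` E" unfolding PQ(4) by auto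
  then obtain p q where p: "p \<in> E" "ch i p = P" "q \<in> E" "ch i q = Q" by blast
  have seg: "z \<in> closed_segment u v \<longleftrightarrow> (\<exists>t\<in>{0..1}. z = u + t *\<^sub>R (v - u))" for z u v :: "real^2"
    by (auto simp: in_segment algebra_simps)
  have E: "y \<in> C i" "y \<in> C j" if "y \<in> E" for y using that by (auto simp: E_def)
  have npq: "p \<noteq> q" using p PQ(3) by auto
  have jpq: "ch j p \<noteq> ch j q" using chart_inj[OF ij(2), of p q] E p npq by auto
  have F: "fnorm M i (ch i z - ch i y) = fnorm M j (ch j z - ch j y)" if "y \<in> E" "z \<in> E" for y z
    using norm_eq[OF ij, of y z] that by (simp add: E_def)
  have aff: "\<exists>t\<in>{0..1}. ch i y = ch i p + t *\<^sub>R (ch i q - ch i p) \<and> ch j y = ch j p + t *\<^sub>R (ch j q - ch j p)"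
    if y: "y \<in> E" for y
  proof -
    have "ch i y \<in> closed_segment P Q" using y PQ(4) by blast
    then obtain t where t: "t \<in> {0..1}" "ch i y = P + t *\<^sub>R (Q - P)" unfolding seg by blast
    \<comment> \<open>In chart \<open>i\<close> the point \<open>y\<close> divides the edge in the
      ratio of \<open>t\<close> to \<open>1 - t\<close>. The norms agree, so the lengths of both
      parts are in this ratio in chart \<open>j\<close> too, and \<open>norm_split\<close> places
      \<open>y\<close> at the same parameter.\<close>
    define v where "v = ch j y - ch j p" define w where "w = ch j q - ch j y"
    have vw: "v + w = ch j q - ch j p" by (simp add: v_def w_def)
    have "fnorm M j v = fnorm M i (t *\<^sub>R (Q - P))" using F[OF p(1) y] t p by (simp add: v_def)
    then have 1: "fnorm M j v = t * fnorm M j (v + w)" using t F[OF p(1,3)] p i.scale by (simp add: vw)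
    have "Q - (P + t *\<^sub>R (Q - P)) = (1 - t) *\<^sub>R (Q - P)" by (simp add: algebra_simps)
    then have "fnorm M j w = fnorm M i ((1 - t) *\<^sub>R (Q - P))" using F[OF y p(3)] t p by (simp add: w_def)
    then have 2: "fnorm M j w = (1 - t) * fnorm M j (v + w)" using t F[OF p(1,3)] p i.scale by (simp add: vw)
    have "v = t *\<^sub>R (v + w)" by (rule j.norm_split[OF 1 2]) (use jpq vw in auto)
    then have "ch j y = ch j p + t *\<^sub>R (ch j q - ch j p)" unfolding vw by (simp add: v_def algebra_simps)
    then show ?thesis using t p by (intro bexI[of _ t]) auto
  qed
  have onto: "\<exists>y\<in>E. ch i y = ch i p + t *\<^sub>R (ch i q - ch i p)" if "t \<in> {0..1}" for t
  proof -
    have "ch i p + t *\<^sub>R (ch i q - ch i p) \<in> ch i ` E" using that p unfolding PQ(4) seg by auto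
    then show ?thesis by auto
  qed
  have "ch j ` E = closed_segment (ch j p) (ch j q)"
  proof
    show "ch j ` E \<subseteq> closed_segment (ch j p) (ch j q)" using aff unfolding seg by (auto simp: subset_iff seg)
    show "closed_segment (ch j p) (ch j q) \<subseteq> ch j ` E"
    proof
      fix z assume "z \<in> closed_segment (ch j p) (ch j q)"
      then obtain t where t: "t \<in> {0..1}" "z = ch j p + t *\<^sub>R (ch j q - ch j p)" unfolding seg by blast
      obtain y where y: "y \<in> E" "ch i y = ch i p + t *\<^sub>R (ch i q - ch i p)" using onto[OF t(1)] by blast
      obtain s where s: "ch i y = ch i p + s *\<^sub>R (ch i q - ch i p)" "ch j y = ch j p + s *\<^sub>R (ch j q - ch j p)" using aff[OF y(1)] by blast
      have "ch i p + s *\<^sub>R (ch i q - ch i p) = ch i p + t *\<^sub>R (ch i q - ch i p)"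
        by (rule trans[OF s(1)[symmetric] y(2)])
      then have "s *\<^sub>R (Q - P) = t *\<^sub>R (Q - P)" unfolding add_left_cancel p(2,4) .
      then have "s = t" using PQ(3) unfolding scaleR_cancel_right by simp
      then have "z = ch j y" using s(2) t(2) by simp
      then show "z \<in> ch j ` E" using y(1) by (rule image_eqI)
    qed
  qed
  then have "{ch j p, ch j q} = {P', Q'}" using PQ'(4) closed_segment_eq by metis
  then have ext: "ch j p \<in> {A', B', D'}" "ch j q \<in> {A', B', D'}" using PQ' by auto
  have cv: "cell_vertex M j p" "cell_vertex M j q" "cell_vertex M i p" "cell_vertex M i q"
    unfolding cell_vertex_def Ti(2) Tj(2) triangle_extreme[OF Ti(1)] triangle_extreme[OF Tj(1)]
    using E p PQ(1,2) ext by auto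
  show ?thesis unfolding E_def[symmetric]
    by (rule exI[of _ p], rule exI[of _ q]) (intro conjI npq cv p(1) p(3) ballI[OF aff] ballI[OF onto]; assumption)
qed

lemma inter_cases:
  assumes ij: "i \<in> cells M" "j \<in> cells M" "i \<noteq> j" and p: "p \<in> C i" "p \<in> C j"
  shows "(C i \<inter> C j = {p} \<and> cell_vertex M i p \<and> cell_vertex M j p) \<or>
    (cell_edge M i (C i \<inter> C j) \<and> cell_edge M j (C i \<inter> C j))"
proof -
  have "C i \<inter> C j = {} \<or> cell_edge M i (C i \<inter> C j) \<and> cell_edge M j (C i \<inter> C j) \<or>
        (\<exists>p. C i \<inter> C j = {p} \<and> cell_vertex M i p \<and> cell_vertex M j p)"
    by (rule pf[unfolded piecewise_flat_surface_def, THEN conjunct2, THEN conjunct2, THEN conjunct2, THEN conjunct2,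
        THEN conjunct1, rule_format, OF ij])
  moreover have "r = p" if "C i \<inter> C j = {r}" for r
  proof -
    have "p \<in> C i \<inter> C j" using p by blast
    then show ?thesis unfolding that by simp
  qed
  moreover have "C i \<inter> C j \<noteq> {}" using p by blast
  ultimately show ?thesis by metis
qed

lemma vertex_segment:
  assumes i: "i \<in> cells M" and x: "cell_vertex M i x" and pq: "p \<in> C i" "q \<in> C i" "p \<noteq> q"
    and t: "t \<in> {0..1}" "ch i x = ch i p + t *\<^sub>R (ch i q - ch i p)"
  shows "x = p \<or> x = q"
proof (rule ccontr)
  assume ne: "\<not> (x = p \<or> x = q)"
  have xi: "x \<in> C i" using x by (simp add: cell_vertex_def)
  have "t \<noteq> 0" using t(2) chart_inj[OF i xi pq(1)] ne by auto
  moreover have "t \<noteq> 1" using t(2) chart_inj[OF i xi pq(2)] ne by auto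
  ultimately have "ch i x \<in> open_segment (ch i p) (ch i q)"
    using t chart_inj[OF i pq(1,2)] pq(3) unfolding in_segment by (intro conjI exI[of _ t]) (auto simp: algebra_simps)
  then show False using x pq unfolding cell_vertex_def extreme_point_of_def by blast
qed

text \<open>The common part is a point that is a vertex of both, or an edge. An extreme point of a
  triangle cannot lie inside an edge, so it is one of the ends, and these are vertices of
  both.\<close>

lemma vertex_shared: assumes "cell_vertex M i x" "i \<in> cells M" "j \<in> cells M" "x \<in> C j" shows "cell_vertex M j x"
proof (cases "i = j")
  case False
  have xi: "x \<in> C i" using assms(1) by (simp add: cell_vertex_def)
  from inter_cases[OF assms(2,3) False xi assms(4)] show ?thesis
  proof (elim disjE conjE)
    assume "cell_edge M i (C i \<inter> C j)" "cell_edge M j (C i \<inter> C j)"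
    from edge_common[OF assms(2,3) this] obtain p q where pq: "p \<noteq> q" "cell_vertex M j p" "cell_vertex M j q"
      "p \<in> C i" "q \<in> C i" "\<forall>y\<in>C i \<inter> C j. \<exists>t\<in>{0..1}. ch i y = ch i p + t *\<^sub>R (ch i q - ch i p) \<and> ch j y = ch j p + t *\<^sub>R (ch j q - ch j p)"
      by blast
    then obtain t where "t \<in> {0..1}" "ch i x = ch i p + t *\<^sub>R (ch i q - ch i p)" using xi assms(4) by blast
    then have "x = p \<or> x = q" using vertex_segment[OF assms(2,1) pq(4,5,1)] by blast
    then show ?thesis using pq by auto
  qed auto
qed (use assms in simp)

end

context pf_surface begin

text \<open>Invariance of domain in the direction from the surface to the chart; it will exclude
  that an edge belongs to one triangle only.\<close>

lemma open_in_cell: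
  assumes i: "i \<in> cells M" and W: "openin X W" "W \<subseteq> C i" "y \<in> W"
  shows "\<exists>r>0. ball (ch i y) r \<subseteq> ch i ` C i"
proof -
  have yX: "y \<in> topspace X" using openin_subset[OF W(1)] W(3) by blast
  then obtain V where V: "openin X V" "y \<in> V" "subtopology X V homeomorphic_space (euclidean :: (real^2) topology)"
    using surf unfolding surface_def by blast
  obtain \<phi> \<phi>' where hm: "homeomorphic_maps (subtopology X V) (euclidean :: (real^2) topology) \<phi> \<phi>'"
    using V(3) unfolding homeomorphic_space_def by blast
  have f: "continuous_map euclidean (subtopology X V) \<phi>'" "\<And>d. \<phi> (\<phi>' d) = d" "\<And>y. y \<in> V \<Longrightarrow> \<phi>' (\<phi> y) = y"
    using hm openin_subset[OF V(1)] unfolding homeomorphic_maps_def by auto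
  have fX: "continuous_map euclidean X \<phi>'" using f(1) by (simp add: continuous_map_in_subtopology)
  define D where "D = {d. \<phi>' d \<in> W}"
  have oD: "open D" using openin_continuous_map_preimage[OF fX W(1)] by (simp add: D_def)
  have "continuous_map (top_of_set D) (subtopology X (C i)) \<phi>'"
    unfolding continuous_map_in_subtopology using continuous_map_from_subtopology[OF fX, of D] W(2) by (auto simp: D_def)
  from continuous_map_compose[OF this homeomorphic_imp_continuous_map[OF chart_homeo[OF i]]]
  have "continuous_on D (ch i \<circ> \<phi>')" by (simp add: continuous_map_in_subtopology)
  moreover have "inj_on (ch i \<circ> \<phi>') D"
  proof (rule inj_onI)
    fix d e assume de: "d \<in> D" "e \<in> D" "(ch i \<circ> \<phi>') d = (ch i \<circ> \<phi>') e"
    have "\<phi>' d = \<phi>' e" by (rule chart_inj[OF i]) (use de W(2) in \<open>auto simp: D_def\<close>)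
    then have "\<phi> (\<phi>' d) = \<phi> (\<phi>' e)" by (rule arg_cong)
    then show "d = e" unfolding f(2) .
  qed
  ultimately have "open ((ch i \<circ> \<phi>') ` D)" using oD by (intro invariance_of_domain)
  moreover have "\<phi> y \<in> D" using f(3)[OF V(2)] W(3) by (simp add: D_def)
  then have "(ch i \<circ> \<phi>') (\<phi> y) \<in> (ch i \<circ> \<phi>') ` D" by (rule imageI)
  then have "ch i y \<in> (ch i \<circ> \<phi>') ` D" using f(3)[OF V(2)] by simp
  ultimately obtain r where "r > 0" "ball (ch i y) r \<subseteq> (ch i \<circ> \<phi>') ` D" using open_contains_ball by blast
  moreover have "(ch i \<circ> \<phi>') ` D \<subseteq> ch i ` C i" using W(2) by (auto simp: D_def)
  ultimately show ?thesis by blast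
qed

end

section \<open>The triangles at a vertex\<close>

locale pf_vertex = pf_surface X M for X :: "'p topology" and M :: "('p, 'i) flat_cells" +
  fixes x :: 'p
  assumes x: "x \<in> vertices M"
begin

definition I where "I = {i \<in> cells M. x \<in> C i}"
definition ev where "ev i y = ch i y - ch i x"
text \<open>The two far vertices of a triangle at \<open>x\<close>; by \<open>shared\<close>, two
  triangles share an edge at \<open>x\<close> exactly if they have such a vertex in common.\<close>

definition Q where "Q i = {y. cell_vertex M i y} - {x}"

lemma I_D: assumes "i \<in> I" shows "i \<in> cells M" "x \<in> C i" "cell_vertex M i x"
proof -
  show 1: "i \<in> cells M" "x \<in> C i" using assms by (auto simp: I_def)
  obtain k where k: "k \<in> cells M" "cell_vertex M k x" using x by (auto simp: vertices_def)
  show "cell_vertex M i x" by (rule vertex_shared[OF k(2,1) 1])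
qed

lemma Q_D: "q \<in> Q i \<Longrightarrow> cell_vertex M i q" "q \<in> Q i \<Longrightarrow> q \<noteq> x" "q \<in> Q i \<Longrightarrow> q \<in> C i"
  by (auto simp: Q_def cell_vertex_def)

lemma ev_x [simp]: "ev i x = 0" by (simp add: ev_def)

lemma ev_inj: "i \<in> I \<Longrightarrow> y \<in> C i \<Longrightarrow> z \<in> C i \<Longrightarrow> ev i y = ev i z \<Longrightarrow> y = z"
  using chart_inj[OF I_D(1), of i y z] by (simp add: ev_def)

lemma tri0: assumes i: "i \<in> I"
  shows "\<exists>p q. Q i = {p, q} \<and> p \<noteq> q \<and> cross2 (ev i p) (ev i q) \<noteq> 0 \<and>
    (\<forall>z. z \<in> ch i ` C i \<longleftrightarrow> (\<exists>s t. 0 \<le> s \<and> 0 \<le> t \<and> s + t \<le> 1 \<and> z = ch i x + s *\<^sub>R ev i p + t *\<^sub>R ev i q))"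
proof -
  note iD = I_D[OF i]
  obtain A B D where T: "\<not> collinear {A, B, D}" "ch i ` C i = convex hull {A, B, D}" using triangle[OF iD(1)] by blast
  have "ch i x \<in> {A, B, D}" using iD(3) unfolding cell_vertex_def T(2) triangle_extreme[OF T(1)] by blast
  then have "\<exists>B' D'. {A, B, D} = {ch i x, B', D'}" by blast
  then obtain B' D' where BD: "{A, B, D} = {ch i x, B', D'}" by blast
  have T': "\<not> collinear {ch i x, B', D'}" "ch i ` C i = convex hull {ch i x, B', D'}" using T unfolding BD by auto
  have "B' \<in> ch i ` C i" "D' \<in> ch i ` C i" unfolding T'(2) by (simp_all add: hull_inc)
  then obtain p q where pq: "p \<in> C i" "ch i p = B'" "q \<in> C i" "ch i q = D'" by blast
  have v: "cell_vertex M i y \<longleftrightarrow> y \<in> {x, p, q}" for y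
  proof
    assume "cell_vertex M i y"
    then have y: "y \<in> C i" "ch i y \<in> {ch i x, ch i p, ch i q}"
      unfolding cell_vertex_def T'(2) triangle_extreme[OF T'(1)] pq by auto
    then show "y \<in> {x, p, q}" using chart_inj[OF iD(1) y(1)] iD(2) pq(1,3) by blast
  next
    assume "y \<in> {x, p, q}"
    then show "cell_vertex M i y" unfolding cell_vertex_def T'(2) triangle_extreme[OF T'(1)] using iD(2) pq by auto
  qed
  have ne: "ch i x \<noteq> B'" "ch i x \<noteq> D'" "B' \<noteq> D'" using triangle_independent[OF T'(1)] by auto
  have n: "p \<noteq> x" "q \<noteq> x" "p \<noteq> q" using ne pq by auto
  have 1: "Q i = {p, q}" using v n unfolding Q_def by blast
  have 2: "cross2 (ev i p) (ev i q) \<noteq> 0" unfolding ev_def pq by (rule cross2_noncollinear[OF T'(1)])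
  have 3: "z \<in> ch i ` C i \<longleftrightarrow> (\<exists>s t. 0 \<le> s \<and> 0 \<le> t \<and> s + t \<le> 1 \<and> z = ch i x + s *\<^sub>R ev i p + t *\<^sub>R ev i q)" for z
    unfolding T'(2) convex_hull_3_alt ev_def pq by blast
  show ?thesis by (rule exI[of _ p], rule exI[of _ q]) (intro conjI 1 2 n(3) allI 3)
qed

lemma tri: assumes i: "i \<in> I" and q: "q \<in> Q i"
  shows "\<exists>q'. Q i = {q, q'} \<and> q \<noteq> q' \<and> cross2 (ev i q) (ev i q') \<noteq> 0 \<and>
    (\<forall>z. z \<in> ch i ` C i \<longleftrightarrow> (\<exists>s t. 0 \<le> s \<and> 0 \<le> t \<and> s + t \<le> 1 \<and> z = ch i x + s *\<^sub>R ev i q + t *\<^sub>R ev i q'))"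
proof -
  obtain p r where pr: "Q i = {p, r}" "p \<noteq> r" "cross2 (ev i p) (ev i r) \<noteq> 0"
    "\<And>z. z \<in> ch i ` C i \<longleftrightarrow> (\<exists>s t. 0 \<le> s \<and> 0 \<le> t \<and> s + t \<le> 1 \<and> z = ch i x + s *\<^sub>R ev i p + t *\<^sub>R ev i r)"
    using tri0[OF i] by blast
  have "q = p \<or> q = r" using q pr(1) by blast
  then show ?thesis
  proof
    assume "q = p"
    then show ?thesis using pr by blast
  next
    assume qr: "q = r"
    have "z \<in> ch i ` C i \<longleftrightarrow> (\<exists>s t. 0 \<le> s \<and> 0 \<le> t \<and> s + t \<le> 1 \<and> z = ch i x + s *\<^sub>R ev i q + t *\<^sub>R ev i p)" for z
    proof -
      have "(\<exists>s t. 0 \<le> s \<and> 0 \<le> t \<and> s + t \<le> 1 \<and> z = ch i x + s *\<^sub>R ev i p + t *\<^sub>R ev i r) \<longleftrightarrow>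
          (\<exists>t s. 0 \<le> s \<and> 0 \<le> t \<and> s + t \<le> 1 \<and> z = ch i x + s *\<^sub>R ev i p + t *\<^sub>R ev i r)" by (rule ex_comm)
      also have "\<dots> \<longleftrightarrow> (\<exists>s t. 0 \<le> s \<and> 0 \<le> t \<and> s + t \<le> 1 \<and> z = ch i x + s *\<^sub>R ev i q + t *\<^sub>R ev i p)"
        unfolding qr by (intro ex_cong1) (auto simp: add.commute add.left_commute)
      finally show ?thesis unfolding pr(4) .
    qed
    moreover have "cross2 (ev i q) (ev i p) \<noteq> 0" using pr(3) unfolding qr cross2_commute[of "ev i r"] by simp
    ultimately show ?thesis using pr(1,2) qr by (intro exI[of _ p]) auto
  qed
qed

lemma ev_nz: "i \<in> I \<Longrightarrow> q \<in> Q i \<Longrightarrow> ev i q \<noteq> 0"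
  using ev_inj[of i q x] I_D(2) Q_D by force

text \<open>A common edge contains \<open>x\<close>, and \<open>x\<close>, being an extreme point,
  is one of its ends. Taking the other end for \<open>q\<close>, the affine parameter of
  \<open>edge_common\<close> starts at \<open>x\<close> after reversal if necessary.\<close>

lemma shared:
  assumes ij: "i \<in> I" "j \<in> I" "i \<noteq> j"
  shows "(C i \<inter> C j = {x} \<and> Q i \<inter> Q j = {}) \<or> (\<exists>q. Q i \<inter> Q j = {q} \<and>
    (\<forall>y\<in>C i \<inter> C j. \<exists>t\<in>{0..1}. ev i y = t *\<^sub>R ev i q \<and> ev j y = t *\<^sub>R ev j q) \<and>
    (\<forall>t\<in>{0..1}. \<exists>y\<in>C i \<inter> C j. ev i y = t *\<^sub>R ev i q \<and> ev j y = t *\<^sub>R ev j q))"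
proof -
  note iD = I_D[OF ij(1)] note jD = I_D[OF ij(2)]
  from inter_cases[OF iD(1) jD(1) ij(3) iD(2) jD(2)] show ?thesis
  proof (elim disjE conjE)
    assume e: "C i \<inter> C j = {x}"
    have "Q i \<inter> Q j \<subseteq> C i \<inter> C j - {x}" using Q_D by blast
    then show ?thesis using e by blast
  next
    assume e: "cell_edge M i (C i \<inter> C j)" "cell_edge M j (C i \<inter> C j)"
    obtain p r where pr: "p \<noteq> r" "cell_vertex M i p" "cell_vertex M i r" "cell_vertex M j p" "cell_vertex M j r"
      "p \<in> C i \<inter> C j" "r \<in> C i \<inter> C j" and
      aff: "\<forall>y\<in>C i \<inter> C j. \<exists>t\<in>{0..1}. ch i y = ch i p + t *\<^sub>R (ch i r - ch i p) \<and> ch j y = ch j p + t *\<^sub>R (ch j r - ch j p)" and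
      onto: "\<forall>t\<in>{0..1}. \<exists>y\<in>C i \<inter> C j. ch i y = ch i p + t *\<^sub>R (ch i r - ch i p)"
      using edge_common[OF iD(1) jD(1) e] by (elim exE conjE)
    obtain t0 where t0: "t0 \<in> {0..1}" "ch i x = ch i p + t0 *\<^sub>R (ch i r - ch i p)"
      using aff[rule_format, of x] iD(2) jD(2) by blast
    have "p \<in> C i" "r \<in> C i" using pr by auto
    then have xpr: "x = p \<or> x = r" using vertex_segment[OF iD(1,3) _ _ pr(1) t0] by blast
    have "\<exists>q. q \<noteq> x \<and> cell_vertex M i q \<and> cell_vertex M j q \<and>
      (\<forall>y\<in>C i \<inter> C j. \<exists>t\<in>{0..1}. ev i y = t *\<^sub>R ev i q \<and> ev j y = t *\<^sub>R ev j q) \<and>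
      (\<forall>t\<in>{0..1}. \<exists>y\<in>C i \<inter> C j. ev i y = t *\<^sub>R ev i q)"
      using xpr
    proof
      assume xp: "x = p"
      have 1: "\<forall>y\<in>C i \<inter> C j. \<exists>t\<in>{0..1}. ev i y = t *\<^sub>R ev i r \<and> ev j y = t *\<^sub>R ev j r"
        using aff unfolding ev_def xp[symmetric] by (simp add: algebra_simps)
      have 2: "\<forall>t\<in>{0..1}. \<exists>y\<in>C i \<inter> C j. ev i y = t *\<^sub>R ev i r"
        using onto unfolding ev_def xp[symmetric] by (simp add: algebra_simps)
      show ?thesis by (rule exI[of _ r]) (use pr(1,3,5) xp 1 2 in simp)
    next
      assume xr: "x = r"
      have 1: "\<forall>y\<in>C i \<inter> C j. \<exists>t\<in>{0..1}. ev i y = t *\<^sub>R ev i p \<and> ev j y = t *\<^sub>R ev j p"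
      proof
        fix y assume "y \<in> C i \<inter> C j"
        then obtain t where t: "t \<in> {0..1}" "ch i y = ch i p + t *\<^sub>R (ch i r - ch i p)" "ch j y = ch j p + t *\<^sub>R (ch j r - ch j p)"
          using aff by blast
        then show "\<exists>t\<in>{0..1}. ev i y = t *\<^sub>R ev i p \<and> ev j y = t *\<^sub>R ev j p"
          unfolding ev_def xr[symmetric] by (intro bexI[of _ "1 - t"]) (simp_all add: algebra_simps)
      qed
      have 2: "\<forall>t\<in>{0..1}. \<exists>y\<in>C i \<inter> C j. ev i y = t *\<^sub>R ev i p"
      proof
        fix t :: real assume "t \<in> {0..1}"
        then have "1 - t \<in> {0..1}" by auto
        then obtain y where "y \<in> C i \<inter> C j" "ch i y = ch i p + (1 - t) *\<^sub>R (ch i r - ch i p)" using onto by blast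
        then show "\<exists>y\<in>C i \<inter> C j. ev i y = t *\<^sub>R ev i p"
          unfolding ev_def xr[symmetric] by (intro bexI[of _ y]) (simp_all add: algebra_simps)
      qed
      show ?thesis by (rule exI[of _ p]) (use pr(1,2,4) xr 1 2 in simp)
    qed
    then obtain q where q: "q \<noteq> x" "cell_vertex M i q" "cell_vertex M j q" and
      A: "\<forall>y\<in>C i \<inter> C j. \<exists>t\<in>{0..1}. ev i y = t *\<^sub>R ev i q \<and> ev j y = t *\<^sub>R ev j q" and
      B: "\<forall>t\<in>{0..1}. \<exists>y\<in>C i \<inter> C j. ev i y = t *\<^sub>R ev i q" by (elim exE conjE)
    have qQ: "q \<in> Q i" "q \<in> Q j" using q by (auto simp: Q_def)
    have "s = q" if s: "s \<in> Q i" "s \<in> Q j" for s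
    proof -
      obtain t where t: "t \<in> {0..1}" "ev i s = t *\<^sub>R ev i q" using A s Q_D(3) by blast
      have "ch i s = ch i x + t *\<^sub>R (ch i q - ch i x)" using t(2) by (simp add: ev_def algebra_simps)
      from vertex_segment[OF iD(1) Q_D(1)[OF s(1)] iD(2) Q_D(3)[OF qQ(1)] q(1)[symmetric] t(1) this]
      show ?thesis using Q_D(2)[OF s(1)] by blast
    qed
    then have 1: "Q i \<inter> Q j = {q}" using qQ by blast
    have 2: "\<forall>t\<in>{0..1}. \<exists>y\<in>C i \<inter> C j. ev i y = t *\<^sub>R ev i q \<and> ev j y = t *\<^sub>R ev j q"
    proof
      fix t :: real assume "t \<in> {0..1}"
      then obtain y where y: "y \<in> C i \<inter> C j" "ev i y = t *\<^sub>R ev i q" using B by blast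
      then obtain s where s: "ev i y = s *\<^sub>R ev i q" "ev j y = s *\<^sub>R ev j q" using A by blast
      have "t *\<^sub>R ev i q = s *\<^sub>R ev i q" by (rule trans[OF y(2)[symmetric] s(1)])
      then have "t = s" using ev_nz[OF ij(1) qQ(1)] unfolding scaleR_cancel_right by blast
      then show "\<exists>y\<in>C i \<inter> C j. ev i y = t *\<^sub>R ev i q \<and> ev j y = t *\<^sub>R ev j q" using y s by blast
    qed
    show ?thesis by (rule disjI2, rule exI[of _ q]) (intro conjI 1 A 2)
  qed
qed

lemma shared_q:
  assumes "i \<in> I" "j \<in> I" "i \<noteq> j" "q \<in> Q i" "q \<in> Q j"
  shows "y \<in> C i \<Longrightarrow> y \<in> C j \<Longrightarrow> \<exists>t\<in>{0..1}. ev i y = t *\<^sub>R ev i q \<and> ev j y = t *\<^sub>R ev j q"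
    and "t \<in> {0..1} \<Longrightarrow> \<exists>y\<in>C i \<inter> C j. ev i y = t *\<^sub>R ev i q \<and> ev j y = t *\<^sub>R ev j q"
proof -
  obtain q' where q': "Q i \<inter> Q j = {q'}" and
    A: "\<forall>y\<in>C i \<inter> C j. \<exists>t\<in>{0..1}. ev i y = t *\<^sub>R ev i q' \<and> ev j y = t *\<^sub>R ev j q'" and
    B: "\<forall>t\<in>{0..1}. \<exists>y\<in>C i \<inter> C j. ev i y = t *\<^sub>R ev i q' \<and> ev j y = t *\<^sub>R ev j q'"
    using shared[OF assms(1-3)] assms(4,5) by blast
  have "q \<in> Q i \<inter> Q j" using assms(4,5) by blast
  then have q: "q' = q" unfolding q' by simp
  show "y \<in> C i \<Longrightarrow> y \<in> C j \<Longrightarrow> \<exists>t\<in>{0..1}. ev i y = t *\<^sub>R ev i q \<and> ev j y = t *\<^sub>R ev j q"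
    using A unfolding q by blast
  show "t \<in> {0..1} \<Longrightarrow> \<exists>y\<in>C i \<inter> C j. ev i y = t *\<^sub>R ev i q \<and> ev j y = t *\<^sub>R ev j q"
    using B unfolding q by blast
qed

text \<open>The midpoint is not a vertex of \<open>i\<close>, so \<open>i\<close> and
  \<open>k\<close> share an edge through it. The ends of that edge are vertices of \<open>i\<close>,
  and only the segment from \<open>x\<close> to \<open>q\<close> passes through the
  midpoint.\<close>

lemma edge_cells:
  assumes i: "i \<in> I" and q: "q \<in> Q i" and y: "y \<in> C i" "ev i y = (1/2) *\<^sub>R ev i q"
    and k: "k \<in> cells M" "y \<in> C k" "k \<noteq> i"
  shows "k \<in> I" "q \<in> Q k"
proof -
  note iD = I_D[OF i]
  obtain q' where q': "Q i = {q, q'}" "cross2 (ev i q) (ev i q') \<noteq> 0" using tri[OF i q] by blast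
  \<comment> \<open>\<open>f\<close> and \<open>g\<close> are the barycentric coordinates for
    \<open>q'\<close> and \<open>q\<close> in triangle \<open>i\<close>.\<close>
  define f where "f z = cross2 (ev i q) (ev i z) / cross2 (ev i q) (ev i q')" for z
  define g where "g z = cross2 (ev i z) (ev i q') / cross2 (ev i q) (ev i q')" for z
  have fg: "f x = 0" "f q = 0" "f q' = 1" "g x = 0" "g q = 1" "g q' = 0" using q'(2) by (simp_all add: f_def g_def)
  have "x \<in> C k \<and> cell_vertex M k q"
    using inter_cases[OF iD(1) k(1) k(3)[symmetric] y(1) k(2)]
  proof (elim disjE conjE)
    assume v: "cell_vertex M i y"
    have "ch i y = ch i x + (1/2) *\<^sub>R (ch i q - ch i x)" using y(2) by (simp add: ev_def algebra_simps)
    from vertex_segment[OF iD(1) v iD(2) Q_D(3)[OF q] Q_D(2)[OF q, symmetric] _ this]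
    have "y = x \<or> y = q" by simp
    moreover have "1 *\<^sub>R ev i q \<noteq> (1/2) *\<^sub>R ev i q" "0 \<noteq> (1/2) *\<^sub>R ev i q"
      using ev_nz[OF i q] unfolding scaleR_cancel_right by auto
    ultimately have False using y(2) by (elim disjE) simp_all
    then show ?thesis ..
  next
    assume e: "cell_edge M i (C i \<inter> C k)" "cell_edge M k (C i \<inter> C k)"
    obtain p r where pr: "p \<noteq> r" "cell_vertex M i p" "cell_vertex M i r" "cell_vertex M k p" "cell_vertex M k r"
      "p \<in> C i \<inter> C k" "r \<in> C i \<inter> C k" and
      aff: "\<forall>y\<in>C i \<inter> C k. \<exists>t\<in>{0..1}. ch i y = ch i p + t *\<^sub>R (ch i r - ch i p) \<and> ch k y = ch k p + t *\<^sub>R (ch k r - ch k p)"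
      using edge_common[OF iD(1) k(1) e] by (elim exE conjE)
    obtain t where t: "ch i y = ch i p + t *\<^sub>R (ch i r - ch i p)" using aff[rule_format, of y] y(1) k(2) by blast
    then have "ev i y = ev i p + t *\<^sub>R (ev i r - ev i p)" unfolding ev_def by (simp add: algebra_simps)
    then have ev: "(1/2) *\<^sub>R ev i q = ev i p + t *\<^sub>R (ev i r - ev i p)" unfolding y(2) .
    have "f p + t * (f r - f p) = cross2 (ev i q) ((1/2) *\<^sub>R ev i q) / cross2 (ev i q) (ev i q')"
      unfolding ev by (simp add: f_def add_divide_distrib diff_divide_distrib right_diff_distrib)
    then have 1: "f p + t * (f r - f p) = 0" by simp
    have "g p + t * (g r - g p) = cross2 ((1/2) *\<^sub>R ev i q) (ev i q') / cross2 (ev i q) (ev i q')"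
      unfolding ev by (simp add: g_def add_divide_distrib diff_divide_distrib right_diff_distrib)
    then have 2: "g p + t * (g r - g p) = 1/2" using q'(2) by simp
    have "p = x \<or> p = q \<or> p = q'" "r = x \<or> r = q \<or> r = q'" using pr(2,3) q'(1) unfolding Q_def by auto
    then have "p = x \<and> r = q \<or> p = q \<and> r = x" using 1 2 fg pr(1) by auto
    then show ?thesis using pr by auto
  qed
  then show "k \<in> I" "q \<in> Q k" using k(1) Q_D(2)[OF q] by (auto simp: I_def Q_def)
qed

lemma midpoint: assumes "i \<in> I" "q \<in> Q i" shows "\<exists>y\<in>C i. ev i y = (1/2) *\<^sub>R ev i q"
proof -
  obtain q' where "\<forall>z. z \<in> ch i ` C i \<longleftrightarrow> (\<exists>s t. 0 \<le> s \<and> 0 \<le> t \<and> s + t \<le> 1 \<and> z = ch i x + s *\<^sub>R ev i q + t *\<^sub>R ev i q')"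
    using tri[OF assms] by blast
  then have "ch i x + (1/2) *\<^sub>R ev i q + 0 *\<^sub>R ev i q' \<in> ch i ` C i"
    by (elim allE[of _ "ch i x + (1/2) *\<^sub>R ev i q + 0 *\<^sub>R ev i q'"] iffD2) (intro exI[of _ "1/2"] exI[of _ 0], simp)
  then obtain y where y: "y \<in> C i" "ch i y = ch i x + (1/2) *\<^sub>R ev i q + 0 *\<^sub>R ev i q'" by (metis imageE)
  then have "ev i y = (1/2) *\<^sub>R ev i q" unfolding ev_def[of i y] by simp
  then show ?thesis using y(1) by blast
qed

text \<open>Otherwise triangle \<open>i\<close> alone is a neighbourhood of the midpoint of the
  edge, and its chart image contains a disc around a boundary point of the triangle. Here the
  surface being without boundary is used.\<close>

lemma ex_neighbour: assumes i: "i \<in> I" and q: "q \<in> Q i" shows "\<exists>j\<in>I. j \<noteq> i \<and> q \<in> Q j"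
proof (rule ccontr)
  assume no: "\<not> ?thesis"
  note iD = I_D[OF i]
  obtain y where y: "y \<in> C i" "ev i y = (1/2) *\<^sub>R ev i q" using midpoint[OF i q] by blast
  obtain q' where q': "cross2 (ev i q) (ev i q') \<noteq> 0" and
    T: "\<And>z. z \<in> ch i ` C i \<longleftrightarrow> (\<exists>s t. 0 \<le> s \<and> 0 \<le> t \<and> s + t \<le> 1 \<and> z = ch i x + s *\<^sub>R ev i q + t *\<^sub>R ev i q')"
    using tri[OF i q] by blast
  have K: "k = i" if k: "k \<in> cells M" "y \<in> C k" for k
    using edge_cells[OF i q y k] no by blast
  have yX: "y \<in> topspace X" using cell_sub[OF iD(1)] y(1) by blast
  obtain W where W': "openin X W" "y \<in> W" "W \<subseteq> (\<Union>k\<in>{k \<in> cells M. y \<in> C k}. C k)"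
    using star_nbhd[OF yX] by (elim exE conjE)
  have "W \<subseteq> C i"
  proof
    fix w assume "w \<in> W"
    then obtain k where "k \<in> cells M" "y \<in> C k" "w \<in> C k" using W'(3) by blast
    then show "w \<in> C i" using K by simp
  qed
  note W = W'(1,2) this
  obtain r where r: "r > 0" "ball (ch i y) r \<subseteq> ch i ` C i" using open_in_cell[OF iD(1) W(1,3,2)] by blast
  \<comment> \<open>A step of length \<open>r / 2\<close> across the edge, away from the third
    vertex: inside the disc but outside the triangle.\<close>
  define e where "e = r / (2 * norm (ev i q'))"
  have nz: "ev i q' \<noteq> 0" using q' by auto
  then have e: "e > 0" "norm (e *\<^sub>R ev i q') < r" using r(1) by (auto simp: e_def field_simps)
  then have "ch i y - e *\<^sub>R ev i q' \<in> ball (ch i y) r" by (simp add: dist_norm)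
  then obtain s t where st: "0 \<le> t" "ch i y - e *\<^sub>R ev i q' = ch i x + s *\<^sub>R ev i q + t *\<^sub>R ev i q'" using r(2) T by blast
  have "ev i y = s *\<^sub>R ev i q + (t + e) *\<^sub>R ev i q'" using st(2) unfolding ev_def[of i y] by (simp add: algebra_simps)
  then have "(1/2) *\<^sub>R ev i q = s *\<^sub>R ev i q + (t + e) *\<^sub>R ev i q'" unfolding y(2) .
  then have "cross2 (ev i q) ((1/2) *\<^sub>R ev i q) = cross2 (ev i q) (s *\<^sub>R ev i q + (t + e) *\<^sub>R ev i q')" by (rule arg_cong)
  then have "(t + e) * cross2 (ev i q) (ev i q') = 0" by (simp del: cross2_simps(1) add: cross2_simps)
  then show False using q' e(1) st(1) by simp
qed

text \<open>Two of the triangles, glued along the edge, already form a neighbourhood of its midpoint, so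
  there is no room for the third.\<close>

lemma neighbour_unique:
  assumes i: "i \<in> I" and j: "j \<in> I" and k: "k \<in> I" and q: "q \<in> Q i" "q \<in> Q j" "q \<in> Q k"
    and ne: "i \<noteq> j" "i \<noteq> k" "j \<noteq> k"
  shows False
proof -
  note iD = I_D[OF i] note jD = I_D[OF j] note kD = I_D[OF k]
  obtain qi where qi: "cross2 (ev i q) (ev i qi) \<noteq> 0" and
    Ti: "\<And>z. z \<in> ch i ` C i \<longleftrightarrow> (\<exists>s t. 0 \<le> s \<and> 0 \<le> t \<and> s + t \<le> 1 \<and> z = ch i x + s *\<^sub>R ev i q + t *\<^sub>R ev i qi)"
    using tri[OF i q(1)] by blast
  obtain qj where qj: "cross2 (ev j q) (ev j qj) \<noteq> 0" and
    Tj: "\<And>z. z \<in> ch j ` C j \<longleftrightarrow> (\<exists>s t. 0 \<le> s \<and> 0 \<le> t \<and> s + t \<le> 1 \<and> z = ch j x + s *\<^sub>R ev j q + t *\<^sub>R ev j qj)"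
    using tri[OF j q(2)] by blast
  obtain qk where qk: "cross2 (ev k q) (ev k qk) \<noteq> 0" and
    Tk: "\<And>z. z \<in> ch k ` C k \<longleftrightarrow> (\<exists>s t. 0 \<le> s \<and> 0 \<le> t \<and> s + t \<le> 1 \<and> z = ch k x + s *\<^sub>R ev k q + t *\<^sub>R ev k qk)"
    using tri[OF k q(3)] by blast
  obtain gi where gi: "continuous_map (top_of_set (ch i ` C i)) X gi" "\<And>y. y \<in> C i \<Longrightarrow> gi (ch i y) = y"
    using chart_inv[OF iD(1)] by blast
  obtain gj where gj: "continuous_map (top_of_set (ch j ` C j)) X gj" "\<And>y. y \<in> C j \<Longrightarrow> gj (ch j y) = y"
    using chart_inv[OF jD(1)] by blast
  \<comment> \<open>A planar model of the two glued triangles: \<open>i\<close> fills the upper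
    half, \<open>j\<close> the lower half, and the open common edge lies on the axis
    \<open>v$2 = 0\<close>.\<close>
  define D where "D = {v::real^2. 0 < v$1 \<and> v$1 + v$2 < 1 \<and> v$1 - v$2 < 1}"
  define Li where "Li v = ch i x + v$1 *\<^sub>R ev i q + v$2 *\<^sub>R ev i qi" for v :: "real^2"
  define Lj where "Lj v = ch j x + v$1 *\<^sub>R ev j q + (- v$2) *\<^sub>R ev j qj" for v :: "real^2"
  define \<psi> where "\<psi> v = (if 0 \<le> v$2 then gi (Li v) else gj (Lj v))" for v :: "real^2"
  have oD: "open D" unfolding D_def by (intro open_Collect_conj open_Collect_less continuous_intros)
  have Lin: "Li v \<in> ch i ` C i" if "v \<in> D" "0 \<le> v$2" for v
    unfolding Ti Li_def by (rule exI[of _ "v$1"], rule exI[of _ "v$2"]) (use that in \<open>simp add: D_def\<close>)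
  have Ljn: "Lj v \<in> ch j ` C j" if "v \<in> D" "v$2 \<le> 0" for v
    unfolding Tj Lj_def by (rule exI[of _ "v$1"], rule exI[of _ "- v$2"]) (use that in \<open>simp add: D_def\<close>)
  have agree: "gi (Li v) = gj (Lj v)" if v: "v \<in> D" "v$2 = 0" for v
  proof -
    have "v$1 \<in> {0..1}" using v by (simp add: D_def)
    then obtain y where y: "y \<in> C i" "y \<in> C j" "ev i y = v$1 *\<^sub>R ev i q" "ev j y = v$1 *\<^sub>R ev j q"
      using shared_q(2)[OF i j ne(1) q(1,2)] by blast
    have "Li v = ch i y" "Lj v = ch j y" using y(3,4) v(2) unfolding Li_def Lj_def ev_def[of _ y] by (simp_all add: algebra_simps)
    then show ?thesis using gi(2)[OF y(1)] gj(2)[OF y(2)] by simp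
  qed
  have \<psi>i: "\<psi> v \<in> C i \<and> ch i (\<psi> v) = Li v" if v: "v \<in> D" "0 \<le> v$2" for v
  proof -
    obtain z where "z \<in> C i" "Li v = ch i z" using Lin[OF v] by blast
    then show ?thesis using gi(2)[of z] v(2) by (simp add: \<psi>_def)
  qed
  have \<psi>j: "\<psi> v \<in> C j \<and> ch j (\<psi> v) = Lj v" if v: "v \<in> D" "v$2 \<le> 0" for v
  proof -
    obtain z where "z \<in> C j" "Lj v = ch j z" using Ljn[OF v] by blast
    then have "gj (Lj v) \<in> C j" "ch j (gj (Lj v)) = Lj v" using gj(2)[of z] by auto
    moreover have "\<psi> v = gj (Lj v)" using agree[OF v(1)] v(2) by (simp add: \<psi>_def)
    ultimately show ?thesis by simp
  qed
  have "continuous_map (top_of_set D) X \<psi>"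
    unfolding \<psi>_def
  proof (rule continuous_map_cases_le)
    show "continuous_map (subtopology (top_of_set D) {v \<in> topspace (top_of_set D). 0 \<le> v$2}) X (\<lambda>v. gi (Li v))"
    proof (rule continuous_map_compose[of _ "top_of_set (ch i ` C i)" Li X gi, unfolded o_def])
      show "continuous_map (subtopology (top_of_set D) {v \<in> topspace (top_of_set D). 0 \<le> v$2}) (top_of_set (ch i ` C i)) Li"
        unfolding continuous_map_in_subtopology subtopology_subtopology
        using Lin by (auto simp: Li_def intro!: continuous_intros)
    qed (rule gi(1))
    show "continuous_map (subtopology (top_of_set D) {v \<in> topspace (top_of_set D). v$2 \<le> 0}) X (\<lambda>v. gj (Lj v))"
    proof (rule continuous_map_compose[of _ "top_of_set (ch j ` C j)" Lj X gj, unfolded o_def])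
      show "continuous_map (subtopology (top_of_set D) {v \<in> topspace (top_of_set D). v$2 \<le> 0}) (top_of_set (ch j ` C j)) Lj"
        unfolding continuous_map_in_subtopology subtopology_subtopology
        using Ljn by (auto simp: Lj_def intro!: continuous_intros)
    qed (rule gj(1))
    show "gi (Li v) = gj (Lj v)" if "v \<in> topspace (top_of_set D)" "0 = v$2" for v
      using agree[of v] that by simp
  qed (auto intro!: continuous_intros)
  moreover have "inj_on \<psi> D"
  proof -
    have Li_inj: "v = w" if "Li v = Li w" for v w
    proof -
      have e: "v$1 *\<^sub>R ev i q + v$2 *\<^sub>R ev i qi = w$1 *\<^sub>R ev i q + w$2 *\<^sub>R ev i qi" using that by (simp add: Li_def)
      have "v$2 * cross2 (ev i q) (ev i qi) = w$2 * cross2 (ev i q) (ev i qi)"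
        using arg_cong[OF e, of "cross2 (ev i q)"] by simp
      moreover have "v$1 * cross2 (ev i q) (ev i qi) = w$1 * cross2 (ev i q) (ev i qi)"
        using arg_cong[OF e, of "\<lambda>z. cross2 z (ev i qi)"] by simp
      ultimately show ?thesis using qi by (simp add: vec2_eq_iff)
    qed
    have Lj_inj: "v = w" if "Lj v = Lj w" for v w
    proof -
      have e: "v$1 *\<^sub>R ev j q + (- v$2) *\<^sub>R ev j qj = w$1 *\<^sub>R ev j q + (- w$2) *\<^sub>R ev j qj"
        using that unfolding Lj_def add.assoc add_left_cancel .
      have "v$2 * cross2 (ev j q) (ev j qj) = w$2 * cross2 (ev j q) (ev j qj)"
        using arg_cong[OF e, of "cross2 (ev j q)"] by simp
      moreover have "v$1 * cross2 (ev j q) (ev j qj) = w$1 * cross2 (ev j q) (ev j qj)"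
        using arg_cong[OF e, of "\<lambda>z. cross2 z (ev j qj)"] by simp
      ultimately show ?thesis using qj by (simp add: vec2_eq_iff)
    qed
    have mixed: "v = w" if v: "v \<in> D" "0 \<le> v$2" and w: "w \<in> D" "w$2 \<le> 0" and e: "\<psi> v = \<psi> w" for v w
    proof -
      have vi: "\<psi> v \<in> C i" "ch i (\<psi> v) = Li v" using \<psi>i[OF v] by auto
      have wj: "\<psi> w \<in> C j" "ch j (\<psi> w) = Lj w" using \<psi>j[OF w] by auto
      obtain s where s: "ev i (\<psi> v) = s *\<^sub>R ev i q" using shared_q(1)[OF i j ne(1) q(1,2) vi(1)] wj(1) e by auto
      have "v$1 *\<^sub>R ev i q + v$2 *\<^sub>R ev i qi = s *\<^sub>R ev i q"
        using s vi(2) unfolding ev_def[of i "\<psi> v"] Li_def by (simp add: algebra_simps)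
      from arg_cong[OF this, of "cross2 (ev i q)"] have "v$2 = 0" using qi by simp
      then have "ch j (\<psi> v) = Lj v" using \<psi>j[OF v(1)] by simp
      then have "Lj v = Lj w" using wj(2) e by simp
      then show ?thesis by (rule Lj_inj)
    qed
    show ?thesis
    proof (rule inj_onI)
      fix v w assume vw: "v \<in> D" "w \<in> D" "\<psi> v = \<psi> w"
      consider "0 \<le> v$2" "0 \<le> w$2" | "0 \<le> v$2" "w$2 \<le> 0" | "v$2 \<le> 0" "0 \<le> w$2" | "v$2 \<le> 0" "w$2 \<le> 0" by linarith
      then show "v = w"
      proof cases
        case 1
        have "Li v = Li w" using \<psi>i[OF vw(1) 1(1)] \<psi>i[OF vw(2) 1(2)] vw(3) by simp
        then show ?thesis by (rule Li_inj)
      next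
        case 2
        show ?thesis by (rule mixed[OF vw(1) 2(1) vw(2) 2(2) vw(3)])
      next
        case 3
        show ?thesis by (rule mixed[OF vw(2) 3(2) vw(1) 3(1) vw(3)[symmetric], symmetric])
      next
        case 4
        have "Lj v = Lj w" using \<psi>j[OF vw(1) 4(1)] \<psi>j[OF vw(2) 4(2)] vw(3) by simp
        then show ?thesis by (rule Lj_inj)
      qed
    qed
  qed
  moreover define d0 :: "real^2" where "d0 = vector [1/2, 0]"
  moreover have d0: "d0 \<in> D" "d0$1 = 1/2" "d0$2 = 0" by (simp_all add: d0_def D_def)
  ultimately obtain O' where O': "openin X O'" "\<psi> d0 \<in> O'" "O' \<subseteq> \<psi> ` D"
    using surface_image_nbhd[OF surf oD d0(1)] by blast
  have sub: "z \<in> C i \<or> z \<in> C j" if z: "z \<in> O'" for z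
  proof -
    obtain v where v: "v \<in> D" "z = \<psi> v" using z O'(3) by blast
    show ?thesis using \<psi>i[OF v(1)] \<psi>j[OF v(1)] v(2) by (cases "0 \<le> v$2") auto
  qed
  obtain y where y: "y \<in> C i" "y \<in> C k" "ev i y = (1/2) *\<^sub>R ev i q" "ev k y = (1/2) *\<^sub>R ev k q"
    using shared_q(2)[OF i k ne(2) q(1,3), of "1/2"] by auto
  have "\<psi> d0 \<in> C i" "ch i (\<psi> d0) = Li d0" using \<psi>i[OF d0(1)] d0(3) by auto
  then have "\<psi> d0 = y" using y(1,3) d0(2,3) by (intro ev_inj[OF i]) (auto simp: ev_def Li_def)
  then have yO: "y \<in> O'" using O'(2) by simp
  \<comment> \<open>The third triangle reaches from the midpoint towards \<open>qk\<close> into the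
    open set \<open>O'\<close>. But \<open>O'\<close> is covered by \<open>i\<close> and
    \<open>j\<close>, which meet \<open>k\<close> only along the edge.\<close>
  have "ch k y + t *\<^sub>R ev k qk \<in> ch k ` C k" if t: "0 \<le> t" "t \<le> 1/2" for t
    unfolding Tk by (rule exI[of _ "1/2"], rule exI[of _ t]) (use y(4) t in \<open>simp add: ev_def[of k y] algebra_simps\<close>)
  from near_in_cell[OF kD(1) y(2) O'(1) yO this, of "1/2"]
  obtain t z where z: "t > 0" "z \<in> C k" "z \<in> O'" "ch k z = ch k y + t *\<^sub>R ev k qk" by auto
  have "\<exists>s. ev k z = s *\<^sub>R ev k q"
    using sub[OF z(3)] shared_q(1)[OF i k ne(2) q(1,3) _ z(2)] shared_q(1)[OF j k ne(3) q(2,3) _ z(2)] by blast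
  then obtain s where s: "ev k z = s *\<^sub>R ev k q" by blast
  have "ev k z = (1/2) *\<^sub>R ev k q + t *\<^sub>R ev k qk" using z(4) y(4) by (simp add: ev_def[of k z] ev_def[of k y] algebra_simps)
  then have e: "(1/2) *\<^sub>R ev k q + t *\<^sub>R ev k qk = s *\<^sub>R ev k q" using s by simp
  have "t * cross2 (ev k q) (ev k qk) = 0" using arg_cong[OF e, of "cross2 (ev k q)"] by simp
  then show False using z(1) qk by simp
qed

text \<open>A punctured disc around the vertex is connected.\<close>

lemma link_connected:
  assumes A: "A \<subseteq> I" "A \<noteq> {}" and cl: "\<And>i j. i \<in> A \<Longrightarrow> j \<in> I \<Longrightarrow> Q i \<inter> Q j \<noteq> {} \<Longrightarrow> j \<in> A"
  shows "A = I"
proof (rule ccontr)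
  assume "A \<noteq> I"
  define B where "B = I - A"
  have B: "B \<subseteq> I" "B \<noteq> {}" using A \<open>A \<noteq> I\<close> by (auto simp: B_def)
  obtain i0 where i0: "i0 \<in> I" using A by blast
  have xX: "x \<in> topspace X" using cell_sub[OF I_D(1)[OF i0]] I_D(2)[OF i0] by blast
  obtain W where W: "openin X W" "x \<in> W" "W \<subseteq> (\<Union>k\<in>{k \<in> cells M. x \<in> C k}. C k)" "finite {k \<in> cells M. x \<in> C k}"
    using star_nbhd[OF xX] by (elim exE conjE)
  obtain V where V: "openin X V" "x \<in> V" "subtopology X V homeomorphic_space (euclidean :: (real^2) topology)"
    using surf xX unfolding surface_def by blast
  obtain \<phi> \<phi>' where hm: "homeomorphic_maps (subtopology X V) (euclidean :: (real^2) topology) \<phi> \<phi>'"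
    using V(3) unfolding homeomorphic_space_def by blast
  have f: "continuous_map euclidean (subtopology X V) \<phi>'" "continuous_map (subtopology X V) euclidean \<phi>"
    "\<And>d. \<phi> (\<phi>' d) = d" "\<And>y. y \<in> V \<Longrightarrow> \<phi>' (\<phi> y) = y"
    using hm openin_subset[OF V(1)] unfolding homeomorphic_maps_def by auto
  have fX: "continuous_map euclidean X \<phi>'" using f(1) by (simp add: continuous_map_in_subtopology)
  have fV: "\<phi>' d \<in> V" for d using continuous_map_funspace[OF f(1)] by auto
  have "open {d. \<phi>' d \<in> W}" using openin_continuous_map_preimage[OF fX W(1)] by simp
  moreover have "\<phi> x \<in> {d. \<phi>' d \<in> W}" using f(4)[OF V(2)] W(2) by simp
  ultimately obtain r where r: "r > 0" "ball (\<phi> x) r \<subseteq> {d. \<phi>' d \<in> W}" using open_contains_ball by blast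
  define P where "P = \<phi>' ` (ball (\<phi> x) r - {\<phi> x})"
  have "connectedin euclidean (ball (\<phi> x) r - {\<phi> x})"
    using connected_punctured_ball[of "\<phi> x" r] by simp
  then have cP: "connectedin X P" unfolding P_def by (rule connectedin_continuous_map_image[OF fX])
  have xP: "x \<notin> P"
  proof
    assume "x \<in> P"
    then obtain d where "d \<noteq> \<phi> x" "x = \<phi>' d" unfolding P_def by blast
    then show False using f(3)[of d] by simp
  qed
  define N where "N = {y \<in> topspace (subtopology X V). \<phi> y \<in> ball (\<phi> x) r}"
  have "openin (subtopology X V) N" unfolding N_def by (intro openin_continuous_map_preimage[OF f(2)]) simp
  then have oN: "openin X N" using V(1) openin_trans_full by blast
  have xN: "x \<in> N" using V(2) xX r(1) by (simp add: N_def)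
  have NP: "z \<in> P" if z: "z \<in> N" "z \<noteq> x" for z
  proof -
    have zV: "z \<in> V" "\<phi> z \<in> ball (\<phi> x) r" using z(1) by (auto simp: N_def)
    have "\<phi> z \<noteq> \<phi> x"
    proof
      assume "\<phi> z = \<phi> x"
      then have "\<phi>' (\<phi> z) = \<phi>' (\<phi> x)" by (rule arg_cong)
      then show False using z(2) unfolding f(4)[OF zV(1)] f(4)[OF V(2)] by simp
    qed
    then have "\<phi>' (\<phi> z) \<in> P" using zV unfolding P_def by blast
    then show ?thesis unfolding f(4)[OF zV(1)] .
  qed
  have meets: "\<exists>z\<in>C i. z \<in> P" if i: "i \<in> I" for i
  proof -
    obtain q where q: "q \<in> Q i" using tri0[OF i] by blast
    obtain q' where T: "\<And>z. z \<in> ch i ` C i \<longleftrightarrow> (\<exists>s t. 0 \<le> s \<and> 0 \<le> t \<and> s + t \<le> 1 \<and> z = ch i x + s *\<^sub>R ev i q + t *\<^sub>R ev i q')"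
      using tri[OF i q] by blast
    have "ch i x + t *\<^sub>R ev i q \<in> ch i ` C i" if t: "0 \<le> t" "t \<le> 1" for t
      unfolding T by (rule exI[of _ t], rule exI[of _ 0]) (use t in simp)
    from near_in_cell[OF I_D(1,2)[OF i] oN xN this, of 1]
    obtain t z where z: "t > 0" "z \<in> C i" "z \<in> N" "ch i z = ch i x + t *\<^sub>R ev i q" by auto
    have "z \<noteq> x" using z(1,4) ev_nz[OF i q] by auto
    then show ?thesis using NP[OF z(3)] z(2) by blast
  qed
  have fin: "finite A" "finite B" using A(1) B(1) W(4) unfolding I_def[symmetric] by (auto intro: finite_subset)
  have "closedin X (\<Union>i\<in>A. C i)" "closedin X (\<Union>i\<in>B. C i)"
    using fin A(1) B(1) by (auto intro!: closedin_Union cell_closed simp: I_def)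
  moreover have "P \<subseteq> (\<Union>i\<in>A. C i) \<union> (\<Union>i\<in>B. C i)"
  proof
    fix z assume "z \<in> P"
    then have "z \<in> W" using r(2) unfolding P_def by blast
    then obtain k where "k \<in> I" "z \<in> C k" using W(3) unfolding I_def by blast
    then show "z \<in> (\<Union>i\<in>A. C i) \<union> (\<Union>i\<in>B. C i)" unfolding B_def by blast
  qed
  \<comment> \<open>Triangles of \<open>A\<close> and of \<open>B\<close> share no edge at
    \<open>x\<close>, so they meet only in \<open>x\<close>, which the punctured disc omits.\<close>
  moreover have "(\<Union>i\<in>A. C i) \<inter> (\<Union>i\<in>B. C i) \<inter> P = {}"
  proof -
    have False if z: "i \<in> A" "j \<in> B" "z \<in> C i" "z \<in> C j" "z \<in> P" for i j z
    proof -
      have ij: "i \<in> I" "j \<in> I" "i \<noteq> j" "Q i \<inter> Q j = {}" using z(1,2) A(1) cl[of i j] by (auto simp: B_def)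
      then have "C i \<inter> C j = {x}" using shared[OF ij(1-3)] by auto
      moreover have "z \<in> C i \<inter> C j" using z by blast
      ultimately show False using xP z(5) by simp
    qed
    then show ?thesis by blast
  qed
  moreover have "(\<Union>i\<in>A. C i) \<inter> P \<noteq> {}" "(\<Union>i\<in>B. C i) \<inter> P \<noteq> {}" using meets A B by blast+
  ultimately show False using cP unfolding connectedin_closedin by blast
qed

end

text \<open>
  The part of \<open>vertex_cone\<close> that does not involve the norms, so that a surface and its reversal
  share it. In \<open>edge\<close>, \<open>y\<close> is the midpoint of the edge from \<open>x\<close> to \<open>q\<close>, where the Landsberg
  condition is applied.
\<close>

locale vertex_geometry =
  fixes M :: "('p, 'i) flat_cells" and x :: 'p and ori :: "'i \<Rightarrow> real" and nxt :: "'i \<Rightarrow> 'i"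
    and a b :: "'i \<Rightarrow> real^2" and al be :: "'i \<Rightarrow> real" and I :: "'i set"
  assumes I_eq: "I = {i \<in> cells M. x \<in> cell M i}"
    and finI: "finite I" and I_ne: "I \<noteq> {}"
    and nxt: "bij_betw nxt I I"
    and nxt1: "i \<in> I \<Longrightarrow> nxt i \<noteq> i" and nxt2: "i \<in> I \<Longrightarrow> nxt (nxt i) \<noteq> i"
    and conn: "A \<subseteq> I \<Longrightarrow> A \<noteq> {} \<Longrightarrow> nxt ` A \<subseteq> A \<Longrightarrow> A = I"
    and ori: "i \<in> I \<Longrightarrow> ori i \<in> {1, -1}"
    and angle_a: "i \<in> I \<Longrightarrow> \<exists>r>0. a i = r *\<^sub>R polar (ori i) (al i)"
    and angle_b: "i \<in> I \<Longrightarrow> \<exists>r>0. b i = r *\<^sub>R polar (ori i) (be i)"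
    and al_be: "i \<in> I \<Longrightarrow> al i < be i \<and> be i < al i + pi"
    and S_eq: "i \<in> I \<Longrightarrow> sector M x i = {s *\<^sub>R a i + t *\<^sub>R b i | s t. 0 \<le> s \<and> 0 \<le> t}"
    and rel: "((i, y), (j, z)) \<in> cone_rel M x \<longleftrightarrow> i \<in> I \<and> j \<in> I \<and> y \<in> sector M x i \<and> z \<in> sector M x j \<and>
      (i = j \<and> y = z \<or> y = 0 \<and> z = 0 \<or> j = nxt i \<and> (\<exists>r\<ge>0. y = r *\<^sub>R b i \<and> z = r *\<^sub>R a j)
       \<or> i = nxt j \<and> (\<exists>r\<ge>0. y = r *\<^sub>R a i \<and> z = r *\<^sub>R b j))"
    and edge: "i \<in> I \<Longrightarrow> \<exists>y q. {x, y, q} \<subseteq> cell M i \<inter> cell M (nxt i) \<and> y \<notin> vertices M \<and>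
      chart M i q - chart M i x = b i \<and> chart M (nxt i) q - chart M (nxt i) x = a (nxt i) \<and>
      chart M i q - chart M i y = (1/2) *\<^sub>R b i \<and> chart M (nxt i) q - chart M (nxt i) y = (1/2) *\<^sub>R a (nxt i) \<and>
      sector M y i = {z. ori i * cross2 (b i) z \<le> 0} \<and>
      sector M y (nxt i) = {z. 0 \<le> ori (nxt i) * cross2 (a (nxt i)) z}"

section \<open>Sectors, orientation and cyclic order at a vertex\<close>

context pf_vertex begin

lemma finI: "finite I" and I_ne: "I \<noteq> {}"
proof -
  obtain k where k: "k \<in> cells M" "cell_vertex M k x" using x by (auto simp: vertices_def)
  then have "k \<in> I" by (auto simp: I_def cell_vertex_def)
  then show "I \<noteq> {}" by blast
  have "x \<in> topspace X" using cell_sub[OF k(1)] k(2) by (auto simp: cell_vertex_def)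
  from star_nbhd[OF this] show "finite I" unfolding I_def by blast
qed

lemma tri_pair: assumes i: "i \<in> I" and q: "q \<in> Q i" "q' \<in> Q i" "q \<noteq> q'"
  shows "Q i = {q, q'}" "cross2 (ev i q) (ev i q') \<noteq> 0"
    "z \<in> ch i ` C i \<longleftrightarrow> (\<exists>s t. 0 \<le> s \<and> 0 \<le> t \<and> s + t \<le> 1 \<and> z = ch i x + s *\<^sub>R ev i q + t *\<^sub>R ev i q')"
proof -
  obtain r where r: "Q i = {q, r}" "q \<noteq> r" "cross2 (ev i q) (ev i r) \<noteq> 0"
    "\<And>z. z \<in> ch i ` C i \<longleftrightarrow> (\<exists>s t. 0 \<le> s \<and> 0 \<le> t \<and> s + t \<le> 1 \<and> z = ch i x + s *\<^sub>R ev i q + t *\<^sub>R ev i r)"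
    using tri[OF i q(1)] by blast
  have "r = q'" using r(1) q by auto
  then show "Q i = {q, q'}" "cross2 (ev i q) (ev i q') \<noteq> 0"
    "z \<in> ch i ` C i \<longleftrightarrow> (\<exists>s t. 0 \<le> s \<and> 0 \<le> t \<and> s + t \<le> 1 \<and> z = ch i x + s *\<^sub>R ev i q + t *\<^sub>R ev i q')"
    using r by auto
qed

lemma sector_iff: "y \<in> sector M x i \<longleftrightarrow> (\<exists>p\<in>C i. \<exists>c\<ge>0. y = c *\<^sub>R ev i p)"
  unfolding sector_def cone_hull_expl ev_def by blast

lemma rel_iff: "((i, y), (j, z)) \<in> cone_rel M x \<longleftrightarrow>
    i \<in> I \<and> j \<in> I \<and> (\<exists>p\<in>C i \<inter> C j. \<exists>c\<ge>0. y = c *\<^sub>R ev i p \<and> z = c *\<^sub>R ev j p)"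
  unfolding cone_rel_def I_def ev_def mem_Collect_eq prod.case by blast

lemma rel_self: "((i, y), (i, z)) \<in> cone_rel M x \<longleftrightarrow> i \<in> I \<and> y = z \<and> y \<in> sector M x i"
  unfolding rel_iff sector_iff Int_absorb by blast

lemma sector_tri: assumes i: "i \<in> I" and q: "q \<in> Q i" "q' \<in> Q i" "q \<noteq> q'"
  shows "sector M x i = {s *\<^sub>R ev i q + t *\<^sub>R ev i q' | s t. 0 \<le> s \<and> 0 \<le> t}"
proof (rule set_eqI, rule iffI)
  fix y assume "y \<in> sector M x i"
  then obtain p c where pc: "p \<in> C i" "c \<ge> 0" "y = c *\<^sub>R ev i p" unfolding sector_iff by blast
  have "ch i p \<in> ch i ` C i" using pc(1) by (rule imageI)
  then obtain s t where st: "0 \<le> s" "0 \<le> t" "ch i p = ch i x + s *\<^sub>R ev i q + t *\<^sub>R ev i q'" unfolding tri_pair(3)[OF i q] by blast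
  have "y = (c * s) *\<^sub>R ev i q + (c * t) *\<^sub>R ev i q'" using pc(3) st(3) unfolding ev_def[of i p] by (simp add: algebra_simps)
  moreover have "0 \<le> c * s" "0 \<le> c * t" using pc(2) st by simp_all
  ultimately show "y \<in> {s *\<^sub>R ev i q + t *\<^sub>R ev i q' | s t. 0 \<le> s \<and> 0 \<le> t}" by blast
next
  fix y assume "y \<in> {s *\<^sub>R ev i q + t *\<^sub>R ev i q' | s t. 0 \<le> s \<and> 0 \<le> t}"
  then obtain s t where st: "0 \<le> s" "0 \<le> t" "y = s *\<^sub>R ev i q + t *\<^sub>R ev i q'" by blast
  \<comment> \<open>Dividing by \<open>c\<close> brings the vector into the triangle, where it is
    the difference of a point of the cell and \<open>x\<close>.\<close>
  define c where "c = s + t + 1"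
  have c: "c > 0" using st by (simp add: c_def)
  have "ch i x + (s / c) *\<^sub>R ev i q + (t / c) *\<^sub>R ev i q' \<in> ch i ` C i" unfolding tri_pair(3)[OF i q]
  proof (rule exI[of _ "s / c"], rule exI[of _ "t / c"], intro conjI)
    have "s / c + t / c = (s + t) / c" by (simp add: add_divide_distrib)
    then show "s / c + t / c \<le> 1" using c by (simp add: c_def)
  qed (use st c in auto)
  then obtain p where p: "p \<in> C i" "ch i p = ch i x + (s / c) *\<^sub>R ev i q + (t / c) *\<^sub>R ev i q'" by (metis imageE)
  have "y = c *\<^sub>R ev i p" using p(2) st(3) c unfolding ev_def[of i p] by (simp add: scaleR_add_right)
  then show "y \<in> sector M x i" unfolding sector_iff using p(1) c by (intro bexI[of _ p] exI[of _ c]) auto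
qed

text \<open>At the midpoint of an edge the directions into the triangle fill the half plane on the
  side of the third vertex; this makes the unit vectors there a half circle.\<close>

lemma sector_midpoint: assumes i: "i \<in> I" and q: "q \<in> Q i" "q' \<in> Q i" "q \<noteq> q'"
    and y: "y \<in> C i" "ev i y = (1/2) *\<^sub>R ev i q"
  shows "sector M y i = {z. 0 \<le> cross2 (ev i q) z / cross2 (ev i q) (ev i q')}"
proof (rule set_eqI, rule iffI)
  note nz = tri_pair(2)[OF i q]
  fix z assume "z \<in> sector M y i"
  then obtain p c where pc: "p \<in> C i" "c \<ge> 0" "z = c *\<^sub>R (ch i p - ch i y)" unfolding sector_def cone_hull_expl by blast
  have "ch i p \<in> ch i ` C i" using pc(1) by (rule imageI)
  then obtain s t where st: "0 \<le> s" "0 \<le> t" "ch i p = ch i x + s *\<^sub>R ev i q + t *\<^sub>R ev i q'" unfolding tri_pair(3)[OF i q] by blast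
  have "ch i p - ch i y = s *\<^sub>R ev i q + t *\<^sub>R ev i q' - (1/2) *\<^sub>R ev i q" using st(3) y(2) unfolding ev_def[of i y] by (simp add: algebra_simps)
  then have "cross2 (ev i q) z = (c * t) * cross2 (ev i q) (ev i q')" using pc(3) by simp
  then have "cross2 (ev i q) z / cross2 (ev i q) (ev i q') = c * t" using nz by simp
  then show "z \<in> {z. 0 \<le> cross2 (ev i q) z / cross2 (ev i q) (ev i q')}" using pc(2) st(2) by simp
next
  note nz = tri_pair(2)[OF i q]
  fix z assume z: "z \<in> {z. 0 \<le> cross2 (ev i q) z / cross2 (ev i q) (ev i q')}"
  define \<alpha> where "\<alpha> = cross2 z (ev i q') / cross2 (ev i q) (ev i q')"
  define \<beta> where "\<beta> = cross2 (ev i q) z / cross2 (ev i q) (ev i q')"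
  have e: "z = \<alpha> *\<^sub>R ev i q + \<beta> *\<^sub>R ev i q'" unfolding \<alpha>_def \<beta>_def by (rule cross2_basis[OF nz])
  have \<beta>: "\<beta> \<ge> 0" using z by (simp add: \<beta>_def)
  \<comment> \<open>Large enough that \<open>z\<close> divided by \<open>c\<close>, attached at the
    midpoint, stays in the triangle: both coordinates change by at most one half in total.\<close>
  define c where "c = 2 * (\<bar>\<alpha>\<bar> + \<beta>) + 1"
  have c: "c > 0" using \<beta> by (simp add: c_def)
  have "ch i x + (1/2 + \<alpha> / c) *\<^sub>R ev i q + (\<beta> / c) *\<^sub>R ev i q' \<in> ch i ` C i" unfolding tri_pair(3)[OF i q]
  proof (rule exI[of _ "1/2 + \<alpha> / c"], rule exI[of _ "\<beta> / c"], intro conjI)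
    have "- c \<le> 2 * \<alpha>" "2 * (\<alpha> + \<beta>) \<le> c" using \<beta> by (auto simp: c_def)
    then have "- (1/2) \<le> \<alpha> / c" "(\<alpha> + \<beta>) / c \<le> 1/2" using c by (simp_all add: field_simps)
    moreover have "(\<alpha> + \<beta>) / c = \<alpha> / c + \<beta> / c" by (rule add_divide_distrib)
    ultimately show "0 \<le> 1/2 + \<alpha> / c" "1/2 + \<alpha> / c + \<beta> / c \<le> 1" by linarith+
  qed (use \<beta> c in auto)
  then obtain p where p: "p \<in> C i" "ch i p = ch i x + (1/2 + \<alpha> / c) *\<^sub>R ev i q + (\<beta> / c) *\<^sub>R ev i q'"
    by - (erule imageE, rule that, assumption, erule sym)
  have "ch i p - ch i y = ev i p - ev i y" by (simp add: ev_def)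
  also have "\<dots> = (\<alpha> / c) *\<^sub>R ev i q + (\<beta> / c) *\<^sub>R ev i q'" unfolding y(2) using p(2) unfolding ev_def[of i p] by (simp add: algebra_simps)
  finally have "z = c *\<^sub>R (ch i p - ch i y)" using e c by (simp add: scaleR_add_right)
  then show "z \<in> sector M y i" unfolding sector_def cone_hull_expl using p(1) c by (auto intro!: exI[of _ c])
qed

text \<open>The class that \<open>vertex_cone\<close> calls \<open>pt\<close>, at a stage where that
  locale is not yet established.\<close>

definition cls where "cls i y = cone_rel M x `` {(i, y)}"

lemma cls_in: assumes "((i, y), (j, z)) \<in> cone_rel M x"
  shows "cls i y \<in> cell (tangent_cone M x) j"
proof -
  have i: "i \<in> I" "y \<in> sector M x i" using assms unfolding rel_iff sector_iff by auto
  then have "cls i y \<in> cone_points M x" unfolding cone_points_def cls_def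
    by (intro quotientI) (simp add: I_def)
  moreover have "(j, z) \<in> cls i y" using assms by (simp add: cls_def)
  ultimately show ?thesis by (auto simp: tangent_cone_def)
qed

lemma cls_chart: assumes "((i, y), (j, z)) \<in> cone_rel M x" "\<And>w. ((i, y), (j, w)) \<in> cone_rel M x \<Longrightarrow> w = z"
  shows "chart (tangent_cone M x) j (cls i y) = z"
proof -
  have "(THE y'. (j, y') \<in> cls i y) = z"
  proof (rule the_equality)
    show "(j, z) \<in> cls i y" using assms(1) by (simp add: cls_def)
    show "w = z" if "(j, w) \<in> cls i y" for w
      by (rule assms(2)) (use that in \<open>simp add: cls_def\<close>)
  qed
  then show ?thesis by (simp add: tangent_cone_def)
qed

text \<open>\<open>cone_orientation\<close> only gives a weak inequality. Evaluated at the third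
  vertices, where the determinants do not vanish, it becomes strict.\<close>

lemma orientation_edge:
  assumes o: "cone_orientation M x ori" and ij: "i \<in> I" "j \<in> I" "i \<noteq> j"
    and q: "q \<in> Q i" "q \<in> Q j" and qi: "qi \<in> Q i" "qi \<noteq> q" and qj: "qj \<in> Q j" "qj \<noteq> q"
  shows "(ori i * cross2 (ev i q) (ev i qi)) * (ori j * cross2 (ev j q) (ev j qj)) < 0" "ori i \<in> {1, -1}"
proof -
  have cellsT: "cells (tangent_cone M x) = I" by (simp add: tangent_cone_def I_def)
  have R: "((k, ev k p), (k, ev k p)) \<in> cone_rel M x" if "k \<in> I" "p \<in> Q k" for k p
    unfolding rel_iff using that Q_D(3)[OF that(2)] by (intro conjI bexI[of _ p] exI[of _ 1]) auto
  have T: "cls k (ev k p) \<in> cell (tangent_cone M x) k" "chart (tangent_cone M x) k (cls k (ev k p)) = ev k p"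
    if "k \<in> I" "p \<in> Q k" for k p
    using cls_in[OF R[OF that]] cls_chart[OF R[OF that]] by (auto simp: rel_self)
  have Rij: "((i, ev i q), (j, ev j q)) \<in> cone_rel M x"
    unfolding rel_iff using ij Q_D(3)[OF q(1)] Q_D(3)[OF q(2)] by (intro conjI bexI[of _ q] exI[of _ 1]) auto
  have cj: "chart (tangent_cone M x) j (cls i (ev i q)) = ev j q"
  proof (rule cls_chart[OF Rij])
    fix w assume "((i, ev i q), (j, w)) \<in> cone_rel M x"
    then obtain p c where pc: "p \<in> C i" "p \<in> C j" "ev i q = c *\<^sub>R ev i p" "w = c *\<^sub>R ev j p" unfolding rel_iff by blast
    obtain t where t: "ev i p = t *\<^sub>R ev i q" "ev j p = t *\<^sub>R ev j q" using shared_q(1)[OF ij q pc(1,2)] by blast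
    have "1 *\<^sub>R ev i q = (c * t) *\<^sub>R ev i q" using pc(3) t(1) by simp
    then have "c * t = 1" using ev_nz[OF ij(1) q(1)] unfolding scaleR_cancel_right by simp
    then show "w = ev j q" using pc(4) t(2) by simp
  qed
  note o' = o[unfolded cone_orientation_def Let_def cellsT]
  show oi: "ori i \<in> {1, -1}" using o' ij by blast
  have oj: "ori j \<in> {1, -1}" using o' ij by blast
  have "(ori i * det (vector [chart (tangent_cone M x) i (cls i (ev i q)), chart (tangent_cone M x) i (cls i (ev i qi))] :: real^2^2)) *
           (ori j * det (vector [chart (tangent_cone M x) j (cls i (ev i q)), chart (tangent_cone M x) j (cls j (ev j qj))] :: real^2^2)) \<le> 0"
    by (rule o'[THEN conjunct2, rule_format, OF ij IntI]) (use T ij q qi qj cls_in[OF Rij] in auto)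
  then have "(ori i * cross2 (ev i q) (ev i qi)) * (ori j * cross2 (ev j q) (ev j qj)) \<le> 0"
    unfolding cj T(2)[OF ij(1) q(1)] T(2)[OF ij(1) qi(1)] T(2)[OF ij(2) qj(1)] det_vector2 .
  moreover have "(ori i * cross2 (ev i q) (ev i qi)) * (ori j * cross2 (ev j q) (ev j qj)) \<noteq> 0"
    using oi oj tri_pair(2)[OF ij(1) q(1) qi(1) qi(2)[symmetric]] tri_pair(2)[OF ij(2) q(2) qj(1) qj(2)[symmetric]] by auto
  ultimately show "(ori i * cross2 (ev i q) (ev i qi)) * (ori j * cross2 (ev j q) (ev j qj)) < 0" by (rule le_neq_trans)
qed

end

context pf_vertex begin

text \<open>The orientation orders the two far vertices of each triangle. Orientations alternate
  across an edge, so the last far vertex of a triangle is the first of its neighbour there, and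
  passing to this neighbour defines \<open>nxt\<close>. Exactly two triangles at each edge make it a
  bijection, and \<open>link_connected\<close> makes it a single cycle.\<close>

lemma ex_vertex_geometry:
  assumes o: "cone_orientation M x ori"
  shows "\<exists>nxt a b al be. vertex_geometry M x ori nxt a b al be I"
proof -
  have ori: "ori i \<in> {1, -1}" if i: "i \<in> I" for i
    by (rule o[unfolded cone_orientation_def Let_def, THEN conjunct1, rule_format])
      (use i in \<open>simp add: tangent_cone_def I_def\<close>)
  \<comment> \<open>The pair lists first and last far vertex so that the sector turns left from one
    to the other.\<close>
  have "\<forall>i\<in>I. \<exists>P. Q i = {fst P, snd P} \<and> fst P \<noteq> snd P \<and> 0 < ori i * cross2 (ev i (fst P)) (ev i (snd P))"
  proof
    fix i assume i: "i \<in> I"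
    obtain p q where pq: "Q i = {p, q}" "p \<noteq> q" "cross2 (ev i p) (ev i q) \<noteq> 0" using tri0[OF i] by blast
    show "\<exists>P. Q i = {fst P, snd P} \<and> fst P \<noteq> snd P \<and> 0 < ori i * cross2 (ev i (fst P)) (ev i (snd P))"
    proof (cases "0 < ori i * cross2 (ev i p) (ev i q)")
      case True
      then show ?thesis using pq by (intro exI[of _ "(p, q)"]) simp
    next
      case False
      have "ori i * cross2 (ev i p) (ev i q) \<noteq> 0" using ori[OF i] pq(3) by auto
      then have "ori i * cross2 (ev i p) (ev i q) < 0" using False by linarith
      then have "0 < ori i * cross2 (ev i q) (ev i p)" unfolding cross2_commute[of "ev i q"] by simp
      then show ?thesis using pq by (intro exI[of _ "(q, p)"]) (simp add: insert_commute)
    qed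
  qed
  from bchoice[OF this] obtain P where P: "\<forall>i\<in>I. Q i = {fst (P i), snd (P i)} \<and> fst (P i) \<noteq> snd (P i) \<and> 0 < ori i * cross2 (ev i (fst (P i))) (ev i (snd (P i)))"
    by (elim exE)
  define fr where "fr i = fst (P i)" for i
  define sr where "sr i = snd (P i)" for i
  have Qi: "Q i = {fr i, sr i}" and fs: "fr i \<noteq> sr i" and pos: "0 < ori i * cross2 (ev i (fr i)) (ev i (sr i))"
    and frQ: "fr i \<in> Q i" and srQ: "sr i \<in> Q i" if "i \<in> I" for i
    using P[rule_format, OF that] unfolding fr_def sr_def by simp_all
  have neg: "ori i * cross2 (ev i (sr i)) (ev i (fr i)) < 0" if "i \<in> I" for i
    using pos[OF that] unfolding cross2_commute[of "ev i (sr i)"] by simp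
  \<comment> \<open>A shared vertex that is last in both triangles, or first in both, would make the
    product in \<open>orientation_edge\<close> positive.\<close>
  have match: "q = sr i \<and> q = fr j \<or> q = fr i \<and> q = sr j" if ij: "i \<in> I" "j \<in> I" "i \<noteq> j" "q \<in> Q i" "q \<in> Q j" for i j q
  proof -
    note O = orientation_edge(1)[OF o ij]
    have "False" if "q = sr i" "q = sr j"
      using O[of "fr i" "fr j"] frQ[OF ij(1)] frQ[OF ij(2)] fs[OF ij(1)] fs[OF ij(2)] mult_neg_neg[OF neg[OF ij(1)] neg[OF ij(2)]] that by simp
    moreover have "False" if "q = fr i" "q = fr j"
      using O[of "sr i" "sr j"] srQ[OF ij(1)] srQ[OF ij(2)] fs[OF ij(1)] fs[OF ij(2)] mult_pos_pos[OF pos[OF ij(1)] pos[OF ij(2)]] that by simp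
    moreover have "q = fr i \<or> q = sr i" "q = fr j \<or> q = sr j" using ij(4,5) Qi[OF ij(1)] Qi[OF ij(2)] by auto
    ultimately show ?thesis by blast
  qed
  have "\<forall>i\<in>I. \<exists>j. j \<in> I \<and> j \<noteq> i \<and> sr i \<in> Q j" 
  proof
    fix i assume i: "i \<in> I"
    show "\<exists>j. j \<in> I \<and> j \<noteq> i \<and> sr i \<in> Q j" using ex_neighbour[OF i srQ[OF i]] by blast
  qed
  from bchoice[OF this] obtain nxt where n: "\<forall>i\<in>I. nxt i \<in> I \<and> nxt i \<noteq> i \<and> sr i \<in> Q (nxt i)" 
    by (elim exE)
  have nI: "nxt i \<in> I" and n1: "nxt i \<noteq> i" and nQ: "sr i \<in> Q (nxt i)" if "i \<in> I" for i using n[rule_format, OF that] by simp_all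
  have sf: "sr i = fr (nxt i)" if i: "i \<in> I" for i
    using match[OF i nI[OF i] n1[OF i, symmetric] srQ[OF i] nQ[OF i]] fs[OF i] by auto
  have uniq: "j = nxt i" if ij: "i \<in> I" "j \<in> I" "i \<noteq> j" "sr i \<in> Q j" for i j
    using neighbour_unique[OF ij(1) nI[OF ij(1)] ij(2) srQ[OF ij(1)] nQ[OF ij(1)] ij(4) n1[OF ij(1), symmetric] ij(3)] by blast
  have nb: "j = nxt i \<and> q = sr i \<or> i = nxt j \<and> q = sr j" if ij: "i \<in> I" "j \<in> I" "i \<noteq> j" "q \<in> Q i" "q \<in> Q j" for i j q
    using match[OF ij] uniq[OF ij(1,2,3)] uniq[OF ij(2,1) ij(3)[symmetric]] ij(4,5) by auto
  have prev: "\<exists>k\<in>I. nxt k = i" if i: "i \<in> I" for i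
  proof -
    obtain k where k: "k \<in> I" "k \<noteq> i" "fr i \<in> Q k" using ex_neighbour[OF i frQ[OF i]] by blast
    have "i = nxt k" using nb[OF i k(1) k(2)[symmetric] frQ[OF i] k(3)] fs[OF i] by auto
    then show ?thesis using k(1) by blast
  qed
  have inj: "inj_on nxt I" by (rule finite_surj_inj[OF finI]) (use prev in blast)
  have bij: "bij_betw nxt I I" unfolding bij_betw_def using inj prev nI by blast
  \<comment> \<open>With period two, the two triangles would share both edges at \<open>x\<close>,
    but two triangles have at most one edge in common.\<close>
  have n2: "nxt (nxt i) \<noteq> i" if i: "i \<in> I" for i
  proof
    assume e: "nxt (nxt i) = i"
    have "sr (nxt i) \<in> Q i" using nQ[OF nI[OF i]] e by simp
    moreover have "sr (nxt i) \<in> Q (nxt i)" "sr i \<in> Q i" "sr i \<in> Q (nxt i)" using srQ nI i nQ by auto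
    ultimately have "{sr i, sr (nxt i)} \<subseteq> Q i \<inter> Q (nxt i)" by blast
    moreover have "sr i \<noteq> sr (nxt i)" using sf[OF i] fs[OF nI[OF i]] by simp
    moreover have "\<exists>q. Q i \<inter> Q (nxt i) \<subseteq> {q}"
      using shared[OF i nI[OF i] n1[OF i, symmetric]]
    proof (elim disjE exE conjE)
      fix q assume "Q i \<inter> Q (nxt i) = {q}"
      then show ?thesis by (intro exI[of _ q]) simp
    qed simp
    ultimately show False by blast
  qed
  have cn: "A = I" if A: "A \<subseteq> I" "A \<noteq> {}" "nxt ` A \<subseteq> A" for A
  proof (rule link_connected[OF A(1,2)])
    fix i j assume ij: "i \<in> A" "j \<in> I" "Q i \<inter> Q j \<noteq> {}"
    \<comment> \<open>On a finite set an injective self-map is onto, so a set closed under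
      successors is also closed under predecessors, hence under all neighbours.\<close>
    have eq: "nxt ` A = A" by (rule endo_inj_surj[OF finite_subset[OF A(1) finI] A(3) inj_on_subset[OF inj A(1)]])
    have iI: "i \<in> I" using ij(1) A(1) by blast
    show "j \<in> A"
    proof (cases "i = j")
      case False
      obtain q where "q \<in> Q i" "q \<in> Q j" using ij(3) by blast
      from nb[OF iI ij(2) False this] show ?thesis
      proof (elim disjE conjE)
        assume "i = nxt j"
        moreover have "i \<in> nxt ` A" using eq ij(1) by simp
        then obtain k where k: "k \<in> A" "i = nxt k" by blast
        have kI: "k \<in> I" by (rule subsetD[OF A(1) k(1)])
        ultimately have "nxt k = nxt j" using k(2) by simp
        then have "k = j" by (rule inj_onD[OF inj _ kI ij(2)])
        then show ?thesis using k by simp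
      qed (use A(3) ij(1) in blast)
    qed (use ij in simp)
  qed
  define a where "a i = ev i (fr i)" for i
  define b where "b i = ev i (sr i)" for i
  have "\<forall>i\<in>I. \<exists>A. \<exists>r>0. a i = r *\<^sub>R polar (ori i) A"
  proof
    fix i assume i: "i \<in> I"
    interpret sign "ori i" by unfold_locales (rule ori[OF i])
    show "\<exists>A. \<exists>r>0. a i = r *\<^sub>R polar (ori i) A" using ex_polar[of "a i" 0] ev_nz[OF i frQ[OF i]] unfolding a_def by blast
  qed
  from bchoice[OF this] obtain al where al: "\<forall>i\<in>I. \<exists>r>0. a i = r *\<^sub>R polar (ori i) (al i)" 
    by (elim exE)
  have "\<forall>i\<in>I. \<exists>B. (\<exists>r>0. b i = r *\<^sub>R polar (ori i) B) \<and> al i < B \<and> B < al i + pi"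
  proof
    fix i assume i: "i \<in> I"
    interpret sign "ori i" by unfold_locales (rule ori[OF i])
    obtain r where r: "r > 0" "a i = r *\<^sub>R polar (ori i) (al i)" using al i by blast
    have "0 < r * (ori i * cross2 (polar (ori i) (al i)) (b i))"
      using pos[OF i] unfolding a_def[symmetric] b_def[symmetric] r(2) by (simp add: algebra_simps)
    then have "0 < ori i * cross2 (polar (ori i) (al i)) (b i)" using r(1) by (simp add: zero_less_mult_iff)
    from ex_polar_gt[OF this] show "\<exists>B. (\<exists>r>0. b i = r *\<^sub>R polar (ori i) B) \<and> al i < B \<and> B < al i + pi" by auto
  qed
  from bchoice[OF this] obtain be where be: "\<forall>i\<in>I. (\<exists>r>0. b i = r *\<^sub>R polar (ori i) (be i)) \<and> al i < be i \<and> be i < al i + pi"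
    by (elim exE)
  have S: "sector M x i = {s *\<^sub>R a i + t *\<^sub>R b i | s t. 0 \<le> s \<and> 0 \<le> t}" if i: "i \<in> I" for i
    unfolding a_def b_def by (rule sector_tri[OF i frQ[OF i] srQ[OF i] fs[OF i]])
  have inS: "r *\<^sub>R a i \<in> sector M x i" "r *\<^sub>R b i \<in> sector M x i" if "i \<in> I" "0 \<le> r" for i r
    unfolding a_def b_def sector_iff using Q_D(3)[OF frQ[OF that(1)]] Q_D(3)[OF srQ[OF that(1)]] that(2) by blast+
  have rl: "((i, y), (j, z)) \<in> cone_rel M x \<longleftrightarrow> i \<in> I \<and> j \<in> I \<and> y \<in> sector M x i \<and> z \<in> sector M x j \<and>
      (i = j \<and> y = z \<or> y = 0 \<and> z = 0 \<or> j = nxt i \<and> (\<exists>r\<ge>0. y = r *\<^sub>R b i \<and> z = r *\<^sub>R a j)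
       \<or> i = nxt j \<and> (\<exists>r\<ge>0. y = r *\<^sub>R a i \<and> z = r *\<^sub>R b j))" (is "_ \<longleftrightarrow> ?R") for i y j z
  proof
    assume r: "((i, y), (j, z)) \<in> cone_rel M x"
    then obtain p c where pc: "i \<in> I" "j \<in> I" "p \<in> C i" "p \<in> C j" "0 \<le> c" "y = c *\<^sub>R ev i p" "z = c *\<^sub>R ev j p"
      unfolding rel_iff by blast
    have yz: "y \<in> sector M x i" "z \<in> sector M x j" unfolding sector_iff using pc by blast+
    have "i = j \<and> y = z \<or> y = 0 \<and> z = 0 \<or> j = nxt i \<and> (\<exists>r\<ge>0. y = r *\<^sub>R b i \<and> z = r *\<^sub>R a j)
       \<or> i = nxt j \<and> (\<exists>r\<ge>0. y = r *\<^sub>R a i \<and> z = r *\<^sub>R b j)"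
    proof (cases "i = j")
      case True
      then show ?thesis using pc(6,7) by simp
    next
      case False
      show ?thesis
      proof (cases "Q i \<inter> Q j = {}")
        case True
        then have "C i \<inter> C j = {x}" using shared[OF pc(1,2) False] by auto
        then have "p = x" using pc(3,4) by blast
        then show ?thesis using pc(6,7) by simp
      next
        case q: False
        obtain q where q: "q \<in> Q i" "q \<in> Q j" using q by blast
        obtain t where t: "t \<in> {0..1}" "ev i p = t *\<^sub>R ev i q" "ev j p = t *\<^sub>R ev j q"
          using shared_q(1)[OF pc(1,2) False q pc(3,4)] by blast
        have ct: "0 \<le> c * t" "y = (c * t) *\<^sub>R ev i q" "z = (c * t) *\<^sub>R ev j q" using pc(5-7) t by auto
        from nb[OF pc(1,2) False q] show ?thesis
        proof (elim disjE conjE)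
          assume n: "j = nxt i" "q = sr i"
          have "y = (c * t) *\<^sub>R b i \<and> z = (c * t) *\<^sub>R a j" using ct(2,3) n sf[OF pc(1)] by (simp add: a_def b_def)
          then show ?thesis using n(1) ct(1) by blast
        next
          assume n: "i = nxt j" "q = sr j"
          have "y = (c * t) *\<^sub>R a i \<and> z = (c * t) *\<^sub>R b j" using ct(2,3) n sf[OF pc(2)] by (simp add: a_def b_def)
          then show ?thesis using n(1) ct(1) by blast
        qed
      qed
    qed
    then show ?R using pc(1,2) yz by (intro conjI)
  next
    assume R: ?R
    then have ij: "i \<in> I" "j \<in> I" by auto
    have e: "\<exists>p\<in>C i \<inter> C (nxt i). r *\<^sub>R b i = r *\<^sub>R ev i p \<and> r *\<^sub>R a (nxt i) = r *\<^sub>R ev (nxt i) p" if i: "i \<in> I" for i r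
      using Q_D(3)[OF srQ[OF i]] Q_D(3)[OF nQ[OF i]] sf[OF i] by (intro bexI[of _ "sr i"]) (auto simp: a_def b_def)
    from R have "i = j \<and> y = z \<and> y \<in> sector M x i \<or> y = 0 \<and> z = 0 \<or> j = nxt i \<and> (\<exists>r\<ge>0. y = r *\<^sub>R b i \<and> z = r *\<^sub>R a j)
       \<or> i = nxt j \<and> (\<exists>r\<ge>0. y = r *\<^sub>R a i \<and> z = r *\<^sub>R b j)" by blast
    then show "((i, y), (j, z)) \<in> cone_rel M x"
    proof (elim disjE conjE exE)
      assume "i = j" "y = z" "y \<in> sector M x i"
      then show ?thesis using rel_self ij by blast
    next
      assume "y = 0" "z = 0"
      then show ?thesis unfolding rel_iff using ij I_D(2)[OF ij(1)] I_D(2)[OF ij(2)] by (intro conjI bexI[of _ x] exI[of _ 0]) auto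
    next
      fix r assume r: "j = nxt i" "0 \<le> r" "y = r *\<^sub>R b i" "z = r *\<^sub>R a j"
      show ?thesis unfolding rel_iff r(3,4) unfolding r(1) using ij e[OF ij(1), of r] r(1,2) by blast
    next
      fix r assume r: "i = nxt j" "0 \<le> r" "y = r *\<^sub>R a i" "z = r *\<^sub>R b j"
      show ?thesis unfolding rel_iff r(3,4) unfolding r(1) using ij e[OF ij(2), of r] r(1,2) by blast
    qed
  qed
  have ed: "\<exists>y q. {x, y, q} \<subseteq> C i \<inter> C (nxt i) \<and> y \<notin> vertices M \<and>
      ch i q - ch i x = b i \<and> ch (nxt i) q - ch (nxt i) x = a (nxt i) \<and>
      ch i q - ch i y = (1/2) *\<^sub>R b i \<and> ch (nxt i) q - ch (nxt i) y = (1/2) *\<^sub>R a (nxt i) \<and>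
      sector M y i = {z. ori i * cross2 (b i) z \<le> 0} \<and>
      sector M y (nxt i) = {z. 0 \<le> ori (nxt i) * cross2 (a (nxt i)) z}" if i: "i \<in> I" for i
  proof -
    define j where "j = nxt i"
    have j: "j \<in> I" "i \<noteq> j" "sr i \<in> Q j" "sr i = fr j" using nI[OF i] n1[OF i] nQ[OF i] sf[OF i] by (auto simp: j_def)
    obtain y where y: "y \<in> C i" "y \<in> C j" "ev i y = (1/2) *\<^sub>R ev i (sr i)" "ev j y = (1/2) *\<^sub>R ev j (sr i)"
      using shared_q(2)[OF i j(1,2) srQ[OF i] j(3), of "1/2"] by auto
    have q: "sr i \<in> C i" "sr i \<in> C j" "x \<in> C i" "x \<in> C j" using Q_D(3)[OF srQ[OF i]] Q_D(3)[OF j(3)] I_D(2)[OF i] I_D(2)[OF j(1)] by auto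
    have yv: "y \<notin> vertices M"
    proof
      assume "y \<in> vertices M"
      then obtain k where k: "k \<in> cells M" "cell_vertex M k y" by (auto simp: vertices_def)
      have v: "cell_vertex M i y" by (rule vertex_shared[OF k(2,1) I_D(1)[OF i] y(1)])
      have "ch i y = ch i x + (1/2) *\<^sub>R (ch i (sr i) - ch i x)" using y(3) by (simp add: ev_def algebra_simps)
      from vertex_segment[OF I_D(1)[OF i] v q(3,1) Q_D(2)[OF srQ[OF i], symmetric] _ this]
      have "y = x \<or> y = sr i" by simp
      moreover have "1 *\<^sub>R ev i (sr i) \<noteq> (1/2) *\<^sub>R ev i (sr i)" "0 \<noteq> (1/2) *\<^sub>R ev i (sr i)"
        using ev_nz[OF i srQ[OF i]] unfolding scaleR_cancel_right by auto
      ultimately show False using y(3) by (elim disjE) simp_all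
    qed
    have half: "ch k p - ch k y = (1/2) *\<^sub>R ev k p" if "ev k y = (1/2) *\<^sub>R ev k p" for k p
    proof -
      have "ch k p - ch k y = ev k p - ev k y" by (simp add: ev_def)
      also have "\<dots> = (1 - 1/2) *\<^sub>R ev k p" unfolding that scaleR_diff_left by simp
      finally show ?thesis by simp
    qed
    have "0 \<le> c / d \<longleftrightarrow> e * c \<le> 0" if "e * d < 0" "e \<in> {1, -1}" for c d e :: real
      using that by (auto simp: zero_le_divide_iff)
    then have s1: "sector M y i = {z. ori i * cross2 (b i) z \<le> 0}"
      unfolding sector_midpoint[OF i srQ[OF i] frQ[OF i] fs[OF i, symmetric] y(1,3)] b_def using neg[OF i] ori[OF i] by blast
    have "0 \<le> c / d \<longleftrightarrow> 0 \<le> e * c" if "0 < e * d" "e \<in> {1, -1}" for c d e :: real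
      using that by (auto simp: zero_le_divide_iff)
    then have s2: "sector M y j = {z. 0 \<le> ori j * cross2 (a j) z}"
      unfolding sector_midpoint[OF j(1) frQ[OF j(1)] srQ[OF j(1)] fs[OF j(1)] y(2) y(4)[unfolded j(4)]] a_def using pos[OF j(1)] ori[OF j(1)] by blast
    show ?thesis unfolding j_def[symmetric]
    proof (rule exI[of _ y], rule exI[of _ "sr i"], intro conjI)
      show "{x, y, sr i} \<subseteq> C i \<inter> C j" using y q by blast
      show "ch i (sr i) - ch i x = b i" by (simp add: b_def ev_def)
      show "ch j (sr i) - ch j x = a j" unfolding a_def j(4) by (simp add: ev_def)
      show "ch i (sr i) - ch i y = (1/2) *\<^sub>R b i" unfolding b_def by (rule half[OF y(3)])
      show "ch j (sr i) - ch j y = (1/2) *\<^sub>R a j" using half[OF y(4)] unfolding a_def j(4) .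
    qed (rule yv s1 s2)+
  qed
  show ?thesis
  proof (rule exI[of _ nxt], rule exI[of _ a], rule exI[of _ b], rule exI[of _ al], rule exI[of _ be], unfold_locales)
    show "I = {i \<in> cells M. x \<in> C i}" by (rule I_def)
  qed (fact finI I_ne bij n1 n2 cn ori rl | erule S ed al[rule_format] be[rule_format, THEN conjunct1] be[rule_format, THEN conjunct2])+
qed

end

text \<open>The Landsberg condition is applied at the midpoint of each edge in both orders: from
  \<open>i\<close> to \<open>nxt i\<close> it gives \<open>refract\<close>, and from
  \<open>nxt i\<close> back to \<open>i\<close> it gives \<open>half_minus\<close>.\<close>

lemma vertex_geometry_imp_vertex_cone:
  assumes pf: "piecewise_flat_surface X M" and L: "landsberg_type M"
    and g: "vertex_geometry M x ori nxt a b al be I"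
  shows "vertex_cone M x ori nxt a b al be"
proof -
  interpret P: pf_surface X M by unfold_locales (rule pf)
  interpret G: vertex_geometry M x ori nxt a b al be I by (rule g)
  have ID: "i \<in> cells M" if "i \<in> I" for i using that unfolding G.I_eq by simp
  have nI: "nxt i \<in> I" if "i \<in> I" for i using bij_betwE[OF G.nxt] that by blast
  have or: "ori i \<in> {1, -1}" "- ori i \<in> {1, -1}" if "i \<in> I" for i using G.ori[OF that] by auto
  \<comment> \<open>The condition speaks of vectors from the edge point to \<open>q\<close>, here
    half the edge vector; linearity of \<open>fform\<close> in the last argument removes the
    factor.\<close>
  have lands: "\<exists>h h'. homeomorphism (unit_vectors M (- 1) y i) (unit_vectors M 1 y j) h h' \<and>
      (\<forall>u\<in>unit_vectors M (- 1) y i. fform (fnorm M i) u u B = fform (fnorm M j) (h u) (h u) A) \<and>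
      (\<forall>u\<in>unit_vectors M (- 1) y i. \<forall>u'\<in>unit_vectors M (- 1) y i.
            arc_dist (fnorm M j) (unit_vectors M 1 y j) (h u) (h u') =
            arc_dist (fnorm M i) (unit_vectors M (- 1) y i) u u')"
    if ij: "i \<in> cells M" "j \<in> cells M" "y \<in> cell M i \<inter> cell M j" "i \<noteq> j \<and> y \<notin> vertices M"
      and q: "q \<in> cell M i \<inter> cell M j" "chart M i q - chart M i y = (1/2) *\<^sub>R B" "chart M j q - chart M j y = (1/2) *\<^sub>R A"
    for i j y q A B
  proof -
    interpret Fi: minkowski "fnorm M i" by (rule P.minkowski[OF ij(1)])
    interpret Fj: minkowski "fnorm M j" by (rule P.minkowski[OF ij(2)])
    obtain h h' where h: "homeomorphism (unit_vectors M (- 1) y i) (unit_vectors M 1 y j) h h'"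
        "\<And>u q. u \<in> unit_vectors M (- 1) y i \<Longrightarrow> q \<in> cell M i \<inter> cell M j \<Longrightarrow>
            fform (fnorm M i) u u (chart M i q - chart M i y) =
            fform (fnorm M j) (h u) (h u) (chart M j q - chart M j y)"
        "\<forall>u\<in>unit_vectors M (- 1) y i. \<forall>u'\<in>unit_vectors M (- 1) y i.
            arc_dist (fnorm M j) (unit_vectors M 1 y j) (h u) (h u') =
            arc_dist (fnorm M i) (unit_vectors M (- 1) y i) u u'"
      using L[unfolded landsberg_type_def, rule_format, OF ij] by blast
    have "fform (fnorm M i) u u B = fform (fnorm M j) (h u) (h u) A" if u: "u \<in> unit_vectors M (- 1) y i" for u
    proof -
      have "h u \<in> unit_vectors M 1 y j" using h(1) u unfolding homeomorphism_def by blast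
      then have "h u \<noteq> 0" "u \<noteq> 0" using u by (auto simp: unit_vectors_def)
      then show ?thesis using h(2)[OF u q(1)] unfolding q(2,3)
        by (simp add: linear_scale[OF Fi.linear_fform2] linear_scale[OF Fj.linear_fform2])
    qed
    then show ?thesis using h(1,3) by blast
  qed
  have main: "(\<forall>r. fnorm M i (r *\<^sub>R b i) = fnorm M (nxt i) (r *\<^sub>R a (nxt i))) \<and>
     (\<forall>\<phi>\<in>{be i..be i + pi}. \<exists>\<phi>'\<in>{al (nxt i)..al (nxt i) + pi}.
      minkowski.dF (fnorm M i) (nu (fnorm M i) (ori i) \<phi>) (b i)
        = minkowski.dF (fnorm M (nxt i)) (nu (fnorm M (nxt i)) (ori (nxt i)) \<phi>') (a (nxt i)) \<and>
      Th (fnorm M i) (ori i) \<phi> - Th (fnorm M i) (ori i) (be i)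
        = Th (fnorm M (nxt i)) (ori (nxt i)) \<phi>' - Th (fnorm M (nxt i)) (ori (nxt i)) (al (nxt i)) \<and>
      (\<phi> = be i + pi \<longrightarrow> \<phi>' = al (nxt i) + pi)) \<and>
     Th (fnorm M i) (ori i) (be i) - Th (fnorm M i) (ori i) (be i - pi)
        = Th (fnorm M (nxt i)) (ori (nxt i)) (al (nxt i)) - Th (fnorm M (nxt i)) (ori (nxt i)) (al (nxt i) - pi)"
    if i: "i \<in> I" for i
  proof -
    define j where "j = nxt i"
    have j: "j \<in> I" "i \<noteq> j" using nI[OF i] G.nxt1[OF i] by (auto simp: j_def)
    note ci = ID[OF i] and cj = ID[OF j(1)]
    obtain y q where e: "{x, y, q} \<subseteq> cell M i \<inter> cell M j" "y \<notin> vertices M"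
      "chart M i q - chart M i x = b i" "chart M j q - chart M j x = a j"
      "chart M i q - chart M i y = (1/2) *\<^sub>R b i" "chart M j q - chart M j y = (1/2) *\<^sub>R a j"
      "sector M y i = {z. ori i * cross2 (b i) z \<le> 0}" "sector M y j = {z. 0 \<le> ori j * cross2 (a j) z}"
      using G.edge[OF i] unfolding j_def by (elim exE conjE)
    have m: "x \<in> cell M i \<inter> cell M j" "q \<in> cell M i \<inter> cell M j" "y \<in> cell M i \<inter> cell M j"
      "x \<in> cell M j \<inter> cell M i" "q \<in> cell M j \<inter> cell M i" "y \<in> cell M j \<inter> cell M i" using e(1) by auto
    interpret Fi: planar "fnorm M i" "ori i" by unfold_locales (use P.mink[OF ci] or[OF i] in auto)
    interpret Fj: planar "fnorm M j" "ori j" by unfold_locales (use P.mink[OF cj] or[OF j(1)] in auto)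
    have F1: "fnorm M i (b i) = fnorm M j (a j)" using P.norm_eq[OF ci cj m(1,2)] unfolding e(3,4) .
    have mb: "chart M i x - chart M i q = - b i" "chart M j x - chart M j q = - a j" using e(3,4) by (simp_all add: algebra_simps flip: e(3,4))
    have F2: "fnorm M i (- b i) = fnorm M j (- a j)" using P.norm_eq[OF ci cj m(2,1)] unfolding mb .
    \<comment> \<open>The norms need not be reversible, so negative multiples use the agreement on
      the edge in the opposite direction.\<close>
    have gl: "fnorm M i (r *\<^sub>R b i) = fnorm M j (r *\<^sub>R a j)" for r
    proof (cases "0 \<le> r")
      case True
      then show ?thesis using F1 by (simp add: Fi.scale Fj.scale)
    next
      case False
      then have "fnorm M i ((- r) *\<^sub>R (- b i)) = fnorm M j ((- r) *\<^sub>R (- a j))" using F2 Fi.scale[of "- r" "- b i"] Fj.scale[of "- r" "- a j"] by simp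
      then show ?thesis by simp
    qed
    obtain rb where rb: "rb > 0" "b i = rb *\<^sub>R polar (ori i) (be i)" using G.angle_b[OF i] by blast
    obtain ra where ra: "ra > 0" "a j = ra *\<^sub>R polar (ori j) (al j)" using G.angle_a[OF j(1)] by blast
    have U: "unit_vectors M (- 1) y i = {u. fnorm M i u = 1 \<and> 0 \<le> ori i * cross2 (b i) u}"
      "unit_vectors M 1 y j = {u. fnorm M j u = 1 \<and> 0 \<le> ori j * cross2 (a j) u}"
      "unit_vectors M (- 1) y j = {u. fnorm M j u = 1 \<and> 0 \<le> - ori j * cross2 (a j) u}"
      "unit_vectors M 1 y i = {u. fnorm M i u = 1 \<and> 0 \<le> - ori i * cross2 (b i) u}"
      unfolding unit_vectors_def e(7,8) by auto
    have 1: "\<exists>\<phi>'\<in>{al j..al j + pi}.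
      minkowski.dF (fnorm M i) (nu (fnorm M i) (ori i) \<phi>) (b i)
        = minkowski.dF (fnorm M j) (nu (fnorm M j) (ori j) \<phi>') (a j) \<and>
      Th (fnorm M i) (ori i) \<phi> - Th (fnorm M i) (ori i) (be i)
        = Th (fnorm M j) (ori j) \<phi>' - Th (fnorm M j) (ori j) (al j) \<and>
      (\<phi> = be i + pi \<longrightarrow> \<phi>' = al j + pi)" if \<phi>: "\<phi> \<in> {be i..be i + pi}" for \<phi>
    proof -
      obtain h h' where h: "homeomorphism {u. fnorm M i u = 1 \<and> 0 \<le> ori i * cross2 (b i) u} {u. fnorm M j u = 1 \<and> 0 \<le> ori j * cross2 (a j) u} h h'"
        and mo: "\<forall>u\<in>{u. fnorm M i u = 1 \<and> 0 \<le> ori i * cross2 (b i) u}. fform (fnorm M i) u u (b i) = fform (fnorm M j) (h u) (h u) (a j)"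
        and iso: "\<forall>u\<in>{u. fnorm M i u = 1 \<and> 0 \<le> ori i * cross2 (b i) u}. \<forall>u'\<in>{u. fnorm M i u = 1 \<and> 0 \<le> ori i * cross2 (b i) u}.
            arc_dist (fnorm M j) {u. fnorm M j u = 1 \<and> 0 \<le> ori j * cross2 (a j) u} (h u) (h u') =
            arc_dist (fnorm M i) {u. fnorm M i u = 1 \<and> 0 \<le> ori i * cross2 (b i) u} u u'"
        using lands[OF ci cj m(3) conjI[OF j(2) e(2)] m(2) e(5,6)] unfolding U(1,2) by (elim exE conjE)
      show ?thesis
        by (rule landsberg_half[OF P.mink[OF ci] P.mink[OF cj] or(1)[OF i] or(1)[OF j(1)] rb(2,1) ra(2,1) F1 F2 h _ _ \<phi>])
          (use mo iso in \<open>simp_all del: cross2_simps\<close>)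
    qed
    \<comment> \<open>With both orientations reversed, \<open>nxt i\<close> precedes
      \<open>i\<close> and \<open>landsberg_half\<close> applies to the other half circles. Only
      their total lengths are kept, and \<open>reflect\<close> expresses them in the original
      angles.\<close>
    have 2: "Th (fnorm M i) (ori i) (be i) - Th (fnorm M i) (ori i) (be i - pi)
        = Th (fnorm M j) (ori j) (al j) - Th (fnorm M j) (ori j) (al j - pi)"
    proof -
      obtain h h' where h: "homeomorphism {u. fnorm M j u = 1 \<and> 0 \<le> - ori j * cross2 (a j) u} {u. fnorm M i u = 1 \<and> 0 \<le> - ori i * cross2 (b i) u} h h'"
        and mo: "\<forall>u\<in>{u. fnorm M j u = 1 \<and> 0 \<le> - ori j * cross2 (a j) u}. fform (fnorm M j) u u (a j) = fform (fnorm M i) (h u) (h u) (b i)"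
        and iso: "\<forall>u\<in>{u. fnorm M j u = 1 \<and> 0 \<le> - ori j * cross2 (a j) u}. \<forall>u'\<in>{u. fnorm M j u = 1 \<and> 0 \<le> - ori j * cross2 (a j) u}.
            arc_dist (fnorm M i) {u. fnorm M i u = 1 \<and> 0 \<le> - ori i * cross2 (b i) u} (h u) (h u') =
            arc_dist (fnorm M j) {u. fnorm M j u = 1 \<and> 0 \<le> - ori j * cross2 (a j) u} u u'"
        using lands[OF cj ci m(6) conjI[OF j(2)[symmetric] e(2)] m(5) e(6,5)] unfolding U(3,4) by (elim exE conjE)
      have ra': "a j = ra *\<^sub>R polar (- ori j) (- al j)" "b i = rb *\<^sub>R polar (- ori i) (- be i)"
        using ra(2) rb(2) by (simp_all add: polar_uminus)
      have "\<exists>\<phi>'\<in>{- be i..- be i + pi}. minkowski.dF (fnorm M j) (nu (fnorm M j) (- ori j) (- al j + pi)) (a j)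
          = minkowski.dF (fnorm M i) (nu (fnorm M i) (- ori i) \<phi>') (b i) \<and>
        Th (fnorm M j) (- ori j) (- al j + pi) - Th (fnorm M j) (- ori j) (- al j)
          = Th (fnorm M i) (- ori i) \<phi>' - Th (fnorm M i) (- ori i) (- be i) \<and> (- al j + pi = - al j + pi \<longrightarrow> \<phi>' = - be i + pi)"
        by (rule landsberg_half[OF P.mink[OF cj] P.mink[OF ci] or(2)[OF j(1)] or(2)[OF i] ra'(1) ra(1) ra'(2) rb(1) F1[symmetric] F2[symmetric] h])
          (use mo iso in \<open>simp_all del: cross2_simps\<close>)
      then have "Th (fnorm M j) (- ori j) (- al j + pi) - Th (fnorm M j) (- ori j) (- al j)
          = Th (fnorm M i) (- ori i) (- be i + pi) - Th (fnorm M i) (- ori i) (- be i)" by auto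
      then show ?thesis unfolding Fi.reflect Fj.reflect by (simp add: algebra_simps)
    qed
    show ?thesis unfolding j_def[symmetric] by (intro conjI allI ballI gl 1 2)
  qed
  show ?thesis
  proof (unfold_locales, unfold G.I_eq[symmetric])
    show "finite I" "I \<noteq> {}" "bij_betw nxt I I" by (rule G.finI G.I_ne G.nxt)+
    show "\<And>A. A \<subseteq> I \<Longrightarrow> A \<noteq> {} \<Longrightarrow> nxt ` A \<subseteq> A \<Longrightarrow> A = I" by (rule G.conn)
    fix i assume i: "i \<in> I"
    show "nxt i \<noteq> i" "nxt (nxt i) \<noteq> i" "ori i \<in> {1, -1}" "\<exists>r>0. a i = r *\<^sub>R polar (ori i) (al i)"
      "\<exists>r>0. b i = r *\<^sub>R polar (ori i) (be i)" "al i < be i \<and> be i < al i + pi"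
      "sector M x i = {s *\<^sub>R a i + t *\<^sub>R b i | s t. 0 \<le> s \<and> 0 \<le> t}"
      by (rule G.nxt1[OF i] G.nxt2[OF i] G.ori[OF i] G.angle_a[OF i] G.angle_b[OF i] G.al_be[OF i] G.S_eq[OF i])+
    show "minkowski_norm (fnorm M i)" by (rule P.mink[OF ID[OF i]])
    show "fnorm M i (r *\<^sub>R b i) = fnorm M (nxt i) (r *\<^sub>R a (nxt i))" for r using main[OF i] by blast
    show "\<exists>\<phi>'\<in>{al (nxt i)..al (nxt i) + pi}.
      minkowski.dF (fnorm M i) (nu (fnorm M i) (ori i) \<phi>) (b i)
        = minkowski.dF (fnorm M (nxt i)) (nu (fnorm M (nxt i)) (ori (nxt i)) \<phi>') (a (nxt i)) \<and>
      Th (fnorm M i) (ori i) \<phi> - Th (fnorm M i) (ori i) (be i)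
        = Th (fnorm M (nxt i)) (ori (nxt i)) \<phi>' - Th (fnorm M (nxt i)) (ori (nxt i)) (al (nxt i)) \<and>
      (\<phi> = be i + pi \<longrightarrow> \<phi>' = al (nxt i) + pi)" if "\<phi> \<in> {be i..be i + pi}" for \<phi>
      using main[OF i] that by blast
    show "Th (fnorm M i) (ori i) (be i) - Th (fnorm M i) (ori i) (be i - pi)
        = Th (fnorm M (nxt i)) (ori (nxt i)) (al (nxt i)) - Th (fnorm M (nxt i)) (ori (nxt i)) (al (nxt i) - pi)"
      using main[OF i] by blast
  qed (rule G.rel)
qed

text \<open>The locale speaks of charts and incidences only, so the same cyclic order and the same
  angles serve for any choice of norms.\<close>

lemma vertex_geometry_rev_norm:
  assumes "vertex_geometry M x ori nxt a b al be I"
  shows "vertex_geometry (M\<lparr>fnorm := N\<rparr>) x ori nxt a b al be I"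
proof -
  have e: "sector (M\<lparr>fnorm := N\<rparr>) = sector M" "cone_rel (M\<lparr>fnorm := N\<rparr>) = cone_rel M" "vertices (M\<lparr>fnorm := N\<rparr>) = vertices M"
    "cells (M\<lparr>fnorm := N\<rparr>) = cells M" "cell (M\<lparr>fnorm := N\<rparr>) = cell M" "chart (M\<lparr>fnorm := N\<rparr>) = chart M"
    by (simp_all add: fun_eq_iff sector_def cone_rel_def vertices_def cell_vertex_def)
  show ?thesis using assms unfolding vertex_geometry_def e .
qed

section \<open>Reversing the norms\<close>

text \<open>Running curves backwards turns geodesics into geodesics of this structure and exchanges
  incoming and outgoing vectors. Charts and the tangent cone as a set stay the same.\<close>

definition rev_norm :: "('p, 'i) flat_cells \<Rightarrow> ('p, 'i) flat_cells" where
  "rev_norm M = M\<lparr>fnorm := \<lambda>i y. fnorm M i (- y)\<rparr>"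

lemma rev_sel [simp]: "cells (rev_norm M) = cells M" "cell (rev_norm M) = cell M" "chart (rev_norm M) = chart M"
    "fnorm (rev_norm M) = (\<lambda>i y. fnorm M i (- y))"
  by (simp_all add: rev_norm_def)

lemma rev_rev [simp]: "rev_norm (rev_norm M) = M"
  by (simp add: rev_norm_def)

lemma rev_cone [simp]: "sector (rev_norm M) = sector M" "cone_rel (rev_norm M) = cone_rel M"
    "vertices (rev_norm M) = vertices M" "cell_vertex (rev_norm M) = cell_vertex M" "cell_edge (rev_norm M) = cell_edge M"
    "cone_apex (rev_norm M) = cone_apex M"
  by (simp_all add: fun_eq_iff sector_def cone_rel_def vertices_def cell_vertex_def cell_edge_def cone_apex_def)

lemma rev_cone2 [simp]: "cone_points (rev_norm M) = cone_points M" "cone_scale (rev_norm M) = cone_scale M"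
  by (simp_all add: fun_eq_iff cone_points_def cone_scale_def)

lemma rev_tangent_cone [simp]: "tangent_cone (rev_norm M) x = rev_norm (tangent_cone M x)"
  unfolding tangent_cone_def rev_sel rev_cone rev_cone2 by (simp add: rev_norm_def)

lemma fform_reverse: "fform (\<lambda>y. F (- y)) y u v = fform F (- y) (- u) (- v)"
proof -
  have "- (y + s *\<^sub>R u + t *\<^sub>R v) = - y + s *\<^sub>R (- u) + t *\<^sub>R (- v)" for s t by simp
  then show ?thesis unfolding fform_def by presburger
qed

lemma arc_norm_rev: "arc_norm (rev_norm M) (- \<sigma>) i y u = arc_norm M \<sigma> i y (- u)"
  by (simp add: arc_norm_def fform_reverse)

lemma pw_smooth_reverse:
  assumes "pw_smooth M N \<gamma> \<rho> a b" "cells M' = cells M" "cell M' = cell M" "chart M' = chart M"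
    "\<And>i y u. N' i y u = N i y (- u)"
  shows "pw_smooth M' N' (\<lambda>t. \<gamma> (- t)) (\<lambda>t. \<rho> (- t)) (- b) (- a)"
  using assms(1)
proof induction
  case (piece a b i U g)
  define g' where "g' = (\<lambda>t::real. g (0 + t *\<^sub>R (- 1)))"
  have V: "uminus ` U = (\<lambda>t. - t) -` U" by (auto simp: image_iff) (metis minus_minus)
  have d: "vector_derivative g' (at t) = - vector_derivative g (at (- t))" if "- t \<in> {a..b}" for t
  proof -
    have 1: "((\<lambda>t::real. 0 + t *\<^sub>R (- 1)) has_vector_derivative - 1) (at t)"
      by (auto intro!: derivative_eq_intros simp: has_vector_derivative_def)
    have "(g has_vector_derivative vector_derivative g (at (- t))) (at (0 + t *\<^sub>R (- 1)))"
      using smooth_on_vector_derivative(1)[OF piece(6) piece(5) that] by simp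
    from vector_diff_chain_at[OF 1 this] show ?thesis
      unfolding g'_def o_def by (intro vector_derivative_at) simp
  qed
  show ?case
  proof (rule pw_smooth.piece[where i = i and U = "uminus ` U" and g = g'])
    show "- b < - a" "i \<in> cells M'" using piece(1,2) assms(2) by auto
    show "(\<lambda>t. \<gamma> (- t)) ` {- b..- a} \<subseteq> cell M' i" using piece(3) unfolding assms(3) by fastforce
    show oU: "open (uminus ` U)" using piece(4) open_negations by blast
    show "{- b..- a} \<subseteq> uminus ` U" using piece(5) unfolding V by fastforce
    show "smooth_on (uminus ` U) g'" unfolding g'_def
      by (rule smooth_on_compose_line[OF oU _ piece(6)]) auto
    show "\<forall>t\<in>{- b..- a}. chart M' i (\<gamma> (- t)) = g' t" using piece(7) unfolding assms(4) g'_def by fastforce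
    show "\<forall>t\<in>{- b<..<- a}. \<rho> (- t) = N' i (g' t) (vector_derivative g' (at t))"
    proof
      fix t assume "t \<in> {- b<..<- a}"
      then have t: "- t \<in> {a<..<b}" by auto
      then have "vector_derivative g' (at t) = - vector_derivative g (at (- t))" by (intro d) auto
      then show "\<rho> (- t) = N' i (g' t) (vector_derivative g' (at t))" using piece(8) t assms(5) by (simp add: g'_def)
    qed
  qed
next
  case (join a b c)
  show ?case by (rule pw_smooth.join[OF join.IH(2) join.IH(1)])
qed

text \<open>Reversal of curves maps lengths to lengths, and \<open>rev_norm\<close> is an
  involution, so one inclusion of the two sets of lengths gives the other.\<close>

lemma fdist_rev: "fdist (rev_norm M) q p = fdist M p q"
proof -
  define D where "D M p q = {integral {a..b} \<rho> | \<gamma> \<rho> a b. pw_smooth M (finsler M) \<gamma> \<rho> a b \<and> \<gamma> a = p \<and> \<gamma> b = q}"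
    for M :: "('a, 'b) flat_cells" and p q
  have sub: "D M p q \<subseteq> D (rev_norm M) q p" for M p q
  proof
    fix l assume "l \<in> D M p q"
    then obtain \<gamma> \<rho> a b where g: "l = integral {a..b} \<rho>" "pw_smooth M (finsler M) \<gamma> \<rho> a b" "\<gamma> a = p" "\<gamma> b = q"
      unfolding D_def by blast
    have 1: "pw_smooth (rev_norm M) (finsler (rev_norm M)) (\<lambda>t. \<gamma> (- t)) (\<lambda>t. \<rho> (- t)) (- b) (- a)"
      by (rule pw_smooth_reverse[OF g(2)]) (simp_all add: finsler_def)
    have 2: "l = integral {- b..- a} (\<lambda>t. \<rho> (- t))" using g(1) by simp
    show "l \<in> D (rev_norm M) q p" unfolding D_def mem_Collect_eq
      by (rule exI[of _ "\<lambda>t. \<gamma> (- t)"], rule exI[of _ "\<lambda>t. \<rho> (- t)"], rule exI[of _ "- b"], rule exI[of _ "- a"])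
        (use 1 2 g(3,4) in simp)
  qed
  have "D (rev_norm M) q p = D M p q" using sub[of M p q] sub[of "rev_norm M" q p] by simp
  then show ?thesis unfolding fdist_def D_def by simp
qed

lemma geodesic_rev: assumes "geodesic M \<gamma>" shows "geodesic (rev_norm M) (\<lambda>t. \<gamma> (- t))"
proof -
  obtain c where c: "c > 0" "\<And>a b. a < b \<Longrightarrow> pw_smooth M (finsler M) \<gamma> (\<lambda>_. c) a b"
    "\<And>t. \<exists>\<delta>>0. \<forall>a b. t - \<delta> < a \<and> a < b \<and> b < t + \<delta> \<longrightarrow> fdist M (\<gamma> a) (\<gamma> b) = integral {a..b} (\<lambda>_. c)"
    using assms unfolding geodesic_def by blast
  have 1: "pw_smooth (rev_norm M) (finsler (rev_norm M)) (\<lambda>t. \<gamma> (- t)) (\<lambda>_. c) a b" if "a < b" for a b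
    using pw_smooth_reverse[OF c(2)[of "- b" "- a"], of "rev_norm M" "finsler (rev_norm M)"] that by (simp add: finsler_def)
  have 2: "\<exists>\<delta>>0. \<forall>a b. t - \<delta> < a \<and> a < b \<and> b < t + \<delta> \<longrightarrow>
      fdist (rev_norm M) (\<gamma> (- a)) (\<gamma> (- b)) = integral {a..b} (\<lambda>_. c)" for t
  proof -
    obtain \<delta> where d: "\<delta> > 0" "\<And>a b. - t - \<delta> < a \<Longrightarrow> a < b \<Longrightarrow> b < - t + \<delta> \<Longrightarrow> fdist M (\<gamma> a) (\<gamma> b) = integral {a..b} (\<lambda>_. c)"
      using c(3)[of "- t"] by blast
    have "fdist M (\<gamma> (- b)) (\<gamma> (- a)) = integral {a..b} (\<lambda>_. c)" if "t - \<delta> < a" "a < b" "b < t + \<delta>" for a b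
      using d(2)[of "- b" "- a"] that by simp
    then show ?thesis unfolding fdist_rev using d(1) by blast
  qed
  show ?thesis unfolding geodesic_def by (rule exI[of _ c]) (use c(1) 1 2 in simp)
qed

lemma perturbed_rev: assumes "perturbed M \<sigma> x v i w s \<gamma>"
  shows "perturbed (rev_norm M) (- \<sigma>) x v i w s (\<lambda>t. \<gamma> (- t))"
proof -
  obtain \<epsilon> where e: "geodesic (tangent_cone M x) \<gamma>" "\<And>t. \<gamma> t \<noteq> cone_apex M x" "\<epsilon> > 0"
    "\<And>t. \<bar>t - \<sigma>\<bar> < \<epsilon> \<Longrightarrow> \<gamma> t \<in> cell (tangent_cone M x) i \<and>
        chart (tangent_cone M x) i (\<gamma> t) = chart (tangent_cone M x) i (cone_scale M x (\<sigma> * t) v) + s *\<^sub>R w"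
    using assms unfolding perturbed_def Let_def by blast
  have "\<gamma> (- t) \<in> cell (tangent_cone M x) i \<and>
      chart (tangent_cone M x) i (\<gamma> (- t)) = chart (tangent_cone M x) i (cone_scale M x (- \<sigma> * t) v) + s *\<^sub>R w"
    if "\<bar>t - - \<sigma>\<bar> < \<epsilon>" for t
  proof -
    have "\<bar>- t - \<sigma>\<bar> < \<epsilon>" using that by arith
    from e(4)[OF this] show ?thesis by simp
  qed
  then show ?thesis unfolding perturbed_def Let_def rev_tangent_cone rev_sel rev_cone rev_cone2
    using geodesic_rev[OF e(1)] e(2,3) by (intro conjI allI exI[of _ \<epsilon>] impI) auto
qed

lemma unit_vectors_rev: "unit_vectors (rev_norm M) \<sigma> x i = uminus ` unit_vectors M (- \<sigma>) x i"
proof (rule set_eqI)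
  fix u
  have "u \<in> uminus ` unit_vectors M (- \<sigma>) x i \<longleftrightarrow> - u \<in> unit_vectors M (- \<sigma>) x i"
    by (metis add.inverse_inverse image_iff)
  then show "u \<in> unit_vectors (rev_norm M) \<sigma> x i \<longleftrightarrow> u \<in> uminus ` unit_vectors M (- \<sigma>) x i"
    by (simp add: unit_vectors_def)
qed

lemma indicatrix_rev_subset: "indicatrix (rev_norm M) \<sigma> x \<subseteq> indicatrix M (- \<sigma>) x"
proof
  fix P assume "P \<in> indicatrix (rev_norm M) \<sigma> x"
  then obtain i u where u: "P = cone_rel M x `` {(i, \<sigma> *\<^sub>R u)}" "i \<in> cells M" "x \<in> cell M i"
    "u \<in> unit_vectors (rev_norm M) \<sigma> x i" unfolding indicatrix_def rev_sel rev_cone by blast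
  obtain u' where u': "u' \<in> unit_vectors M (- \<sigma>) x i" "u = - u'" using u(4) unfolding unit_vectors_rev by blast
  show "P \<in> indicatrix M (- \<sigma>) x" unfolding indicatrix_def mem_Collect_eq
    by (rule exI[of _ i], rule exI[of _ u']) (use u u' in simp)
qed

lemma indicatrix_rev: "indicatrix (rev_norm M) \<sigma> x = indicatrix M (- \<sigma>) x"
  using indicatrix_rev_subset[of "rev_norm M" "- \<sigma>" x] indicatrix_rev_subset[of M \<sigma> x] by simp

lemma unit_dir_rev: "unit_dir (rev_norm M) (- \<sigma>) x = unit_dir M \<sigma> x"
  by (simp add: fun_eq_iff unit_dir_def indicatrix_rev)

lemma has_angle_rev: assumes "has_angle (rev_norm M) (- \<sigma>) x (\<lambda>t. \<gamma> (- t)) A" shows "has_angle M \<sigma> x \<gamma> A"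
proof -
  obtain \<rho> where r: "\<And>a b. a < b \<Longrightarrow> pw_smooth (tangent_cone (rev_norm M) x) (arc_norm (rev_norm M) (- \<sigma>))
      (unit_dir (rev_norm M) (- \<sigma>) x \<circ> (\<lambda>t. \<gamma> (- t))) \<rho> a b" "(\<rho> has_integral A) UNIV"
    using assms unfolding has_angle_def by blast
  have "pw_smooth (tangent_cone M x) (arc_norm M \<sigma>) (unit_dir M \<sigma> x \<circ> \<gamma>) (\<lambda>t. \<rho> (- t)) a b" if "a < b" for a b
  proof -
    have "pw_smooth (tangent_cone M x) (arc_norm M \<sigma>) (\<lambda>t. (unit_dir (rev_norm M) (- \<sigma>) x \<circ> (\<lambda>t. \<gamma> (- t))) (- t))
        (\<lambda>t. \<rho> (- t)) (- (- a)) (- (- b))"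
      by (rule pw_smooth_reverse[OF r(1)[of "- b" "- a"]]) (use that in \<open>simp_all add: arc_norm_rev\<close>)
    then show ?thesis by (simp add: unit_dir_rev o_def)
  qed
  moreover have "((\<lambda>t. \<rho> (- t)) has_integral A) UNIV" by (rule has_integral_reflect_UNIV[OF r(2)])
  ultimately show ?thesis unfolding has_angle_def by blast
qed

lemma circle_length_rev: assumes "circle_length (rev_norm M) (- \<sigma>) x L" shows "circle_length M \<sigma> x L"
proof -
  obtain \<tau> \<rho> a b where t: "pw_smooth (tangent_cone (rev_norm M) x) (arc_norm (rev_norm M) (- \<sigma>)) \<tau> \<rho> a b"
     "\<tau> ` {a..b} = indicatrix (rev_norm M) (- \<sigma>) x" "inj_on \<tau> {a..<b}" "\<tau> a = \<tau> b" "L = integral {a..b} \<rho>"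
    using assms unfolding circle_length_def by blast
  have ab: "a < b" by (rule pw_smooth_less[OF t(1)])
  have 1: "pw_smooth (tangent_cone M x) (arc_norm M \<sigma>) (\<lambda>t. \<tau> (- t)) (\<lambda>t. \<rho> (- t)) (- b) (- a)"
    by (rule pw_smooth_reverse[OF t(1)]) (simp_all add: arc_norm_rev)
  have "(\<lambda>t. \<tau> (- t)) ` {- b..- a} = \<tau> ` (uminus ` {- b..- a})" by (simp only: image_image)
  moreover have "uminus ` {- b..- a} = {a..b}" by simp
  ultimately have 2: "(\<lambda>t. \<tau> (- t)) ` {- b..- a} = indicatrix M \<sigma> x" using t(2) by (simp add: indicatrix_rev)
  have 3: "inj_on (\<lambda>t. \<tau> (- t)) {- b..<- a}"
  proof (rule inj_onI)
    fix s u assume su: "s \<in> {- b..<- a}" "u \<in> {- b..<- a}" "\<tau> (- s) = \<tau> (- u)"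
    define f where "f r = (if r = b then a else r)" for r
    have f: "f (- s) \<in> {a..<b}" "f (- u) \<in> {a..<b}" using su(1,2) ab by (auto simp: f_def)
    have "\<tau> (f r) = \<tau> r" for r using t(4) by (simp add: f_def)
    then have "\<tau> (f (- s)) = \<tau> (f (- u))" using su(3) by simp
    then have "f (- s) = f (- u)" by (rule inj_onD[OF t(3) _ f])
    then show "s = u" using su(1,2) by (auto simp: f_def split: if_splits)
  qed
  show ?thesis unfolding circle_length_def
    by (rule exI[of _ "\<lambda>t. \<tau> (- t)"], rule exI[of _ "\<lambda>t. \<rho> (- t)"], rule exI[of _ "- b"], rule exI[of _ "- a"])
      (use 1 2 3 t(4,5) in simp)
qed

lemma perturbed_scale:
  assumes "perturbed M \<sigma> x v i w s \<gamma>" "s *\<^sub>R w = s' *\<^sub>R w'" shows "perturbed M \<sigma> x v i w' s' \<gamma>"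
  using assms unfolding perturbed_def by simp

lemma sector_scale: "y \<in> sector M x i \<Longrightarrow> 0 \<le> c \<Longrightarrow> c *\<^sub>R y \<in> sector M x i"
  unfolding sector_def by (rule mem_cone[OF cone_cone_hull])

text \<open>Time reversal changes the sign of the velocity of the ray, and thereby exchanges left
  and right.\<close>

lemma perturbed_angle_rev:
  assumes mn: "\<And>i. i \<in> cells (tangent_cone M x) \<Longrightarrow> minkowski_norm (fnorm M i)"
    and A: "perturbed_angle (rev_norm M) ori (- 1) x v (- side) A"
  shows "perturbed_angle M ori 1 x v side A"
  unfolding perturbed_angle_def Let_def
proof (intro ballI impI)
  fix i w assume i: "i \<in> cells (tangent_cone M x)" and w: "w \<in> unit_vectors (tangent_cone M x) 1 v i"
    and c: "v \<in> cell (tangent_cone M x) i \<and> 0 < side * ori i * det (vector [1 *\<^sub>R chart (tangent_cone M x) i v, w] :: real^2^2)"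
  interpret minkowski "fnorm M i" by unfold_locales (rule mn[OF i])
  \<comment> \<open>The vector \<open>w\<close> has norm 1 for \<open>M\<close> but norm
    \<open>m\<close> for the reversal. It is rescaled, and the shift \<open>s\<close> is multiplied
    by \<open>m\<close> so that the translated segment is unchanged.\<close>
  define m where "m = fnorm M i (- w)"
  have "w \<noteq> 0" using c by (auto simp: det_vector2)
  then have m: "m > 0" unfolding m_def by (intro pos) simp
  define w' where "w' = (1 / m) *\<^sub>R w"
  have ww: "s *\<^sub>R w = (s * m) *\<^sub>R w'" for s using m by (simp add: w'_def)
  have "fnorm M i (- w') = 1" using scale[of "1 / m" "- w"] m unfolding w'_def m_def by simp
  moreover have "w \<in> sector (tangent_cone M x) v i" using w by (simp add: unit_vectors_def)
  then have "w' \<in> sector (tangent_cone M x) v i" unfolding w'_def using m by (intro sector_scale) auto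
  moreover have "fnorm (tangent_cone M x) = fnorm M" by (simp add: tangent_cone_def)
  ultimately have 1: "w' \<in> unit_vectors (tangent_cone (rev_norm M) x) 1 v i" by (simp add: unit_vectors_def)
  have "0 < (1 / m) * (side * ori i * cross2 (chart (tangent_cone M x) i v) w)" using c m by (simp add: det_vector2)
  then have 2: "v \<in> cell (tangent_cone (rev_norm M) x) i \<and>
      0 < - side * ori i * det (vector [- 1 *\<^sub>R chart (tangent_cone (rev_norm M) x) i v, w'] :: real^2^2)"
    using c unfolding det_vector2 w'_def by (simp add: algebra_simps)
  have i': "i \<in> cells (tangent_cone (rev_norm M) x)" using i by simp
  obtain \<eta> where \<eta>: "\<eta> > 0" "\<And>s. 0 < s \<Longrightarrow> s < \<eta> \<Longrightarrow> (\<exists>\<gamma>. perturbed (rev_norm M) (- 1) x v i w' s \<gamma>) \<and>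
      (\<forall>\<gamma>. perturbed (rev_norm M) (- 1) x v i w' s \<gamma> \<longrightarrow> has_angle (rev_norm M) (- (- 1)) x \<gamma> A)"
    using A[unfolded perturbed_angle_def Let_def, rule_format, OF i' 1 2] by blast
  have "(\<exists>\<gamma>. perturbed M 1 x v i w s \<gamma>) \<and> (\<forall>\<gamma>. perturbed M 1 x v i w s \<gamma> \<longrightarrow> has_angle M (- 1) x \<gamma> A)"
    if s: "0 < s" "s < \<eta> / m" for s
  proof
    have sm: "0 < s * m" "s * m < \<eta>" using s m by (simp_all add: field_simps)
    note H = \<eta>(2)[OF sm]
    obtain \<gamma> where "perturbed (rev_norm M) (- 1) x v i w' (s * m) \<gamma>" using H by blast
    from perturbed_rev[OF this] have "perturbed M 1 x v i w' (s * m) (\<lambda>t. \<gamma> (- t))" by simp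
    from perturbed_scale[OF this ww[symmetric]] show "\<exists>\<gamma>. perturbed M 1 x v i w s \<gamma>" by blast
    show "\<forall>\<gamma>. perturbed M 1 x v i w s \<gamma> \<longrightarrow> has_angle M (- 1) x \<gamma> A"
    proof (intro allI impI)
      fix \<gamma> assume "perturbed M 1 x v i w s \<gamma>"
      from perturbed_rev[OF perturbed_scale[OF this ww]]
      have "has_angle (rev_norm M) (- (- 1)) x (\<lambda>t. \<gamma> (- t)) A" using H by blast
      then show "has_angle M (- 1) x \<gamma> A" by (rule has_angle_rev)
    qed
  qed
  then show "\<exists>\<eta>>0. \<forall>s. 0 < s \<and> s < \<eta> \<longrightarrow> (\<exists>\<gamma>. perturbed M 1 x v i w s \<gamma>) \<and>
      (\<forall>\<gamma>. perturbed M 1 x v i w s \<gamma> \<longrightarrow> has_angle M (- 1) x \<gamma> A)"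
    by (intro exI[of _ "\<eta> / m"] conjI[OF divide_pos_pos[OF \<eta>(1) m]] allI impI) blast
qed

text \<open>The two angles change places under reversal, which does not affect their sum.\<close>

lemma has_curvature_rev:
  assumes "\<And>i. i \<in> cells (tangent_cone M x) \<Longrightarrow> minkowski_norm (fnorm M i)"
    and "has_curvature (rev_norm M) ori (- 1) x v k"
  shows "has_curvature M ori 1 x v k"
proof -
  obtain A B L where h: "perturbed_angle (rev_norm M) ori (- 1) x v 1 A" "perturbed_angle (rev_norm M) ori (- 1) x v (- 1) B"
     "circle_length (rev_norm M) (- (- 1)) x L" "k = A + B - L" using assms(2) unfolding has_curvature_def by blast
  have "perturbed_angle M ori 1 x v 1 B" by (rule perturbed_angle_rev[OF assms(1) h(2)])
  moreover have "perturbed_angle M ori 1 x v (- 1) A" by (rule perturbed_angle_rev[OF assms(1)]) (use h(1) in simp_all)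
  moreover have "circle_length M (- 1) x L" by (rule circle_length_rev[OF h(3)])
  ultimately show ?thesis unfolding has_curvature_def using h(4)
    by (intro exI[of _ B] exI[of _ A] exI[of _ L]) simp
qed

lemma piecewise_flat_rev: assumes "piecewise_flat_surface X M" shows "piecewise_flat_surface X (rev_norm M)"
proof -
  note p = assms[unfolded piecewise_flat_surface_def]
  note c2 = conjunct2 and c1 = conjunct1
  show ?thesis unfolding piecewise_flat_surface_def rev_sel rev_cone
  proof (intro conjI)
    show "\<forall>i\<in>cells M. minkowski_norm (\<lambda>y. fnorm M i (- y)) \<and>
        (\<exists>a b c. \<not> collinear {a, b, c} \<and> chart M i ` cell M i = convex hull {a, b, c}) \<and>
        homeomorphic_map (subtopology X (cell M i)) (top_of_set (chart M i ` cell M i)) (chart M i)"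
      using p[THEN c2, THEN c2, THEN c2, THEN c1] minkowski_norm_reverse(1) by (intro ballI conjI) auto
    show "\<forall>i\<in>cells M. \<forall>j\<in>cells M. \<forall>p\<in>cell M i \<inter> cell M j. \<forall>q\<in>cell M i \<inter> cell M j.
        fnorm M i (- (chart M i q - chart M i p)) = fnorm M j (- (chart M j q - chart M j p))"
      unfolding minus_diff_eq using p[THEN c2, THEN c2, THEN c2, THEN c2, THEN c2] by blast
  qed (rule p[THEN c1] p[THEN c2, THEN c1] p[THEN c2, THEN c2, THEN c1] p[THEN c2, THEN c2, THEN c2, THEN c2, THEN c1])+
qed

lemma arc_dist_rev: "arc_dist (\<lambda>y. F (- y)) (uminus ` S) (- u) (- u') = arc_dist F S u u'"
proof -
  define D where "D F S u u' = {integral {a..b} (\<lambda>t. sqrt (fform F (g t)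
       (vector_derivative g (at t)) (vector_derivative g (at t)))) | g a b U.
     a < b \<and> open U \<and> {a..b} \<subseteq> U \<and> smooth_on U g \<and> g ` {a..b} \<subseteq> S \<and> g a = u \<and> g b = u'}"
    for F :: "real^2 \<Rightarrow> real" and S u u'
  have sub: "D F S u u' \<subseteq> D (\<lambda>y. F (- y)) (uminus ` S) (- u) (- u')" for F S u u'
  proof
    fix l assume "l \<in> D F S u u'"
    then obtain g a b U where g: "l = integral {a..b} (\<lambda>t. sqrt (fform F (g t) (vector_derivative g (at t)) (vector_derivative g (at t))))"
       "a < b" "open U" "{a..b} \<subseteq> U" "smooth_on U g" "g ` {a..b} \<subseteq> S" "g a = u" "g b = u'" unfolding D_def by blast
    define g' where "g' = (\<lambda>t::real. (- 1 :: real) *\<^sub>R g t)"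
    have s: "smooth_on U g'" using g(5) unfolding smooth_on_def g'_def by (intro allI Ck_on_scaleR g(3) Ck_on_const) auto
    have d: "vector_derivative g' (at t) = - vector_derivative g (at t)" if "t \<in> {a..b}" for t
      unfolding g'_def
      by (rule vector_derivative_at)
        (use bounded_linear.has_vector_derivative[OF bounded_linear_scaleR_right smooth_on_vector_derivative(1)[OF g(5,4) that], of "- 1"] in simp)
    have "l = integral {a..b} (\<lambda>t. sqrt (fform (\<lambda>y. F (- y)) (g' t) (vector_derivative g' (at t)) (vector_derivative g' (at t))))"
      unfolding g(1) by (rule integral_cong) (simp only: d fform_reverse minus_minus, simp add: g'_def)
    then show "l \<in> D (\<lambda>y. F (- y)) (uminus ` S) (- u) (- u')" unfolding D_def mem_Collect_eq
      by (intro exI[of _ g'] exI[of _ a] exI[of _ b] exI[of _ U]) (use g s in \<open>auto simp: g'_def\<close>)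
  qed
  have "D (\<lambda>y. F (- y)) (uminus ` S) (- u) (- u') \<subseteq> D F S u u'"
    using sub[of "\<lambda>y. F (- y)" "uminus ` S" "- u" "- u'"] by (simp add: image_image)
  then have "D (\<lambda>y. F (- y)) (uminus ` S) (- u) (- u') = D F S u u'" using sub by blast
  then show ?thesis unfolding arc_dist_def D_def by simp
qed

text \<open>Incoming unit vectors of the reversal are the negatives of outgoing ones of
  \<open>M\<close>. The condition for the pair \<open>i\<close>, \<open>j\<close> is therefore that
  of \<open>M\<close> for \<open>j\<close>, \<open>i\<close>, with the inverse homeomorphism
  conjugated by the point reflection.\<close>

lemma landsberg_rev: assumes L: "landsberg_type M" and mn: "\<And>i. i \<in> cells M \<Longrightarrow> minkowski_norm (fnorm M i)"
  shows "landsberg_type (rev_norm M)"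
  unfolding landsberg_type_def rev_sel rev_cone
proof (intro ballI impI)
  fix i j x assume i: "i \<in> cells M" and j: "j \<in> cells M" and x: "x \<in> cell M i \<inter> cell M j" and n: "i \<noteq> j \<and> x \<notin> vertices M"
  have x': "x \<in> cell M j \<inter> cell M i" and n': "j \<noteq> i \<and> x \<notin> vertices M" using x n by auto
  define A where "A = unit_vectors M (- 1) x j" define B where "B = unit_vectors M 1 x i"
  have UA: "unit_vectors (rev_norm M) 1 x j = uminus ` A" by (simp add: A_def unit_vectors_rev)
  have UB: "unit_vectors (rev_norm M) (- 1) x i = uminus ` B" by (simp add: B_def unit_vectors_rev)
  interpret Fi: minkowski "fnorm M i" by unfold_locales (rule mn[OF i])
  interpret Fj: minkowski "fnorm M j" by unfold_locales (rule mn[OF j])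
  obtain h h' where h: "homeomorphism A B h h'" and
    mom: "\<And>u q. u \<in> A \<Longrightarrow> q \<in> cell M j \<inter> cell M i \<Longrightarrow> fform (fnorm M j) u u (chart M j q - chart M j x) =
            fform (fnorm M i) (h u) (h u) (chart M i q - chart M i x)" and
    iso: "\<And>u u'. u \<in> A \<Longrightarrow> u' \<in> A \<Longrightarrow> arc_dist (fnorm M i) B (h u) (h u') = arc_dist (fnorm M j) A u u'"
    using L[unfolded landsberg_type_def, rule_format, OF j i x' n'] unfolding A_def B_def by blast
  note hh = h[unfolded homeomorphism_def]
  have h'A: "h' u \<in> A" "h (h' u) = u" if "u \<in> B" for u using hh that by auto
  have hB: "h u \<in> B" "h' (h u) = u" if "u \<in> A" for u using hh that by auto
  have nzA: "u \<noteq> 0" if "u \<in> A" for u using that by (auto simp: A_def unit_vectors_def)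
  have nzB: "u \<noteq> 0" if "u \<in> B" for u using that by (auto simp: B_def unit_vectors_def)
  have homeo: "homeomorphism (uminus ` B) (uminus ` A) (\<lambda>u. - h' (- u)) (\<lambda>u. - h (- u))"
  proof (rule homeomorphismI)
    have "continuous_on (uminus ` uminus ` B) h'" using hh by (simp add: image_image)
    then show "continuous_on (uminus ` B) (\<lambda>u. - h' (- u))"
      by (intro continuous_on_minus continuous_on_compose2[of "uminus ` uminus ` B" h' "uminus ` B" uminus] continuous_intros) auto
    have "continuous_on (uminus ` uminus ` A) h" using hh by (simp add: image_image)
    then show "continuous_on (uminus ` A) (\<lambda>u. - h (- u))"
      by (intro continuous_on_minus continuous_on_compose2[of "uminus ` uminus ` A" h "uminus ` A" uminus] continuous_intros) auto
  qed (use h'A hB in auto)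
  have mom': "fform (\<lambda>y. fnorm M i (- y)) u u (chart M i q - chart M i x) =
      fform (\<lambda>y. fnorm M j (- y)) (- h' (- u)) (- h' (- u)) (chart M j q - chart M j x)"
    if u: "u \<in> uminus ` B" and q: "q \<in> cell M i \<inter> cell M j" for u q
  proof -
    have uB: "- u \<in> B" using u by auto
    note m = mom[OF h'A(1)[OF uB], of q]
    have q': "q \<in> cell M j \<inter> cell M i" using q by blast
    show ?thesis unfolding fform_reverse
      using m[OF q'] linear_neg[OF Fi.linear_fform2[OF nzB[OF uB]], of "- u" "chart M i q - chart M i x"]
        linear_neg[OF Fj.linear_fform2[OF nzA[OF h'A(1)[OF uB]]], of "h' (- u)" "chart M j q - chart M j x"] h'A(2)[OF uB] by simp
  qed
  have iso': "arc_dist (\<lambda>y. fnorm M j (- y)) (uminus ` A) (- h' (- u)) (- h' (- u')) =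
      arc_dist (\<lambda>y. fnorm M i (- y)) (uminus ` B) u u'" if "u \<in> uminus ` B" "u' \<in> uminus ` B" for u u'
  proof -
    have B: "- u \<in> B" "- u' \<in> B" using that by auto
    have 1: "arc_dist (\<lambda>y. fnorm M i (- y)) (uminus ` B) u u' = arc_dist (fnorm M i) B (- u) (- u')"
      using arc_dist_rev[of "fnorm M i" B "- u" "- u'"] by simp
    show ?thesis unfolding 1 arc_dist_rev
      using iso[OF h'A(1)[OF B(1)] h'A(1)[OF B(2)]] unfolding h'A(2)[OF B(1)] h'A(2)[OF B(2)] by simp
  qed
  show "\<exists>h h'. homeomorphism (unit_vectors (rev_norm M) (- 1) x i) (unit_vectors (rev_norm M) 1 x j) h h' \<and>
         (\<forall>u\<in>unit_vectors (rev_norm M) (- 1) x i. \<forall>q\<in>cell M i \<inter> cell M j.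
            fform (\<lambda>y. fnorm M i (- y)) u u (chart M i q - chart M i x) =
            fform (\<lambda>y. fnorm M j (- y)) (h u) (h u) (chart M j q - chart M j x)) \<and>
         (\<forall>u\<in>unit_vectors (rev_norm M) (- 1) x i. \<forall>u'\<in>unit_vectors (rev_norm M) (- 1) x i.
            arc_dist (\<lambda>y. fnorm M j (- y)) (unit_vectors (rev_norm M) 1 x j) (h u) (h u') =
            arc_dist (\<lambda>y. fnorm M i (- y)) (unit_vectors (rev_norm M) (- 1) x i) u u')"
    unfolding UA UB
    by (rule exI[of _ "\<lambda>u. - h' (- u)"], rule exI[of _ "\<lambda>u. - h (- u)"]) (intro conjI homeo ballI mom' iso'; assumption)
qed

section \<open>The curvature of a vertex\<close>

lemma (in planar) T_shift_int: "T (s + of_int n * (2 * pi)) - T s = of_int n * T (2 * pi)"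
proof (induction n rule: int_induct[where k = 0])
  case base
  then show ?case by simp
next
  case (step1 n)
  have e: "s + of_int (n + 1) * (2 * pi) = (s + of_int n * (2 * pi)) + 2 * pi" by (simp add: algebra_simps)
  have "T (s + of_int (n + 1) * (2 * pi)) = T (s + of_int n * (2 * pi)) + T (2 * pi)"
    unfolding e using T_period[of "s + of_int n * (2 * pi)"] by linarith
  then show ?case using step1 by (simp add: distrib_right)
next
  case (step2 n)
  have e: "s + of_int n * (2 * pi) = (s + of_int (n - 1) * (2 * pi)) + 2 * pi" by (simp add: algebra_simps)
  have "T (s + of_int n * (2 * pi)) = T (s + of_int (n - 1) * (2 * pi)) + T (2 * pi)"
    by (subst e) (use T_period[of "s + of_int (n - 1) * (2 * pi)"] in linarith)
  then show ?case using step2 by (simp add: left_diff_distrib)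
qed

text \<open>Two angles of the same direction differ by full turns, and \<open>T\<close> grows by the
  same amount in each turn.\<close>

lemma (in planar) half_arc_eq:
  assumes "r *\<^sub>R polar e s = r' *\<^sub>R polar e t" "0 < r" "0 < r'"
  shows "T s - T (s - pi) = T t - T (t - pi)"
proof -
  have c: "r * cos s = r' * cos t" and d: "r * sin s = r' * sin t"
    using assms(1) ee(2) by (auto simp: vec2_eq_iff)
  have "r\<^sup>2 = (r * cos s)\<^sup>2 + (r * sin s)\<^sup>2" by (simp add: power_mult_distrib flip: distrib_left)
  also have "\<dots> = (r' * cos t)\<^sup>2 + (r' * sin t)\<^sup>2" unfolding c d ..
  also have "\<dots> = r'\<^sup>2" by (simp add: power_mult_distrib flip: distrib_left)
  finally have "r = r'" using assms(2,3) by (simp add: power2_eq_iff_nonneg)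
  then have "cos s = cos t" "sin s = sin t" using c d assms(2) by auto
  then have "cos (s - t) = 1" by (simp add: cos_diff flip: power2_eq_square)
  then obtain n :: int where "s - t = of_int n * 2 * pi" unfolding cos_one_2pi_int by blast
  then have n: "s = t + of_int n * (2 * pi)" "s - pi = (t - pi) + of_int n * (2 * pi)" by (simp_all add: algebra_simps)
  show ?thesis using T_shift_int[of t n] T_shift_int[of "t - pi" n] unfolding n(2) unfolding n(1) by simp
qed

lemma perturbed_angle_flip:
  "perturbed_angle M (\<lambda>i. - ori i) \<sigma> x v side A \<Longrightarrow> perturbed_angle M ori \<sigma> x v (- side) A"
  unfolding perturbed_angle_def by simp

text \<open>Changing the orientation exchanges left and right, and the curvature is symmetric in the
  two angles.\<close>

lemma has_curvature_flip:
  assumes "has_curvature M ori \<sigma> x v k" shows "has_curvature M (\<lambda>i. - ori i) \<sigma> x v k"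
proof -
  obtain A B L where h: "perturbed_angle M ori \<sigma> x v 1 A" "perturbed_angle M ori \<sigma> x v (- 1) B"
     "circle_length M (- \<sigma>) x L" "k = A + B - L" using assms unfolding has_curvature_def by blast
  have "perturbed_angle M (\<lambda>i. - ori i) \<sigma> x v (- (- 1)) B" by (rule perturbed_angle_flip) (use h(2) in simp)
  moreover have "perturbed_angle M (\<lambda>i. - ori i) \<sigma> x v (- 1) A" by (rule perturbed_angle_flip) (use h(1) in simp)
  ultimately show ?thesis unfolding has_curvature_def using h(3,4)
    by (intro exI[of _ B] exI[of _ A] exI[of _ L]) simp
qed

lemma has_curvature_cong:
  assumes "has_curvature M ori \<sigma> x v k" "\<And>i. i \<in> cells (tangent_cone M x) \<Longrightarrow> ori' i = ori i"
  shows "has_curvature M ori' \<sigma> x v k"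
proof -
  have "perturbed_angle M ori' \<sigma> x v side A" if "perturbed_angle M ori \<sigma> x v side A" for side A
    using that unfolding perturbed_angle_def Let_def by (simp add: assms(2))
  then show ?thesis using assms(1) unfolding has_curvature_def by blast
qed

text \<open>The angle on the left is the angle on the right for the opposite orientation.\<close>

lemma has_curvature_incoming:
  assumes V: "vertex_cone M x ori nxt a b al be" and W: "vertex_cone M x (\<lambda>i. - ori i) nxt' a' b' al' be'"
    and v: "v \<in> indicatrix M (- 1) x" and i0: "i0 \<in> {i \<in> cells M. x \<in> cell M i}"
  shows "has_curvature M ori (- 1) x v (Th (fnorm M i0) (ori i0) (2 * pi) -
    (\<Sum>i\<in>{i \<in> cells M. x \<in> cell M i}. Th (fnorm M i) (ori i) (be i) - Th (fnorm M i) (ori i) (al i)))"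
proof -
  interpret V: vertex_cone M x ori nxt a b al be "{i \<in> cells M. x \<in> cell M i}" "fnorm M" "sector M x" by (rule V reflexive)+
  interpret W: vertex_cone M x "\<lambda>i. - ori i" nxt' a' b' al' be' "{i \<in> cells M. x \<in> cell M i}" "fnorm M" "sector M x" by (rule W reflexive)+
  obtain i u where u: "v = cone_rel M x `` {(i, (- 1) *\<^sub>R u)}" "i \<in> {i \<in> cells M. x \<in> cell M i}" "u \<in> unit_vectors M (- 1) x i"
    using v unfolding indicatrix_def by blast
  define y where "y = (- 1) *\<^sub>R u"
  have y: "y \<in> sector M x i" "fnorm M i (- y) = 1" using u(3) by (auto simp: unit_vectors_def y_def)
  interpret planar "fnorm M i" "ori i" by (rule V.planar[OF u(2)])
  have y0: "y \<noteq> 0" using y(2) by auto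
  obtain r \<eta> where r: "r > 0" "\<eta> \<in> {al i..be i}" "y = r *\<^sub>R polar (ori i) \<eta>" using V.polar_of_S[OF u(2) y(1) y0] by blast
  obtain r' \<eta>' where r': "r' > 0" "\<eta>' \<in> {al' i..be' i}" "y = r' *\<^sub>R polar (- ori i) \<eta>'" using W.polar_of_S[OF u(2) y(1) y0] by blast
  have R: "perturbed_angle M ori (- 1) x v (- 1) (T (\<eta> + pi) - T \<eta>)"
    using V.perturbed_angle_right[OF u(2) y r(3,1,2)] unfolding V.pt_def u(1) y_def .
  have "perturbed_angle M (\<lambda>i. - ori i) (- 1) x v (- 1) (Th (fnorm M i) (- ori i) (\<eta>' + pi) - Th (fnorm M i) (- ori i) \<eta>')"
    using W.perturbed_angle_right[OF u(2) y r'(3,1,2)] unfolding W.pt_def u(1) y_def .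
  from perturbed_angle_flip[OF this]
  have L: "perturbed_angle M ori (- 1) x v 1 (T (- \<eta>') - T (- \<eta>' - pi))" unfolding reflect by simp
  \<comment> \<open>The two orientations come with independently chosen angles, so after reflection
    the angles of \<open>y\<close> agree only up to full turns.\<close>
  have "r' *\<^sub>R polar (ori i) (- \<eta>') = r *\<^sub>R polar (ori i) \<eta>" using r(3) r'(3) by (simp add: polar_uminus)
  then have "T (- \<eta>') - T (- \<eta>' - pi) = T \<eta> - T (\<eta> - pi)" by (rule half_arc_eq) (use r r' in auto)
  moreover have "T (\<eta> + pi) - T (\<eta> - pi) = T (2 * pi)" using T_period[of "\<eta> - pi"] by (simp add: add.commute)
  moreover have "T (2 * pi) = Th (fnorm M i0) (ori i0) (2 * pi)" by (rule V.total_length[OF u(2) i0])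
  ultimately have s: "(T (- \<eta>') - T (- \<eta>' - pi)) + (T (\<eta> + pi) - T \<eta>) = Th (fnorm M i0) (ori i0) (2 * pi)" by linarith
  show ?thesis unfolding has_curvature_def
    by (rule exI[of _ "T (- \<eta>') - T (- \<eta>' - pi)"], rule exI[of _ "T (\<eta> + pi) - T \<eta>"], rule exI, intro conjI, rule L, rule R)
      (use V.circle_length_eq in \<open>simp add: V.sector_arc_def\<close>, simp add: s)
qed

context pf_vertex begin

text \<open>Vertex cones are needed for both orientations and for both \<open>M\<close> and its
  reversal. \<open>M\<close> and the reversal share the angles \<open>al\<close> and
  \<open>be\<close>, so \<open>reverse\<close> and \<open>opposite_arcs\<close> show that the same
  expression \<open>K\<close> is obtained from either.\<close>

lemma curvature_of_orientation:
  assumes L: "landsberg_type M" and o: "cone_orientation M x ori"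
  shows "\<exists>K. (\<forall>v\<in>indicatrix M (- 1) x. has_curvature M ori (- 1) x v K) \<and>
    (\<forall>v\<in>indicatrix M 1 x. has_curvature M ori 1 x v K)"
proof -
  have o': "cone_orientation M x (\<lambda>i. - ori i)" using o unfolding cone_orientation_def Let_def by auto
  obtain nxt a b al be where G: "vertex_geometry M x ori nxt a b al be I" using ex_vertex_geometry[OF o] by blast
  obtain nxt' a' b' al' be' where G': "vertex_geometry M x (\<lambda>i. - ori i) nxt' a' b' al' be' I" using ex_vertex_geometry[OF o'] by blast
  note V = vertex_geometry_imp_vertex_cone[OF pf L G]
  note W = vertex_geometry_imp_vertex_cone[OF pf L G']
  note pr = piecewise_flat_rev[OF pf]
  have Lr: "landsberg_type (rev_norm M)" by (rule landsberg_rev[OF L]) (rule mink)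
  have Vr: "vertex_cone (rev_norm M) x ori nxt a b al be"
    by (rule vertex_geometry_imp_vertex_cone[OF pr Lr]) (unfold rev_norm_def, rule vertex_geometry_rev_norm[OF G])
  have Wr: "vertex_cone (rev_norm M) x (\<lambda>i. - ori i) nxt' a' b' al' be'"
    by (rule vertex_geometry_imp_vertex_cone[OF pr Lr]) (unfold rev_norm_def, rule vertex_geometry_rev_norm[OF G'])
  obtain i0 where i0: "i0 \<in> I" using I_ne by blast
  define K where "K = Th (fnorm M i0) (ori i0) (2 * pi) - (\<Sum>i\<in>I. Th (fnorm M i) (ori i) (be i) - Th (fnorm M i) (ori i) (al i))"
  interpret V: vertex_cone M x ori nxt a b al be "{i \<in> cells M. x \<in> cell M i}" "fnorm M" "sector M x" by (rule V reflexive)+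
  have 1: "has_curvature M ori (- 1) x v K" if "v \<in> indicatrix M (- 1) x" for v
    using has_curvature_incoming[OF V W that i0[unfolded I_def]] unfolding K_def I_def .
  have rv: "Th (\<lambda>y. fnorm M i (- y)) (ori i) t - Th (\<lambda>y. fnorm M i (- y)) (ori i) s = Th (fnorm M i) (ori i) (t + pi) - Th (fnorm M i) (ori i) (s + pi)"
    if "i \<in> I" for i s t
  proof -
    interpret planar "fnorm M i" "ori i" by (rule V.planar) (use that in \<open>simp add: I_def\<close>)
    show ?thesis by (rule reverse)
  qed
  have "Th (\<lambda>y. fnorm M i0 (- y)) (ori i0) (2 * pi) = Th (fnorm M i0) (ori i0) (2 * pi)"
  proof -
    interpret planar "fnorm M i0" "ori i0" by (rule V.planar) (use i0 in \<open>simp add: I_def\<close>)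
    have "Th (\<lambda>y. fnorm M i0 (- y)) (ori i0) 0 = 0" by (simp add: Th_def zero_ereal_def[symmetric])
    then show ?thesis using rv[OF i0, of "2 * pi" 0] T_period[of pi] by (simp add: add.commute)
  qed
  moreover have "(\<Sum>i\<in>I. Th (\<lambda>y. fnorm M i (- y)) (ori i) (be i) - Th (\<lambda>y. fnorm M i (- y)) (ori i) (al i))
      = (\<Sum>i\<in>I. Th (fnorm M i) (ori i) (be i) - Th (fnorm M i) (ori i) (al i))"
    using V.opposite_arcs unfolding V.sector_arc_def I_def[symmetric] by (simp add: rv)
  ultimately have K': "K = Th (fnorm (rev_norm M) i0) (ori i0) (2 * pi) -
      (\<Sum>i\<in>{i \<in> cells (rev_norm M). x \<in> cell (rev_norm M) i}. Th (fnorm (rev_norm M) i) (ori i) (be i) - Th (fnorm (rev_norm M) i) (ori i) (al i))"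
    unfolding K_def rev_sel I_def[symmetric] by simp
  have 2: "has_curvature M ori 1 x v K" if v: "v \<in> indicatrix M 1 x" for v
  proof (rule has_curvature_rev)
    show "minkowski_norm (fnorm M i)" if "i \<in> cells (tangent_cone M x)" for i
      using that mink by (simp add: tangent_cone_def)
    show "has_curvature (rev_norm M) ori (- 1) x v K" unfolding K'
      by (rule has_curvature_incoming[OF Vr Wr]) (use v i0 in \<open>simp_all add: indicatrix_rev I_def\<close>)
  qed
  show ?thesis by (rule exI[of _ K]) (intro conjI ballI 1 2; assumption)
qed

text \<open>By \<open>orientation_edge\<close> the product of the signs of two triangles with a
  common edge is forced by the charts. So the quotient of two orientations is the same in
  neighbours, and it is constant since the link is connected.\<close>

lemma orientation_unique:
  assumes o: "cone_orientation M x ori" and o': "cone_orientation M x ori'"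
  shows "(\<forall>i\<in>I. ori' i = ori i) \<or> (\<forall>i\<in>I. ori' i = - ori i)"
proof -
  have pm: "f i \<in> {1, -1}" if "cone_orientation M x f" "i \<in> I" for f i
    by (rule that(1)[unfolded cone_orientation_def Let_def, THEN conjunct1, rule_format])
      (use that(2) in \<open>simp add: tangent_cone_def I_def\<close>)
  obtain i0 where i0: "i0 \<in> I" using I_ne by blast
  define A where "A = {j \<in> I. ori j * ori' j = ori i0 * ori' i0}"
  have "A = I"
  proof (rule link_connected)
    show "A \<subseteq> I" "A \<noteq> {}" using i0 by (auto simp: A_def)
    fix i j assume ij: "i \<in> A" "j \<in> I" "Q i \<inter> Q j \<noteq> {}"
    have iI: "i \<in> I" using ij(1) by (simp add: A_def)
    show "j \<in> A"
    proof (cases "i = j")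
      case False
      obtain q where q: "q \<in> Q i" "q \<in> Q j" using ij(3) by blast
      obtain qi where "Q i = {q, qi}" "q \<noteq> qi" using tri[OF iI q(1)] by (elim exE conjE)
      then have qi: "qi \<in> Q i" "qi \<noteq> q" by auto
      obtain qj where "Q j = {q, qj}" "q \<noteq> qj" using tri[OF ij(2) q(2)] by (elim exE conjE)
      then have qj: "qj \<in> Q j" "qj \<noteq> q" by auto
      define p where "p = cross2 (ev i q) (ev i qi) * cross2 (ev j q) (ev j qj)"
      have e: "(f i * f j) * p = (f i * cross2 (ev i q) (ev i qi)) * (f j * cross2 (ev j q) (ev j qj))" for f :: "'i \<Rightarrow> real"
        unfolding p_def by (simp only: mult.assoc mult.commute mult.left_commute)
      have "(ori i * ori j) * p < 0" "(ori' i * ori' j) * p < 0"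
        using orientation_edge(1)[OF o iI ij(2) False q qi qj] orientation_edge(1)[OF o' iI ij(2) False q qi qj]
        unfolding e by simp_all
      then have "ori i * ori' i = ori j * ori' j" using pm[OF o iI] pm[OF o ij(2)] pm[OF o' iI] pm[OF o' ij(2)] by auto
      then show ?thesis using ij(1,2) by (simp add: A_def)
    qed (use ij in simp)
  qed
  then have eq: "ori j * ori' j = ori i0 * ori' i0" if "j \<in> I" for j using that unfolding A_def by blast
  consider "ori i0 * ori' i0 = 1" | "ori i0 * ori' i0 = - 1" using pm[OF o i0] pm[OF o' i0] by auto
  then show ?thesis
  proof cases
    case 1
    have "ori' j = ori j" if "j \<in> I" for j using eq[OF that] pm[OF o that] pm[OF o' that] unfolding 1 by auto
    then show ?thesis by blast
  next
    case 2
    have "ori' j = - ori j" if "j \<in> I" for j using eq[OF that] pm[OF o that] pm[OF o' that] unfolding 2 by auto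
    then show ?thesis by blast
  qed
qed

lemma curvature_independent:
  assumes L: "landsberg_type M"
  shows "\<exists>K::real. \<forall>ori. cone_orientation M x ori \<longrightarrow>
    (\<forall>v\<in>indicatrix M (- 1) x. has_curvature M ori (- 1) x v K) \<and>
    (\<forall>v\<in>indicatrix M 1 x. has_curvature M ori 1 x v K)"
proof (cases "\<exists>ori. cone_orientation M x ori")
  case True
  then obtain ori where o: "cone_orientation M x ori" by blast
  obtain K where K: "\<And>v. v \<in> indicatrix M (- 1) x \<Longrightarrow> has_curvature M ori (- 1) x v K"
     "\<And>v. v \<in> indicatrix M 1 x \<Longrightarrow> has_curvature M ori 1 x v K"
    using curvature_of_orientation[OF L o] by blast
  have cT: "cells (tangent_cone M x) = I" by (simp add: tangent_cone_def I_def)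
  have "has_curvature M ori' \<sigma> x v K" if o': "cone_orientation M x ori'" and h: "has_curvature M ori \<sigma> x v K" for ori' \<sigma> v
    using orientation_unique[OF o o']
  proof
    assume "\<forall>i\<in>I. ori' i = ori i"
    then show ?thesis by (intro has_curvature_cong[OF h]) (simp add: cT)
  next
    assume "\<forall>i\<in>I. ori' i = - ori i"
    then show ?thesis by (intro has_curvature_cong[OF has_curvature_flip[OF h]]) (simp add: cT)
  qed
  then show ?thesis using K by (intro exI[of _ K]) blast
qed blast

end

theorem theorem6p2:
  fixes X :: "'p topology" and M :: "('p, 'i) flat_cells"
  assumes "piecewise_flat_surface X M"
    and "landsberg_type M"
  shows "\<forall>x\<in>vertices M. \<exists>K::real. \<forall>ori. cone_orientation M x ori \<longrightarrow>
    (\<forall>v\<in>indicatrix M (- 1) x. has_curvature M ori (- 1) x v K) \<and>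
    (\<forall>v\<in>indicatrix M 1 x. has_curvature M ori 1 x v K)"
proof
  fix x assume "x \<in> vertices M"
  then interpret pf_vertex X M x using assms(1) by unfold_locales
  show "\<exists>K::real. \<forall>ori. cone_orientation M x ori \<longrightarrow>
    (\<forall>v\<in>indicatrix M (- 1) x. has_curvature M ori (- 1) x v K) \<and>
    (\<forall>v\<in>indicatrix M 1 x. has_curvature M ori 1 x v K)"
    by (rule curvature_independent[OF assms(2)])
qed

end
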